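(* Let $g,d>0$, let $T>0$ with $T/(gd^2)\neq 1/3$, and let $k\in\Sigma$. Consider the small-amplitude, $2\pi/k$-periodic traveling waves $u(x,t)=w(k,a,b)(k(x-c(k,a,b)t))$ of the capillarity-modified Whitham equation $u_t+\mathcal{M}u_x+(u^2)_x=0$. Define $$\Delta_{MI}(z)=\frac{(z\,m(z))''\,\big((z\,m(z))'-m(0)\big)}{m(z)-m(2z)}\,\Delta_{BF}(z),\qquad \Delta_{BF}(z)=2\big(m(z)-m(2z)\big)+\big((z\,m(z))'-m(0)\big),$$ where $'$ denotes differentiation with respect to $z$. (i) If $\Delta_{MI}(k)<0$, then such a wave with sufficiently small amplitude (i.e. $w(k,a,b)$ with $a\neq 0$ and $|a|,|b|$ sufficiently small) is modulationally unstable. (ii) If $\Delta_{MI}(k)>0$, then such a wave with sufficiently small amplitude is modulationally stable.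
   Context: **Symbol.** $g>0$ is the gravitational constant, $d>0$ the undisturbed fluid depth, $T>0$ the coefficient of surface tension. The variables are scaled so that the wave number $k$ is dimensionless (it stands for wave number times depth). Set $$m(k)=\sqrt{gd\Big(1+\frac{T}{gd^2}k^2\Big)\frac{\tanh k}{k}}\quad (k\ne0),\qquad m(0)=\sqrt{gd},$$ a smooth even function on $\mathbb{R}$. $\mathcal{M}$ is the Fourier multiplier in $x$, $\widehat{\mathcal{M}f}(k)=m(k)\widehat f(k)$. For $k>0$, $\mathcal{M}_k$ acts on $2\pi$-periodic functions of $z$ by $\mathcal{M}_k e^{inz}=m(kn)e^{inz}$, $n\in\mathbb{Z}$. The capillarity-modified Whitham equation is $u_t+\mathcal{M}u_x+(u^2)_x=0$. **The set $\Sigma$.** If $T/(gd^2)\ge 1/3$, $\Sigma=(0,\infty)$. If $0<T/(gd^2)<1/3$, $\Sigma=(0,\infty)\setminus\{k_N:N=2,3,\dots\}$, where for each integer $N\ge2$, $k_N$ is the unique positive number with $m(k_N)=m(Nk_N)$. **The waves.** For $k\in\Sigma$ and $|a|,|b|$ sufficiently small, $w=w(k,a,b)$ and $c=c(k,a,b)$ denote the family, depending smoothly on $(k,a,b)$, such that $w$ is a smooth, even, $2\pi$-periodic function of $z$, $c$ is even in $a$, $$\mathcal{M}_k w-cw+w^2=(m(0)-c)^2b,$$ and, as $|a|,|b|\to0$, $$w(k,a,b)(z)=w_0(k,b)+a\cos z+\tfrac12a^2\Big(\frac{1}{m(k)-m(0)}+\frac{\cos 2z}{m(k)-m(2k)}\Big)+O(a(a^2+b^2)),$$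 $$c(k,a,b)=c_0(k,b)+a^2\Big(\frac{1}{m(k)-m(0)}+\frac12\frac{1}{m(k)-m(2k)}\Big)+O(a(a^2+b^2)),$$ with $w_0(k,b)=(m(0)-m(k))(b-3b^2+O(b^3))$ and $c_0(k,b)=m(k)+2(m(0)-m(k))(b-3b^2+O(b^3))$. Then $u(x,t)=w(k,a,b)(k(x-c(k,a,b)t))$ is a $2\pi/k$-periodic traveling wave of the equation. **Modulational stability.** Linearizing the equation about $w$ in the frame moving with speed $c$ (with $z=k(x-ct)$, perturbations $e^{\lambda kt}v(z)$) gives the spectral problem $\lambda v=\mathcal{L}(k,a,b)v$, $\mathcal{L}(k,a,b)v=\partial_z(-\mathcal{M}_k+c-2w)v$, where now $\mathcal{M}_k$ acts on functions on $\mathbb{R}$ as the Fourier multiplier in $z$ with symbol $\eta\mapsto m(k\eta)$. For $\xi\in[-1/2,1/2)$ let $$\mathcal{L}_\xi(k,a,b)=e^{-i\xi z}\mathcal{L}(k,a,b)e^{i\xi z}$$ acting on $L^2_{2\pi}$, the space of $2\pi$-periodic, complex-valued, locally square-integrable functions; explicitly $\mathcal{L}_\xi\phi=(\partial_z+i\xi)(-\mathcal{M}_{k,\xi}+c-2w)\phi$ with $\mathcal{M}_{k,\xi}e^{inz}=m(k(n+\xi))e^{inz}$. Its $L^2_{2\pi}$-spectrum consists of discrete eigenvalues of finite multiplicity. The wave $w$ is *modulationally unstable* if the $L^2_{2\pi}$-spectrum of $\mathcal{L}_\xi(k,a,b)$ in the vicinity of the origin is not contained in the imaginary axis $i\mathbb{R}$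 for some $|\xi|$ small, and *modulationally stable* otherwise. *)

theory Defs
  imports "HOL-Analysis.Analysis" "HOL-Library.Landau_Symbols"
begin

section \<open>The dispersion symbol and the modulation index\<close>

definition phase_speed :: "real \<Rightarrow> real \<Rightarrow> real \<Rightarrow> real \<Rightarrow> real" where
  "phase_speed g d T k =
     (if k = 0 then sqrt (g * d)
      else sqrt (g * d * (1 + T / (g * d\<^sup>2) * k\<^sup>2) * (tanh k / k)))"

definition resonant_number :: "real \<Rightarrow> real \<Rightarrow> real \<Rightarrow> nat \<Rightarrow> real" where
  "resonant_number g d T N =
     (THE k. 0 < k \<and> phase_speed g d T k = phase_speed g d T (real N * k))"

definition admissible_wave_numbers :: "real \<Rightarrow> real \<Rightarrow> real \<Rightarrow> real set" where
  "admissible_wave_numbers g d T =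
     (if T / (g * d\<^sup>2) \<ge> 1/3 then {0<..}
      else {0<..} - {resonant_number g d T N | N. N \<ge> 2})"

definition Delta_BF :: "real \<Rightarrow> real \<Rightarrow> real \<Rightarrow> real \<Rightarrow> real" where
  "Delta_BF g d T z =
     (let m = phase_speed g d T
      in 2 * (m z - m (2 * z)) + (deriv (\<lambda>x. x * m x) z - m 0))"

definition Delta_MI :: "real \<Rightarrow> real \<Rightarrow> real \<Rightarrow> real \<Rightarrow> real" where
  "Delta_MI g d T z =
     (let m = phase_speed g d T; f = (\<lambda>x. x * m x)
      in deriv (deriv f) z * (deriv f z - m 0) / (m z - m (2 * z)) * Delta_BF g d T z)"


section \<open>Smooth functions\<close>

text \<open>Continuous differentiability up to order n on an open subset of a finite-dimensional space.\<close>

fun Ck_on :: "nat \<Rightarrow> 'a::euclidean_space set \<Rightarrow> ('a \<Rightarrow> real) \<Rightarrow> bool" where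
  "Ck_on 0 S f \<longleftrightarrow> continuous_on S f"
| "Ck_on (Suc n) S f \<longleftrightarrow>
     (\<forall>x\<in>S. f differentiable (at x)) \<and>
     (\<forall>v. Ck_on n S (\<lambda>x. frechet_derivative f (at x) v))"

definition smooth_on :: "'a::euclidean_space set \<Rightarrow> ('a \<Rightarrow> real) \<Rightarrow> bool" where
  "smooth_on S f \<longleftrightarrow> (\<forall>n. Ck_on n S f)"


section \<open>Fourier multipliers on periodic functions\<close>

definition fourier_coeff :: "(real \<Rightarrow> complex) \<Rightarrow> int \<Rightarrow> complex" where
  "fourier_coeff f n =
     (LINT z:{-pi..pi}|lborel. f z * cis (- (of_int n * z))) / of_real (2 * pi)"

definition fourier_multiplier :: "(int \<Rightarrow> complex) \<Rightarrow> (real \<Rightarrow> complex) \<Rightarrow> real \<Rightarrow> complex" where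
  "fourier_multiplier \<sigma> f z = (\<Sum>\<^sub>\<infinity>n. \<sigma> n * fourier_coeff f n * cis (of_int n * z))"


section \<open>The small-amplitude travelling waves\<close>

definition travelling_wave ::
    "real \<Rightarrow> real \<Rightarrow> real \<Rightarrow> real \<Rightarrow> real \<Rightarrow> (real \<Rightarrow> real) \<Rightarrow> real \<Rightarrow> bool" where
  "travelling_wave g d T k b w c \<longleftrightarrow>
     (\<forall>z. w (- z) = w z) \<and> (\<forall>z. w (z + 2 * pi) = w z) \<and>
     (\<forall>z. fourier_multiplier (\<lambda>n. of_real (phase_speed g d T (k * of_int n)))
              (\<lambda>x. of_real (w x)) z
            - of_real (c * w z) + of_real ((w z)\<^sup>2)
          = of_real ((phase_speed g d T 0 - c)\<^sup>2 * b))"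

text \<open>The arguments of \<open>w\<close> are \<open>a\<close>, \<open>b\<close>, \<open>z\<close>; the error term of \<open>w\<close> is uniform in \<open>z\<close>.
  Taking the filter \<open>nhds 0\<close> (not punctured) makes the error terms vanish with their bounds.
  If \<open>phase_speed g d T k = phase_speed g d T 0\<close>, the coefficient \<open>1 / (m(k) - m(0))\<close> is
  undefined on paper and \<open>0\<close> here; no travelling waves have the resulting expansion, since the
  mean of the travelling wave equation with \<open>b = 0\<close> fails at order \<open>a\<^sup>2\<close>.\<close>

definition small_amplitude_expansion ::
    "real \<Rightarrow> real \<Rightarrow> real \<Rightarrow> real \<Rightarrow>
     (real \<Rightarrow> real \<Rightarrow> real \<Rightarrow> real) \<Rightarrow> (real \<Rightarrow> real \<Rightarrow> real) \<Rightarrow> bool" where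
  "small_amplitude_expansion g d T k w c \<longleftrightarrow>
     (let m = phase_speed g d T in
      \<exists>w0 c0 r s :: real \<Rightarrow> real.
        r \<in> O[nhds 0](\<lambda>b. b ^ 3) \<and> s \<in> O[nhds 0](\<lambda>b. b ^ 3) \<and>
        (\<forall>\<^sub>F b in nhds 0.
           w0 b = (m 0 - m k) * (b - 3 * b\<^sup>2 + r b) \<and>
           c0 b = m k + 2 * (m 0 - m k) * (b - 3 * b\<^sup>2 + s b)) \<and>
        (\<exists>K. \<forall>\<^sub>F (a, b) in nhds (0, 0).
           (\<forall>z. \<bar>w a b z -
                 (w0 b + a * cos z
                  + 1/2 * a\<^sup>2 * (1 / (m k - m 0) + cos (2 * z) / (m k - m (2 * k))))\<bar>
               \<le> K * (\<bar>a\<bar> * (a\<^sup>2 + b\<^sup>2))) \<and>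
           \<bar>c a b -
              (c0 b + a\<^sup>2 * (1 / (m k - m 0) + 1/2 * (1 / (m k - m (2 * k)))))\<bar>
             \<le> K * (\<bar>a\<bar> * (a\<^sup>2 + b\<^sup>2))))"

text \<open>The family of waves for wave numbers \<open>\<kappa>\<close> near \<open>k\<close> and for small \<open>a\<close>, \<open>b\<close>. Joint smoothness
  in \<open>(\<kappa>, a, b, z)\<close> says both that each wave is smooth in \<open>z\<close> and that it depends smoothly on
  the parameters as an element of the space of smooth periodic functions.\<close>

definition wave_family ::
    "real \<Rightarrow> real \<Rightarrow> real \<Rightarrow> real \<Rightarrow>
     (real \<Rightarrow> real \<Rightarrow> real \<Rightarrow> real \<Rightarrow> real) \<Rightarrow> (real \<Rightarrow> real \<Rightarrow> real \<Rightarrow> real) \<Rightarrow> bool" where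
  "wave_family g d T k w c \<longleftrightarrow>
     (\<exists>\<epsilon>>0.
        (let K = {k - \<epsilon> <..< k + \<epsilon>}; I = {- \<epsilon> <..< \<epsilon>} in
         smooth_on (K \<times> I \<times> I \<times> UNIV) (\<lambda>(\<kappa>, a, b, z). w \<kappa> a b z) \<and>
         smooth_on (K \<times> I \<times> I) (\<lambda>(\<kappa>, a, b). c \<kappa> a b) \<and>
         (\<forall>\<kappa>\<in>K. \<forall>a\<in>I. \<forall>b\<in>I.
            travelling_wave g d T \<kappa> b (w \<kappa> a b) (c \<kappa> a b) \<and> c \<kappa> (- a) b = c \<kappa> a b) \<and>
         (\<forall>\<kappa>\<in>K. small_amplitude_expansion g d T \<kappa> (w \<kappa>) (c \<kappa>))))"


section \<open>Operators in the space of square-integrable periodic functions\<close>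

text \<open>Elements are functions rather than classes modulo equality almost everywhere. An unbounded
  operator is represented by its graph, a set of pairs closed under changes on null sets.\<close>

definition L2per :: "(real \<Rightarrow> complex) set" where
  "L2per = {\<phi>. \<phi> \<in> borel_measurable borel \<and> (\<forall>z. \<phi> (z + 2 * pi) = \<phi> z) \<and>
               set_integrable lborel {-pi..pi} (\<lambda>z. (cmod (\<phi> z))\<^sup>2)}"

definition L2per_norm :: "(real \<Rightarrow> complex) \<Rightarrow> real" where
  "L2per_norm \<phi> = sqrt (LINT z:{-pi..pi}|lborel. (cmod (\<phi> z))\<^sup>2)"

definition multiplier_graph ::
    "(int \<Rightarrow> complex) \<Rightarrow> ((real \<Rightarrow> complex) \<times> (real \<Rightarrow> complex)) set" where
  "multiplier_graph \<sigma> =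
     {(\<phi>, \<psi>). \<phi> \<in> L2per \<and> \<psi> \<in> L2per \<and>
               (\<forall>n. fourier_coeff \<psi> n = \<sigma> n * fourier_coeff \<phi> n)}"

text \<open>A number is in the resolvent set iff the operator minus it maps the domain onto the whole
  space and is bounded below; the lower bound is injectivity with bounded inverse.\<close>

definition L2per_resolvent_set ::
    "((real \<Rightarrow> complex) \<times> (real \<Rightarrow> complex)) set \<Rightarrow> complex set" where
  "L2per_resolvent_set A =
     {\<mu>. (\<forall>f\<in>L2per. \<exists>(\<phi>, \<psi>)\<in>A. AE z in lborel. \<mu> * \<phi> z - \<psi> z = f z) \<and>
          (\<exists>C. \<forall>(\<phi>, \<psi>)\<in>A. L2per_norm \<phi> \<le> C * L2per_norm (\<lambda>z. \<mu> * \<phi> z - \<psi> z))}"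

definition L2per_spectrum ::
    "((real \<Rightarrow> complex) \<times> (real \<Rightarrow> complex)) set \<Rightarrow> complex set" where
  "L2per_spectrum A = - L2per_resolvent_set A"


section \<open>Modulational stability\<close>

text \<open>The graph of \<open>\<phi> \<mapsto> (\<partial>\<^sub>z + \<i>\<xi>) (- M\<^bsub>k,\<xi>\<^esub> + c - 2 w) \<phi>\<close> on its natural
  domain; the factor \<open>\<partial>\<^sub>z + \<i>\<xi>\<close> multiplies the \<open>n\<close>-th Fourier coefficient by \<open>\<i> (n + \<xi>)\<close>.\<close>

definition bloch_operator ::
    "real \<Rightarrow> real \<Rightarrow> real \<Rightarrow> real \<Rightarrow> (real \<Rightarrow> real) \<Rightarrow> real \<Rightarrow> real \<Rightarrow>
     ((real \<Rightarrow> complex) \<times> (real \<Rightarrow> complex)) set" where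
  "bloch_operator g d T k w c \<xi> =
     {(\<phi>, \<psi>). \<exists>\<eta>.
        (\<phi>, \<eta>) \<in> multiplier_graph (\<lambda>n. of_real (phase_speed g d T (k * (of_int n + \<xi>)))) \<and>
        (\<lambda>z. - \<eta> z + of_real (c - 2 * w z) * \<phi> z, \<psi>)
          \<in> multiplier_graph (\<lambda>n. \<i> * of_real (of_int n + \<xi>))}"

definition modulationally_unstable ::
    "real \<Rightarrow> real \<Rightarrow> real \<Rightarrow> real \<Rightarrow> (real \<Rightarrow> real) \<Rightarrow> real \<Rightarrow> bool" where
  "modulationally_unstable g d T k w c \<longleftrightarrow>
     (\<forall>\<delta>>0. \<forall>r>0. \<exists>\<xi>\<in>{-1/2..<1/2}. \<bar>\<xi>\<bar> < \<delta> \<and>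
        (\<exists>\<mu>\<in>L2per_spectrum (bloch_operator g d T k w c \<xi>). cmod \<mu> < r \<and> Re \<mu> \<noteq> 0))"

abbreviation modulationally_stable ::
    "real \<Rightarrow> real \<Rightarrow> real \<Rightarrow> real \<Rightarrow> (real \<Rightarrow> real) \<Rightarrow> real \<Rightarrow> bool" where
  "modulationally_stable g d T k w c \<equiv> \<not> modulationally_unstable g d T k w c"

end

theory Submission
  imports Defs "HOL-Computational_Algebra.Fundamental_Theorem_Algebra"
begin

text \<open>In Fourier coordinates the Bloch operator is \<open>\<i> (n + \<xi>)\<close> times the symmetric operator
  \<open>v \<mapsto> (V - m(k (n + \<xi>))) v\<^sub>n - 2 (p * v)\<^sub>n\<close>, where \<open>p\<close> collects the nonconstant Fourier modes of the wave
  and \<open>V\<close> is the speed minus twice its mean. Since \<open>k\<close> is not resonant, the diagonal entries with \<open>\<bar>n\<bar> \<ge> 2\<close> are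
  bounded away from \<open>0\<close>, so a contraction argument produces an invariant subspace which is a graph over the modes
  \<open>-1, 0, 1\<close> and carries the whole spectrum near the origin. On it the operator is \<open>\<i>\<close> times a real
  matrix of order three. Symmetry, reflection, and the kernel element given by the derivative of the wave show that for
  \<open>\<bar>\<xi>\<bar> \<le> \<bar>x\<bar>\<^sup>3\<close>, \<open>x = p\<^sub>1\<close>, its eigenvalues are \<open>\<xi> (- k m'(k) + x s)\<close> with \<open>s\<close> a root of a
  real cubic whose coefficients converge, as \<open>x \<rightarrow> 0\<close>, to those of \<open>h2 s\<^sup>2 + h0\<close>, where \<open>h0 h2\<close> is
  \<open>- 2 k\<close> times the modulation index. So for small \<open>x\<close> all roots are real if the index is positive, and
  there are nonreal ones if it is negative. The case \<open>\<xi> = 0\<close> is separate: there the origin is the only eigenvalue nearby.\<close>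

section \<open>Summable sequences over the integers\<close>

text \<open>Modulational instability quantifies over arbitrarily small \<delta>, so it is decided by
  Bloch parameters that are tiny even compared with the amplitude; in this regime \<xi>/x and
  \<xi>/x^2 are negligible and a one-variable limit remains. The obstacle is the accuracy this
  demands. The entry of the reduced matrix that couples the odd combination to itself has size
  \<xi>^2 and needs a smaller error, whereas regularity of the invariant subspace in \<xi> gives
  only O(\<xi>). The gain comes from pairing the odd frame vector with the derivative of the wave:
  symmetry annihilates the full sum, and parity removes the first order part off the critical modes.
  The same kernel element stands in for the second order expansion of the speed: it identifies the
  columns of the modes 1 and -1, so only the second harmonic enters, which is read off from the wave
  equation. The resolvent is studied on summable Fourier coefficients; square integrable data become
  summable after division by n + \<xi>. Limits are taken along sequences of waves that violate the
  claim, which spares uniform estimates in the parameters.\<close>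

definition l1_le :: "('i \<Rightarrow> 'a::real_normed_vector) \<Rightarrow> real \<Rightarrow> bool" where
  "l1_le f M \<longleftrightarrow> (\<forall>F. finite F \<longrightarrow> (\<Sum>n\<in>F. norm (f n)) \<le> M)"

text \<open>The kernel is real and the values lie in any Banach space, so that the same operation
  acts on the real frame vectors and on complex Fourier coefficients.\<close>

definition conv :: "(int \<Rightarrow> real) \<Rightarrow> (int \<Rightarrow> 'a::banach) \<Rightarrow> int \<Rightarrow> 'a" where
  "conv p v n = (\<Sum>\<^sub>\<infinity>j. p j *\<^sub>R v (n - j))"

lemma l1_leD: "l1_le f M \<Longrightarrow> finite F \<Longrightarrow> (\<Sum>n\<in>F. norm (f n)) \<le> M"
  by (simp add: l1_le_def)

lemma l1_leI: "(\<And>F. finite F \<Longrightarrow> (\<Sum>n\<in>F. norm (f n)) \<le> M) \<Longrightarrow> l1_le f M"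
  by (simp add: l1_le_def)

lemma l1_le_norm: "l1_le f M \<Longrightarrow> norm (f n) \<le> M"
  using l1_leD[of f M "{n}"] by simp

lemma l1_le_nonneg: "l1_le f M \<Longrightarrow> 0 \<le> M"
  using l1_leD[of f M "{}"] by simp

lemma l1_le_mono: "l1_le f M \<Longrightarrow> M \<le> N \<Longrightarrow> l1_le f N"
  unfolding l1_le_def by (meson order_trans)

lemma l1_le_summable: "l1_le f M \<Longrightarrow> (\<lambda>n. norm (f n)) summable_on UNIV"
  by (rule nonneg_bdd_above_summable_on) (auto simp: bdd_above_def l1_le_def)

lemma l1_le_infsum: "l1_le f M \<Longrightarrow> (\<Sum>\<^sub>\<infinity>n. norm (f n)) \<le> M"
  by (rule infsum_le_finite_sums[OF l1_le_summable]) (auto simp: l1_le_def)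

lemma summable_l1_le:
  "(\<lambda>n. norm (f n)) summable_on UNIV \<Longrightarrow> l1_le f (\<Sum>\<^sub>\<infinity>n. norm (f n))"
  by (rule l1_leI) (rule finite_sum_le_infsum, auto)

lemma l1_le_norm_infsum:
  fixes f :: "'i \<Rightarrow> 'a::banach"
  assumes "l1_le f M"
  shows "norm (\<Sum>\<^sub>\<infinity>n. f n) \<le> M" "f summable_on UNIV"
  using norm_infsum_bound[OF l1_le_summable[OF assms]] l1_le_infsum[OF assms]
    abs_summable_summable[OF l1_le_summable[OF assms]] by auto

lemma l1_le_scale:
  assumes "l1_le f M" "\<And>n. norm (g n) \<le> c * norm (f n)" "0 \<le> c"
  shows "l1_le g (c * M)"
proof (rule l1_leI)
  fix F :: "'a set" assume F: "finite F"
  have "(\<Sum>n\<in>F. norm (g n)) \<le> (\<Sum>n\<in>F. c * norm (f n))" by (intro sum_mono assms)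
  also have "\<dots> = c * (\<Sum>n\<in>F. norm (f n))" by (simp add: sum_distrib_left)
  also have "\<dots> \<le> c * M" by (intro mult_left_mono l1_leD assms F)
  finally show "(\<Sum>n\<in>F. norm (g n)) \<le> c * M" .
qed

lemma l1_le_compare:
  assumes "l1_le f M" "\<And>n. norm (g n) \<le> norm (f n)"
  shows "l1_le g M"
  using l1_le_scale[of f M g 1] assms by simp

lemma l1_le_add:
  assumes "l1_le f M" "l1_le g N" shows "l1_le (\<lambda>n. f n + g n) (M + N)"
proof (rule l1_leI)
  fix F :: "'a set" assume F: "finite F"
  have "(\<Sum>n\<in>F. norm (f n + g n)) \<le> (\<Sum>n\<in>F. norm (f n)) + (\<Sum>n\<in>F. norm (g n))"
    by (simp add: sum.distrib[symmetric] sum_mono norm_triangle_ineq)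
  also have "\<dots> \<le> M + N" by (intro add_mono l1_leD assms F)
  finally show "(\<Sum>n\<in>F. norm (f n + g n)) \<le> M + N" .
qed

lemma l1_le_cmult: "l1_le f M \<Longrightarrow> l1_le (\<lambda>n. c *\<^sub>R f n) (\<bar>c\<bar> * M)"
  by (rule l1_le_scale) auto

lemma l1_le_minus: "l1_le f M \<Longrightarrow> l1_le (\<lambda>n. - f n) M"
  by (simp add: l1_le_def)

lemma l1_le_diff: "l1_le f M \<Longrightarrow> l1_le g N \<Longrightarrow> l1_le (\<lambda>n. f n - g n) (M + N)"
  using l1_le_add[OF _ l1_le_minus] by fastforce

lemma l1_le_sum:
  "finite A \<Longrightarrow> (\<And>i. i \<in> A \<Longrightarrow> l1_le (f i) (M i)) \<Longrightarrow> l1_le (\<lambda>n. \<Sum>i\<in>A. f i n) (\<Sum>i\<in>A. M i)"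
  by (induction A rule: finite_induct) (auto intro: l1_le_add simp: l1_le_def[of "\<lambda>_. 0"])

lemma l1_le_reindex:
  fixes f :: "'i \<Rightarrow> 'a::real_normed_vector" and h :: "'j \<Rightarrow> 'i"
  assumes "l1_le f M" "inj h" shows "l1_le (\<lambda>n. f (h n)) M"
proof (rule l1_leI)
  fix F :: "'j set" assume F: "finite F"
  have "(\<Sum>n\<in>F. norm (f (h n))) = (\<Sum>m\<in>h ` F. norm (f m))"
    using assms(2) by (subst sum.reindex) (auto intro: inj_on_subset)
  also have "\<dots> \<le> M" using F by (intro l1_leD assms) auto
  finally show "(\<Sum>n\<in>F. norm (f (h n))) \<le> M" .
qed

lemma l1_le_finite_support:
  fixes f :: "'i \<Rightarrow> 'a::real_normed_vector"
  assumes "finite A" "\<And>n. n \<notin> A \<Longrightarrow> f n = 0"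
  shows "l1_le f (\<Sum>n\<in>A. norm (f n))"
proof (rule l1_leI)
  fix F :: "'i set" assume F: "finite F"
  have "(\<Sum>n\<in>F. norm (f n)) = (\<Sum>n\<in>F \<inter> A. norm (f n))"
    using F assms by (intro sum.mono_neutral_right) auto
  also have "\<dots> \<le> (\<Sum>n\<in>A. norm (f n))" using assms by (intro sum_mono2) auto
  finally show "(\<Sum>n\<in>F. norm (f n)) \<le> (\<Sum>n\<in>A. norm (f n))" .
qed

lemma sum_summable_on:
  fixes f :: "'i \<Rightarrow> 'j \<Rightarrow> 'a::{comm_monoid_add, topological_comm_monoid_add}"
  assumes "finite F" "\<And>n. n \<in> F \<Longrightarrow> f n summable_on A"
  shows "(\<lambda>j. \<Sum>n\<in>F. f n j) summable_on A"
  using assms by (induction F rule: finite_induct) (auto intro: summable_on_add)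

lemma conv_l1_kernel:
  fixes n :: int and v :: "int \<Rightarrow> 'a::banach"
  assumes p: "l1_le p P" and v: "\<And>n. norm (v n) \<le> M"
  shows "l1_le (\<lambda>j. p j *\<^sub>R v (n - j)) (M * P)"
proof -
  have M: "0 \<le> M" using v norm_ge_zero order_trans by blast
  show ?thesis
  proof (rule l1_le_scale[OF p _ M])
    fix j show "norm (p j *\<^sub>R v (n - j)) \<le> M * norm (p j)"
      using mult_left_mono[OF v[of "n - j"], of "\<bar>p j\<bar>"] by (simp add: mult.commute[of M])
  qed
qed

lemma conv_bound:
  assumes p: "l1_le p P" and v: "\<And>n. norm (v n) \<le> M"
  shows "norm (conv p v n) \<le> P * M"
  using l1_le_norm_infsum(1)[OF conv_l1_kernel[OF p v, where n=n]]
  by (simp add: conv_def mult.commute)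

lemma conv_summable:
  fixes v :: "int \<Rightarrow> 'a::banach"
  assumes p: "l1_le p P" and v: "\<And>n. norm (v n) \<le> M"
  shows "(\<lambda>j. p j *\<^sub>R v (n - j)) summable_on UNIV"
  using l1_le_norm_infsum(2)[OF conv_l1_kernel[OF p v, where n=n]] .

lemma conv_add:
  fixes v w :: "int \<Rightarrow> 'a::banach"
  assumes p: "l1_le p P" and v: "\<And>n. norm (v n) \<le> M" and w: "\<And>n. norm (w n) \<le> N"
  shows "conv p (\<lambda>n. v n + w n) n = conv p v n + conv p w n"
  unfolding conv_def
  by (subst infsum_add[symmetric, OF conv_summable[OF p v] conv_summable[OF p w]])
     (simp add: scaleR_add_right)

lemma conv_uminus: "conv p (\<lambda>n. - v n) n = - conv p v n"
  by (simp add: conv_def infsum_uminus)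

lemma conv_diff:
  fixes v w :: "int \<Rightarrow> 'a::banach"
  assumes p: "l1_le p P" and v: "\<And>n. norm (v n) \<le> M" and w: "\<And>n. norm (w n) \<le> N"
  shows "conv p (\<lambda>n. v n - w n) n = conv p v n - conv p w n"
  using conv_add[where v=v and w="\<lambda>n. - w n" and n=n, OF p v, where N=N] w by (simp add: conv_uminus)

lemma conv_cmult:
  fixes v :: "int \<Rightarrow> 'a::{banach, real_normed_field}"
  shows "conv p (\<lambda>n. c * v n) n = c * conv p v n"
proof -
  have "(\<lambda>j. p j *\<^sub>R (c * v (n - j))) = (\<lambda>j. c * (p j *\<^sub>R v (n - j)))"
    by (simp add: fun_eq_iff)
  then show ?thesis unfolding conv_def by (simp only: infsum_cmult_right')
qed

lemma conv_sum:
  assumes p: "l1_le p P" and fin: "finite A" and v: "\<And>i n. i \<in> A \<Longrightarrow> norm (v i n) \<le> M i"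
  shows "conv p (\<lambda>n. \<Sum>i\<in>A. v i n) n = (\<Sum>i\<in>A. conv p (v i) n)"
  using fin v
proof (induction A rule: finite_induct)
  case empty then show ?case by (simp add: conv_def)
next
  case (insert i A)
  have "norm (\<Sum>i\<in>A. v i n) \<le> (\<Sum>i\<in>A. M i)" for n
    by (rule order_trans[OF norm_sum sum_mono]) (use insert in auto)
  then have "conv p (\<lambda>n. v i n + (\<Sum>i\<in>A. v i n)) n = conv p (v i) n + conv p (\<lambda>n. \<Sum>i\<in>A. v i n) n"
    using insert by (intro conv_add[OF p, where M="M i"]) auto
  then show ?case using insert by auto
qed

lemma conv_of_real:
  fixes v :: "int \<Rightarrow> real"
  assumes p: "l1_le p P" and v: "\<And>n. norm (v n) \<le> M"
  shows "conv p (\<lambda>n. of_real (v n) :: complex) n = of_real (conv p v n)"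
proof -
  have "((\<lambda>j. p j *\<^sub>R v (n - j)) has_sum conv p v n) UNIV"
    using conv_summable[OF p v] unfolding conv_def by (rule has_sum_infsum)
  then have "((\<lambda>j. of_real (p j *\<^sub>R v (n - j)) :: complex) has_sum of_real (conv p v n)) UNIV"
    by (rule has_sum_of_real)
  then have "((\<lambda>j. p j *\<^sub>R (of_real (v (n - j)) :: complex)) has_sum of_real (conv p v n)) UNIV"
    by (simp add: scaleR_conv_of_real)
  then show ?thesis unfolding conv_def by (rule infsumI)
qed

text \<open>Young's inequality. Only finitely many n are summed, so the sums over n and j are
  interchanged by additivity alone.\<close>

lemma conv_l1:
  fixes v :: "int \<Rightarrow> 'a::banach"
  assumes p: "l1_le p P" and v: "l1_le v M"
  shows "l1_le (conv p v) (P * M)"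
proof (rule l1_leI)
  fix F :: "int set" assume F: "finite F"
  have S: "(\<lambda>j. \<bar>p j\<bar> * norm (v (n - j))) summable_on UNIV" for n
    using l1_le_summable[OF conv_l1_kernel[OF p l1_le_norm[OF v], where n=n]] by simp
  have "(\<Sum>n\<in>F. norm (conv p v n)) \<le> (\<Sum>n\<in>F. \<Sum>\<^sub>\<infinity>j. \<bar>p j\<bar> * norm (v (n - j)))"
  proof (rule sum_mono)
    fix n
    show "norm (conv p v n) \<le> (\<Sum>\<^sub>\<infinity>j. \<bar>p j\<bar> * norm (v (n - j)))"
      using norm_infsum_bound[OF l1_le_summable[OF conv_l1_kernel[OF p l1_le_norm[OF v], where n=n]]]
      by (simp add: conv_def)
  qed
  also have "\<dots> = (\<Sum>\<^sub>\<infinity>j. \<Sum>n\<in>F. \<bar>p j\<bar> * norm (v (n - j)))"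
    using F by (induction F rule: finite_induct) (auto simp: infsum_add S sum_summable_on)
  also have "\<dots> = (\<Sum>\<^sub>\<infinity>j. \<bar>p j\<bar> * (\<Sum>n\<in>F. norm (v (n - j))))"
    by (simp add: sum_distrib_left)
  also have "\<dots> \<le> M * P"
  proof -
    have "l1_le (\<lambda>j. \<bar>p j\<bar> * (\<Sum>n\<in>F. norm (v (n - j)))) (M * P)"
    proof (rule l1_le_scale[OF p])
      fix j
      have "(\<Sum>n\<in>F. norm (v (n - j))) \<le> M"
        using l1_leD[OF l1_le_reindex[OF v, of "\<lambda>n. n - j"] F] by (simp add: inj_def)
      then show "norm (\<bar>p j\<bar> * (\<Sum>n\<in>F. norm (v (n - j)))) \<le> M * norm (p j)"
        using mult_left_mono[of "\<Sum>n\<in>F. norm (v (n - j))" M "\<bar>p j\<bar>"]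
          by (simp add: abs_mult sum_nonneg mult.commute[of M])
    qed (use l1_le_nonneg[OF v] in auto)
    from l1_le_norm_infsum(1)[OF this] show ?thesis by simp
  qed
  finally show "(\<Sum>n\<in>F. norm (conv p v n)) \<le> P * M" by (simp add: mult.commute)
qed

lemma conv_reflect:
  assumes "\<And>n. p (- n) = p n"
  shows "conv p (\<lambda>n. v (- n)) n = conv p v (- n)"
  unfolding conv_def
  by (rule infsum_reindex_bij_witness[of _ uminus uminus]) (use assms in auto)

text \<open>This is the symmetry of the operator for the bilinear pairing: an even kernel depends on
  n and m only through the distance. The interchange of sums rests on absolute summability over
  pairs, checked on rectangles, for which the pointwise bound P of the kernel is enough.\<close>

lemma infsum_conv_symmetric:
  fixes u v :: "int \<Rightarrow> real"
  assumes p: "l1_le p P" and ev: "\<And>n. p (- n) = p n" and u: "l1_le u M" and v: "l1_le v N"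
  shows "(\<Sum>\<^sub>\<infinity>n. u n * conv p v n) = (\<Sum>\<^sub>\<infinity>n. v n * conv p u n)"
proof -
  have conv': "conv p w n = (\<Sum>\<^sub>\<infinity>m. p (n - m) * w m)" for w :: "int \<Rightarrow> real" and n
    unfolding conv_def
    by (rule infsum_reindex_bij_witness[of _ "\<lambda>m. n - m" "\<lambda>m. n - m"]) auto
  have S: "(\<lambda>(n, m). u n * (p (n - m) * v m)) summable_on UNIV \<times> UNIV"
  proof -
    have "l1_le (\<lambda>(n, m). u n * (p (n - m) * v m)) (M * (P * N))"
    proof (rule l1_leI)
      fix F :: "(int \<times> int) set" assume F: "finite F"
      define A where "A = fst ` F" define B where "B = snd ` F"
      have fin: "finite A" "finite B" and sub: "F \<subseteq> A \<times> B"
        using F by (auto simp: A_def B_def image_iff) force+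
      have "(\<Sum>x\<in>F. norm (case x of (n, m) \<Rightarrow> u n * (p (n - m) * v m)))
            \<le> (\<Sum>x\<in>A \<times> B. norm (case x of (n, m) \<Rightarrow> u n * (p (n - m) * v m)))"
        using sub fin by (intro sum_mono2) auto
      also have "\<dots> = (\<Sum>n\<in>A. \<Sum>m\<in>B. \<bar>u n\<bar> * (\<bar>p (n - m)\<bar> * \<bar>v m\<bar>))"
        by (simp add: sum.cartesian_product case_prod_unfold abs_mult)
      also have "\<dots> \<le> (\<Sum>n\<in>A. \<Sum>m\<in>B. \<bar>u n\<bar> * (P * \<bar>v m\<bar>))"
        using l1_le_norm[OF p] by (intro sum_mono mult_left_mono mult_right_mono) auto
      also have "\<dots> = (\<Sum>n\<in>A. \<bar>u n\<bar>) * (P * (\<Sum>m\<in>B. \<bar>v m\<bar>))"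
        by (simp add: sum_distrib_left[symmetric] sum_distrib_right[symmetric])
      also have "\<dots> \<le> M * (P * N)"
        using l1_leD[OF u fin(1)] l1_leD[OF v fin(2)] l1_le_nonneg[OF p] l1_le_nonneg[OF u]
        by (intro mult_mono mult_left_mono) (auto intro!: mult_nonneg_nonneg sum_nonneg)
      finally show "(\<Sum>x\<in>F. norm (case x of (n, m) \<Rightarrow> u n * (p (n - m) * v m))) \<le> M * (P * N)" .
    qed
    then show ?thesis using l1_le_norm_infsum(2) by fastforce
  qed
  have "(\<Sum>\<^sub>\<infinity>n. u n * conv p v n) = (\<Sum>\<^sub>\<infinity>n. \<Sum>\<^sub>\<infinity>m. u n * (p (n - m) * v m))"
    by (simp add: conv' infsum_cmult_right')
  also have "\<dots> = (\<Sum>\<^sub>\<infinity>m. \<Sum>\<^sub>\<infinity>n. u n * (p (n - m) * v m))"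
    by (rule infsum_swap_banach[OF S])
  also have "\<dots> = (\<Sum>\<^sub>\<infinity>m. v m * conv p u m)"
  proof (rule infsum_cong)
    fix m
    have "(\<Sum>\<^sub>\<infinity>n. u n * (p (n - m) * v m)) = (\<Sum>\<^sub>\<infinity>n. v m * (p (m - n) * u n))"
      by (rule infsum_cong) (metis ev minus_diff_eq mult.commute mult.left_commute)
    then show "(\<Sum>\<^sub>\<infinity>n. u n * (p (n - m) * v m)) = v m * conv p u m"
      by (simp add: conv' infsum_cmult_right')
  qed
  finally show ?thesis .
qed

section \<open>A contraction principle for families\<close>

text \<open>Families are compared in the sup distance, expressed by arbitrary uniform bounds
  \<open>d\<close>, so that no supremum has to exist in advance. \<open>D\<close> is any starting
  bound; iteration shrinks it to \<open>q ^ n * D\<close>.\<close>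

lemma contraction_unique:
  fixes \<Phi> :: "('i \<Rightarrow> 'b::real_normed_vector) \<Rightarrow> 'i \<Rightarrow> 'b"
  assumes "0 \<le> q" "q < 1"
    and contr: "\<And>d i. (\<And>i. norm (f i - g i) \<le> d) \<Longrightarrow> norm (\<Phi> f i - \<Phi> g i) \<le> q * d"
    and bnd: "\<And>i. norm (f i - g i) \<le> D" and "\<Phi> f = f" "\<Phi> g = g"
  shows "f = g"
proof -
  have "norm (f i - g i) \<le> q ^ n * D" for i n
  proof (induction n arbitrary: i)
    case (Suc n)
    have "norm (\<Phi> f i - \<Phi> g i) \<le> q * (q ^ n * D)" by (rule contr) (rule Suc)
    then show ?case using assms by (simp add: mult.assoc)
  qed (use bnd in simp)
  moreover have "(\<lambda>n. q ^ n * D) \<longlonglongrightarrow> 0"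
    using assms(1,2) by (intro tendsto_mult_left_zero LIMSEQ_power_zero) auto
  ultimately have "norm (f i - g i) \<le> 0" for i
    by (meson LIMSEQ_le_const)
  then show ?thesis by (simp add: fun_eq_iff)
qed

text \<open>Contraction is measured in the sup distance, while \<open>S\<close> is closed under
  pointwise limits. This combination admits l^1 balls: the contraction estimate is a pointwise one,
  and membership in the ball carries the l^1 bound over to the fixed point.\<close>

lemma contraction_exists:
  fixes \<Phi> :: "('i \<Rightarrow> 'b::banach) \<Rightarrow> 'i \<Rightarrow> 'b"
  assumes q: "0 \<le> q" "q < 1" and f0: "f0 \<in> S" and maps: "\<And>f. f \<in> S \<Longrightarrow> \<Phi> f \<in> S"
    and closed: "\<And>X f. (\<And>n. X n \<in> S) \<Longrightarrow> (\<And>i. (\<lambda>n. X n i) \<longlonglongrightarrow> f i) \<Longrightarrow> f \<in> S"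
    and contr: "\<And>f g d i. f \<in> S \<Longrightarrow> g \<in> S \<Longrightarrow> (\<And>i. norm (f i - g i) \<le> d) \<Longrightarrow>
                  norm (\<Phi> f i - \<Phi> g i) \<le> q * d"
    and bnd: "\<And>f g i. f \<in> S \<Longrightarrow> g \<in> S \<Longrightarrow> norm (f i - g i) \<le> D"
  shows "\<exists>f\<in>S. \<Phi> f = f"
proof -
  define X where "X n = (\<Phi> ^^ n) f0" for n
  have XS: "X n \<in> S" for n by (induction n) (auto simp: X_def f0 maps)
  have Xm: "norm (X (n + m) i - X n i) \<le> q ^ n * D" for n m i
  proof (induction n arbitrary: i)
    case 0 then show ?case using bnd[OF XS XS] by simp
  next
    case (Suc n)
    have "norm (\<Phi> (X (n + m)) i - \<Phi> (X n) i) \<le> q * (q ^ n * D)"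
      by (rule contr[OF XS XS]) (rule Suc)
    then show ?case by (simp add: X_def mult.assoc)
  qed
  have lim0: "(\<lambda>n. q ^ n * D) \<longlonglongrightarrow> 0"
    using q by (intro tendsto_mult_left_zero LIMSEQ_power_zero) auto
  have "Cauchy (\<lambda>n. X n i)" for i
  proof (rule metric_CauchyI)
    fix e :: real assume "e > 0"
    then obtain N where N: "\<And>n. n \<ge> N \<Longrightarrow> norm (q ^ n * D) < e / 2"
      using LIMSEQ_D[OF lim0, of "e / 2"] by auto
    have "dist (X n i) (X N i) < e / 2" if "n \<ge> N" for n
      using Xm[of N "n - N" i] N[of N] that by (simp add: dist_norm)
    then have "dist (X m i) (X n i) < e" if "m \<ge> N" "n \<ge> N" for m n
      using that dist_triangle_half_l[of "X m i" "X N i" e "X n i"]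
      by (metis dist_commute)
    then show "\<exists>N. \<forall>m\<ge>N. \<forall>n\<ge>N. dist (X m i) (X n i) < e" by blast
  qed
  then have "\<exists>l. (\<lambda>n. X n i) \<longlonglongrightarrow> l" for i
    by (meson Cauchy_convergent convergent_def)
  then obtain f where f: "\<And>i. (\<lambda>n. X n i) \<longlonglongrightarrow> f i" by metis
  have fS: "f \<in> S" by (rule closed[OF XS f])
  have fX: "norm (f i - X n i) \<le> q ^ n * D" for i n
  proof (rule LIMSEQ_le_const2)
    show "(\<lambda>m. norm (X (n + m) i - X n i)) \<longlonglongrightarrow> norm (f i - X n i)"
      using LIMSEQ_ignore_initial_segment[OF f[of i], of n]
      by (intro tendsto_intros) (simp add: add.commute)
  qed (use Xm in auto)
  have "\<Phi> f i = f i" for i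
  proof -
    have le: "norm (\<Phi> f i - X (Suc n) i) \<le> q * (q ^ n * D)" for n
      using contr[OF fS XS[of n] fX[of _ n], of i] by (simp add: X_def)
    have lim: "(\<lambda>n. q * (q ^ n * D)) \<longlonglongrightarrow> 0"
      using tendsto_mult_right_zero[OF lim0] .
    have "(\<lambda>n. \<Phi> f i - X (Suc n) i) \<longlonglongrightarrow> 0"
      by (rule Lim_null_comparison[OF _ lim]) (simp add: le)
    then have "(\<lambda>n. \<Phi> f i - (\<Phi> f i - X (Suc n) i)) \<longlonglongrightarrow> \<Phi> f i - 0"
      by (intro tendsto_diff tendsto_const)
    then have "(\<lambda>n. X (Suc n) i) \<longlonglongrightarrow> \<Phi> f i" by simp
    moreover have "(\<lambda>n. X (Suc n) i) \<longlonglongrightarrow> f i" using f LIMSEQ_Suc by blast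
    ultimately show ?thesis by (rule LIMSEQ_unique)
  qed
  then show ?thesis using fS by (auto simp: fun_eq_iff)
qed

text \<open>Fatou's lemma for series. The encoding of \<open>l1_le\<close> by finite sums makes it
  immediate, and it is what lets l^1 balls serve as closed sets in
  \<open>contraction_exists\<close>.\<close>

lemma l1_le_tendsto:
  assumes "\<And>k. l1_le (X k) M" "\<And>n. (\<lambda>k. X k n) \<longlonglongrightarrow> f n"
  shows "l1_le f M"
proof (rule l1_leI)
  fix F :: "'a set" assume "finite F"
  then show "(\<Sum>n\<in>F. norm (f n)) \<le> M"
    by (intro LIMSEQ_le_const2[of "\<lambda>k. \<Sum>n\<in>F. norm (X k n)"] tendsto_sum tendsto_norm assms)
       (use assms in \<open>auto intro: l1_leD\<close>)
qed

section \<open>Block diagonalisation on the critical modes\<close>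

text \<open>For the zero wave and \<xi> = 0 the eigenvalue of mode n is \<open>\<i>\<close> times n
  (S 1 - S n). It vanishes at n = 0 through the factor n, at n = 1 trivially and at n = -1 by
  evenness of S; absence of resonances excludes all other n.\<close>

definition Core :: "int set" where "Core = {-1, 0, 1}"

lemma finite_Core [simp]: "finite Core" and card_Core [simp]: "card Core = 3"
  by (auto simp: Core_def)

lemma Core_iff: "n \<in> Core \<longleftrightarrow> \<bar>n\<bar> \<le> 1"
  by (auto simp: Core_def)

lemma sum_Core: "(\<Sum>i\<in>Core. f i) = f (-1) + f 0 + f 1"
  by (simp add: Core_def add.assoc)

lemma uminus_Core [simp]: "- n \<in> Core \<longleftrightarrow> n \<in> Core"
  by (simp add: Core_iff)

definition tail :: "(int \<Rightarrow> 'a::zero) \<Rightarrow> int \<Rightarrow> 'a" where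
  "tail f n = (if n \<in> Core then 0 else f n)"

text \<open>S is going to be y \<mapsto> m(k y), and \<gamma> measures the distance to resonance.
  Differentiability at the origin is avoided: \<open>lip\<close> and \<open>second\<close> exclude n
  = 0, where \<open>near0\<close> suffices because row 0 of the operator carries the factor \<xi>.
  The bound on \<xi>0 keeps \<Lambda> \<bar>\<xi>\<bar> below \<gamma> / 100, so that a Bloch shift
  cannot close the gap.\<close>

locale symbol =
  fixes S :: "real \<Rightarrow> real" and \<gamma> \<Lambda> \<xi>0 :: real
  assumes S_even: "S (- y) = S y"
    and gamma: "0 < \<gamma>" "\<gamma> \<le> 1" and Lambda: "\<bar>S 0 - S 1\<bar> + 2 \<le> \<Lambda>"
    and xi0: "0 < \<xi>0" "\<xi>0 \<le> \<gamma> / (100 * \<Lambda>)"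
    and gap: "n \<notin> Core \<Longrightarrow> \<bar>\<xi>\<bar> \<le> \<xi>0 \<Longrightarrow> 2 * \<gamma> \<le> \<bar>S (of_int n + \<xi>) - S 1\<bar>"
    and lip: "n \<noteq> 0 \<Longrightarrow> \<bar>\<xi>\<bar> \<le> \<xi>0 \<Longrightarrow> \<bar>S (of_int n + \<xi>) - S (of_int n)\<bar> \<le> \<Lambda> * \<bar>\<xi>\<bar>"
    and second: "n \<noteq> 0 \<Longrightarrow> \<bar>\<xi>\<bar> \<le> \<xi>0 \<Longrightarrow>
          \<bar>S (of_int n + \<xi>) + S (of_int n - \<xi>) - 2 * S (of_int n)\<bar> \<le> \<Lambda> * \<xi>\<^sup>2"
    and near0: "\<bar>\<xi>\<bar> \<le> \<xi>0 \<Longrightarrow> \<bar>S \<xi> - S 0\<bar> \<le> 1"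

locale potential = symbol +
  fixes p :: "int \<Rightarrow> real" and V P :: real
  assumes p_even: "p (- n) = p n" and p_0: "p 0 = 0" and p_l1: "l1_le p P"
    and P_small: "P \<le> \<gamma>\<^sup>2 / 400" and V_near: "\<bar>V - S 1\<bar> \<le> \<gamma> / 100"
begin

text \<open>Radius for the parts of the frame vectors outside \<open>Core\<close>. The choice R
  \<gamma> = 8 P lets the source term 2 P (1 + R) of \<open>Phi\<close>, divided by \<gamma>, use at
  most half of the radius.\<close>

definition R :: real where "R = 8 * P / \<gamma>"

definition Aop :: "real \<Rightarrow> (int \<Rightarrow> 'a::banach) \<Rightarrow> int \<Rightarrow> 'a" where
  "Aop \<xi> v n = (V - S (of_int n + \<xi>)) *\<^sub>R v n - 2 *\<^sub>R conv p v n"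

lemma P_nonneg: "0 \<le> P" using l1_le_nonneg[OF p_l1] .

lemma P_small': "P \<le> \<gamma> / 400"
proof -
  have "\<gamma>\<^sup>2 \<le> \<gamma>" using gamma by (simp add: power2_eq_square mult_left_le)
  then show ?thesis using P_small by linarith
qed

lemma R_nonneg: "0 \<le> R" using P_nonneg gamma by (simp add: R_def)

lemma R_gamma: "R * \<gamma> = 8 * P" using gamma by (simp add: R_def)

lemma R_small: "R \<le> 1 / 50"
proof -
  have "R * \<gamma> \<le> (1 / 50) * \<gamma>" using P_small' R_gamma by simp
  then show ?thesis using gamma(1) by simp
qed

lemma Lambda_pos: "2 \<le> \<Lambda>" using Lambda by linarith

lemma xi_small: assumes "\<bar>\<xi>\<bar> \<le> \<xi>0" shows "\<Lambda> * \<bar>\<xi>\<bar> \<le> \<gamma> / 100" "\<bar>\<xi>\<bar> \<le> 1 / 200"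
proof -
  have "\<bar>\<xi>\<bar> * \<Lambda> \<le> \<gamma> / (100 * \<Lambda>) * \<Lambda>" using assms xi0 Lambda_pos by (intro mult_right_mono) auto
  then show *: "\<Lambda> * \<bar>\<xi>\<bar> \<le> \<gamma> / 100" using Lambda_pos by (simp add: mult.commute)
  have "2 * \<bar>\<xi>\<bar> \<le> \<Lambda> * \<bar>\<xi>\<bar>" using Lambda_pos by (intro mult_right_mono) auto
  then show "\<bar>\<xi>\<bar> \<le> 1 / 200" using * gamma by linarith
qed

lemma denom: assumes "n \<notin> Core" "\<bar>\<xi>\<bar> \<le> \<xi>0" shows "\<gamma> \<le> \<bar>V - S (of_int n + \<xi>)\<bar>"
  using gap[OF assms] V_near gamma by linarith

lemma denom_n: assumes "n \<notin> Core" "\<bar>\<xi>\<bar> \<le> \<xi>0" shows "1 \<le> \<bar>of_int n + \<xi>\<bar>"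
proof -
  have "2 \<le> \<bar>real_of_int n\<bar>" using assms(1) by (simp add: Core_iff)
  then show ?thesis using xi_small(2)[OF assms(2)] by linarith
qed

lemma Aop_core_zero:
  assumes "v n = 0" shows "Aop \<xi> v n = - 2 *\<^sub>R conv p v n"
  using assms by (simp add: Aop_def)

text \<open>Frame vectors restrict to unit vectors on \<open>Core\<close>, so coordinates with
  respect to them are read off at the core entries. This is therefore the matrix of the operator,
  without the factor \<open>\<i>\<close>, as soon as the span is invariant.\<close>

definition Bm :: "real \<Rightarrow> (int \<times> int \<Rightarrow> real) \<Rightarrow> int \<Rightarrow> int \<Rightarrow> real" where
  "Bm \<xi> v i j = (of_int i + \<xi>) * Aop \<xi> (\<lambda>n. v (j, n)) i"

text \<open>The pair \<open>(j, n)\<close> stands for mode n of the vector attached to the core mode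
  j. A whole frame is one family, padded by zeros for j outside \<open>Core\<close>, so that the
  contraction principle treats the three coupled vectors at once.\<close>

definition Frames :: "(int \<times> int \<Rightarrow> real) set" where
  "Frames = {v. (\<forall>j n. j \<notin> Core \<longrightarrow> v (j, n) = 0) \<and>
                (\<forall>j\<in>Core. \<forall>n\<in>Core. v (j, n) = of_bool (n = j)) \<and>
                (\<forall>j\<in>Core. l1_le (tail (\<lambda>n. v (j, n))) R)}"

text \<open>Off the core, invariance of the span reads \<open>(of_int n + \<xi>) * Aop \<xi>
  (\<lambda>n. v (j, n)) n = (\<Sum>i\<in>Core. v (i, n) * Bm \<xi> v i j)\<close>; this is solved
  for the diagonal term. Since \<open>Bm\<close> depends on \<open>v\<close>, the equation is
  quadratic, of Riccati type.\<close>

definition Phi :: "real \<Rightarrow> (int \<times> int \<Rightarrow> real) \<Rightarrow> int \<times> int \<Rightarrow> real" where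
  "Phi \<xi> v = (\<lambda>(j, n). if j \<notin> Core then 0 else if n \<in> Core then of_bool (n = j)
     else (2 * conv p (\<lambda>n. v (j, n)) n + (\<Sum>i\<in>Core. v (i, n) * Bm \<xi> v i j) / (of_int n + \<xi>))
          / (V - S (of_int n + \<xi>)))"

lemma Frames_tail: "v \<in> Frames \<Longrightarrow> n \<notin> Core \<Longrightarrow> \<bar>v (j, n)\<bar> \<le> R"
  using l1_le_norm[of "tail (\<lambda>n. v (j, n))" R n] R_nonneg
  by (cases "j \<in> Core") (auto simp: Frames_def tail_def)

lemma Frames_bound: "v \<in> Frames \<Longrightarrow> \<bar>v (j, n)\<bar> \<le> 1"
  using Frames_tail[of v n j] R_small
  by (cases "n \<in> Core"; cases "j \<in> Core") (auto simp: Frames_def)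

lemma Frames_l1: assumes "v \<in> Frames" "j \<in> Core" shows "l1_le (\<lambda>n. v (j, n)) (1 + R)"
proof -
  have "l1_le (\<lambda>n. if n = j then 1 else 0 :: real) (\<Sum>n\<in>{j}. norm (if n = j then 1 else 0 :: real))"
    by (rule l1_le_finite_support) auto
  then have *: "l1_le (\<lambda>n. if n = j then 1 else 0 :: real) 1" by simp
  have "l1_le (tail (\<lambda>n. v (j, n))) R" using assms by (simp add: Frames_def)
  from l1_le_add[OF * this] show ?thesis
    by (rule l1_le_compare) (use assms in \<open>auto simp: tail_def Frames_def\<close>)
qed

lemma Aop_core_bound:
  assumes v: "v \<in> Frames" and i: "i \<in> Core" and j: "j \<in> Core" and xi: "\<bar>\<xi>\<bar> \<le> \<xi>0"
  shows "\<bar>Aop \<xi> (\<lambda>n. v (j, n)) i\<bar> \<le> (if i = 0 then 2 * \<Lambda> else \<gamma> / 40)"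
proof -
  have c: "\<bar>conv p (\<lambda>n. v (j, n)) i\<bar> \<le> P"
    using conv_bound[OF p_l1, of "\<lambda>n. v (j, n)" 1 i] Frames_bound[OF v] by simp
  have vij: "\<bar>v (j, i)\<bar> \<le> 1" using Frames_bound[OF v] .
  have "\<bar>Aop \<xi> (\<lambda>n. v (j, n)) i\<bar> \<le> \<bar>V - S (of_int i + \<xi>)\<bar> * \<bar>v (j, i)\<bar> + 2 * \<bar>conv p (\<lambda>n. v (j, n)) i\<bar>"
    by (simp add: Aop_def abs_mult[symmetric])
  also have "\<dots> \<le> \<bar>V - S (of_int i + \<xi>)\<bar> * 1 + 2 * P"
    using c vij by (intro add_mono mult_left_mono) auto
  finally have *: "\<bar>Aop \<xi> (\<lambda>n. v (j, n)) i\<bar> \<le> \<bar>V - S (of_int i + \<xi>)\<bar> + 2 * P" by simp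
  show ?thesis
  proof (cases "i = 0")
    case True
    have "\<bar>V - S \<xi>\<bar> \<le> \<Lambda>" "P \<le> 1" using near0[OF xi] V_near Lambda P_small' gamma by linarith+
    then show ?thesis using * True Lambda_pos by simp
  next
    case False
    then have "S (of_int i) = S 1" using i S_even[of 1] by (auto simp: Core_def)
    then have "\<bar>V - S (of_int i + \<xi>)\<bar> \<le> \<gamma> / 50"
      using lip[OF False xi] xi_small(1)[OF xi] V_near by linarith
    then show ?thesis using * False P_small' gamma by simp
  qed
qed

text \<open>The reduced matrix is small for two different reasons. Row 0 carries the factor \<xi>,
  although its diagonal entry is merely bounded; in the rows 1 and -1 the diagonal is small because
  V is near S 1. With three core modes, \<gamma> / 36 adds up to \<gamma> / 12 in the contraction
  estimate.\<close>

lemma Bm_bound: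
  assumes v: "v \<in> Frames" and i: "i \<in> Core" and j: "j \<in> Core" and xi: "\<bar>\<xi>\<bar> \<le> \<xi>0"
  shows "\<bar>Bm \<xi> v i j\<bar> \<le> \<gamma> / 36"
proof (cases "i = 0")
  case True
  have "\<bar>Bm \<xi> v i j\<bar> \<le> \<bar>\<xi>\<bar> * (2 * \<Lambda>)"
    using Aop_core_bound[OF assms] True by (simp add: Bm_def abs_mult mult_left_mono)
  moreover have "\<bar>\<xi>\<bar> * (2 * \<Lambda>) \<le> \<gamma> / 50" using xi_small(1)[OF xi] by (simp add: mult.commute)
  ultimately show ?thesis using gamma by linarith
next
  case False
  have "\<bar>of_int i + \<xi>\<bar> \<le> 201 / 200" using i xi_small[OF xi] by (auto simp: Core_def)
  then have "\<bar>Bm \<xi> v i j\<bar> \<le> (201 / 200) * (\<gamma> / 40)"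
    using Aop_core_bound[OF assms] False unfolding Bm_def abs_mult
    by (intro mult_mono) auto
  then show ?thesis using gamma by simp
qed

lemma Aop_core_diff:
  assumes v: "v \<in> Frames" and w: "w \<in> Frames" and d: "\<And>i. \<bar>v i - w i\<bar> \<le> d"
    and i: "i \<in> Core" and j: "j \<in> Core"
  shows "\<bar>Aop \<xi> (\<lambda>n. v (j, n)) i - Aop \<xi> (\<lambda>n. w (j, n)) i\<bar> \<le> 2 * P * d"
proof -
  have "conv p (\<lambda>n. v (j, n) - w (j, n)) i = conv p (\<lambda>n. v (j, n)) i - conv p (\<lambda>n. w (j, n)) i"
    by (rule conv_diff[OF p_l1, of _ 1 _ 1]) (use Frames_bound[OF v] Frames_bound[OF w] in auto)
  moreover have "\<bar>conv p (\<lambda>n. v (j, n) - w (j, n)) i\<bar> \<le> P * d"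
    using conv_bound[OF p_l1, of "\<lambda>n. v (j, n) - w (j, n)" d i] d by simp
  moreover have "v (j, i) = w (j, i)" using v w i j by (simp add: Frames_def)
  ultimately show ?thesis by (simp add: Aop_def)
qed

lemma Bm_diff:
  assumes v: "v \<in> Frames" and w: "w \<in> Frames" and d: "\<And>i. \<bar>v i - w i\<bar> \<le> d"
    and i: "i \<in> Core" and j: "j \<in> Core" and xi: "\<bar>\<xi>\<bar> \<le> \<xi>0"
  shows "\<bar>Bm \<xi> v i j - Bm \<xi> w i j\<bar> \<le> 3 * P * d"
proof -
  have d0: "0 \<le> d" using d abs_ge_zero order_trans by blast
  have "\<bar>of_int i + \<xi>\<bar> \<le> 3 / 2" using i xi_small[OF xi] by (auto simp: Core_def)
  then have "\<bar>of_int i + \<xi>\<bar> * \<bar>Aop \<xi> (\<lambda>n. v (j, n)) i - Aop \<xi> (\<lambda>n. w (j, n)) i\<bar> \<le> (3 / 2) * (2 * P * d)"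
    using Aop_core_diff[OF v w d i j] by (intro mult_mono) auto
  then show ?thesis by (simp add: Bm_def abs_mult[symmetric] right_diff_distrib)
qed

lemma Phi_Frames:
  assumes v: "v \<in> Frames" and xi: "\<bar>\<xi>\<bar> \<le> \<xi>0"
  shows "Phi \<xi> v \<in> Frames"
proof -
  have "l1_le (tail (\<lambda>n. Phi \<xi> v (j, n))) R" if j: "j \<in> Core" for j
  proof -
    have c: "l1_le (conv p (\<lambda>n. v (j, n))) (P * (1 + R))"
      by (rule conv_l1[OF p_l1 Frames_l1[OF v j]])
    have s: "l1_le (\<lambda>n. \<Sum>i\<in>Core. Bm \<xi> v i j *\<^sub>R tail (\<lambda>n. v (i, n)) n) (\<Sum>i\<in>Core. (\<gamma> / 36) * R)"
    proof (rule l1_le_sum)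
      fix i assume i: "i \<in> Core"
      have "l1_le (tail (\<lambda>n. v (i, n))) R" using v i by (simp add: Frames_def)
      then show "l1_le (\<lambda>n. Bm \<xi> v i j *\<^sub>R tail (\<lambda>n. v (i, n)) n) ((\<gamma> / 36) * R)"
        by (rule l1_le_scale)
           (use mult_right_mono[OF Bm_bound[OF v i j xi] abs_ge_zero] gamma in \<open>simp_all add: abs_mult\<close>)
    qed simp
    have "l1_le (\<lambda>n. 2 *\<^sub>R \<bar>conv p (\<lambda>n. v (j, n)) n\<bar> + \<bar>\<Sum>i\<in>Core. Bm \<xi> v i j *\<^sub>R tail (\<lambda>n. v (i, n)) n\<bar>)
            (2 * (P * (1 + R)) + (\<Sum>i\<in>Core. (\<gamma> / 36) * R))"
    proof (rule l1_le_add)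
      show "l1_le (\<lambda>n. 2 *\<^sub>R \<bar>conv p (\<lambda>n. v (j, n)) n\<bar>) (2 * (P * (1 + R)))"
        by (rule l1_le_scale[OF c]) auto
      show "l1_le (\<lambda>n. \<bar>\<Sum>i\<in>Core. Bm \<xi> v i j *\<^sub>R tail (\<lambda>n. v (i, n)) n\<bar>) (\<Sum>i\<in>Core. (\<gamma> / 36) * R)"
        by (rule l1_le_compare[OF s]) auto
    qed
    then have "l1_le (tail (\<lambda>n. Phi \<xi> v (j, n))) (1 / \<gamma> * (2 * (P * (1 + R)) + (\<Sum>i\<in>Core. (\<gamma> / 36) * R)))"
    proof (rule l1_le_scale)
      fix n
      let ?a = "conv p (\<lambda>n. v (j, n)) n" and ?b = "\<Sum>i\<in>Core. Bm \<xi> v i j *\<^sub>R tail (\<lambda>n. v (i, n)) n"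
      show "norm (tail (\<lambda>n. Phi \<xi> v (j, n)) n) \<le> 1 / \<gamma> * norm (2 *\<^sub>R \<bar>?a\<bar> + \<bar>?b\<bar>)"
      proof (cases "n \<in> Core")
        case True then show ?thesis using gamma by (simp add: tail_def)
      next
        case False
        have b: "?b = (\<Sum>i\<in>Core. v (i, n) * Bm \<xi> v i j)" using False by (simp add: tail_def mult.commute)
        have "\<bar>?b / (of_int n + \<xi>)\<bar> \<le> \<bar>?b\<bar>"
          using denom_n[OF False xi] by (simp add: abs_divide divide_le_eq mult_le_cancel_left1)
        then have "\<bar>2 * ?a + ?b / (of_int n + \<xi>)\<bar> \<le> 2 * \<bar>?a\<bar> + \<bar>?b\<bar>" by linarith
        then have "\<bar>(2 * ?a + ?b / (of_int n + \<xi>)) / (V - S (of_int n + \<xi>))\<bar> \<le> (2 * \<bar>?a\<bar> + \<bar>?b\<bar>) / \<gamma>"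
          unfolding abs_divide using denom[OF False xi] gamma by (intro frac_le) auto
        then show ?thesis using False j by (simp add: tail_def Phi_def mult.commute)
      qed
    qed (use gamma in auto)
    moreover have "1 / \<gamma> * (2 * (P * (1 + R)) + (\<Sum>i\<in>Core. (\<gamma> / 36) * R)) \<le> R"
    proof -
      have "P * (1 + R) \<le> P * 2" using R_small P_nonneg by (intro mult_left_mono) auto
      then have "2 * (P * (1 + R)) + 3 * (\<gamma> / 36 * R) \<le> R * \<gamma>"
        using R_gamma P_nonneg by (simp add: mult.commute)
      then show ?thesis using gamma by (simp add: field_simps)
    qed
    ultimately show ?thesis by (rule l1_le_mono)
  qed
  then show ?thesis by (auto simp: Frames_def Phi_def)
qed

text \<open>In the quadratic term the change of the frame meets the small \<open>Bm\<close>, and the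
  change of \<open>Bm\<close> meets entries of modulus at most 1. On the core all frames agree, so
  \<open>Bm\<close> varies only through the convolution, at the rate 3 P.\<close>

lemma Phi_contraction:
  assumes v: "v \<in> Frames" and w: "w \<in> Frames" and d: "\<And>i. norm (v i - w i) \<le> d" and xi: "\<bar>\<xi>\<bar> \<le> \<xi>0"
  shows "norm (Phi \<xi> v i - Phi \<xi> w i) \<le> 1 / 2 * d"
proof -
  obtain j n where i: "i = (j, n)" by (cases i)
  have d': "\<And>i. \<bar>v i - w i\<bar> \<le> d" using d by simp
  have d0: "0 \<le> d" using d norm_ge_zero order_trans by blast
  show ?thesis
  proof (cases "j \<in> Core \<and> n \<notin> Core")
    case False then show ?thesis using d0 by (auto simp: i Phi_def)
  next
    case True
    then have j: "j \<in> Core" and n: "n \<notin> Core" by auto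
    let ?b = "\<lambda>v. \<Sum>i\<in>Core. v (i, n) * Bm \<xi> v i j"
    have "conv p (\<lambda>n. v (j, n) - w (j, n)) n = conv p (\<lambda>n. v (j, n)) n - conv p (\<lambda>n. w (j, n)) n"
      by (rule conv_diff[OF p_l1, of _ 1 _ 1]) (use Frames_bound[OF v] Frames_bound[OF w] in auto)
    then have c: "\<bar>conv p (\<lambda>n. v (j, n)) n - conv p (\<lambda>n. w (j, n)) n\<bar> \<le> P * d"
      using conv_bound[OF p_l1, of "\<lambda>n. v (j, n) - w (j, n)" d n] d by simp
    have "\<bar>v (i, n) * Bm \<xi> v i j - w (i, n) * Bm \<xi> w i j\<bar> \<le> d * (\<gamma> / 36) + 1 * (3 * P * d)" if i: "i \<in> Core" for i
    proof -
      have eq: "v (i, n) * Bm \<xi> v i j - w (i, n) * Bm \<xi> w i j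
          = (v (i, n) - w (i, n)) * Bm \<xi> v i j + w (i, n) * (Bm \<xi> v i j - Bm \<xi> w i j)"
        by (simp add: algebra_simps)
      have "\<bar>v (i, n) * Bm \<xi> v i j - w (i, n) * Bm \<xi> w i j\<bar>
          \<le> \<bar>v (i, n) - w (i, n)\<bar> * \<bar>Bm \<xi> v i j\<bar> + \<bar>w (i, n)\<bar> * \<bar>Bm \<xi> v i j - Bm \<xi> w i j\<bar>"
        unfolding eq abs_mult[symmetric] by (rule abs_triangle_ineq)
      also have "\<dots> \<le> d * (\<gamma> / 36) + 1 * (3 * P * d)"
      proof (rule add_mono)
        show "\<bar>v (i, n) - w (i, n)\<bar> * \<bar>Bm \<xi> v i j\<bar> \<le> d * (\<gamma> / 36)"
          by (rule mult_mono[OF d'[of "(i, n)"] Bm_bound[OF v i j xi] d0 abs_ge_zero])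
        show "\<bar>w (i, n)\<bar> * \<bar>Bm \<xi> v i j - Bm \<xi> w i j\<bar> \<le> 1 * (3 * P * d)"
          by (rule mult_mono[OF Frames_bound[OF w] Bm_diff[OF v w d' i j xi] zero_le_one abs_ge_zero])
      qed
      finally show ?thesis .
    qed
    then have "\<bar>?b v - ?b w\<bar> \<le> (\<Sum>i\<in>Core. d * (\<gamma> / 36) + 1 * (3 * P * d))"
      unfolding sum_subtractf[symmetric] by (intro order_trans[OF sum_abs sum_mono])
    then have b: "\<bar>?b v - ?b w\<bar> \<le> 3 * (d * (\<gamma> / 36) + 3 * P * d)" by simp
    have b': "\<bar>(?b v - ?b w) / (of_int n + \<xi>)\<bar> \<le> \<bar>?b v - ?b w\<bar>"
      using denom_n[OF n xi] by (simp add: abs_divide divide_le_eq mult_le_cancel_left1)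
    have triangle: "\<bar>2 * x + y\<bar> \<le> 2 * \<bar>x\<bar> + \<bar>y\<bar>" for x y :: real by linarith
    have "\<bar>2 * (conv p (\<lambda>n. v (j, n)) n - conv p (\<lambda>n. w (j, n)) n) + (?b v - ?b w) / (of_int n + \<xi>)\<bar>
          \<le> 2 * (P * d) + 3 * (d * (\<gamma> / 36) + 3 * P * d)" (is "\<bar>?N\<bar> \<le> ?M")
      by (rule order_trans[OF triangle add_mono[OF mult_left_mono[OF c] order_trans[OF b' b]]]) simp
    then have f1: "\<bar>?N / (V - S (of_int n + \<xi>))\<bar> \<le> ?M / \<gamma>"
      unfolding abs_divide using denom[OF n xi] gamma by (intro frac_le) auto
    have f2: "?M / \<gamma> \<le> 1 / 2 * d"
    proof -
      have "P * d \<le> \<gamma> / 400 * d" using P_small' d0 by (intro mult_right_mono) auto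
      moreover have "0 \<le> \<gamma> * d" using gamma d0 by simp
      ultimately have "?M \<le> (1 / 2 * d) * \<gamma>" by (simp add: algebra_simps)
      then show ?thesis using gamma by (simp add: divide_le_eq)
    qed
    have f3: "Phi \<xi> v i - Phi \<xi> w i = ?N / (V - S (of_int n + \<xi>))"
      using j n by (simp add: i Phi_def diff_divide_distrib add_divide_distrib algebra_simps)
    show ?thesis unfolding f3 real_norm_def by (rule order_trans[OF f1 f2])
  qed
qed

lemma Frames_nonempty: "(\<lambda>(j, n). of_bool (j \<in> Core \<and> n = j)) \<in> Frames"
proof -
  have "tail (\<lambda>n. of_bool (n = j) :: real) = (\<lambda>_. 0)" if "j \<in> Core" for j :: int
    using that by (auto simp: tail_def fun_eq_iff)
  then show ?thesis using R_nonneg by (auto simp: Frames_def l1_le_def)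
qed

lemma frame_exists: assumes xi: "\<bar>\<xi>\<bar> \<le> \<xi>0" shows "\<exists>v\<in>Frames. Phi \<xi> v = v"
proof (rule contraction_exists[of "1 / 2" _ Frames, OF _ _ Frames_nonempty])
  fix X f assume X: "\<And>n. X n \<in> Frames" and lim: "\<And>i. (\<lambda>n. X n i) \<longlonglongrightarrow> f i"
  have "f (j, n) = 0" if "j \<notin> Core" for j n
    using lim[of "(j, n)"] X that by (simp add: Frames_def LIMSEQ_const_iff)
  moreover have "f (j, n) = of_bool (n = j)" if "j \<in> Core" "n \<in> Core" for j n
    using lim[of "(j, n)"] X that by (simp add: Frames_def LIMSEQ_const_iff)
  moreover have "l1_le (tail (\<lambda>n. f (j, n))) R" if "j \<in> Core" for j
  proof (rule l1_le_tendsto[of "\<lambda>k. tail (\<lambda>n. X k (j, n))"])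
    show "l1_le (tail (\<lambda>n. X k (j, n))) R" for k using X that by (simp add: Frames_def)
    show "(\<lambda>k. tail (\<lambda>n. X k (j, n)) n) \<longlonglongrightarrow> tail (\<lambda>n. f (j, n)) n" for n
      using lim by (simp add: tail_def)
  qed
  ultimately show "f \<in> Frames" by (simp add: Frames_def)
next
  fix v w :: "int \<times> int \<Rightarrow> real" and i assume "v \<in> Frames" "w \<in> Frames"
  then show "norm (v i - w i) \<le> 2"
    using Frames_bound[of v "fst i" "snd i"] Frames_bound[of w "fst i" "snd i"] by simp
qed (use Phi_Frames[OF _ xi] Phi_contraction[OF _ _ _ xi] in auto)

definition frame :: "real \<Rightarrow> int \<times> int \<Rightarrow> real" where
  "frame \<xi> = (SOME v. v \<in> Frames \<and> Phi \<xi> v = v)"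

lemma frame_Frames: "\<bar>\<xi>\<bar> \<le> \<xi>0 \<Longrightarrow> frame \<xi> \<in> Frames"
  and frame_fixed: "\<bar>\<xi>\<bar> \<le> \<xi>0 \<Longrightarrow> Phi \<xi> (frame \<xi>) = frame \<xi>"
  using someI_ex[OF frame_exists[unfolded Bex_def], of \<xi>] by (auto simp: frame_def)

lemma frame_unique:
  assumes xi: "\<bar>\<xi>\<bar> \<le> \<xi>0" and v: "v \<in> Frames" "Phi \<xi> v = v"
  shows "v = frame \<xi>"
proof (rule contraction_unique[of "1 / 2" v "frame \<xi>" "Phi \<xi>" 2])
  show "norm (v i - frame \<xi> i) \<le> 2" for i
    using Frames_bound[OF v(1), of "fst i" "snd i"]
      Frames_bound[OF frame_Frames[OF xi], of "fst i" "snd i"] by simp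
qed (use Phi_contraction[OF v(1) frame_Frames[OF xi] _ xi] frame_fixed[OF xi] v in auto)

lemma frame_core:
  assumes "\<bar>\<xi>\<bar> \<le> \<xi>0" "j \<in> Core" "n \<in> Core" shows "frame \<xi> (j, n) = of_bool (n = j)"
  using frame_Frames[OF assms(1)] assms by (simp add: Frames_def)

text \<open>On the core both sides agree by the definition of \<open>Bm\<close>; off the core this
  is the fixed point equation multiplied out, where \<open>denom\<close> and \<open>denom_n\<close>
  keep the divisors away from 0.\<close>

lemma frame_invariant:
  assumes xi: "\<bar>\<xi>\<bar> \<le> \<xi>0" and j: "j \<in> Core"
  shows "(of_int n + \<xi>) * Aop \<xi> (\<lambda>n. frame \<xi> (j, n)) n
       = (\<Sum>i\<in>Core. frame \<xi> (i, n) * Bm \<xi> (frame \<xi>) i j)"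
proof (cases "n \<in> Core")
  case True
  have "(\<Sum>i\<in>Core. frame \<xi> (i, n) * Bm \<xi> (frame \<xi>) i j) = (\<Sum>i\<in>Core. if i = n then Bm \<xi> (frame \<xi>) i j else 0)"
    by (rule sum.cong[OF refl]) (simp add: frame_core[OF xi _ True])
  then show ?thesis using True by (simp add: Bm_def)
next
  case False
  have "frame \<xi> (j, n) = Phi \<xi> (frame \<xi>) (j, n)" using frame_fixed[OF xi] by simp
  then have "frame \<xi> (j, n) * (V - S (of_int n + \<xi>)) = 2 * conv p (\<lambda>n. frame \<xi> (j, n)) n
      + (\<Sum>i\<in>Core. frame \<xi> (i, n) * Bm \<xi> (frame \<xi>) i j) / (of_int n + \<xi>)"
    using False j denom[OF False xi] gamma by (simp add: Phi_def eq_divide_eq)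
  then have "Aop \<xi> (\<lambda>n. frame \<xi> (j, n)) n
      = (\<Sum>i\<in>Core. frame \<xi> (i, n) * Bm \<xi> (frame \<xi>) i j) / (of_int n + \<xi>)"
    by (simp add: Aop_def mult.commute)
  then show ?thesis using denom_n[OF False xi] by auto
qed

end

section \<open>Dependence of the frame on the Bloch parameter, and its reflection symmetry\<close>

context potential
begin

text \<open>Lipschitz constant of the frame in \<xi>. It is twice the constant of
  \<open>Phi_xi_diff\<close>, the factor 2 being 1 / (1 - 1 / 2) for the contraction rate 1 / 2. It
  is proportional to R, hence to the size P of the wave.\<close>

definition Q :: real where "Q = 20 * R * \<Lambda> / \<gamma>"

text \<open>Row 0 vanishes at \<xi> = 0, so its difference is the row itself, which is O(\<xi>)
  without any Lipschitz bound for S at the origin. In the other rows the symbol is Lipschitz and the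
  vectors are the same on both sides.\<close>

lemma Bm_xi_diff:
  assumes w: "w \<in> Frames" and i: "i \<in> Core" and j: "j \<in> Core" and xi: "\<bar>\<xi>\<bar> \<le> \<xi>0"
  shows "\<bar>Bm \<xi> w i j - Bm 0 w i j\<bar> \<le> 2 * \<Lambda> * \<bar>\<xi>\<bar>"
proof -
  let ?A = "Aop \<xi> (\<lambda>n. w (j, n)) i" and ?C = "Aop 0 (\<lambda>n. w (j, n)) i"
  note A = Aop_core_bound[OF w i j xi]
  show ?thesis
  proof (cases "i = 0")
    case True
    then have "\<bar>?A\<bar> * \<bar>\<xi>\<bar> \<le> 2 * \<Lambda> * \<bar>\<xi>\<bar>" using A by (intro mult_right_mono) auto
    then show ?thesis using True by (simp add: Bm_def abs_mult mult.commute)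
  next
    case False
    have eq: "Bm \<xi> w i j - Bm 0 w i j = \<xi> * ?A + of_int i * (?A - ?C)"
      by (simp add: Bm_def algebra_simps)
    have "?A - ?C = - (S (of_int i + \<xi>) - S (of_int i)) * w (j, i)"
      by (simp add: Aop_def algebra_simps)
    then have "\<bar>?A - ?C\<bar> \<le> (\<Lambda> * \<bar>\<xi>\<bar>) * 1"
      using lip[OF False xi] Frames_bound[OF w, of j i] Lambda_pos
      by (simp add: abs_mult mult_mono del: mult_1_right)
    then have 1: "\<bar>of_int i * (?A - ?C)\<bar> \<le> \<Lambda> * \<bar>\<xi>\<bar>" using i by (auto simp: Core_def abs_mult)
    have "\<bar>?A\<bar> * \<bar>\<xi>\<bar> \<le> 1 * \<bar>\<xi>\<bar>" using A False gamma by (intro mult_right_mono) auto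
    moreover have "1 * \<bar>\<xi>\<bar> \<le> \<Lambda> * \<bar>\<xi>\<bar>" using Lambda_pos by (intro mult_right_mono) auto
    ultimately have 2: "\<bar>\<xi> * ?A\<bar> \<le> \<Lambda> * \<bar>\<xi>\<bar>" by (simp add: abs_mult mult.commute)
    show ?thesis unfolding eq using 1 2 abs_triangle_ineq[of "\<xi> * ?A" "of_int i * (?A - ?C)"] by linarith
  qed
qed

lemma xi0_nonneg: "\<bar>0\<bar> \<le> \<xi>0" using xi0 by simp

lemma Phi_xi_diff:
  assumes w: "w \<in> Frames" and fixed: "Phi 0 w = w" and xi: "\<bar>\<xi>\<bar> \<le> \<xi>0"
  shows "\<bar>Phi \<xi> w k - Phi 0 w k\<bar> \<le> 10 * R * \<Lambda> * \<bar>\<xi>\<bar> / \<gamma>"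
proof -
  obtain j n where k: "k = (j, n)" by (cases k)
  show ?thesis
  proof (cases "j \<in> Core \<and> n \<notin> Core")
    case False
    then show ?thesis using R_nonneg Lambda_pos gamma by (auto simp: k Phi_def)
  next
    case True
    then have j: "j \<in> Core" and n: "n \<notin> Core" by auto
    let ?x = "of_int n + \<xi> :: real" and ?D = "V - S (of_int n + \<xi>)" and ?E = "V - S (of_int n)"
    let ?b = "\<lambda>\<xi>. (\<Sum>i\<in>Core. w (i, n) * Bm \<xi> w i j) / (of_int n + \<xi>)"
    let ?c = "2 * conv p (\<lambda>n. w (j, n)) n"
    have D: "\<gamma> \<le> \<bar>?D\<bar>" using denom[OF n xi] .
    have D0: "\<gamma> \<le> \<bar>?E\<bar>" using denom[OF n xi0_nonneg] by simp
    have n1: "1 \<le> \<bar>real_of_int n\<bar>" using denom_n[OF n xi0_nonneg] by simp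
    have x1: "1 \<le> \<bar>?x\<bar>" using denom_n[OF n xi] .
    have w0: "w (j, n) = (?c + ?b 0) / ?E" using fun_cong[OF fixed, of "(j, n)"] j n by (simp add: Phi_def)
    have quot: "\<bar>Bm \<xi> w i j / ?x - Bm 0 w i j / of_int n\<bar> \<le> 3 * \<Lambda> * \<bar>\<xi>\<bar>" if i: "i \<in> Core" for i
    proof -
      have eq: "Bm \<xi> w i j / ?x - Bm 0 w i j / of_int n
         = (Bm \<xi> w i j - Bm 0 w i j) / ?x + Bm 0 w i j * (- \<xi> / (?x * of_int n))"
      proof -
        have "- \<xi> / (?x * of_int n) = 1 / ?x - 1 / of_int n" using n1 x1 by (auto simp: field_simps)
        then show ?thesis by (simp add: diff_divide_distrib right_diff_distrib)
      qed
      have 1: "\<bar>(Bm \<xi> w i j - Bm 0 w i j) / ?x\<bar> \<le> 2 * \<Lambda> * \<bar>\<xi>\<bar>"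
      proof -
        have "\<bar>Bm \<xi> w i j - Bm 0 w i j\<bar> / \<bar>?x\<bar> \<le> (2 * \<Lambda> * \<bar>\<xi>\<bar>) / 1"
          using Bm_xi_diff[OF w i j xi] x1 Lambda_pos by (intro frac_le) auto
        then show ?thesis by (simp add: abs_divide)
      qed
      have 2: "\<bar>Bm 0 w i j * (- \<xi> / (?x * of_int n))\<bar> \<le> \<Lambda> * \<bar>\<xi>\<bar>"
      proof -
        have "1 * 1 \<le> \<bar>?x\<bar> * \<bar>real_of_int n\<bar>" using n1 x1 by (intro mult_mono) auto
        then have "\<bar>\<xi>\<bar> / (\<bar>?x\<bar> * \<bar>real_of_int n\<bar>) \<le> \<bar>\<xi>\<bar> / 1" by (intro frac_le) auto
        then have "\<bar>Bm 0 w i j\<bar> * (\<bar>\<xi>\<bar> / (\<bar>?x\<bar> * \<bar>real_of_int n\<bar>)) \<le> \<Lambda> * \<bar>\<xi>\<bar>"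
          using Bm_bound[OF w i j xi0_nonneg] gamma Lambda_pos by (intro mult_mono) auto
        then show ?thesis by (simp add: abs_mult abs_divide)
      qed
      show ?thesis unfolding eq
        by (rule order_trans[OF abs_triangle_ineq order_trans[OF add_mono[OF 1 2]]]) simp
    qed
    have b: "\<bar>?b \<xi> - ?b 0\<bar> \<le> 9 * R * \<Lambda> * \<bar>\<xi>\<bar>"
    proof -
      have eq: "?b \<xi> - ?b 0 = (\<Sum>i\<in>Core. w (i, n) * (Bm \<xi> w i j / ?x - Bm 0 w i j / of_int n))"
        by (simp add: sum_divide_distrib sum_subtractf right_diff_distrib)
      have "\<bar>?b \<xi> - ?b 0\<bar> \<le> (\<Sum>i\<in>Core. R * (3 * \<Lambda> * \<bar>\<xi>\<bar>))"
        unfolding eq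
      proof (rule order_trans[OF sum_abs sum_mono])
        fix i assume i: "i \<in> Core"
        show "\<bar>w (i, n) * (Bm \<xi> w i j / ?x - Bm 0 w i j / of_int n)\<bar> \<le> R * (3 * \<Lambda> * \<bar>\<xi>\<bar>)"
          unfolding abs_mult by (rule mult_mono[OF Frames_tail[OF w n] quot[OF i] R_nonneg abs_ge_zero])
      qed
      then show ?thesis by simp
    qed
    have "Phi \<xi> w k - Phi 0 w k = (?c + ?b \<xi>) / ?D - (?c + ?b 0) / ?E"
      using j n by (simp add: k Phi_def)
    \<comment> \<open>The fixed point equation at \<xi> = 0 eliminates the convolution term: a
      difference of the coupling sums remains, together with \<open>w (j, n)\<close> times the
      relative change of the denominator. Both parts contain off-core frame entries and thus a
      factor R.\<close>
    also have "\<dots> = (?b \<xi> - ?b 0) / ?D + w (j, n) * ((?E - ?D) / ?D)"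
    proof -
      have "(?c + ?b 0) = w (j, n) * ?E" using w0 D0 gamma by auto
      moreover have "(c + b1) / D = (b1 - b2) / D + y * (E / D)" if "c + b2 = y * E" for c b1 b2 y D E :: real
      proof -
        have eq: "c + b1 = (b1 - b2) + y * E" using that by simp
        show ?thesis unfolding eq add_divide_distrib by simp
      qed
      ultimately have "(?c + ?b \<xi>) / ?D = (?b \<xi> - ?b 0) / ?D + w (j, n) * (?E / ?D)"
        by blast
      moreover have "w (j, n) * ((?E - ?D) / ?D) = w (j, n) * (?E / ?D) - w (j, n)"
      proof -
        have "?D / ?D = 1" using D gamma by auto
        then show ?thesis by (simp only: diff_divide_distrib[of ?E] right_diff_distrib mult_1_right)
      qed
      ultimately show ?thesis using w0 by simp
    qed
    finally have eq: "Phi \<xi> w k - Phi 0 w k = (?b \<xi> - ?b 0) / ?D + w (j, n) * ((?E - ?D) / ?D)" .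
    have 1: "\<bar>(?b \<xi> - ?b 0) / ?D\<bar> \<le> 9 * R * \<Lambda> * \<bar>\<xi>\<bar> / \<gamma>"
      unfolding abs_divide using b D gamma R_nonneg Lambda_pos by (intro frac_le) auto
    have nz: "n \<noteq> 0" using n by (auto simp: Core_def)
    have "\<bar>?E - ?D\<bar> / \<bar>?D\<bar> \<le> (\<Lambda> * \<bar>\<xi>\<bar>) / \<gamma>"
      using lip[OF nz xi] D gamma by (intro frac_le) auto
    then have 2: "\<bar>w (j, n) * ((?E - ?D) / ?D)\<bar> \<le> R * (\<Lambda> * \<bar>\<xi>\<bar> / \<gamma>)"
      unfolding abs_mult abs_divide by (rule mult_mono[OF Frames_tail[OF w n] _ R_nonneg]) auto
    have "\<bar>Phi \<xi> w k - Phi 0 w k\<bar> \<le> 9 * R * \<Lambda> * \<bar>\<xi>\<bar> / \<gamma> + R * (\<Lambda> * \<bar>\<xi>\<bar> / \<gamma>)"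
      unfolding eq by (rule order_trans[OF abs_triangle_ineq add_mono[OF 1 2]])
    also have "\<dots> = 10 * R * \<Lambda> * \<bar>\<xi>\<bar> / \<gamma>" by (simp add: add_divide_distrib[symmetric])
    finally show ?thesis .
  qed
qed

lemma frame_lipschitz:
  assumes xi: "\<bar>\<xi>\<bar> \<le> \<xi>0" shows "\<bar>frame \<xi> k - frame 0 k\<bar> \<le> Q * \<bar>\<xi>\<bar>"
proof -
  note v = frame_Frames[OF xi] and w = frame_Frames[OF xi0_nonneg]
  let ?e = "10 * R * \<Lambda> * \<bar>\<xi>\<bar> / \<gamma>"
  have le2: "\<bar>frame \<xi> k - frame 0 k\<bar> \<le> 2" for k
    using Frames_bound[OF v, of "fst k" "snd k"] Frames_bound[OF w, of "fst k" "snd k"] by simp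
  have step: "\<bar>frame \<xi> k - frame 0 k\<bar> \<le> 1 / 2 * d + ?e"
    if d: "\<And>k. \<bar>frame \<xi> k - frame 0 k\<bar> \<le> d" for d k
  proof -
    have 1: "\<bar>Phi \<xi> (frame \<xi>) k - Phi \<xi> (frame 0) k\<bar> \<le> 1 / 2 * d"
      using Phi_contraction[OF v w _ xi, of d k] d by simp
    have 2: "\<bar>Phi \<xi> (frame 0) k - Phi 0 (frame 0) k\<bar> \<le> ?e"
      by (rule Phi_xi_diff[OF w frame_fixed[OF xi0_nonneg] xi])
    show ?thesis using 1 2 unfolding frame_fixed[OF xi] frame_fixed[OF xi0_nonneg] by linarith
  qed
  define d where "d = (SUP k. \<bar>frame \<xi> k - frame 0 k\<bar>)"
  have bdd: "bdd_above (range (\<lambda>k. \<bar>frame \<xi> k - frame 0 k\<bar>))"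
    using le2 by (intro bdd_aboveI2[where M=2]) auto
  have le_d: "\<bar>frame \<xi> k - frame 0 k\<bar> \<le> d" for k
    unfolding d_def by (rule cSUP_upper[OF _ bdd]) simp
  have "d \<le> 1 / 2 * d + ?e"
    unfolding d_def by (rule cSUP_least) (use step[OF le_d] in \<open>auto simp: d_def\<close>)
  then have "d \<le> Q * \<bar>\<xi>\<bar>" by (simp add: Q_def)
  then show ?thesis using le_d[of k] by linarith
qed

lemma Aop_reflect: "Aop 0 (\<lambda>n. v (- n)) n = Aop 0 v (- n)"
  using S_even[of "of_int n"] conv_reflect[of p v n] p_even by (simp add: Aop_def)

text \<open>Reflection n \<mapsto> -n reverses the factor n and commutes with \<open>Aop 0\<close>,
  so the reflected frame is again a fixed point of \<open>Phi 0\<close>; uniqueness identifies the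
  two.\<close>

lemma frame_reflect: "frame 0 (- j, - n) = frame 0 (j, n)"
proof -
  let ?w = "frame 0" and ?v = "\<lambda>(j, n). frame 0 (- j, - n)"
  note w = frame_Frames[OF xi0_nonneg]
  have tl: "l1_le (tail (\<lambda>n. ?w (- j, - n))) R" if "j \<in> Core" for j
  proof -
    have "l1_le (tail (\<lambda>n. ?w (- j, n))) R" using w that by (simp add: Frames_def)
    from l1_le_reindex[OF this, of uminus] show ?thesis by (simp add: tail_def[abs_def])
  qed
  then have v: "?v \<in> Frames" using w by (auto simp: Frames_def)
  have B: "Bm 0 ?v i j = - Bm 0 ?w (- i) (- j)" for i j
    using Aop_reflect[of "\<lambda>n. ?w (- j, n)" i] by (simp add: Bm_def)
  have "Phi 0 ?v (j, n) = ?v (j, n)" for j n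
  proof -
    have c: "conv p (\<lambda>n. ?w (- j, - n)) n = conv p (\<lambda>n. ?w (- j, n)) (- n)"
      using conv_reflect[of p "\<lambda>n. ?w (- j, n)" n] p_even by simp
    have s: "(\<Sum>i\<in>Core. ?w (- i, - n) * - Bm 0 ?w (- i) (- j)) / real_of_int n
        = (\<Sum>i\<in>Core. ?w (i, - n) * Bm 0 ?w i (- j)) / real_of_int (- n)"
      by (simp add: sum_Core divide_simps)
    have "Phi 0 ?v (j, n) = Phi 0 ?w (- j, - n)"
      using c s S_even[of "of_int n"] unfolding Phi_def by (simp add: B)
    then show ?thesis by (simp add: frame_fixed[OF xi0_nonneg])
  qed
  then have "?v = ?w" by (intro frame_unique[OF xi0_nonneg v]) auto
  then show ?thesis by (metis case_prod_conv)
qed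

lemma Aop_of_real:
  assumes "\<And>n. \<bar>v n\<bar> \<le> M"
  shows "Aop \<xi> (\<lambda>n. of_real (v n) :: complex) n = of_real (Aop \<xi> v n)"
  using conv_of_real[OF p_l1, of v M n] assms by (simp add: Aop_def scaleR_conv_of_real)

lemma Aop_add:
  fixes v w :: "int \<Rightarrow> 'a::banach"
  assumes "\<And>n. norm (v n) \<le> M" "\<And>n. norm (w n) \<le> N"
  shows "Aop \<xi> (\<lambda>n. v n + w n) n = Aop \<xi> v n + Aop \<xi> w n"
  using conv_add[OF p_l1, of v M w N n] assms by (simp add: Aop_def algebra_simps)

lemma Aop_cmult:
  fixes v :: "int \<Rightarrow> complex"
  shows "Aop \<xi> (\<lambda>n. c * v n) n = c * Aop \<xi> v n"
  by (simp add: Aop_def conv_cmult scaleR_conv_of_real algebra_simps)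

lemma Aop_sum:
  fixes v :: "'i \<Rightarrow> int \<Rightarrow> 'a::banach"
  assumes "finite A" "\<And>i n. i \<in> A \<Longrightarrow> norm (v i n) \<le> M i"
  shows "Aop \<xi> (\<lambda>n. \<Sum>i\<in>A. v i n) n = (\<Sum>i\<in>A. Aop \<xi> (v i) n)"
  unfolding Aop_def by (subst conv_sum[OF p_l1 assms]) (auto simp: scaleR_sum_right sum_subtractf)

definition combine :: "real \<Rightarrow> (int \<Rightarrow> complex) \<Rightarrow> int \<Rightarrow> complex" where
  "combine \<xi> u n = (\<Sum>j\<in>Core. u j * of_real (frame \<xi> (j, n)))"

lemma combine_core: assumes "\<bar>\<xi>\<bar> \<le> \<xi>0" "n \<in> Core" shows "combine \<xi> u n = u n"
proof -
  have "combine \<xi> u n = (\<Sum>j\<in>Core. if j = n then u j else 0)"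
    unfolding combine_def by (rule sum.cong) (auto simp: frame_core assms)
  then show ?thesis using assms by simp
qed

lemma combine_l1:
  assumes "\<bar>\<xi>\<bar> \<le> \<xi>0" shows "l1_le (combine \<xi> u) (\<Sum>j\<in>Core. norm (u j) * (1 + R))"
  unfolding combine_def
  by (intro l1_le_sum l1_le_scale[OF Frames_l1[OF frame_Frames[OF assms]]])
     (auto simp: norm_mult)

lemma combine_Aop:
  assumes xi: "\<bar>\<xi>\<bar> \<le> \<xi>0"
  shows "of_real (of_int n + \<xi>) * Aop \<xi> (combine \<xi> u) n
       = (\<Sum>i\<in>Core. of_real (frame \<xi> (i, n)) * (\<Sum>j\<in>Core. of_real (Bm \<xi> (frame \<xi>) i j) * u j))"
proof -
  note v = frame_Frames[OF xi]
  have "Aop \<xi> (combine \<xi> u) n = (\<Sum>j\<in>Core. Aop \<xi> (\<lambda>n. u j * of_real (frame \<xi> (j, n))) n)"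
    unfolding combine_def
    by (rule Aop_sum[where M="\<lambda>j. norm (u j)"])
       (use Frames_bound[OF v] in \<open>auto simp: norm_mult mult_left_le\<close>)
  also have "\<dots> = (\<Sum>j\<in>Core. u j * of_real (Aop \<xi> (\<lambda>n. frame \<xi> (j, n)) n))"
    by (simp add: Aop_cmult Aop_of_real[OF Frames_bound[OF v]])
  finally have "of_real (of_int n + \<xi>) * Aop \<xi> (combine \<xi> u) n
     = (\<Sum>j\<in>Core. u j * of_real ((of_int n + \<xi>) * Aop \<xi> (\<lambda>n. frame \<xi> (j, n)) n))"
    by (simp add: sum_distrib_left mult.left_commute)
  also have "\<dots> = (\<Sum>j\<in>Core. u j * of_real (\<Sum>i\<in>Core. frame \<xi> (i, n) * Bm \<xi> (frame \<xi>) i j))"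
    by (rule sum.cong[OF refl]) (simp only: frame_invariant[OF xi])
  also have "\<dots> = (\<Sum>i\<in>Core. of_real (frame \<xi> (i, n)) * (\<Sum>j\<in>Core. of_real (Bm \<xi> (frame \<xi>) i j) * u j))"
    by (simp add: sum_Core algebra_simps)
  finally show ?thesis .
qed

end

text \<open>Eigenvectors are functions on the integers of which only the core entries count. The
  factor \<open>\<i>\<close> of the Bloch operator is left out, so a core eigenvalue \<mu>
  corresponds to the spectral value \<open>\<i> * \<mu>\<close>.\<close>

definition core_eigenvalue :: "(int \<Rightarrow> int \<Rightarrow> real) \<Rightarrow> complex \<Rightarrow> bool" where
  "core_eigenvalue B \<mu> \<longleftrightarrow> (\<exists>u. (\<exists>i\<in>Core. u i \<noteq> 0) \<and>
     (\<forall>i\<in>Core. (\<Sum>j\<in>Core. of_real (B i j) * u j) = \<mu> * u i))"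

section \<open>The resolvent equation near the origin\<close>

context potential
begin

text \<open>Fixed point form of the equation induced on the quotient by the span of the frame,
  represented by sequences that vanish on \<open>Core\<close>: the image of y is corrected by the
  frame combination that cancels its core entries. For such y, \<open>Aop\<close> at a core mode is
  -2 times the convolution, whence the last sum.\<close>

definition Psi :: "real \<Rightarrow> complex \<Rightarrow> (int \<Rightarrow> complex) \<Rightarrow> (int \<Rightarrow> complex) \<Rightarrow> int \<Rightarrow> complex" where
  "Psi \<xi> \<mu> r y n = (if n \<in> Core then 0 else
     (2 * conv p y n + (\<mu> * y n - r n - 2 * (\<Sum>i\<in>Core. of_real (frame \<xi> (i, n) * (of_int i + \<xi>)) * conv p y i))
        / of_real (of_int n + \<xi>)) / of_real (V - S (of_int n + \<xi>)))"

definition Defect :: "real \<Rightarrow> complex \<Rightarrow> (int \<Rightarrow> complex) \<Rightarrow> int \<Rightarrow> complex" where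
  "Defect \<xi> \<mu> y n = \<mu> * y n - of_real (of_int n + \<xi>) * Aop \<xi> y n"

lemma Psi_fixed_iff:
  assumes xi: "\<bar>\<xi>\<bar> \<le> \<xi>0"
  shows "Psi \<xi> \<mu> r y = y \<longleftrightarrow> (\<forall>n\<in>Core. y n = 0) \<and>
     (\<forall>n. n \<notin> Core \<longrightarrow> Defect \<xi> \<mu> y n
        + (\<Sum>i\<in>Core. of_real (frame \<xi> (i, n)) * (of_real (of_int i + \<xi>) * Aop \<xi> y i)) = r n)"
proof -
  have "Psi \<xi> \<mu> r y n = y n \<longleftrightarrow>  Defect \<xi> \<mu> y n
        + (\<Sum>i\<in>Core. of_real (frame \<xi> (i, n)) * (of_real (of_int i + \<xi>) * Aop \<xi> y i)) = r n"
    if core: "\<forall>n\<in>Core. y n = 0" and n: "n \<notin> Core" for n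
  proof -
    define x where "x = complex_of_real (of_int n + \<xi>)"
    define D where "D = complex_of_real (V - S (of_int n + \<xi>))"
    define s where "s = (\<Sum>i\<in>Core. of_real (frame \<xi> (i, n) * (of_int i + \<xi>)) * conv p y i)"
    have nz: "x \<noteq> 0" "D \<noteq> 0"
      using denom_n[OF n xi] denom[OF n xi] gamma unfolding x_def D_def of_real_eq_0_iff by auto
    have s: "(\<Sum>i\<in>Core. of_real (frame \<xi> (i, n)) * (of_real (of_int i + \<xi>) * Aop \<xi> y i)) = - 2 * s"
      unfolding s_def sum_distrib_left
      by (rule sum.cong[OF refl]) (use core in \<open>simp add: Aop_core_zero scaleR_conv_of_real\<close>)
    have "Psi \<xi> \<mu> r y n = y n \<longleftrightarrow> 2 * conv p y n + (\<mu> * y n - r n - 2 * s) / x = D * y n"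
      using n nz unfolding Psi_def s_def x_def D_def by (simp add: divide_eq_eq mult.commute)
    also have "\<dots> \<longleftrightarrow> \<mu> * y n - x * (D * y n - 2 * conv p y n) - 2 * s = r n"
      using nz(1) by (auto simp: field_simps)
    finally show ?thesis unfolding s by (simp add: Defect_def Aop_def x_def D_def scaleR_conv_of_real)
  qed
  moreover have "Psi \<xi> \<mu> r y n = 0" if "n \<in> Core" for n using that by (simp add: Psi_def)
  ultimately show ?thesis by (auto simp: fun_eq_iff) metis+
qed

lemma Psi_diff_aux:
  fixes a b c :: complex
  assumes n: "n \<notin> Core" and xi: "\<bar>\<xi>\<bar> \<le> \<xi>0"
  shows "norm ((2 * a + b / of_real (of_int n + \<xi>)) / of_real (V - S (of_int n + \<xi>)))
      \<le> (2 * norm a + norm b) / \<gamma>"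
proof -
  have "norm (b / of_real (of_int n + \<xi>)) \<le> norm b / 1"
    unfolding norm_divide norm_of_real using denom_n[OF n xi] by (intro frac_le) auto
  then have "norm (2 * a + b / of_real (of_int n + \<xi>)) \<le> 2 * norm a + norm b"
    using norm_triangle_ineq[of "2 * a" "b / of_real (of_int n + \<xi>)"] by (simp add: norm_mult)
  then show ?thesis
    unfolding norm_divide norm_of_real using denom[OF n xi] gamma by (intro frac_le) auto
qed

lemma frame_coupling:
  assumes n: "n \<notin> Core" and xi: "\<bar>\<xi>\<bar> \<le> \<xi>0" and c: "\<And>i. norm (c i) \<le> d"
  shows "norm (\<Sum>i\<in>Core. complex_of_real (frame \<xi> (i, n) * (of_int i + \<xi>)) * c i) \<le> 6 * R * d"
proof -
  have "norm (\<Sum>i\<in>Core. complex_of_real (frame \<xi> (i, n) * (of_int i + \<xi>)) * c i) \<le> (\<Sum>i\<in>Core. (R * 2) * d)"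
  proof (rule order_trans[OF norm_sum sum_mono])
    fix i assume i: "i \<in> Core"
    have "\<bar>of_int i + \<xi>\<bar> \<le> 2" using i xi_small[OF xi] by (auto simp: Core_def)
    then have "\<bar>frame \<xi> (i, n)\<bar> * \<bar>of_int i + \<xi>\<bar> \<le> R * 2"
      by (intro mult_mono Frames_tail[OF frame_Frames[OF xi] n] R_nonneg) auto
    then show "norm (complex_of_real (frame \<xi> (i, n) * (of_int i + \<xi>)) * c i) \<le> (R * 2) * d"
      unfolding norm_mult norm_of_real abs_mult by (rule mult_mono) (use c R_nonneg in auto)
  qed
  then show ?thesis by simp
qed

lemma Psi_contraction:
  assumes xi: "\<bar>\<xi>\<bar> \<le> \<xi>0" and lam: "norm \<mu> \<le> \<gamma> / 8"
    and y: "\<And>n. norm (y n) \<le> M" and z: "\<And>n. norm (z n) \<le> N" and d: "\<And>n. norm (y n - z n) \<le> d"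
  shows "norm (Psi \<xi> \<mu> r y n - Psi \<xi> \<mu> r z n) \<le> 1 / 2 * d"
proof -
  have d0: "0 \<le> d" using d norm_ge_zero order_trans by blast
  have cd: "conv p y n - conv p z n = conv p (\<lambda>n. y n - z n) n" for n
    by (rule conv_diff[OF p_l1 y z, symmetric])
  have c: "norm (conv p y n - conv p z n) \<le> P * d" for n
    unfolding cd by (rule conv_bound[OF p_l1 d])
  show ?thesis
  proof (cases "n \<in> Core")
    case True then show ?thesis using d0 by (simp add: Psi_def)
  next
    case False
    let ?s = "\<lambda>c. \<Sum>i\<in>Core. complex_of_real (frame \<xi> (i, n) * (of_int i + \<xi>)) * c i"
    let ?b = "\<mu> * (y n - z n) - 2 * ?s (\<lambda>i. conv p y i - conv p z i)"
    have eq: "Psi \<xi> \<mu> r y n - Psi \<xi> \<mu> r z n = (2 * (conv p y n - conv p z n) + ?b / of_real (of_int n + \<xi>))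
       / of_real (V - S (of_int n + \<xi>))"
      using False by (simp add: Psi_def diff_divide_distrib[symmetric] sum_subtractf right_diff_distrib algebra_simps)
    have "norm (\<mu> * (y n - z n)) \<le> \<gamma> / 8 * d"
      unfolding norm_mult using lam d gamma by (intro mult_mono) auto
    moreover have "norm (?s (\<lambda>i. conv p y i - conv p z i)) \<le> 6 * R * (P * d)"
      by (rule frame_coupling[OF False xi c])
    moreover have "6 * R * (P * d) \<le> P * d"
      using mult_right_mono[of "6 * R" 1 "P * d"] R_small P_nonneg d0 by simp
    ultimately have b: "norm ?b \<le> \<gamma> / 8 * d + 2 * (P * d)"
      using norm_triangle_ineq4[of "\<mu> * (y n - z n)" "2 * ?s (\<lambda>i. conv p y i - conv p z i)"]
      by (simp add: norm_mult)
    have Pd: "P * d \<le> \<gamma> / 400 * d" using P_small' d0 by (intro mult_right_mono) auto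
    have gd: "0 \<le> \<gamma> * d" using gamma d0 by simp
    have "2 * norm (conv p y n - conv p z n) + norm ?b \<le> 2 * (P * d) + (\<gamma> / 8 * d + 2 * (P * d))"
      by (rule add_mono[OF mult_left_mono[OF c] b]) simp
    also have "\<dots> \<le> 1 / 2 * (\<gamma> * d)" using Pd gd by simp
    finally have "(2 * norm (conv p y n - conv p z n) + norm ?b) / \<gamma> \<le> (1 / 2 * (\<gamma> * d)) / \<gamma>"
      using gamma by (intro divide_right_mono) simp_all
    then have "(2 * norm (conv p y n - conv p z n) + norm ?b) / \<gamma> \<le> 1 / 2 * d" using gamma by simp
    then show ?thesis unfolding eq using Psi_diff_aux[OF False xi] order_trans by blast
  qed
qed

text \<open>Uniqueness is wanted among bounded sequences, since the Fourier coefficients of an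
  arbitrary element of the domain are not known to be summable beforehand.\<close>

lemma tail_unique:
  assumes xi: "\<bar>\<xi>\<bar> \<le> \<xi>0" and lam: "norm \<mu> \<le> \<gamma> / 8" and core: "\<And>n. n \<in> Core \<Longrightarrow> y n = 0"
    and y: "\<And>n. norm (y n) \<le> M"
    and eq: "\<And>n. n \<notin> Core \<Longrightarrow> Defect \<xi> \<mu> y n
        + (\<Sum>i\<in>Core. of_real (frame \<xi> (i, n)) * (of_real (of_int i + \<xi>) * Aop \<xi> y i)) = 0"
  shows "y = (\<lambda>_. 0)"
proof (rule contraction_unique[of "1 / 2" y _ "Psi \<xi> \<mu> (\<lambda>_. 0)" M])
  show "Psi \<xi> \<mu> (\<lambda>_. 0) y = y" using core eq by (subst Psi_fixed_iff[OF xi]) auto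
  show "Psi \<xi> \<mu> (\<lambda>_. 0) (\<lambda>_. 0) = (\<lambda>_. 0)" by (auto simp: Psi_def conv_def)
qed (use y Psi_contraction[OF xi lam, of y M "\<lambda>_. 0" 0] in auto)

text \<open>Summability is asked of r only after division by n + \<xi>. The operator contains a
  derivative, so this division is part of its inversion, and a square integrable right-hand side
  offers no more.\<close>

lemma tail_exists:
  assumes xi: "\<bar>\<xi>\<bar> \<le> \<xi>0" and lam: "norm \<mu> \<le> \<gamma> / 8"
    and r: "l1_le (tail (\<lambda>n. r n / of_real (of_int n + \<xi>))) N"
  obtains y where "\<And>n. n \<in> Core \<Longrightarrow> y n = 0" "l1_le y (2 * N / \<gamma>)"
    "\<And>n. n \<notin> Core \<Longrightarrow> Defect \<xi> \<mu> y n
        + (\<Sum>i\<in>Core. of_real (frame \<xi> (i, n)) * (of_real (of_int i + \<xi>) * Aop \<xi> y i)) = r n"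
proof -
  define Y where "Y = 2 * N / \<gamma>"
  have N0: "0 \<le> N" using l1_le_nonneg[OF r] .
  have Y0: "0 \<le> Y" using N0 gamma by (simp add: Y_def)
  have YN: "N = \<gamma> * Y / 2" using gamma by (simp add: Y_def)
  have maps: "l1_le (Psi \<xi> \<mu> r y) Y" if y: "l1_le y Y" for y
  proof -
    let ?s = "\<lambda>n. \<Sum>i\<in>Core. tail (\<lambda>n. frame \<xi> (i, n)) n *\<^sub>R (of_real (of_int i + \<xi>) * conv p y i)"
    have c: "l1_le (conv p y) (P * Y)" by (rule conv_l1[OF p_l1 y])
    have s: "l1_le ?s (\<Sum>i\<in>Core. (2 * (P * Y)) * R)"
    proof (rule l1_le_sum)
      fix i assume i: "i \<in> Core"
      have "\<bar>of_int i + \<xi>\<bar> \<le> 2" using i xi_small[OF xi] by (auto simp: Core_def)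
      then have b: "norm (of_real (of_int i + \<xi>) * conv p y i) \<le> 2 * (P * Y)"
        unfolding norm_mult norm_of_real using l1_le_norm[OF c] by (intro mult_mono) auto
      have "l1_le (tail (\<lambda>n. frame \<xi> (i, n))) R" using frame_Frames[OF xi] i by (simp add: Frames_def)
      then show "l1_le (\<lambda>n. tail (\<lambda>n. frame \<xi> (i, n)) n *\<^sub>R (of_real (of_int i + \<xi>) * conv p y i)) ((2 * (P * Y)) * R)"
      proof (rule l1_le_scale)
        fix n
        show "norm (tail (\<lambda>n. frame \<xi> (i, n)) n *\<^sub>R (of_real (of_int i + \<xi>) * conv p y i))
            \<le> 2 * (P * Y) * norm (tail (\<lambda>n. frame \<xi> (i, n)) n)"
          unfolding norm_scaleR real_norm_def by (subst mult.commute) (rule mult_right_mono[OF b abs_ge_zero])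
      qed (use P_nonneg Y0 in simp)
    qed simp
    let ?g = "\<lambda>n. 2 * norm (conv p y n) + \<gamma> / 8 * norm (y n) + norm (tail (\<lambda>n. r n / of_real (of_int n + \<xi>)) n) + 2 * norm (?s n)"
    have "l1_le ?g (2 * (P * Y) + \<gamma> / 8 * Y + N + 2 * (\<Sum>i\<in>Core. (2 * (P * Y)) * R))"
      by (intro l1_le_add l1_le_scale[OF c] l1_le_scale[OF y] l1_le_scale[OF s] l1_le_compare[OF r])
         (use gamma in auto)
    then have "l1_le (Psi \<xi> \<mu> r y) (1 / \<gamma> * (2 * (P * Y) + \<gamma> / 8 * Y + N + 2 * (\<Sum>i\<in>Core. (2 * (P * Y)) * R)))"
    proof (rule l1_le_scale)
      fix n
      show "norm (Psi \<xi> \<mu> r y n) \<le> 1 / \<gamma> * norm (?g n)"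
      proof (cases "n \<in> Core")
        case True then show ?thesis using gamma by (simp add: Psi_def)
      next
        case False
        let ?x = "complex_of_real (of_int n + \<xi>)"
        have x1: "1 \<le> norm ?x" using denom_n[OF False xi] unfolding norm_of_real .
        have s': "(\<Sum>i\<in>Core. of_real (frame \<xi> (i, n) * (of_int i + \<xi>)) * conv p y i) = ?s n"
          using False by (intro sum.cong) (auto simp: tail_def scaleR_conv_of_real)
        have a1: "norm (\<mu> * y n / ?x) \<le> (\<gamma> / 8 * norm (y n)) / 1"
          unfolding norm_divide norm_mult using lam x1 gamma by (intro frac_le mult_right_mono) auto
        have a2: "norm (2 * ?s n / ?x) \<le> 2 * norm (?s n) / 1"
          unfolding norm_divide using x1 by (intro frac_le) (auto simp: norm_mult)
        have quad: "norm (a + b - e - f) \<le> norm a + norm b + norm e + norm f" for a b e f :: complex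
          by (smt (verit) norm_triangle_ineq norm_triangle_ineq4)
        have "norm (2 * conv p y n + \<mu> * y n / ?x - r n / ?x - 2 * ?s n / ?x)
           \<le> norm (2 * conv p y n) + norm (\<mu> * y n / ?x) + norm (r n / ?x) + norm (2 * ?s n / ?x)"
          by (rule quad)
        also have "\<dots> \<le> 2 * norm (conv p y n) + \<gamma> / 8 * norm (y n) + norm (r n / ?x) + 2 * norm (?s n)"
          by (intro add_mono order_trans[OF a1] order_trans[OF a2]) (simp_all add: norm_mult)
        also have "\<dots> = ?g n" using False by (simp add: tail_def)
        finally have *: "norm (2 * conv p y n + (\<mu> * y n - r n - 2 * ?s n) / ?x) \<le> ?g n"
          by (simp only: diff_divide_distrib add_diff_eq)
        then have "norm ((2 * conv p y n + (\<mu> * y n - r n - 2 * ?s n) / ?x) / of_real (V - S (of_int n + \<xi>))) \<le> ?g n / \<gamma>"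
          unfolding norm_divide[of _ "of_real (V - S (of_int n + \<xi>))"] norm_of_real
          using denom[OF False xi] gamma norm_ge_zero order_trans[OF norm_ge_zero *] by (intro frac_le) auto
        moreover have "?g n \<le> norm (?g n)" by simp
        ultimately show ?thesis using False gamma unfolding Psi_def s'
          by (simp add: divide_right_mono order_trans)
      qed
    qed (use gamma in auto)
    moreover have "1 / \<gamma> * (2 * (P * Y) + \<gamma> / 8 * Y + N + 2 * (\<Sum>i\<in>Core. (2 * (P * Y)) * R)) \<le> Y"
    proof -
      have "P * Y \<le> \<gamma> / 400 * Y" using P_small' Y0 by (intro mult_right_mono) auto
      moreover have "P * Y * R \<le> P * Y * 1" using R_small P_nonneg Y0 by (intro mult_left_mono) auto
      moreover have "0 \<le> \<gamma> * Y" using gamma Y0 by simp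
      ultimately have "2 * (P * Y) + \<gamma> / 8 * Y + N + 2 * (\<Sum>i\<in>Core. (2 * (P * Y)) * R) \<le> \<gamma> * Y"
        by (simp add: YN algebra_simps)
      then show ?thesis using gamma by (simp add: divide_le_eq mult.commute)
    qed
    ultimately show ?thesis by (rule l1_le_mono)
  qed
  have "\<exists>y\<in>{y. l1_le y Y}. Psi \<xi> \<mu> r y = y"
  proof (rule contraction_exists[of "1 / 2" "\<lambda>_. 0" _ _ "2 * Y"])
    show "(\<lambda>_. 0) \<in> {y. l1_le y Y}" using Y0 by (simp add: l1_le_def)
    show "f \<in> {y. l1_le y Y}" if "\<And>n. X n \<in> {y. l1_le y Y}" "\<And>i. (\<lambda>n. X n i) \<longlonglongrightarrow> f i" for X f
      using that by (auto intro: l1_le_tendsto)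
    show "norm (f i - g i) \<le> 2 * Y" if "f \<in> {y. l1_le y Y}" "g \<in> {y. l1_le y Y}" for f g i
      using that l1_le_norm[of f Y i] l1_le_norm[of g Y i] norm_triangle_ineq4[of "f i" "g i"] by simp
    show "norm (Psi \<xi> \<mu> r f i - Psi \<xi> \<mu> r g i) \<le> 1 / 2 * d"
      if "f \<in> {y. l1_le y Y}" "g \<in> {y. l1_le y Y}" "\<And>i. norm (f i - g i) \<le> d" for f g d i
      by (rule Psi_contraction[where M=Y and N=Y, OF xi lam])
         (use that l1_le_norm[of f Y] l1_le_norm[of g Y] in auto)
  qed (use maps in auto)
  then obtain y where y: "l1_le y Y" "Psi \<xi> \<mu> r y = y" by blast
  show ?thesis
    by (rule that[of y]) (use y Psi_fixed_iff[OF xi] in \<open>auto simp: Y_def\<close>)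
qed

text \<open>Block triangularity: a combination of frame vectors stays in the span, where the matrix
  \<open>Bm\<close> acts, while y contributes its own defect.\<close>

lemma Defect_combine:
  assumes xi: "\<bar>\<xi>\<bar> \<le> \<xi>0" and y: "\<And>n. norm (y n) \<le> M"
  shows "Defect \<xi> \<mu> (\<lambda>n. combine \<xi> u n + y n) n
     = (\<Sum>i\<in>Core. of_real (frame \<xi> (i, n)) * (\<mu> * u i - (\<Sum>j\<in>Core. of_real (Bm \<xi> (frame \<xi>) i j) * u j)))
       + Defect \<xi> \<mu> y n"
proof -
  have "Aop \<xi> (\<lambda>n. combine \<xi> u n + y n) n = Aop \<xi> (combine \<xi> u) n + Aop \<xi> y n"
    by (rule Aop_add[OF l1_le_norm[OF combine_l1[OF xi]] y])
  then have "Defect \<xi> \<mu> (\<lambda>n. combine \<xi> u n + y n) n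
     = \<mu> * combine \<xi> u n - of_real (of_int n + \<xi>) * Aop \<xi> (combine \<xi> u) n + Defect \<xi> \<mu> y n"
    by (simp add: Defect_def algebra_simps)
  then show ?thesis unfolding combine_Aop[OF xi]
    by (simp add: combine_def sum_Core algebra_simps)
qed

lemma sum_frame_core:
  assumes "\<bar>\<xi>\<bar> \<le> \<xi>0" "n \<in> Core"
  shows "(\<Sum>i\<in>Core. of_real (frame \<xi> (i, n)) * c i) = (c n :: complex)"
  using combine_core[OF assms, of c] by (simp add: combine_def mult.commute)

lemma eigenvector_sequence:
  assumes xi: "\<bar>\<xi>\<bar> \<le> \<xi>0" and u: "\<And>i. i \<in> Core \<Longrightarrow> (\<Sum>j\<in>Core. of_real (Bm \<xi> (frame \<xi>) i j) * u j) = \<mu> * u i"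
  shows "Defect \<xi> \<mu> (combine \<xi> u) n = 0"
  using Defect_combine[OF xi, of "\<lambda>_. 0" 0 \<mu> u n] u by (simp add: Defect_def Aop_def conv_def)

text \<open>After the core part is split off, the remainder solves the homogeneous quotient equation
  and vanishes by \<open>tail_unique\<close>. This serves twice: for injectivity of the resolvent
  equation and, with \<mu> = 0, to recognise the derivative of the wave inside the span.\<close>

lemma Defect_zero_combine:
  fixes v :: "int \<Rightarrow> complex"
  assumes xi: "\<bar>\<xi>\<bar> \<le> \<xi>0" and lam: "norm \<mu> \<le> \<gamma> / 8"
    and v: "\<And>n. norm (v n) \<le> M" and eq: "\<And>n. Defect \<xi> \<mu> v n = 0"
  shows "v = combine \<xi> v"
    and "i \<in> Core \<Longrightarrow> (\<Sum>j\<in>Core. of_real (Bm \<xi> (frame \<xi>) i j) * v j) = \<mu> * v i"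
proof -
  define y where "y n = v n - combine \<xi> v n" for n
  define c where "c i = \<mu> * v i - (\<Sum>j\<in>Core. of_real (Bm \<xi> (frame \<xi>) i j) * v j)" for i
  have y_core: "y n = 0" if "n \<in> Core" for n using that by (simp add: y_def combine_core[OF xi])
  obtain K where K: "\<And>n. norm (y n) \<le> K"
    using v l1_le_norm[OF combine_l1[OF xi, of v]] unfolding y_def
    by (meson norm_triangle_ineq4 order_trans add_mono)
  have v_eq: "v = (\<lambda>n. combine \<xi> v n + y n)" by (simp add: y_def fun_eq_iff)
  have split: "(\<Sum>i\<in>Core. of_real (frame \<xi> (i, n)) * c i) + Defect \<xi> \<mu> y n = 0" for n
    using eq[of n] Defect_combine[where y=y and M=K and \<mu>=\<mu> and u=v and n=n, OF xi K] v_eq by (simp add: c_def)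
  have c: "c n = of_real (of_int n + \<xi>) * Aop \<xi> y n" if "n \<in> Core" for n
    using split[of n] sum_frame_core[OF xi that, of c] y_core[OF that] by (simp add: Defect_def)
  have y0: "y = (\<lambda>_. 0)"
  proof (rule tail_unique[OF xi lam y_core K])
    fix n :: int
    have "(\<Sum>i\<in>Core. of_real (frame \<xi> (i, n)) * (of_real (of_int i + \<xi>) * Aop \<xi> y i))
        = (\<Sum>i\<in>Core. of_real (frame \<xi> (i, n)) * c i)"
      by (rule sum.cong[OF refl]) (simp add: c)
    then show "Defect \<xi> \<mu> y n + (\<Sum>i\<in>Core. of_real (frame \<xi> (i, n)) * (of_real (of_int i + \<xi>) * Aop \<xi> y i)) = 0"
      using split[of n] by (simp add: add.commute)
  qed
  then show "v = combine \<xi> v" using v_eq by simp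
  show "(\<Sum>j\<in>Core. of_real (Bm \<xi> (frame \<xi>) i j) * v j) = \<mu> * v i" if "i \<in> Core"
    using c[OF that] unfolding y0 by (simp add: c_def Aop_def conv_def)
qed

lemma Defect_unique:
  assumes xi: "\<bar>\<xi>\<bar> \<le> \<xi>0" and lam: "norm \<mu> \<le> \<gamma> / 8"
    and no: "\<not> core_eigenvalue (Bm \<xi> (frame \<xi>)) \<mu>"
    and v: "\<And>n. norm (v n) \<le> M" and eq: "\<And>n. Defect \<xi> \<mu> v n = 0"
  shows "v = (\<lambda>_. 0)"
proof -
  note * = Defect_zero_combine[where v=v, OF xi lam v eq]
  have "v n = 0" if "n \<in> Core" for n using no *(2) that unfolding core_eigenvalue_def by blast
  then have "combine \<xi> v = (\<lambda>_. 0)" by (simp add: combine_def fun_eq_iff)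
  then show ?thesis using *(1) by simp
qed

text \<open>An injective linear map of a finite-dimensional space has a bounded inverse, so K does
  not depend on the right-hand side. Core sequences are transcribed to triples, on which the theory
  of linear maps of Euclidean spaces is available.\<close>

lemma linear_system_bound:
  fixes B :: "int \<Rightarrow> int \<Rightarrow> real"
  assumes no: "\<not> core_eigenvalue B \<mu>"
  obtains K where "0 \<le> K"
    "\<And>f N. (\<And>i. i \<in> Core \<Longrightarrow> norm (f i) \<le> N) \<Longrightarrow>
       \<exists>u. \<forall>i\<in>Core. \<mu> * u i - (\<Sum>j\<in>Core. of_real (B i j) * u j) = f i \<and> norm (u i) \<le> K * N"
proof -
  define dec where "dec t = (\<lambda>i::int. if i = -1 then fst t else if i = 0 then fst (snd t) else snd (snd t))"
    for t :: "complex \<times> complex \<times> complex"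
  define row where "row t i = \<mu> * dec t i - (\<Sum>j\<in>Core. of_real (B i j) * dec t j)" for t i
  define f where "f t = (row t (-1), row t 0, row t 1)" for t
  have lin: "linear f"
  proof (rule linearI)
    show "f (s + t) = f s + f t" for s t
      by (simp add: f_def row_def dec_def sum_Core algebra_simps)
    show "f (r *\<^sub>R t) = r *\<^sub>R f t" for r t
      by (simp add: f_def row_def dec_def sum_Core algebra_simps scaleR_conv_of_real)
  qed
  have "inj f"
  proof (subst linear_injective_0[OF lin], intro allI impI)
    fix t assume "f t = 0"
    then have r: "row t i = 0" if "i \<in> Core" for i using that by (auto simp: f_def Core_def zero_prod_def)
    have "dec t i = 0" if "i \<in> Core" for i using no that r unfolding core_eigenvalue_def row_def by (metis right_minus_eq)
    from this[of "-1"] this[of 0] this[of 1] show "t = 0"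
      by (simp add: dec_def Core_def prod_eq_iff)
  qed
  then obtain g where g: "linear g" "\<And>x. f (g x) = x"
    using linear_injective_isomorphism[OF lin] by auto
  from linear_bounded[OF g(1)] obtain K where K: "\<And>x. norm (g x) \<le> K * norm x" by blast
  show ?thesis
  proof (rule that[of "3 * \<bar>K\<bar>"])
    fix h :: "int \<Rightarrow> complex" and N assume h: "\<And>i. i \<in> Core \<Longrightarrow> norm (h i) \<le> N"
    let ?t = "g (h (-1), h 0, h 1)"
    have "norm (h (-1), h 0, h 1) \<le> norm (h (-1)) + (norm (h 0) + norm (h 1))"
      by (meson norm_Pair_le add_left_mono order_trans)
    also have "\<dots> \<le> 3 * N" using h[of "-1"] h[of 0] h[of 1] by (simp add: Core_def)
    finally have "norm ?t \<le> \<bar>K\<bar> * (3 * N)"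
      using K[of "(h (-1), h 0, h 1)"] by (meson abs_ge_self abs_ge_zero mult_mono norm_ge_zero order_trans)
    moreover have "norm (dec t i) \<le> norm t" for t i
      using norm_fst_le[of "fst t" "snd t"] norm_snd_le[of "snd t" "fst t"]
        norm_fst_le[of "fst (snd t)" "snd (snd t)"] norm_snd_le[of "snd (snd t)" "fst (snd t)"]
      by (auto simp: dec_def)
    ultimately have "norm (dec ?t i) \<le> 3 * \<bar>K\<bar> * N" for i
      by (metis (no_types) mult.assoc mult.commute order_trans)
    moreover have "row ?t i = h i" if "i \<in> Core" for i
      using g(2)[of "(h (-1), h 0, h 1)"] that by (auto simp: f_def Core_def)
    ultimately show "\<exists>u. \<forall>i\<in>Core. \<mu> * u i - (\<Sum>j\<in>Core. of_real (B i j) * u j) = h i \<and> norm (u i) \<le> 3 * \<bar>K\<bar> * N"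
      unfolding row_def by blast
  qed simp
qed

text \<open>Back substitution in a block triangular system: remove from f the frame combination with
  the same core entries, solve the quotient equation for the rest, and let the core system absorb
  both the core entries of f and those created by y.\<close>

lemma Defect_surjective:
  assumes xi: "\<bar>\<xi>\<bar> \<le> \<xi>0" and lam: "norm \<mu> \<le> \<gamma> / 8"
    and no: "\<not> core_eigenvalue (Bm \<xi> (frame \<xi>)) \<mu>"
  obtains C where "0 \<le> C"
    "\<And>f N. (\<And>i. i \<in> Core \<Longrightarrow> norm (f i) \<le> N) \<Longrightarrow>
       l1_le (tail (\<lambda>n. f n / of_real (of_int n + \<xi>))) N \<Longrightarrow>
       \<exists>v. l1_le v (C * N) \<and> (\<forall>n. Defect \<xi> \<mu> v n = f n)"
proof -
  obtain K where K0: "0 \<le> K" and K: "\<And>f N. (\<And>i. i \<in> Core \<Longrightarrow> norm (f i) \<le> N) \<Longrightarrow>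
       \<exists>u. \<forall>i\<in>Core. \<mu> * u i - (\<Sum>j\<in>Core. of_real (Bm \<xi> (frame \<xi>) i j) * u j) = f i \<and> norm (u i) \<le> K * N"
    using linear_system_bound[OF no] by blast
  show ?thesis
  proof (rule that[of "12 * K + 4 / \<gamma>"])
    show "0 \<le> 12 * K + 4 / \<gamma>" using K0 gamma by simp
    fix f N assume fc: "\<And>i. i \<in> Core \<Longrightarrow> norm (f i) \<le> N"
      and ft: "l1_le (tail (\<lambda>n. f n / complex_of_real (of_int n + \<xi>))) N"
    have N0: "0 \<le> N" using l1_le_nonneg[OF ft] .
    define r where "r n = f n - (\<Sum>i\<in>Core. of_real (frame \<xi> (i, n)) * f i)" for n
    have "l1_le (tail (\<lambda>n. r n / of_real (of_int n + \<xi>))) (N + (\<Sum>i\<in>Core. N * R))"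
    proof (rule l1_le_compare)
      let ?s = "\<lambda>n. \<Sum>i\<in>Core. tail (\<lambda>n. frame \<xi> (i, n)) n *\<^sub>R f i"
      have "l1_le ?s (\<Sum>i\<in>Core. N * R)"
      proof (rule l1_le_sum)
        fix i assume i: "i \<in> Core"
        have "l1_le (tail (\<lambda>n. frame \<xi> (i, n))) R" using frame_Frames[OF xi] i by (simp add: Frames_def)
        then show "l1_le (\<lambda>n. tail (\<lambda>n. frame \<xi> (i, n)) n *\<^sub>R f i) (N * R)"
        proof (rule l1_le_scale)
          fix n
          show "norm (tail (\<lambda>n. frame \<xi> (i, n)) n *\<^sub>R f i) \<le> N * norm (tail (\<lambda>n. frame \<xi> (i, n)) n)"
            unfolding norm_scaleR real_norm_def by (subst mult.commute) (rule mult_right_mono[OF fc[OF i] abs_ge_zero])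
        qed (rule N0)
      qed simp
      then have "l1_le (\<lambda>n. norm (?s n)) (\<Sum>i\<in>Core. N * R)" by (rule l1_le_compare) simp
      moreover have "l1_le (\<lambda>n. norm (tail (\<lambda>n. f n / complex_of_real (of_int n + \<xi>)) n)) N"
        by (rule l1_le_compare[OF ft]) simp
      ultimately show "l1_le (\<lambda>n. norm (tail (\<lambda>n. f n / of_real (of_int n + \<xi>)) n) + norm (?s n)) (N + (\<Sum>i\<in>Core. N * R))"
        by (rule l1_le_add[rotated])
      fix n
      show "norm (tail (\<lambda>n. r n / of_real (of_int n + \<xi>)) n) \<le> norm (norm (tail (\<lambda>n. f n / complex_of_real (of_int n + \<xi>)) n) + norm (?s n))"
      proof (cases "n \<in> Core")
        case True then show ?thesis by (simp add: tail_def)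
      next
        case False
        let ?x = "complex_of_real (of_int n + \<xi>)"
        have x1: "1 \<le> norm ?x" using denom_n[OF False xi] unfolding norm_of_real .
        have "r n = f n - ?s n" using False by (simp add: r_def tail_def scaleR_conv_of_real)
        then have "norm (r n / ?x) \<le> norm (f n / ?x) + norm (?s n / ?x)"
          by (simp add: diff_divide_distrib norm_triangle_ineq4 del: of_real_add)
        moreover have "norm (?s n / ?x) \<le> norm (?s n) / 1"
          unfolding norm_divide using x1 by (intro frac_le) auto
        moreover have "tail (\<lambda>n. r n / complex_of_real (of_int n + \<xi>)) n = r n / ?x"
          "tail (\<lambda>n. f n / complex_of_real (of_int n + \<xi>)) n = f n / ?x"
          using False by (simp_all add: tail_def)
        ultimately show ?thesis by simp
      qed
    qed
    moreover have "N + (\<Sum>i\<in>Core. N * R) \<le> 2 * N"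
      using mult_left_mono[OF R_small N0] N0 by simp
    ultimately have "l1_le (tail (\<lambda>n. r n / of_real (of_int n + \<xi>))) (2 * N)" by (rule l1_le_mono)
    from tail_exists[OF xi lam this] obtain y where y: "\<And>n. n \<in> Core \<Longrightarrow> y n = 0" "l1_le y (2 * (2 * N) / \<gamma>)"
      "\<And>n. n \<notin> Core \<Longrightarrow> Defect \<xi> \<mu> y n
        + (\<Sum>i\<in>Core. of_real (frame \<xi> (i, n)) * (of_real (of_int i + \<xi>) * Aop \<xi> y i)) = r n" by blast
    define h where "h i = f i + of_real (of_int i + \<xi>) * Aop \<xi> y i" for i
    have "norm (h i) \<le> 2 * N" if i: "i \<in> Core" for i
    proof -
      have "norm (Aop \<xi> y i) = 2 * norm (conv p y i)" using y(1)[OF i] by (simp add: Aop_def norm_mult)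
      also have "\<dots> \<le> 2 * (P * (2 * (2 * N) / \<gamma>))"
        using conv_bound[where v=y and n=i, OF p_l1 l1_le_norm[OF y(2)]] by simp
      also have "\<dots> \<le> 2 * (\<gamma> / 400 * (2 * (2 * N) / \<gamma>))"
        using P_small' N0 gamma by (intro mult_left_mono mult_right_mono) auto
      also have "\<dots> = N / 50" using gamma by simp
      finally have a: "norm (Aop \<xi> y i) \<le> N / 50" .
      have "\<bar>of_int i + \<xi>\<bar> \<le> 2" using i xi_small[OF xi] by (auto simp: Core_def)
      then have "norm (complex_of_real (of_int i + \<xi>) * Aop \<xi> y i) \<le> 2 * (N / 50)"
        unfolding norm_mult norm_of_real using a by (intro mult_mono) auto
      then show ?thesis using fc[OF i] N0 norm_triangle_ineq[of "f i" "of_real (of_int i + \<xi>) * Aop \<xi> y i"]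
        unfolding h_def by linarith
    qed
    from K[of h, OF this] obtain u where
      u: "\<And>i. i \<in> Core \<Longrightarrow> \<mu> * u i - (\<Sum>j\<in>Core. of_real (Bm \<xi> (frame \<xi>) i j) * u j) = h i"
        "\<And>i. i \<in> Core \<Longrightarrow> norm (u i) \<le> K * (2 * N)" by blast
    let ?v = "\<lambda>n. combine \<xi> u n + y n"
    have "Defect \<xi> \<mu> ?v n = f n" for n
    proof -
      have D: "Defect \<xi> \<mu> ?v n = (\<Sum>i\<in>Core. of_real (frame \<xi> (i, n)) * h i) + Defect \<xi> \<mu> y n"
        using Defect_combine[where y=y and \<mu>=\<mu> and u=u and n=n, OF xi l1_le_norm[OF y(2)]] u(1) by simp
      show ?thesis
      proof (cases "n \<in> Core")
        case True
        then show ?thesis unfolding D sum_frame_core[OF xi True] using y(1)[OF True] by (simp add: h_def Defect_def)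
      next
        case False
        have "(\<Sum>i\<in>Core. of_real (frame \<xi> (i, n)) * h i) = (f n - r n)
           + (\<Sum>i\<in>Core. of_real (frame \<xi> (i, n)) * (of_real (of_int i + \<xi>) * Aop \<xi> y i))"
          unfolding r_def h_def by (simp add: distrib_left sum.distrib)
        moreover have "s + D = f" if "s = (f - r) + t" "D + t = r" for s t D f r :: complex
          using that by auto
        ultimately show ?thesis unfolding D using y(3)[OF False] by blast
      qed
    qed
    moreover have "l1_le ?v ((12 * K + 4 / \<gamma>) * N)"
    proof (rule l1_le_mono[OF l1_le_add[OF combine_l1[OF xi] y(2)]])
      have "(\<Sum>j\<in>Core. norm (u j) * (1 + R)) \<le> (\<Sum>j\<in>Core. K * (2 * N) * 2)"
        using u(2) R_small R_nonneg K0 N0 by (intro sum_mono mult_mono) auto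
      then show "(\<Sum>j\<in>Core. norm (u j) * (1 + R)) + 2 * (2 * N) / \<gamma> \<le> (12 * K + 4 / \<gamma>) * N"
        by (simp add: algebra_simps)
    qed
    ultimately show "\<exists>v. l1_le v ((12 * K + 4 / \<gamma>) * N) \<and> (\<forall>n. Defect \<xi> \<mu> v n = f n)" by blast
  qed
qed

end

section \<open>The reduced matrix of a travelling wave\<close>

text \<open>\<open>modes\<close> is the profile equation at the nonzero modes, with the mean of the
  wave absorbed into V; the parameter b occurs only in mode 0. From here on \<open>p 1\<close>
  measures the amplitude: the whole sequence is O(\<open>p 1\<close>), and T2 bounds the harmonics
  beyond the first.\<close>

locale wave = potential +
  fixes T2 :: real
  assumes modes: "n \<noteq> 0 \<Longrightarrow> (S (of_int n) - V) * p n + conv p p n = 0"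
    and p_1: "p 1 \<noteq> 0" and P_le: "P \<le> 3 * \<bar>p 1\<bar>"
    and tail_p: "l1_le (tail p) T2"
    and deriv_summable: "\<exists>M. l1_le (\<lambda>n. of_int n * p n) M"
begin

text \<open>The reduced matrix without the row factors i + \<xi>. At \<xi> = 0 the factor of row 0
  is zero, and the identities for that row would be lost in \<open>Bm\<close>.\<close>

definition At :: "real \<Rightarrow> int \<Rightarrow> int \<Rightarrow> real" where
  "At \<xi> i j = Aop \<xi> (\<lambda>n. frame \<xi> (j, n)) i"

text \<open>The derivative of the wave, without the factor \<open>\<i>\<close> and normalised so
  that its core entries are -1, 0, 1.\<close>

definition zker :: "int \<Rightarrow> real" where
  "zker n = of_int n * p n / p 1"

lemma Bm_At: "Bm \<xi> (frame \<xi>) i j = (of_int i + \<xi>) * At \<xi> i j"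
  by (simp add: Bm_def At_def)

lemma zker_l1: "\<exists>M. l1_le zker M"
proof -
  obtain M where "l1_le (\<lambda>n. of_int n * p n) M" using deriv_summable by blast
  from l1_le_cmult[OF this, of "inverse (p 1)"] show ?thesis
    by (intro exI) (simp add: zker_def[abs_def] divide_inverse mult.commute)
qed

text \<open>The identity (w^2)' = 2 w w' in Fourier coordinates, obtained by averaging over j and n
  - j.\<close>

lemma conv_deriv: "2 * conv p (\<lambda>n. of_int n * p n) n = of_int n * conv p p n"
proof -
  obtain M where M: "l1_le (\<lambda>n. of_int n * p n) M" using deriv_summable by blast
  let ?f = "\<lambda>j. p j * (of_int (n - j) * p (n - j))"
  have f: "?f summable_on UNIV" using conv_summable[where n=n and v="\<lambda>n. of_int n * p n", OF p_l1 l1_le_norm[OF M]] by (simp del: of_int_diff)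
  have bij: "bij_betw (\<lambda>j. n - j) UNIV UNIV"
    by (rule bij_betwI[of _ _ _ "\<lambda>j. n - j"]) auto
  have g: "(\<lambda>j. ?f (n - j)) summable_on UNIV"
    using f by (subst summable_on_reindex_bij_betw[OF bij])
  have "infsum ?f UNIV = infsum (\<lambda>j. ?f (n - j)) UNIV"
    by (rule infsum_reindex_bij_betw[OF bij, symmetric])
  then have "2 * infsum ?f UNIV = infsum ?f UNIV + infsum (\<lambda>j. ?f (n - j)) UNIV" by simp
  also have "\<dots> = (\<Sum>\<^sub>\<infinity>j. ?f j + ?f (n - j))" by (rule infsum_add[OF f g, symmetric])
  also have "\<dots> = (\<Sum>\<^sub>\<infinity>j. of_int n * (p j * p (n - j)))"
    by (rule infsum_cong) (simp add: algebra_simps)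
  also have "\<dots> = of_int n * (\<Sum>\<^sub>\<infinity>j. p j * p (n - j))" by (rule infsum_cmult_right')
  finally show ?thesis by (simp add: conv_def)
qed

lemma Aop_zker: "Aop 0 zker n = 0"
proof -
  have eq: "zker = (\<lambda>n. inverse (p 1) * (of_int n * p n))" by (simp add: zker_def fun_eq_iff divide_inverse)
  have "conv p zker n = inverse (p 1) * conv p (\<lambda>n. of_int n * p n) n"
    unfolding eq by (rule conv_cmult)
  then have "Aop 0 zker n = inverse (p 1) * (of_int n * ((V - S (of_int n)) * p n - conv p p n))"
    using conv_deriv[of n] by (simp add: Aop_def zker_def divide_inverse algebra_simps)
  moreover have "(V - S (of_int n)) * p n - conv p p n = 0" if "n \<noteq> 0"
    using modes[OF that] by (simp add: algebra_simps)
  ultimately show ?thesis by (cases "n = 0") simp_all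
qed

text \<open>As a bounded solution of the kernel equation the derivative of the wave lies in the span
  of the frame, and its core entries determine the combination.\<close>

lemma zker_frame: "zker n = frame 0 (1, n) - frame 0 (-1, n)"
proof -
  obtain M where M: "l1_le zker M" using zker_l1 by blast
  let ?v = "\<lambda>n. complex_of_real (zker n)"
  have D: "Defect 0 0 ?v n = 0" for n
    using Aop_of_real[of zker M 0 n] l1_le_norm[OF M] by (simp add: Defect_def Aop_zker)
  have "?v = combine 0 ?v"
    by (rule Defect_zero_combine(1)[where \<mu>=0 and M=M, OF xi0_nonneg])
       (use gamma l1_le_norm[OF M] D in auto)
  then have "?v n = combine 0 ?v n" by metis
  then have "?v n = of_real (frame 0 (1, n) - frame 0 (-1, n))"
    using p_1 p_even[of 1] by (simp add: combine_def sum_Core zker_def)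
  then show ?thesis using of_real_eq_iff by blast
qed

lemma frame_bound: "\<bar>\<xi>\<bar> \<le> \<xi>0 \<Longrightarrow> \<bar>frame \<xi> (j, n)\<bar> \<le> 1"
  using Frames_bound[OF frame_Frames] .

lemma tail_frame_l1: "\<bar>\<xi>\<bar> \<le> \<xi>0 \<Longrightarrow> j \<in> Core \<Longrightarrow> l1_le (tail (\<lambda>n. frame \<xi> (j, n))) R"
  using frame_Frames by (auto simp: Frames_def)

text \<open>The kernel element makes two columns of the reduced matrix coincide. This determines the
  diagonal entries at the modes 1 and -1, which would otherwise call for an expansion of V to second
  order.\<close>

lemma At_kernel: "At 0 i 1 = At 0 i (-1)"
proof -
  have "Aop 0 (\<lambda>n. frame 0 (1, n) + - frame 0 (-1, n)) i
      = Aop 0 (\<lambda>n. frame 0 (1, n)) i + Aop 0 (\<lambda>n. - frame 0 (-1, n)) i"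
    by (rule Aop_add[where M=1 and N=1]) (use frame_bound[OF xi0_nonneg] in auto)
  moreover have "Aop 0 (\<lambda>n. - frame 0 (-1, n)) i = - Aop 0 (\<lambda>n. frame 0 (-1, n)) i"
    by (simp add: Aop_def conv_uminus)
  moreover have "(\<lambda>n. frame 0 (1, n) + - frame 0 (-1, n)) = zker" by (simp add: zker_frame fun_eq_iff)
  ultimately show ?thesis using Aop_zker[of i] by (simp add: At_def)
qed

lemma At_reflect: "At 0 (- i) (- j) = At 0 i j"
  unfolding At_def using Aop_reflect[of "\<lambda>n. frame 0 (- j, n)" i] by (simp add: frame_reflect)

section \<open>Entries of the reduced matrix to leading order\<close>

lemma conv_delta:
  "conv q (\<lambda>n. if n = j then 1 else 0) i = q (i - j)" for q :: "int \<Rightarrow> real"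
proof -
  have "conv q (\<lambda>n. if n = j then 1 else 0) i = (\<Sum>\<^sub>\<infinity>l. if l = i - j then q (i - j) else 0)"
    unfolding conv_def by (rule infsum_cong) auto
  also have "\<dots> = (\<Sum>\<^sub>\<infinity>l\<in>{i - j}. q (i - j))"
    by (rule infsum_cong_neutral) auto
  finally show ?thesis by simp
qed

lemma conv_frame:
  assumes xi: "\<bar>\<xi>\<bar> \<le> \<xi>0" and j: "j \<in> Core"
  shows "conv p (\<lambda>n. frame \<xi> (j, n)) i = p (i - j) + conv p (tail (\<lambda>n. frame \<xi> (j, n))) i"
proof -
  have "(\<lambda>n. frame \<xi> (j, n)) = (\<lambda>n. (if n = j then 1 else 0) + tail (\<lambda>n. frame \<xi> (j, n)) n)"
    using j by (auto simp: fun_eq_iff tail_def frame_core[OF xi j])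
  then have "conv p (\<lambda>n. frame \<xi> (j, n)) i = conv p (\<lambda>n. (if n = j then 1 else 0) + tail (\<lambda>n. frame \<xi> (j, n)) n) i"
    by simp
  also have "\<dots> = conv p (\<lambda>n. if n = j then 1 else 0) i + conv p (tail (\<lambda>n. frame \<xi> (j, n))) i"
    by (rule conv_add[OF p_l1, where M=1 and N=R]) (use l1_le_norm[OF tail_frame_l1[OF xi j]] in auto)
  finally show ?thesis by (simp add: conv_delta)
qed

lemma conv_tail_bound:
  assumes xi: "\<bar>\<xi>\<bar> \<le> \<xi>0" and j: "j \<in> Core"
  shows "\<bar>conv p (tail (\<lambda>n. frame \<xi> (j, n))) i\<bar> \<le> P * R"
  using conv_bound[OF p_l1 l1_le_norm[OF tail_frame_l1[OF xi j]], where n=i] by simp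

lemma At_eq:
  assumes xi: "\<bar>\<xi>\<bar> \<le> \<xi>0" and i: "i \<in> Core" and j: "j \<in> Core"
  shows "At \<xi> i j = of_bool (i = j) * (V - S (of_int i + \<xi>)) - 2 * p (i - j)
            - 2 * conv p (tail (\<lambda>n. frame \<xi> (j, n))) i"
  using frame_core[OF xi j i] conv_frame[OF xi j] by (simp add: At_def Aop_def)

lemma At_bound:
  assumes xi: "\<bar>\<xi>\<bar> \<le> \<xi>0" and i: "i \<in> Core" and j: "j \<in> Core"
  shows "\<bar>At \<xi> i j - (of_bool (i = j) * (V - S (of_int i + \<xi>)) - 2 * p (i - j))\<bar> \<le> 2 * (P * R)"
  using At_eq[OF assms] conv_tail_bound[OF xi j, of i] by simp

text \<open>Core entries of the frame do not move with \<xi>, so apart from the explicit diagonal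
  shift only the convolution changes. It contributes the factor P in addition to Q, and both are of
  the order of the amplitude.\<close>

lemma At_lipschitz:
  assumes xi: "\<bar>\<xi>\<bar> \<le> \<xi>0" and i: "i \<in> Core" and j: "j \<in> Core"
  shows "\<bar>At \<xi> i j - At 0 i j + of_bool (i = j) * (S (of_int i + \<xi>) - S (of_int i))\<bar> \<le> 2 * (P * (Q * \<bar>\<xi>\<bar>))"
proof -
  have "conv p (\<lambda>n. frame \<xi> (j, n) - frame 0 (j, n)) i = conv p (\<lambda>n. frame \<xi> (j, n)) i - conv p (\<lambda>n. frame 0 (j, n)) i"
    by (rule conv_diff[OF p_l1, where M=1 and N=1]) (use frame_bound xi xi0_nonneg in auto)
  moreover have "\<bar>conv p (\<lambda>n. frame \<xi> (j, n) - frame 0 (j, n)) i\<bar> \<le> P * (Q * \<bar>\<xi>\<bar>)"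
    using conv_bound[OF p_l1, of "\<lambda>n. frame \<xi> (j, n) - frame 0 (j, n)" "Q * \<bar>\<xi>\<bar>" i] frame_lipschitz[OF xi] by simp
  ultimately show ?thesis
    using frame_core[OF xi j i] frame_core[OF xi0_nonneg j i] by (auto simp: At_def Aop_def)
qed

lemma p_tail: "n \<notin> Core \<Longrightarrow> \<bar>p n\<bar> \<le> T2"
  using l1_le_norm[OF tail_p, of n] by (simp add: tail_def)

lemma conv_split:
  assumes g: "\<And>n. \<bar>g n\<bar> \<le> (M::real)"
  shows "\<bar>conv p g n - p 1 * (g (n - 1) + g (n + 1))\<bar> \<le> T2 * M"
proof -
  let ?q = "\<lambda>j. p j - tail p j"
  have c: "conv (tail p) g n = (\<Sum>\<^sub>\<infinity>j. tail p j * g (n - j))" "conv p g n = (\<Sum>\<^sub>\<infinity>j. p j * g (n - j))"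
    by (simp_all add: conv_def)
  have s: "(\<lambda>j. p j * g (n - j)) summable_on UNIV" "(\<lambda>j. tail p j * g (n - j)) summable_on UNIV"
    using conv_summable[where v=g and M=M and n=n, OF p_l1] conv_summable[where v=g and M=M and n=n, OF tail_p] g
    by simp_all
  have "conv p g n - conv (tail p) g n = (\<Sum>\<^sub>\<infinity>j. ?q j * g (n - j))"
    using infsum_add[OF s(1) summable_on_uminus[THEN iffD2, OF s(2)]] unfolding c
    by (simp add: infsum_uminus left_diff_distrib)
  also have "\<dots> = (\<Sum>\<^sub>\<infinity>j\<in>Core. ?q j * g (n - j))"
    by (rule infsum_cong_neutral) (auto simp: tail_def)
  also have "\<dots> = p 1 * (g (n - 1) + g (n + 1))"
    using p_even[of 1] p_0 by (simp add: sum_Core tail_def) (simp add: Core_def algebra_simps)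
  finally have "conv p g n - p 1 * (g (n - 1) + g (n + 1)) = conv (tail p) g n" by simp
  then show ?thesis using conv_bound[where v=g and M=M and n=n, OF tail_p] g by simp
qed

text \<open>In mode 2 of the profile equation the only product of leading size is that of
  \<open>p 1\<close> with itself, so the second harmonic is -(p 1)^2 / (S 2 - V) up to relative
  errors of the order of the amplitude.\<close>

lemma p_2_eq: "\<bar>(S 2 - V) * p 2 + (p 1)\<^sup>2\<bar> \<le> T2 * \<bar>p 1\<bar> + T2 * P"
proof -
  have "\<bar>conv p p 2 - p 1 * (p 1 + p 3)\<bar> \<le> T2 * P"
    using conv_split[of p P 2] l1_le_norm[OF p_l1] by simp
  moreover have "\<bar>p 1 * p 3\<bar> \<le> \<bar>p 1\<bar> * T2"
    unfolding abs_mult by (intro mult_left_mono p_tail) (auto simp: Core_def)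
  moreover have "(S 2 - V) * p 2 + (p 1)\<^sup>2 = - (conv p p 2 - p 1 * (p 1 + p 3)) - p 1 * p 3"
    using modes[of 2] by (simp add: algebra_simps power2_eq_square)
  moreover have "T2 * \<bar>p 1\<bar> = \<bar>p 1\<bar> * T2" by (rule mult.commute)
  ultimately show ?thesis by linarith
qed

text \<open>This entry has to be known up to third order. Directly, mode -1 is sent to mode 1 by
  \<open>p 2\<close>. The only other contribution of the first harmonic passes through the frame
  vector at mode 2, at distance 3 from mode -1, so that this frame entry is itself of second order.
  For this reason the column of -1 is computed and not that of 1; \<open>At_kernel\<close> transfers
  the result.\<close>

lemma At_cross: "\<bar>At 0 1 (-1) + 2 * p 2\<bar> \<le> 8 * \<bar>p 1\<bar> * (T2 + P * R) / \<gamma> + 2 * (T2 * R)"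
proof -
  let ?g = "tail (\<lambda>n. frame 0 (-1, n))"
  have mem: "-1 \<in> Core" "1 \<in> Core" "0 \<in> Core" "2 \<notin> Core" "3 \<notin> Core" by (auto simp: Core_def)
  have PR: "0 \<le> P * R" using P_nonneg R_nonneg by simp
  have gR: "\<bar>?g n\<bar> \<le> R" for n using l1_le_norm[OF tail_frame_l1[OF xi0_nonneg mem(1)], of n] by simp
  have A1: "At 0 1 (-1) = - 2 * p 2 - 2 * conv p ?g 1"
    using At_eq[OF xi0_nonneg mem(2) mem(1)] by simp
  have A2: "\<bar>At 0 1 (-1)\<bar> \<le> 2 * T2 + 2 * (P * R)"
    using A1 conv_tail_bound[OF xi0_nonneg mem(1), of 1] p_tail[OF mem(4)] by linarith
  have A3: "At 0 (-1) (-1) = At 0 1 (-1)" using At_reflect[of 1 1] At_kernel[of 1] by simp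
  have "?g 2 * (V - S 2) = 2 * conv p (\<lambda>n. frame 0 (-1, n)) 2
       + (\<Sum>i\<in>Core. frame 0 (i, 2) * Bm 0 (frame 0) i (-1)) / 2"
  proof -
    have "2 * (V - S 2) * frame 0 (-1, 2) = 4 * conv p (\<lambda>n. frame 0 (-1, n)) 2
       + (\<Sum>i\<in>Core. frame 0 (i, 2) * Bm 0 (frame 0) i (-1))"
      using frame_invariant[OF xi0_nonneg mem(1), of 2] by (simp add: Aop_def algebra_simps)
    then show ?thesis using mem(4) by (simp add: tail_def field_simps)
  qed
  moreover have "(\<Sum>i\<in>Core. frame 0 (i, 2) * Bm 0 (frame 0) i (-1))
      = (frame 0 (1, 2) - frame 0 (-1, 2)) * At 0 1 (-1)"
    using A3 by (simp add: sum_Core Bm_At left_diff_distrib)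
  moreover have "\<bar>(frame 0 (1, 2) - frame 0 (-1, 2)) * At 0 1 (-1)\<bar> \<le> 2 * (2 * (T2 + P * R))"
    unfolding abs_mult using A2 frame_bound[OF xi0_nonneg, of 1 2] frame_bound[OF xi0_nonneg, of "-1" 2]
    by (intro mult_mono) auto
  moreover have "\<bar>conv p (\<lambda>n. frame 0 (-1, n)) 2\<bar> \<le> T2 + P * R"
    using conv_frame[OF xi0_nonneg mem(1), of 2] conv_tail_bound[OF xi0_nonneg mem(1), of 2] p_tail[OF mem(5)]
    by simp
  moreover have "\<bar>a\<bar> \<le> 4 * B" if "a = 2 * c + s / 2" "s = t" "\<bar>t\<bar> \<le> 2 * (2 * B)" "\<bar>c\<bar> \<le> B"
    for a c s t B :: real
    using that by linarith
  ultimately have "\<bar>?g 2 * (V - S 2)\<bar> \<le> 4 * (T2 + P * R)" by blast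
  moreover have "\<bar>?g 2\<bar> * \<gamma> \<le> \<bar>?g 2 * (V - S 2)\<bar>"
    unfolding abs_mult using denom[OF mem(4) xi0_nonneg] by (intro mult_left_mono) auto
  ultimately have g2: "\<bar>?g 2\<bar> \<le> 4 * (T2 + P * R) / \<gamma>" using gamma by (simp add: le_divide_eq)
  have "\<bar>conv p ?g 1 - p 1 * ?g 2\<bar> \<le> T2 * R"
    using conv_split[of ?g R 1] gR mem(3) by (simp add: tail_def)
  moreover have "\<bar>p 1 * ?g 2\<bar> \<le> \<bar>p 1\<bar> * (4 * (T2 + P * R) / \<gamma>)"
    unfolding abs_mult using g2 by (intro mult_left_mono) auto
  ultimately have "\<bar>conv p ?g 1\<bar> \<le> \<bar>p 1\<bar> * (4 * (T2 + P * R) / \<gamma>) + T2 * R" by linarith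
  then have "\<bar>At 0 1 (-1) + 2 * p 2\<bar> \<le> 2 * (\<bar>p 1\<bar> * (4 * (T2 + P * R) / \<gamma>) + T2 * R)" using A1 by simp
  then show ?thesis by (simp add: algebra_simps)
qed

section \<open>Second order estimate for the odd combination of the modes 1 and -1\<close>

definition vs :: "real \<Rightarrow> int \<Rightarrow> real" where
  "vs \<xi> n = frame \<xi> (1, n) - frame \<xi> (-1, n)"

text \<open>Core entries of the image of \<open>vs\<close> under \<open>Aop\<close>. At \<xi> = 0
  they vanish by \<open>At_kernel\<close>, as \<open>vs 0\<close> is the derivative of the
  wave.\<close>

definition as :: "real \<Rightarrow> int \<Rightarrow> real" where
  "as \<xi> i = At \<xi> i 1 - At \<xi> i (-1)"

lemma mem_Core: "-1 \<in> Core" "1 \<in> Core" "0 \<in> Core" by (auto simp: Core_def)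

lemma Aop_vs: assumes xi: "\<bar>\<xi>\<bar> \<le> \<xi>0"
  shows "Aop \<xi> (vs \<xi>) n = Aop \<xi> (\<lambda>n. frame \<xi> (1, n)) n - Aop \<xi> (\<lambda>n. frame \<xi> (-1, n)) n"
  unfolding Aop_def vs_def
  by (subst conv_diff[OF p_l1, where M=1 and N=1]) (use frame_bound[OF xi] in \<open>auto simp: algebra_simps\<close>)

lemma vs_invariant: assumes xi: "\<bar>\<xi>\<bar> \<le> \<xi>0"
  shows "(of_int n + \<xi>) * Aop \<xi> (vs \<xi>) n
     = (\<Sum>i\<in>Core. frame \<xi> (i, n) * ((of_int i + \<xi>) * as \<xi> i))"
proof -
  have "(of_int n + \<xi>) * Aop \<xi> (vs \<xi>) n
     = (of_int n + \<xi>) * Aop \<xi> (\<lambda>n. frame \<xi> (1, n)) n - (of_int n + \<xi>) * Aop \<xi> (\<lambda>n. frame \<xi> (-1, n)) n"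
    by (simp add: Aop_vs[OF xi] right_diff_distrib)
  also have "\<dots> = (\<Sum>i\<in>Core. frame \<xi> (i, n) * Bm \<xi> (frame \<xi>) i 1) - (\<Sum>i\<in>Core. frame \<xi> (i, n) * Bm \<xi> (frame \<xi>) i (-1))"
    by (simp only: frame_invariant[OF xi mem_Core(2)] frame_invariant[OF xi mem_Core(1)])
  also have "\<dots> = (\<Sum>i\<in>Core. frame \<xi> (i, n) * ((of_int i + \<xi>) * as \<xi> i))"
    by (simp add: sum_Core Bm_At as_def algebra_simps)
  finally show ?thesis .
qed

lemma as_bound:
  assumes xi: "\<bar>\<xi>\<bar> \<le> \<xi>0"
  shows "\<bar>as \<xi> 0\<bar> \<le> 4 * (P * (Q * \<bar>\<xi>\<bar>))"
    and "\<bar>as \<xi> 1 + (S (1 + \<xi>) - S 1)\<bar> \<le> 4 * (P * (Q * \<bar>\<xi>\<bar>))"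
    and "\<bar>as \<xi> (-1) - (S (-1 + \<xi>) - S (-1))\<bar> \<le> 4 * (P * (Q * \<bar>\<xi>\<bar>))"
proof -
  note L = At_lipschitz[OF xi]
  show "\<bar>as \<xi> 0\<bar> \<le> 4 * (P * (Q * \<bar>\<xi>\<bar>))"
    using L[OF mem_Core(3) mem_Core(2)] L[OF mem_Core(3) mem_Core(1)] At_kernel[of 0] by (simp add: as_def)
  show "\<bar>as \<xi> 1 + (S (1 + \<xi>) - S 1)\<bar> \<le> 4 * (P * (Q * \<bar>\<xi>\<bar>))"
    using L[OF mem_Core(2) mem_Core(2)] L[OF mem_Core(2) mem_Core(1)] At_kernel[of 1] by (simp add: as_def)
  show "\<bar>as \<xi> (-1) - (S (-1 + \<xi>) - S (-1))\<bar> \<le> 4 * (P * (Q * \<bar>\<xi>\<bar>))"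
    using L[OF mem_Core(1) mem_Core(2)] L[OF mem_Core(1) mem_Core(1)] At_kernel[of "-1"] by (simp add: as_def)
qed

lemma PQ_small: "P * Q \<le> \<Lambda> / 4"
proof -
  have "P * R * (20 * \<Lambda>) \<le> (\<gamma> / 400) * (1 / 50) * (20 * \<Lambda>)"
    using P_small' R_small P_nonneg R_nonneg gamma Lambda_pos by (intro mult_right_mono mult_mono) auto
  then have "P * Q * \<gamma> \<le> (\<Lambda> / 4) * \<gamma>"
    using gamma Lambda_pos mult_pos_pos[of \<gamma> \<Lambda>] by (simp add: Q_def mult.commute mult.left_commute)
  then show ?thesis using gamma by simp
qed

lemma Q_nonneg: "0 \<le> Q" using R_nonneg Lambda_pos gamma by (simp add: Q_def)

lemma S_minus: "S (- of_int n + \<xi>) = S (of_int n - \<xi>)"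
  using S_even[of "of_int n - \<xi>"] by simp

lemma vs_odd_part:
  assumes xi: "\<bar>\<xi>\<bar> \<le> \<xi>0"
  shows "\<bar>vs \<xi> n - zker n\<bar> \<le> 2 * Q * \<bar>\<xi>\<bar>" "\<bar>vs \<xi> (- n) + zker n\<bar> \<le> 2 * Q * \<bar>\<xi>\<bar>"
proof -
  have *: "\<bar>vs \<xi> n - zker n\<bar> \<le> 2 * Q * \<bar>\<xi>\<bar>" for n
    using frame_lipschitz[OF xi, of "(1, n)"] frame_lipschitz[OF xi, of "(-1, n)"]
    by (simp add: vs_def zker_frame)
  have odd: "zker (- n) = - zker n" using p_even by (simp add: zker_def)
  show "\<bar>vs \<xi> n - zker n\<bar> \<le> 2 * Q * \<bar>\<xi>\<bar>" "\<bar>vs \<xi> (- n) + zker n\<bar> \<le> 2 * Q * \<bar>\<xi>\<bar>"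
    using *[of n] *[of "- n"] odd by simp_all
qed

lemma zker_tail_l1: "l1_le (tail zker) (2 * R)"
proof -
  have "l1_le (\<lambda>n. tail (\<lambda>n. frame 0 (1, n)) n - tail (\<lambda>n. frame 0 (-1, n)) n) (R + R)"
    by (rule l1_le_diff[OF tail_frame_l1[OF xi0_nonneg mem_Core(2)] tail_frame_l1[OF xi0_nonneg mem_Core(1)]])
  then show ?thesis by (rule l1_le_mono[OF l1_le_compare]) (auto simp: tail_def zker_frame)
qed

text \<open>The quotients z / (n + \<xi>) and -z / (-n + \<xi>) coincide at \<xi> = 0, so an odd
  numerator gains a factor \<xi>; the term 2 d pays for the deviation from oddness.\<close>

lemma antisymmetric_quotient:
  assumes n: "n \<notin> Core" and xi: "\<bar>\<xi>\<bar> \<le> \<xi>0"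
    and a: "\<bar>a - z\<bar> \<le> d" and b: "\<bar>b + z\<bar> \<le> d"
  shows "\<bar>a / (of_int n + \<xi>) - b / (- of_int n + \<xi>)\<bar> \<le> 2 * \<bar>z\<bar> * \<bar>\<xi>\<bar> + 2 * d"
proof -
  let ?x = "of_int n + \<xi> :: real" and ?y = "- of_int n + \<xi> :: real"
  have x: "1 \<le> \<bar>?x\<bar>" using denom_n[OF n xi] .
  have y: "1 \<le> \<bar>?y\<bar>" using denom_n[of "- n" \<xi>] n xi by simp
  have d0: "0 \<le> d" using a by linarith
  have nz: "?x \<noteq> 0" "?y \<noteq> 0" using x y by auto
  have eq: "a / ?x - b / ?y = z * (2 * \<xi> / (?x * ?y)) + (a - z) / ?x - (b + z) / ?y"
    using nz by (simp add: divide_simps) (simp add: algebra_simps)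
  have 1: "\<bar>z * (2 * \<xi> / (?x * ?y))\<bar> \<le> \<bar>z\<bar> * (2 * \<bar>\<xi>\<bar>)"
  proof -
    have "1 * 1 \<le> \<bar>?x\<bar> * \<bar>?y\<bar>" using x y by (intro mult_mono) auto
    then have "(2 * \<bar>\<xi>\<bar>) / (\<bar>?x\<bar> * \<bar>?y\<bar>) \<le> (2 * \<bar>\<xi>\<bar>) / 1" by (intro frac_le) auto
    then have "\<bar>2 * \<xi> / (?x * ?y)\<bar> \<le> 2 * \<bar>\<xi>\<bar>" by (simp add: abs_divide abs_mult)
    then show ?thesis unfolding abs_mult[of z] by (rule mult_left_mono) simp
  qed
  have 2: "\<bar>(a - z) / ?x\<bar> \<le> d / 1" unfolding abs_divide using a x d0 by (intro frac_le) auto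
  have 3: "\<bar>(b + z) / ?y\<bar> \<le> d / 1" unfolding abs_divide using b y d0 by (intro frac_le) auto
  have tri: "\<bar>p + q - r\<bar> \<le> \<bar>p\<bar> + \<bar>q\<bar> + \<bar>r\<bar>" for p q r :: real by linarith
  show ?thesis unfolding eq
    by (rule order_trans[OF tri order_trans[OF add_mono[OF add_mono[OF 1 2] 3]]]) simp
qed

text \<open>Here k is \<open>Aop 0\<close> applied to \<open>vs \<xi>\<close>. Its values are only
  O(\<xi>), but the leading part is even in n and cancels: to leading order \<open>vs\<close> is
  odd, and so are the divisor n + \<xi> and the difference S (n + \<xi>) - S n. The coefficient of
  the even combination of frame vectors does not cancel; it is governed by
  \<open>as \<xi> 1 - as \<xi> (-1)\<close> and kept as the last term of the bound.\<close>

lemma vs_defect_bound: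
  assumes n: "n \<notin> Core" and xi: "\<bar>\<xi>\<bar> \<le> \<xi>0"
  defines "k \<equiv> \<lambda>n. Aop \<xi> (vs \<xi>) n + (S (of_int n + \<xi>) - S (of_int n)) * vs \<xi> n"
  shows "\<bar>k n - k (- n)\<bar> \<le> 28 * \<Lambda> * (R + Q) * \<xi>\<^sup>2 + 2 * R * \<bar>as \<xi> 1 - as \<xi> (-1)\<bar>"
proof -
  let ?e = "\<bar>\<xi>\<bar>" and ?x = "of_int n + \<xi> :: real" and ?y = "- of_int n + \<xi> :: real"
  define W where "W = \<bar>as \<xi> 1 - as \<xi> (-1)\<bar>"
  define b1 where "b1 = (1 + \<xi>) * as \<xi> 1"
  define b2 where "b2 = (-1 + \<xi>) * as \<xi> (-1)"
  define b0 where "b0 = \<xi> * as \<xi> 0"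
  define s where "s n = frame \<xi> (1, n) + frame \<xi> (-1, n)" for n
  have n': "- n \<notin> Core" using n by simp
  have nz: "?x \<noteq> 0" "?y \<noteq> 0" using denom_n[OF n xi] denom_n[OF n' xi] by auto
  have n0: "n \<noteq> 0" using n by (auto simp: Core_def)
  have e0: "0 \<le> ?e" and e1: "?e \<le> 1" using xi_small[OF xi] by auto
  have e2: "?e * ?e = \<xi>\<^sup>2" by (simp add: power2_eq_square abs_mult[symmetric])
  have Lam: "0 \<le> \<Lambda>" using Lambda_pos by simp
  have PQe: "4 * (P * (Q * ?e)) \<le> \<Lambda> * ?e"
    using mult_right_mono[OF PQ_small e0] by (simp add: mult.assoc)
  have one: "\<bar>S (1 + \<xi>) - S 1\<bar> \<le> \<Lambda> * ?e" "\<bar>S (-1 + \<xi>) - S (-1)\<bar> \<le> \<Lambda> * ?e"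
    using lip[of 1, OF _ xi] lip[of "-1", OF _ xi] by simp_all
  have a1: "\<bar>as \<xi> 1\<bar> \<le> 2 * \<Lambda> * ?e" and a2: "\<bar>as \<xi> (-1)\<bar> \<le> 2 * \<Lambda> * ?e"
    and a0: "\<bar>as \<xi> 0\<bar> \<le> \<Lambda> * ?e"
    using as_bound[OF xi] one PQe by linarith+
  have xa: "\<bar>\<xi> * a\<bar> \<le> ?e * B" if "\<bar>a\<bar> \<le> B" for a B
    unfolding abs_mult using that by (rule mult_left_mono) simp
  have e_le: "?e * (4 * \<Lambda> * ?e) \<le> 1 * (4 * \<Lambda> * ?e)" using e1 Lam e0 by (intro mult_right_mono) auto
  have sum_a: "\<bar>as \<xi> 1 + as \<xi> (-1)\<bar> \<le> 4 * \<Lambda> * ?e" and diff_a: "\<bar>as \<xi> 1 - as \<xi> (-1)\<bar> \<le> 4 * \<Lambda> * ?e"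
    using a1 a2 by linarith+
  have b12: "\<bar>(b1 - b2) / 2\<bar> \<le> 4 * \<Lambda> * ?e"
  proof -
    have "b1 - b2 = (as \<xi> 1 + as \<xi> (-1)) + \<xi> * (as \<xi> 1 - as \<xi> (-1))" by (simp add: b1_def b2_def algebra_simps)
    then have "\<bar>b1 - b2\<bar> \<le> 4 * \<Lambda> * ?e + 1 * (4 * \<Lambda> * ?e)"
      using order_trans[OF abs_triangle_ineq add_mono[OF sum_a order_trans[OF xa[OF diff_a] e_le]]] by simp
    then show ?thesis by simp
  qed
  have b12': "\<bar>(b1 + b2) / 2\<bar> \<le> (W + 4 * \<Lambda> * \<xi>\<^sup>2) / 2"
  proof -
    have "b1 + b2 = (as \<xi> 1 - as \<xi> (-1)) + \<xi> * (as \<xi> 1 + as \<xi> (-1))" by (simp add: b1_def b2_def algebra_simps)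
    moreover have "?e * (4 * \<Lambda> * ?e) = 4 * \<Lambda> * \<xi>\<^sup>2" by (simp add: e2[symmetric])
    ultimately have "\<bar>b1 + b2\<bar> \<le> W + 4 * \<Lambda> * \<xi>\<^sup>2"
      using order_trans[OF abs_triangle_ineq add_left_mono[OF xa[OF sum_a]]] unfolding W_def by metis
    then show ?thesis by simp
  qed
  have b0: "\<bar>b0\<bar> \<le> \<Lambda> * \<xi>\<^sup>2"
    using xa[OF a0] unfolding b0_def e2[symmetric] by (simp add: mult.left_commute)
  \<comment> \<open>Invariance of the span turns \<open>Aop\<close> off the core into a combination
    of frame entries, here sorted into the odd vector, the even vector and the vector of mode
    0.\<close>
  have A: "Aop \<xi> (vs \<xi>) m = ((b1 - b2) / 2 * vs \<xi> m + (b1 + b2) / 2 * s m + b0 * frame \<xi> (0, m)) / (of_int m + \<xi>)"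
    if "m \<notin> Core" for m
  proof -
    have "(of_int m + \<xi>) * Aop \<xi> (vs \<xi>) m = frame \<xi> (1, m) * b1 + frame \<xi> (-1, m) * b2 + frame \<xi> (0, m) * b0"
      unfolding vs_invariant[OF xi] by (simp add: sum_Core b1_def b2_def b0_def)
    also have "\<dots> = (b1 - b2) / 2 * vs \<xi> m + (b1 + b2) / 2 * s m + b0 * frame \<xi> (0, m)"
      by (simp add: vs_def s_def field_simps)
    finally show ?thesis using denom_n[OF that xi] by (simp add: eq_divide_eq mult.commute)
  qed
  define E where "E = S (of_int n + \<xi>) - S (of_int n)"
  define E' where "E' = S (of_int n - \<xi>) - S (of_int n)"
  define \<delta> where "\<delta> = vs \<xi> n - zker n"
  define \<delta>' where "\<delta>' = vs \<xi> (- n) + zker n"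
  have Eb: "\<bar>E\<bar> \<le> \<Lambda> * ?e" "\<bar>E'\<bar> \<le> \<Lambda> * ?e" "\<bar>E + E'\<bar> \<le> \<Lambda> * \<xi>\<^sup>2"
    using lip[OF n0 xi] lip[of n "- \<xi>", OF n0] xi second[OF n0 xi] by (simp_all add: E_def E'_def)
  have d: "\<bar>\<delta>\<bar> \<le> 2 * Q * ?e" "\<bar>\<delta>'\<bar> \<le> 2 * Q * ?e"
    using vs_odd_part[OF xi, of n] by (simp_all add: \<delta>_def \<delta>'_def)
  have z: "\<bar>zker n\<bar> \<le> 2 * R" using l1_le_norm[OF zker_tail_l1, of n] n by (simp add: tail_def)
  have s: "\<bar>s n\<bar> \<le> 2 * R" "\<bar>s (- n)\<bar> \<le> 2 * R"
    using Frames_tail[OF frame_Frames[OF xi] n, of 1] Frames_tail[OF frame_Frames[OF xi] n, of "-1"]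
      Frames_tail[OF frame_Frames[OF xi] n', of 1] Frames_tail[OF frame_Frames[OF xi] n', of "-1"]
    by (simp_all add: s_def)
  have f0: "\<bar>frame \<xi> (0, n)\<bar> \<le> R" "\<bar>frame \<xi> (0, - n)\<bar> \<le> R"
    using Frames_tail[OF frame_Frames[OF xi] n, of 0] Frames_tail[OF frame_Frames[OF xi] n', of 0] by simp_all
  let ?q1 = "vs \<xi> n / ?x - vs \<xi> (- n) / ?y" and ?q2 = "s n / ?x - s (- n) / ?y"
    and ?q3 = "frame \<xi> (0, n) / ?x - frame \<xi> (0, - n) / ?y"
  have q1: "\<bar>?q1\<bar> \<le> 2 * (2 * R) * ?e + 2 * (2 * Q * ?e)"
    by (rule order_trans[OF antisymmetric_quotient[OF n xi vs_odd_part[OF xi]]])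
       (use z e0 Q_nonneg in \<open>intro add_mono mult_mono, auto\<close>)
  have q2: "\<bar>?q2\<bar> \<le> 2 * (2 * R)" using antisymmetric_quotient[OF n xi, of "s n" 0 "2 * R" "s (- n)"] s by simp
  have q3: "\<bar>?q3\<bar> \<le> 2 * R" using antisymmetric_quotient[OF n xi, of "frame \<xi> (0, n)" 0 R "frame \<xi> (0, - n)"] f0 by simp
  have keq: "k n - k (- n) = (b1 - b2) / 2 * ?q1 + (b1 + b2) / 2 * ?q2 + b0 * ?q3
      + ((E + E') * zker n + E * \<delta> - E' * \<delta>')"
  proof -
    have kn: "k n = ((b1 - b2) / 2 * vs \<xi> n + (b1 + b2) / 2 * s n + b0 * frame \<xi> (0, n)) / ?x + E * vs \<xi> n"
      by (simp add: k_def A[OF n] E_def)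
    have km: "k (- n) = ((b1 - b2) / 2 * vs \<xi> (- n) + (b1 + b2) / 2 * s (- n) + b0 * frame \<xi> (0, - n)) / ?y + E' * vs \<xi> (- n)"
      using S_even[of "of_int n"] S_even[of "of_int n - \<xi>"] by (simp add: k_def A[OF n'] E'_def)
    have kd: "E * vs \<xi> n - E' * vs \<xi> (- n) = (E + E') * zker n + E * \<delta> - E' * \<delta>'"
      by (simp add: \<delta>_def \<delta>'_def algebra_simps)
    have alg: "(a * u + b * v + c * w) / x + f - ((a * u' + b * v' + c * w') / y + f')
        = a * (u / x - u' / y) + b * (v / x - v' / y) + c * (w / x - w' / y) + (f - f')"
      for a b c u v w u' v' w' x y f f' :: real
      by (simp add: add_divide_distrib algebra_simps)
    show ?thesis unfolding kn km alg kd ..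
  qed
  have 1: "\<bar>(b1 - b2) / 2 * ?q1\<bar> \<le> (4 * \<Lambda> * ?e) * (2 * (2 * R) * ?e + 2 * (2 * Q * ?e))"
    unfolding abs_mult using b12 q1 e0 Lam by (intro mult_mono) auto
  have 2: "\<bar>(b1 + b2) / 2 * ?q2\<bar> \<le> (W + 4 * \<Lambda> * \<xi>\<^sup>2) / 2 * (2 * (2 * R))"
    unfolding abs_mult using b12' q2 Lam by (intro mult_mono) (auto simp: W_def)
  have 3: "\<bar>b0 * ?q3\<bar> \<le> \<Lambda> * \<xi>\<^sup>2 * (2 * R)"
    unfolding abs_mult using b0 q3 Lam by (intro mult_mono) auto
  have 4: "\<bar>(E + E') * zker n\<bar> \<le> \<Lambda> * \<xi>\<^sup>2 * (2 * R)"
    unfolding abs_mult using Eb z Lam by (intro mult_mono) auto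
  have 5: "\<bar>E * \<delta>\<bar> \<le> (\<Lambda> * ?e) * (2 * Q * ?e)" "\<bar>E' * \<delta>'\<bar> \<le> (\<Lambda> * ?e) * (2 * Q * ?e)"
    unfolding abs_mult using Eb d Lam e0 by (intro mult_mono; simp)+
  have tri: "\<bar>a + b + c + (d + f - g)\<bar> \<le> \<bar>a\<bar> + \<bar>b\<bar> + \<bar>c\<bar> + (\<bar>d\<bar> + \<bar>f\<bar> + \<bar>g\<bar>)" for a b c d f g :: real
    by linarith
  have "\<bar>k n - k (- n)\<bar> \<le> (4 * \<Lambda> * ?e) * (2 * (2 * R) * ?e + 2 * (2 * Q * ?e))
     + (W + 4 * \<Lambda> * \<xi>\<^sup>2) / 2 * (2 * (2 * R)) + \<Lambda> * \<xi>\<^sup>2 * (2 * R)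
     + (\<Lambda> * \<xi>\<^sup>2 * (2 * R) + (\<Lambda> * ?e) * (2 * Q * ?e) + (\<Lambda> * ?e) * (2 * Q * ?e))"
    unfolding keq by (rule order_trans[OF tri]) (intro add_mono 1 2 3 4 5)
  also have "\<dots> = (28 * R + 20 * Q) * (\<Lambda> * \<xi>\<^sup>2) + 2 * R * W"
  proof -
    have "(4 * \<Lambda> * e) * (2 * (2 * R) * e + 2 * (2 * Q * e)) + (W + 4 * \<Lambda> * (e * e)) / 2 * (2 * (2 * R))
       + \<Lambda> * (e * e) * (2 * R) + (\<Lambda> * (e * e) * (2 * R) + (\<Lambda> * e) * (2 * Q * e) + (\<Lambda> * e) * (2 * Q * e))
       = (28 * R + 20 * Q) * (\<Lambda> * (e * e)) + 2 * R * W" for e :: real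
      by (simp add: algebra_simps)
    from this[of ?e] show ?thesis unfolding e2 .
  qed
  also have "\<dots> \<le> (28 * R + 28 * Q) * (\<Lambda> * \<xi>\<^sup>2) + 2 * R * W"
    by (rule add_right_mono[OF mult_right_mono]) (use Q_nonneg Lam in auto)
  finally show ?thesis unfolding W_def by (simp add: algebra_simps)
qed

text \<open>Pairing \<open>zker\<close> with \<open>Aop 0\<close> applied to \<open>vs \<xi>\<close>
  gives zero, because the operator is symmetric and \<open>zker\<close> lies in its kernel. The core
  terms of this vanishing sum form exactly the quantity to be bounded. Adding the terms at n and -n
  turns the others into \<open>zker n * (k n - k (- n))\<close>, where both factors are small. The
  Lipschitz bound of the frame would give O(\<xi>) only.\<close>

lemma as_second_order:
  assumes xi: "\<bar>\<xi>\<bar> \<le> \<xi>0"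
  shows "\<bar>as \<xi> 1 - as \<xi> (-1) + (S (1 + \<xi>) + S (1 - \<xi>) - 2 * S 1)\<bar> \<le> 60 * \<Lambda> * R * (R + Q) * \<xi>\<^sup>2"
proof -
  define W where "W = \<bar>as \<xi> 1 - as \<xi> (-1)\<bar>"
  define X where "X = as \<xi> 1 - as \<xi> (-1) + (S (1 + \<xi>) + S (1 - \<xi>) - 2 * S 1)"
  define k where "k n = Aop \<xi> (vs \<xi>) n + (S (of_int n + \<xi>) - S (of_int n)) * vs \<xi> n" for n
  define h where "h n = zker n * k n" for n
  define K where "K = 28 * \<Lambda> * (R + Q) * \<xi>\<^sup>2 + 2 * R * W"
  obtain M where z1: "l1_le zker M" using zker_l1 by blast
  have v1: "l1_le (vs \<xi>) ((1 + R) + (1 + R))"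
    unfolding vs_def[abs_def]
    by (intro l1_le_diff Frames_l1[OF frame_Frames[OF xi]] mem_Core)
  have bnd: "norm (zker n) \<le> M" "norm (vs \<xi> n) \<le> (1 + R) + (1 + R)" for n
    using l1_le_norm[OF z1] l1_le_norm[OF v1] by auto
  have Az: "Aop \<xi> zker n = - (S (of_int n + \<xi>) - S (of_int n)) * zker n" for n
    using Aop_zker[of n] by (simp add: Aop_def algebra_simps)
  \<comment> \<open>The diagonal parts cancel mode by mode, and two convolution pairings remain,
    which are equal by \<open>infsum_conv_symmetric\<close>.\<close>
  have h_eq: "h n = - 2 * (zker n * conv p (vs \<xi>) n) + 2 * (vs \<xi> n * conv p zker n)" for n
  proof -
    have "h n = zker n * Aop \<xi> (vs \<xi>) n - vs \<xi> n * Aop \<xi> zker n"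
      by (simp add: h_def k_def Az algebra_simps)
    then show ?thesis by (simp add: Aop_def algebra_simps)
  qed
  have s1: "(\<lambda>n. zker n * conv p (vs \<xi>) n) summable_on UNIV"
    by (rule l1_le_norm_infsum(2)[OF l1_le_scale[OF z1, where c="P * ((1 + R) + (1 + R))"]])
       (use conv_bound[OF p_l1 bnd(2)] P_nonneg R_nonneg in \<open>auto simp: abs_mult mult.commute intro!: mult_left_mono\<close>)
  have s2: "(\<lambda>n. vs \<xi> n * conv p zker n) summable_on UNIV"
  proof (rule l1_le_norm_infsum(2)[OF l1_le_scale[OF v1, where c="P * M"]])
    fix n
    show "norm (vs \<xi> n * conv p zker n) \<le> P * M * norm (vs \<xi> n)"
      unfolding norm_mult
      by (subst mult.commute) (rule mult_right_mono[OF conv_bound[where v=zker, OF p_l1 bnd(1)] norm_ge_zero])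
  qed (use P_nonneg l1_le_nonneg[OF z1] in auto)
  have s1': "(\<lambda>n. - 2 * (zker n * conv p (vs \<xi>) n)) summable_on UNIV"
    and s2': "(\<lambda>n. 2 * (vs \<xi> n * conv p zker n)) summable_on UNIV"
    using summable_on_cmult_right[OF s1, of "- 2"] summable_on_cmult_right[OF s2, of 2] by simp_all
  have sh: "h summable_on UNIV" unfolding h_eq[abs_def] by (rule summable_on_add[OF s1' s2'])
  have "infsum h UNIV = (\<Sum>\<^sub>\<infinity>n. - 2 * (zker n * conv p (vs \<xi>) n)) + (\<Sum>\<^sub>\<infinity>n. 2 * (vs \<xi> n * conv p zker n))"
    unfolding h_eq[abs_def] by (rule infsum_add[OF s1' s2'])
  also have "\<dots> = - 2 * (\<Sum>\<^sub>\<infinity>n. zker n * conv p (vs \<xi>) n) + 2 * (\<Sum>\<^sub>\<infinity>n. vs \<xi> n * conv p zker n)"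
    by (simp only: infsum_cmult_right')
  also have "\<dots> = 0" using infsum_conv_symmetric[OF p_l1 p_even z1 v1] by simp
  finally have h0: "infsum h UNIV = 0" .
  have c: "(\<lambda>n. if n \<in> Core then h n else 0) summable_on UNIV"
    and c_sum: "(\<Sum>\<^sub>\<infinity>n. if n \<in> Core then h n else 0) = (\<Sum>n\<in>Core. h n)"
  proof -
    have "((\<lambda>n. if n \<in> Core then h n else 0) has_sum (\<Sum>n\<in>Core. h n)) UNIV
        \<longleftrightarrow> (h has_sum (\<Sum>n\<in>Core. h n)) Core"
      by (rule has_sum_cong_neutral) auto
    then have "((\<lambda>n. if n \<in> Core then h n else 0) has_sum (\<Sum>n\<in>Core. h n)) UNIV"
      by simp
    then show "(\<lambda>n. if n \<in> Core then h n else 0) summable_on UNIV"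
      "(\<Sum>\<^sub>\<infinity>n. if n \<in> Core then h n else 0) = (\<Sum>n\<in>Core. h n)"
      by (auto simp: has_sum_imp_summable infsumI)
  qed
  have tail_eq: "tail h = (\<lambda>n. h n + - (if n \<in> Core then h n else 0))" by (auto simp: tail_def fun_eq_iff)
  have st: "tail h summable_on UNIV"
    unfolding tail_eq by (rule summable_on_add[OF sh summable_on_uminus[THEN iffD2, OF c]])
  have "infsum (tail h) UNIV = infsum h UNIV + - (\<Sum>n\<in>Core. h n)"
    unfolding tail_eq c_sum[symmetric] infsum_uminus[symmetric]
    by (rule infsum_add[OF sh summable_on_uminus[THEN iffD2, OF c]])
  \<comment> \<open>On the core \<open>zker\<close> and \<open>vs \<xi>\<close> both have the
    entries -1, 0, 1, so the two differences of S combine to the symmetric second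
    difference.\<close>
  moreover have "(\<Sum>n\<in>Core. h n) = X"
  proof -
    have z: "zker 1 = 1" "zker 0 = 0" "zker (-1) = -1" using p_1 p_even[of 1] by (simp_all add: zker_def)
    have v: "vs \<xi> 1 = 1" "vs \<xi> (-1) = -1" using mem_Core by (simp_all add: vs_def frame_core[OF xi])
    have "Aop \<xi> (vs \<xi>) i = as \<xi> i" for i by (simp add: Aop_vs[OF xi] as_def At_def)
    then show ?thesis using S_minus[of 1 \<xi>] S_even[of 1] by (simp add: sum_Core h_def k_def z v X_def)
  qed
  ultimately have X: "X = - infsum (tail h) UNIV" using h0 by simp
  have bij: "bij_betw (uminus :: int \<Rightarrow> int) UNIV UNIV" by (rule bij_betwI[of _ _ _ uminus]) auto
  have "infsum (tail h) UNIV = (\<Sum>\<^sub>\<infinity>n. tail h (- n))" by (rule infsum_reindex_bij_betw[OF bij, symmetric])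
  moreover have "(\<lambda>n. tail h (- n)) summable_on UNIV" using st by (subst summable_on_reindex_bij_betw[OF bij])
  ultimately have "2 * infsum (tail h) UNIV = (\<Sum>\<^sub>\<infinity>n. tail h n + tail h (- n))"
    using infsum_add[OF st] by simp
  moreover have "l1_le (\<lambda>n. tail h n + tail h (- n)) (K * (2 * R))"
  proof (rule l1_le_scale[OF zker_tail_l1])
    fix n
    show "norm (tail h n + tail h (- n)) \<le> K * norm (tail zker n)"
    proof (cases "n \<in> Core")
      case True then show ?thesis by (simp add: tail_def)
    next
      case False
      have "zker (- n) = - zker n" using p_even by (simp add: zker_def)
      then have "tail h n + tail h (- n) = zker n * (k n - k (- n))"
        using False by (simp add: tail_def h_def algebra_simps)
      moreover have "\<bar>k n - k (- n)\<bar> \<le> K"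
        using vs_defect_bound[OF False xi] by (simp add: k_def K_def W_def)
      ultimately show ?thesis using False by (simp add: tail_def abs_mult mult.commute[of K] mult_left_mono)
    qed
  next
    show "0 \<le> K" using Lambda_pos R_nonneg Q_nonneg by (simp add: K_def W_def)
  qed
  ultimately have "\<bar>2 * infsum (tail h) UNIV\<bar> \<le> K * (2 * R)" using l1_le_norm_infsum(1) by fastforce
  then have XK: "\<bar>X\<bar> \<le> K * R" using X by simp
  let ?L = "\<Lambda> * \<xi>\<^sup>2"
  have L0: "0 \<le> ?L" using Lambda_pos by simp
  have "\<bar>S (1 + \<xi>) + S (1 - \<xi>) - 2 * S 1\<bar> \<le> ?L" using second[of 1, OF _ xi] by simp
  then have W: "W \<le> \<bar>X\<bar> + ?L" unfolding W_def X_def by linarith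
  \<comment> \<open>The bound K contains W, which is at most \<bar>X\<bar> plus a term of order
    \<xi>^2. Since R^2 \<le> 1 / 2500, that occurrence of \<bar>X\<bar> is absorbed on the left,
    which raises the constant from 30 = 28 + 2 to 60 with room to spare.\<close>
  have RR: "R * R \<le> (1 / 50) * (1 / 50)" using R_small R_nonneg by (intro mult_mono) auto
  have "(R * R) * W \<le> (R * R) * (\<bar>X\<bar> + ?L)" using W R_nonneg by (intro mult_left_mono) auto
  moreover have "(R * R) * \<bar>X\<bar> \<le> (1 / 50) * (1 / 50) * \<bar>X\<bar>" using RR by (intro mult_right_mono) auto
  moreover have "K * R = 28 * (R * (R + Q) * ?L) + 2 * ((R * R) * W)" by (simp add: K_def algebra_simps)
  moreover have "(R * R) * ?L \<le> (R * (R + Q)) * ?L" using R_nonneg Q_nonneg L0 by (intro mult_right_mono mult_left_mono) auto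
  ultimately have "\<bar>X\<bar> \<le> 60 * (R * (R + Q) * ?L)" using XK by (simp add: distrib_left)
  also have "60 * (R * (R + Q) * ?L) = 60 * \<Lambda> * R * (R + Q) * \<xi>\<^sup>2" by (simp add: algebra_simps)
  finally show ?thesis unfolding X_def .
qed

end

section \<open>Roots of real cubics\<close>

lemma cubic_factor:
  fixes q0 q1 q2 q3 r1 r2 :: "'a::field"
  assumes "q3 * r1 ^ 3 + q2 * r1\<^sup>2 + q1 * r1 + q0 = 0" "q3 * r2 ^ 3 + q2 * r2\<^sup>2 + q1 * r2 + q0 = 0" "r1 \<noteq> r2"
  shows "q3 * s ^ 3 + q2 * s\<^sup>2 + q1 * s + q0 = (s - r1) * (s - r2) * (q3 * s + (q2 + q3 * (r1 + r2)))"
proof -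
  have "(r1 - r2) * (q3 * (r1\<^sup>2 + r1 * r2 + r2\<^sup>2) + q2 * (r1 + r2) + q1)
      = (q3 * r1 ^ 3 + q2 * r1\<^sup>2 + q1 * r1 + q0) - (q3 * r2 ^ 3 + q2 * r2\<^sup>2 + q1 * r2 + q0)"
    by (simp add: algebra_simps power2_eq_square power3_eq_cube)
  then have "q3 * (r1\<^sup>2 + r1 * r2 + r2\<^sup>2) + q2 * (r1 + r2) + q1 = 0" using assms by simp
  then have q1: "q1 = - (q3 * (r1\<^sup>2 + r1 * r2 + r2\<^sup>2) + q2 * (r1 + r2))" by (metis add.commute eq_neg_iff_add_eq_0)
  have q0: "q0 = - (q3 * r1 ^ 3 + q2 * r1\<^sup>2 + q1 * r1)" using assms(1) by (metis add.commute eq_neg_iff_add_eq_0)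
  show ?thesis unfolding q0 q1 by (simp add: algebra_simps power2_eq_square power3_eq_cube)
qed

text \<open>L is chosen so that h2 s^2 + h0 takes the value -h0 at s = \<plusminus>L and h0 at 0. A
  perturbation below \<bar>h0\<bar> keeps these signs, so there are real roots on both sides of 0,
  and the third root belongs to a real linear factor. N sums the powers of L, so coefficient errors
  below \<bar>h0\<bar> / N perturb the values by less than \<bar>h0\<bar>.\<close>

lemma cubic_all_real:
  fixes h0 h2 :: real
  assumes "h0 * h2 < 0"
  obtains \<eta> where "0 < \<eta>"
    "\<And>q0 q1 q2 q3 s. \<bar>q0 - h0\<bar> < \<eta> \<Longrightarrow> \<bar>q1\<bar> < \<eta> \<Longrightarrow> \<bar>q2 - h2\<bar> < \<eta> \<Longrightarrow> \<bar>q3\<bar> < \<eta> \<Longrightarrow> q3 \<noteq> 0 \<Longrightarrow>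
       of_real q3 * s ^ 3 + of_real q2 * s\<^sup>2 + of_real q1 * s + of_real q0 = (0::complex) \<Longrightarrow> Im s = 0"
proof -
  have nz: "h0 \<noteq> 0" "h2 \<noteq> 0" using assms by auto
  define L where "L = sqrt (- 2 * h0 / h2)"
  have pos: "0 < - 2 * h0 / h2" using assms nz by (auto simp: mult_less_0_iff divide_less_0_iff zero_less_divide_iff)
  have L0: "0 < L" and L2: "h2 * L\<^sup>2 = - 2 * h0" using pos nz by (auto simp: L_def)
  define N where "N = L ^ 3 + L\<^sup>2 + L + 1"
  have N: "0 < N" using L0 by (simp add: N_def add_pos_pos)
  show ?thesis
  proof (rule that[of "\<bar>h0\<bar> / N"])
    show "0 < \<bar>h0\<bar> / N" using nz N by simp
    fix q0 q1 q2 q3 :: real and s :: complex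
    assume q: "\<bar>q0 - h0\<bar> < \<bar>h0\<bar> / N" "\<bar>q1\<bar> < \<bar>h0\<bar> / N" "\<bar>q2 - h2\<bar> < \<bar>h0\<bar> / N" "\<bar>q3\<bar> < \<bar>h0\<bar> / N" "q3 \<noteq> 0"
      and root: "of_real q3 * s ^ 3 + of_real q2 * s\<^sup>2 + of_real q1 * s + of_real q0 = (0::complex)"
    define f where "f y = q3 * y ^ 3 + q2 * y\<^sup>2 + q1 * y + q0" for y
    have end_bound: "\<bar>f y + h0\<bar> < \<bar>h0\<bar>" if y: "\<bar>y\<bar> = L" for y
    proof -
      have y2: "y\<^sup>2 = L\<^sup>2" using y by (metis power2_abs)
      have "f y + h0 = q3 * y ^ 3 + (q2 - h2) * y\<^sup>2 + q1 * y + (q0 - h0)"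
        using L2 by (simp add: f_def y2 algebra_simps)
      then have "\<bar>f y + h0\<bar> \<le> \<bar>q3 * y ^ 3\<bar> + \<bar>(q2 - h2) * y\<^sup>2\<bar> + \<bar>q1 * y\<bar> + \<bar>q0 - h0\<bar>" by linarith
      also have "\<dots> = \<bar>q3\<bar> * L ^ 3 + \<bar>q2 - h2\<bar> * L\<^sup>2 + \<bar>q1\<bar> * L + \<bar>q0 - h0\<bar>"
        using y by (simp add: abs_mult power_abs y2)
      also have "\<dots> < \<bar>h0\<bar> / N * L ^ 3 + \<bar>h0\<bar> / N * L\<^sup>2 + \<bar>h0\<bar> / N * L + \<bar>h0\<bar> / N"
        using q L0 by (intro add_le_less_mono add_mono mult_right_mono) auto
      also have "c * L ^ 3 + c * L\<^sup>2 + c * L + c = c * N" for c by (simp add: N_def algebra_simps)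
      finally show ?thesis using N by simp
    qed
    have mid: "\<bar>f 0 - h0\<bar> < \<bar>h0\<bar>"
    proof -
      have "\<bar>h0\<bar> / N \<le> \<bar>h0\<bar> / 1" using L0 N by (intro divide_left_mono) (auto simp: N_def)
      then show ?thesis using q(1) by (simp add: f_def)
    qed
    have cont: "continuous_on S f" for S unfolding f_def by (intro continuous_intros)
    have e1: "\<bar>f (- L) + h0\<bar> < \<bar>h0\<bar>" and e2: "\<bar>f L + h0\<bar> < \<bar>h0\<bar>" using end_bound L0 by auto
    obtain r1 r2 where r: "f r1 = 0" "f r2 = 0" "r1 < r2"
    proof (cases "0 < h0")
      case True
      then have s: "f (- L) < 0" "0 < f 0" "f L < 0" using e1 e2 mid by linarith+
      obtain r1 where r1: "- L \<le> r1" "r1 \<le> 0" "f r1 = 0" using IVT'[of f "- L" 0 0] s L0 cont by auto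
      obtain r2 where r2: "0 \<le> r2" "r2 \<le> L" "f r2 = 0" using IVT2'[of f L 0 0] s L0 cont by auto
      have "r1 \<noteq> 0" using r1 s by auto
      then show ?thesis using that[of r1 r2] r1 r2 by auto
    next
      case False
      then have s: "0 < f (- L)" "f 0 < 0" "0 < f L" using e1 e2 mid nz by linarith+
      obtain r1 where r1: "- L \<le> r1" "r1 \<le> 0" "f r1 = 0" using IVT2'[of f 0 0 "- L"] s L0 cont by auto
      obtain r2 where r2: "0 \<le> r2" "r2 \<le> L" "f r2 = 0" using IVT'[of f 0 0 L] s L0 cont by auto
      have "r1 \<noteq> 0" using r1 s by auto
      then show ?thesis using that[of r1 r2] r1 r2 by auto
    qed
    have c: "of_real q3 * of_real r ^ 3 + of_real q2 * (of_real r)\<^sup>2 + of_real q1 * of_real r + of_real q0 = (0::complex)"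
      if "f r = 0" for r
    proof -
      have "complex_of_real (f r) = 0" using that by simp
      then show ?thesis unfolding f_def by simp
    qed
    have "(s - of_real r1) * (s - of_real r2) * (of_real q3 * s + (of_real q2 + of_real q3 * (of_real r1 + of_real r2))) = 0"
      using cubic_factor[OF c[OF r(1)] c[OF r(2)], of s] r(3) root by simp
    then consider "s = of_real r1" | "s = of_real r2" | "of_real q3 * s + (of_real q2 + of_real q3 * (of_real r1 + of_real r2)) = 0"
      by auto
    then show "Im s = 0"
    proof cases
      case 3
      from arg_cong[OF this, of Im] show ?thesis using q(5) by simp
    qed auto
  qed
qed

text \<open>By Newton's identities (q1^2 - 2 q0 q2) / q0^2 is the sum of the squares of the
  reciprocal roots, which real roots would make nonnegative. Concretely, if a real root r is divided
  out, the number equals c^2 + r^2 (b^2 - 2 q3 c) in terms of the quadratic factor q3 s^2 + b s + c,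
  and its negativity forces a negative discriminant.\<close>

lemma cubic_nonreal_root:
  fixes q0 q1 q2 q3 :: real
  assumes "q1\<^sup>2 - 2 * q0 * q2 < 0" "q3 \<noteq> 0"
  obtains s where "of_real q3 * s ^ 3 + of_real q2 * s\<^sup>2 + of_real q1 * s + of_real q0 = (0::complex)" "Im s \<noteq> 0"
proof -
  have "\<not> constant (poly [:complex_of_real q0, of_real q1, of_real q2, of_real q3:])"
    using assms(2) by (simp add: constant_degree)
  then obtain t where t: "of_real q3 * t ^ 3 + of_real q2 * t\<^sup>2 + of_real q1 * t + of_real q0 = (0::complex)"
    using fundamental_theorem_of_algebra[of "[:complex_of_real q0, of_real q1, of_real q2, of_real q3:]"]
    by (auto simp: algebra_simps power2_eq_square power3_eq_cube)
  show ?thesis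
  proof (cases "Im t = 0")
    case False then show ?thesis using that t by blast
  next
    case True
    define r where "r = Re t"
    have tr: "t = of_real r" using True by (simp add: r_def complex_eq_iff)
    define b where "b = q2 + q3 * r"
    define c where "c = q1 + b * r"
    have "complex_of_real (q3 * r ^ 3 + q2 * r\<^sup>2 + q1 * r + q0) = 0" using t unfolding tr by simp
    then have "q3 * r ^ 3 + q2 * r\<^sup>2 + q1 * r + q0 = 0" using of_real_eq_0_iff by blast
    then have q0: "q0 = - r * c" by (simp add: b_def c_def algebra_simps power2_eq_square power3_eq_cube)
    have "q1\<^sup>2 - 2 * q0 * q2 = c\<^sup>2 + r\<^sup>2 * (b\<^sup>2 - 2 * (q3 * c))"
      unfolding q0 using b_def c_def by (simp add: algebra_simps power2_eq_square)
    then have "r\<^sup>2 * (b\<^sup>2 - 2 * (q3 * c)) < 0" using assms(1) zero_le_power2[of c] by linarith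
    then have "b\<^sup>2 < 2 * (q3 * c)" by (simp add: mult_less_0_iff)
    then have disc: "0 < 4 * (q3 * c) - b\<^sup>2" using zero_le_power2[of b] by linarith
    define s where "s = Complex (- b / (2 * q3)) (sqrt (4 * (q3 * c) - b\<^sup>2) / (2 * q3))"
    define w where "w = sqrt (4 * (q3 * c) - b\<^sup>2)"
    have w: "w * w = 4 * (q3 * c) - b\<^sup>2" "w \<noteq> 0" using disc by (auto simp: w_def)
    have "2 * of_real q3 * s + of_real b = \<i> * of_real w"
      using assms(2) by (simp add: s_def w_def complex_eq_iff)
    then have "(2 * of_real q3 * s + of_real b) * (2 * of_real q3 * s + of_real b) = (\<i> * of_real w) * (\<i> * complex_of_real w)" by simp
    also have "\<dots> = - of_real (w * w)" by (simp add: algebra_simps)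
    finally have "4 * of_real q3 * (of_real q3 * s\<^sup>2 + of_real b * s + of_real c) = (0 :: complex)"
      unfolding w by (simp add: algebra_simps power2_eq_square)
    then have quad: "of_real q3 * s\<^sup>2 + of_real b * s + of_real c = (0 :: complex)" using assms(2) by simp
    have "of_real q3 * s ^ 3 + of_real q2 * s\<^sup>2 + of_real q1 * s + of_real q0
        = (s - of_real r) * (of_real q3 * s\<^sup>2 + of_real b * s + of_real c)"
      unfolding q0 using b_def c_def by (simp add: algebra_simps power2_eq_square power3_eq_cube)
    then have "of_real q3 * s ^ 3 + of_real q2 * s\<^sup>2 + of_real q1 * s + of_real q0 = 0" using quad by simp
    moreover have "Im s \<noteq> 0" using w(2) assms(2) by (simp add: s_def w_def)
    ultimately show ?thesis by (rule that)
  qed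
qed

text \<open>Cauchy's root bound. Together with a lower bound of \<bar>q3\<bar> by \<bar>x\<bar> it
  keeps x s bounded although q3 tends to 0.\<close>

lemma cubic_root_bound:
  fixes q0 q1 q2 q3 :: real and s :: complex
  assumes "of_real q3 * s ^ 3 + of_real q2 * s\<^sup>2 + of_real q1 * s + of_real q0 = 0" "q3 \<noteq> 0"
  shows "norm s \<le> 1 + (\<bar>q0\<bar> + \<bar>q1\<bar> + \<bar>q2\<bar>) / \<bar>q3\<bar>"
proof (cases "norm s \<le> 1")
  case True
  have "0 \<le> (\<bar>q0\<bar> + \<bar>q1\<bar> + \<bar>q2\<bar>) / \<bar>q3\<bar>" by simp
  then show ?thesis using True by linarith
next
  case False
  then have n: "1 \<le> norm s" by simp
  have n2: "norm s \<le> (norm s)\<^sup>2" using mult_left_mono[OF n norm_ge_zero[of s]] by (simp add: power2_eq_square)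
  then have n2: "norm s \<le> (norm s)\<^sup>2" "1 \<le> (norm s)\<^sup>2" using n by linarith+
  have "of_real q3 * s ^ 3 = - (of_real q2 * s\<^sup>2 + of_real q1 * s + of_real q0)"
    using assms(1) by (simp only: eq_neg_iff_add_eq_0 add.assoc)
  then have "norm (of_real q3 * s ^ 3) = norm (of_real q2 * s\<^sup>2 + of_real q1 * s + of_real q0)" by (metis norm_minus_cancel)
  also have "\<dots> \<le> norm (of_real q2 * s\<^sup>2) + norm (of_real q1 * s) + norm (complex_of_real q0)"
    by (meson norm_triangle_ineq norm_triangle_le add_right_mono order_trans)
  also have "\<dots> = \<bar>q2\<bar> * (norm s)\<^sup>2 + \<bar>q1\<bar> * norm s + \<bar>q0\<bar> * 1" by (simp add: norm_mult norm_power)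
  also have "\<dots> \<le> \<bar>q2\<bar> * (norm s)\<^sup>2 + \<bar>q1\<bar> * (norm s)\<^sup>2 + \<bar>q0\<bar> * (norm s)\<^sup>2"
    using n2 by (intro add_mono mult_left_mono) auto
  finally have "(\<bar>q3\<bar> * norm s) * (norm s)\<^sup>2 \<le> (\<bar>q0\<bar> + \<bar>q1\<bar> + \<bar>q2\<bar>) * (norm s)\<^sup>2"
    by (simp add: norm_mult norm_power algebra_simps power2_eq_square power3_eq_cube)
  then have "\<bar>q3\<bar> * norm s \<le> \<bar>q0\<bar> + \<bar>q1\<bar> + \<bar>q2\<bar>" using n by (auto simp: mult_le_cancel_right)
  then have "norm s \<le> (\<bar>q0\<bar> + \<bar>q1\<bar> + \<bar>q2\<bar>) / \<bar>q3\<bar>" using assms(2) by (simp add: le_divide_eq mult.commute)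
  then show ?thesis by simp
qed

section \<open>The characteristic determinant in even and odd combinations\<close>

lemma singular_3:
  fixes a b c d e f g h i :: complex
  shows "(\<exists>x y z. (x \<noteq> 0 \<or> y \<noteq> 0 \<or> z \<noteq> 0) \<and> a * x + b * y + c * z = 0 \<and> d * x + e * y + f * z = 0
            \<and> g * x + h * y + i * z = 0)
    \<longleftrightarrow> a * (e * i - f * h) - b * (d * i - f * g) + c * (d * h - e * g) = 0"
proof -
  let ?M = "vector [vector [a, b, c], vector [d, e, f], vector [g, h, i]] :: complex^3^3"
  have Mv: "?M *v v = vector [a * v$1 + b * v$2 + c * v$3, d * v$1 + e * v$2 + f * v$3, g * v$1 + h * v$2 + i * v$3]" for v
    by (simp add: vec_eq_iff forall_3 matrix_vector_mult_def sum_3)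
  have "det ?M = 0 \<longleftrightarrow> \<not> (\<forall>v. ?M *v v = 0 \<longrightarrow> v = 0)"
    by (metis invertible_det_nz invertible_left_inverse matrix_left_invertible_ker)
  also have "\<dots> \<longleftrightarrow> (\<exists>v::complex^3. (v$1 \<noteq> 0 \<or> v$2 \<noteq> 0 \<or> v$3 \<noteq> 0) \<and> a * v$1 + b * v$2 + c * v$3 = 0
      \<and> d * v$1 + e * v$2 + f * v$3 = 0 \<and> g * v$1 + h * v$2 + i * v$3 = 0)"
    unfolding Mv by (auto simp: vec_eq_iff forall_3)
  also have "\<dots> \<longleftrightarrow> (\<exists>x y z. (x \<noteq> 0 \<or> y \<noteq> 0 \<or> z \<noteq> 0) \<and> a * x + b * y + c * z = 0 \<and> d * x + e * y + f * z = 0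
            \<and> g * x + h * y + i * z = 0)" (is "?l \<longleftrightarrow> ?r")
  proof
    assume ?r
    then obtain x y z where "(x \<noteq> 0 \<or> y \<noteq> 0 \<or> z \<noteq> 0) \<and> a * x + b * y + c * z = 0 \<and> d * x + e * y + f * z = 0
            \<and> g * x + h * y + i * z = 0" by blast
    then show ?l by (intro exI[of _ "vector [x, y, z]"]) simp
  qed blast
  also have "det ?M = a * (e * i - f * h) - b * (d * i - f * g) + c * (d * h - e * g)"
    by (simp add: det_3 algebra_simps)
  finally show ?thesis by blast
qed

text \<open>The letters c and s in the names of the entries stand for cosine and sine, the even and
  odd combinations of the modes 1 and -1. The row factors 1 + \<xi> and \<xi> - 1 are inverted as u
  (1 - \<xi>) and -u (1 + \<xi>); in the new basis the eigenvalue then appears in the combinations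
  \<xi> \<nu> u and \<xi>^2 \<nu> u.\<close>

lemma core_eigenvalue_parity:
  fixes a :: "int \<Rightarrow> int \<Rightarrow> real" and \<nu> :: complex
  assumes xi: "\<xi> \<noteq> 0" "\<bar>\<xi>\<bar> < 1"
  defines "u \<equiv> 1 / (1 - \<xi>\<^sup>2)"
  defines "a0c \<equiv> a 0 1 + a 0 (-1)" and "a0s \<equiv> a 0 1 - a 0 (-1)"
    and "ac0 \<equiv> (a 1 0 + a (-1) 0) / 2" and "as0 \<equiv> (a 1 0 - a (-1) 0) / 2"
    and "acc \<equiv> (a 1 1 + a 1 (-1) + a (-1) 1 + a (-1) (-1)) / 2"
    and "acs \<equiv> (a 1 1 - a 1 (-1) + a (-1) 1 - a (-1) (-1)) / 2"
    and "asc \<equiv> (a 1 1 + a 1 (-1) - a (-1) 1 - a (-1) (-1)) / 2"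
    and "ass \<equiv> (a 1 1 - a 1 (-1) - a (-1) 1 + a (-1) (-1)) / 2"
  shows "core_eigenvalue (\<lambda>i j. (of_int i + \<xi>) * a i j) (of_real \<xi> * \<nu>) \<longleftrightarrow>
     (of_real (a 0 0) - \<nu>) * ((of_real acc + of_real (\<xi>\<^sup>2) * \<nu> * of_real u) * (of_real ass + of_real (\<xi>\<^sup>2) * \<nu> * of_real u)
        - (of_real acs - of_real \<xi> * \<nu> * of_real u) * (of_real asc - of_real \<xi> * \<nu> * of_real u))
     - of_real a0c * (of_real ac0 * (of_real ass + of_real (\<xi>\<^sup>2) * \<nu> * of_real u)
        - (of_real acs - of_real \<xi> * \<nu> * of_real u) * of_real as0)
     + of_real a0s * (of_real ac0 * (of_real asc - of_real \<xi> * \<nu> * of_real u)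
        - (of_real acc + of_real (\<xi>\<^sup>2) * \<nu> * of_real u) * of_real as0) = 0"
proof -
  define X where "X = complex_of_real \<xi>"
  define U where "U = complex_of_real u"
  have sq: "\<xi>\<^sup>2 < 1" using xi(2) by (simp add: abs_square_less_1)
  have nz: "X \<noteq> 0" "1 + X \<noteq> 0" "X - 1 \<noteq> 0"
  proof -
    show "X \<noteq> 0" using xi by (simp add: X_def)
    have "1 + \<xi> \<noteq> 0" "\<xi> - 1 \<noteq> 0" using xi(2) by auto
    then have "complex_of_real (1 + \<xi>) \<noteq> 0" "complex_of_real (\<xi> - 1) \<noteq> 0" unfolding of_real_eq_0_iff by blast+
    then show "1 + X \<noteq> 0" "X - 1 \<noteq> 0" by (simp_all add: X_def)
  qed
  have UX: "U * (1 - X * X) = 1"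
  proof -
    have "u * (1 - \<xi>\<^sup>2) = 1" using sq by (simp add: u_def)
    then have "complex_of_real (u * (1 - \<xi>\<^sup>2)) = 1" by simp
    then show ?thesis by (simp add: U_def X_def power2_eq_square)
  qed
  have inv1: "1 = (1 + X) * (U * (1 - X))" and inv2: "1 = (X - 1) * (- U * (1 + X))"
    using UX by (simp_all add: algebra_simps)
  have s1: "(1 + X) * E = X * \<nu> * y \<longleftrightarrow> E = X * \<nu> * U * (1 - X) * y" for E y
  proof -
    have "(1 + X) * E = X * \<nu> * y \<longleftrightarrow> (1 + X) * E = (1 + X) * (X * \<nu> * U * (1 - X) * y)"
      using inv1 by (metis mult.assoc mult.commute mult_1)
    then show ?thesis using nz by simp
  qed
  have s2: "(X - 1) * E = X * \<nu> * y \<longleftrightarrow> E = - X * \<nu> * U * (1 + X) * y" for E y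
  proof -
    have "(X - 1) * (- X * \<nu> * U * (1 + X) * y) = ((X - 1) * (- U * (1 + X))) * (X * \<nu> * y)" by (simp add: algebra_simps)
    then have "(X - 1) * E = X * \<nu> * y \<longleftrightarrow> (X - 1) * E = (X - 1) * (- X * \<nu> * U * (1 + X) * y)"
      unfolding inv2[symmetric] by simp
    moreover have "(X - 1) * E = (X - 1) * F \<longleftrightarrow> E = F" for F using nz by simp
    ultimately show ?thesis by blast
  qed
  have pairs: "E1 = p * (1 - X) * (y + z) \<and> E2 = - p * (1 + X) * (y - z) \<longleftrightarrow>
      (E1 + E2) / 2 = p * (z - X * y) \<and> (E1 - E2) / 2 = p * (y - X * z)" for E1 E2 p y z
  proof -
    have E: "E1 = (E1 + E2) / 2 + (E1 - E2) / 2" "E2 = (E1 + E2) / 2 - (E1 - E2) / 2" by (simp_all add: field_simps)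
    have p: "p * (1 - X) * (y + z) = p * (z - X * y) + p * (y - X * z)"
      "- p * (1 + X) * (y - z) = p * (z - X * y) - p * (y - X * z)" by (simp_all add: algebra_simps)
    have lin: "A + B = C + D \<and> A - B = C - D \<longleftrightarrow> A = C \<and> B = D" for A B C D :: complex
    proof (intro iffI conjI; elim conjE)
      assume h: "A + B = C + D" "A - B = C - D"
      have "2 * A = (A + B) + (A - B)" "2 * B = (A + B) - (A - B)" by simp_all
      then show "A = C" "B = D" unfolding h by simp_all
    qed simp_all
    have "E1 = p * (1 - X) * (y + z) \<and> E2 = - p * (1 + X) * (y - z) \<longleftrightarrow>
      (E1 + E2) / 2 + (E1 - E2) / 2 = p * (z - X * y) + p * (y - X * z) \<and>
      (E1 + E2) / 2 - (E1 - E2) / 2 = p * (z - X * y) - p * (y - X * z)"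
      unfolding p using E by metis
    then show ?thesis unfolding lin .
  qed
  have "core_eigenvalue (\<lambda>i j. (of_int i + \<xi>) * a i j) (of_real \<xi> * \<nu>) \<longleftrightarrow>
     (\<exists>v::int \<Rightarrow> complex. (v (-1) \<noteq> 0 \<or> v 0 \<noteq> 0 \<or> v 1 \<noteq> (0::complex)) \<and>
       (X - 1) * (of_real (a (-1) (-1)) * v (-1) + of_real (a (-1) 0) * v 0 + of_real (a (-1) 1) * v 1) = X * \<nu> * v (-1) \<and>
       X * (of_real (a 0 (-1)) * v (-1) + of_real (a 0 0) * v 0 + of_real (a 0 1) * v 1) = X * \<nu> * v 0 \<and>
       (1 + X) * (of_real (a 1 (-1)) * v (-1) + of_real (a 1 0) * v 0 + of_real (a 1 1) * v 1) = X * \<nu> * v 1)"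
  proof -
    have row: "(\<Sum>j\<in>Core. of_real ((of_int i + \<xi>) * a i j) * v j)
        = (of_int i + X) * (of_real (a i (-1)) * v (-1) + of_real (a i 0) * v 0 + of_real (a i 1) * v 1)" for i v
      by (simp add: sum_Core X_def algebra_simps)
    have Core: "(\<forall>i\<in>Core. Q i) \<longleftrightarrow> Q (-1) \<and> Q 0 \<and> Q 1" "(\<exists>i\<in>Core. Q i) \<longleftrightarrow> Q (-1) \<or> Q 0 \<or> Q 1" for Q
      by (simp_all add: Core_def)
    show ?thesis unfolding core_eigenvalue_def row Core X_def[symmetric] by simp
  qed
  also have "\<dots> \<longleftrightarrow> (\<exists>x y z. (x \<noteq> 0 \<or> y \<noteq> 0 \<or> z \<noteq> 0) \<and>
       (of_real (a 0 0) - \<nu>) * x + of_real a0c * y + of_real a0s * z = 0 \<and>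
       of_real ac0 * x + (of_real acc + X * X * \<nu> * U) * y + (of_real acs - X * \<nu> * U) * z = 0 \<and>
       of_real as0 * x + (of_real asc - X * \<nu> * U) * y + (of_real ass + X * X * \<nu> * U) * z = 0)"
    (is "(\<exists>v. ?P v) \<longleftrightarrow> (\<exists>x y z. ?Q x y z)")
  proof -
    have key: "?P v \<longleftrightarrow> ?Q (v 0) ((v 1 + v (-1)) / 2) ((v 1 - v (-1)) / 2)" for v
    proof -
      define y where "y = (v 1 + v (-1)) / 2"
      define z where "z = (v 1 - v (-1)) / 2"
      have v: "v 1 = y + z" "v (-1) = y - z" by (simp_all add: y_def z_def field_simps)
      define E1 where "E1 = of_real (a 1 (-1)) * v (-1) + of_real (a 1 0) * v 0 + of_real (a 1 1) * v 1"
      define E2 where "E2 = of_real (a (-1) (-1)) * v (-1) + of_real (a (-1) 0) * v 0 + of_real (a (-1) 1) * v 1"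
      have ne: "(v (-1) \<noteq> 0 \<or> v 0 \<noteq> 0 \<or> v 1 \<noteq> 0) \<longleftrightarrow> (v 0 \<noteq> 0 \<or> y \<noteq> 0 \<or> z \<noteq> 0)"
        unfolding v by (auto simp: add_eq_0_iff)
      have e0: "X * (of_real (a 0 (-1)) * v (-1) + of_real (a 0 0) * v 0 + of_real (a 0 1) * v 1) = X * \<nu> * v 0
          \<longleftrightarrow> (of_real (a 0 0) - \<nu>) * v 0 + of_real a0c * y + of_real a0s * z = 0"
        using nz(1) unfolding v by (simp add: mult.assoc) (auto simp: a0c_def a0s_def algebra_simps)
      have "((1 + X) * E1 = X * \<nu> * v 1 \<and> (X - 1) * E2 = X * \<nu> * v (-1)) \<longleftrightarrow>
          (E1 + E2) / 2 = X * \<nu> * U * (z - X * y) \<and> (E1 - E2) / 2 = X * \<nu> * U * (y - X * z)"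
        unfolding s1 s2 v using pairs[of E1 "X * \<nu> * U" y z E2] by simp
      moreover have "(E1 + E2) / 2 = of_real ac0 * v 0 + of_real acc * y + of_real acs * z"
        unfolding E1_def E2_def v by (simp add: ac0_def acc_def acs_def field_simps)
      moreover have "(E1 - E2) / 2 = of_real as0 * v 0 + of_real asc * y + of_real ass * z"
        unfolding E1_def E2_def v by (simp add: as0_def asc_def ass_def field_simps)
      ultimately have e12: "((1 + X) * E1 = X * \<nu> * v 1 \<and> (X - 1) * E2 = X * \<nu> * v (-1)) \<longleftrightarrow>
          of_real ac0 * v 0 + of_real acc * y + of_real acs * z = X * \<nu> * U * (z - X * y) \<and>
          of_real as0 * v 0 + of_real asc * y + of_real ass * z = X * \<nu> * U * (y - X * z)" by simp
      have m: "s = X * \<nu> * U * (z - X * y) \<longleftrightarrow> s + X * X * \<nu> * U * y - X * \<nu> * U * z = 0"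
        "s = X * \<nu> * U * (y - X * z) \<longleftrightarrow> s - X * \<nu> * U * y + X * X * \<nu> * U * z = 0" for s
        by (auto simp: algebra_simps)
      show ?thesis
        unfolding y_def[symmetric] z_def[symmetric] E1_def[symmetric] E2_def[symmetric]
        using ne e0 e12 unfolding m by (auto simp: algebra_simps)
    qed
    show ?thesis
    proof
      assume "\<exists>v. ?P v" then show "\<exists>x y z. ?Q x y z" unfolding key by blast
    next
      assume "\<exists>x y z. ?Q x y z"
      then obtain x y z where Q: "?Q x y z" by blast
      define v :: "int \<Rightarrow> complex" where "v i = (if i = 0 then x else if i = 1 then y + z else y - z)" for i
      have "v 0 = x" "(v 1 + v (-1)) / 2 = y" "(v 1 - v (-1)) / 2 = z" by (simp_all add: v_def)
      then have "?P v" unfolding key using Q by simp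
      then show "\<exists>v. ?P v" by blast
    qed
  qed
  also note singular_3
  finally show ?thesis by (simp add: X_def U_def power2_eq_square)
qed

text \<open>Coefficients in \<open>s\<close> of the determinant for the eigenvalue \<open>\<xi> (\<nu>0 + x s)\<close>, divided by \<open>\<xi>\<^sup>2 x\<^sup>2\<close>.
  In the even and odd combinations of the modes \<open>\<plusminus>1\<close> the entries of the reduced matrix are
  \<open>\<alpha> + \<nu>0\<close>, \<open>x R1\<close>, \<open>x R2\<close>, \<open>\<xi> x R3\<close>, \<open>\<xi> x R4\<close>, \<open>x\<^sup>2 D0\<close>, \<open>\<xi>\<^sup>2 \<rho>\<close>, \<open>\<xi> (\<nu>0 u + x e1)\<close>, \<open>\<xi> (\<nu>0 u + x e2)\<close>,
  and \<open>u = 1 / (1 - \<xi>\<^sup>2)\<close>, \<open>\<theta> = \<xi>\<^sup>2 / x\<^sup>2\<close>, \<open>D = D0 + \<theta> \<nu>0 u\<close>, \<open>r = \<rho> + \<nu>0 u\<close>.\<close>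

definition cq :: "real \<Rightarrow> real \<Rightarrow> real \<Rightarrow> real \<Rightarrow> real \<Rightarrow> real \<Rightarrow> real \<Rightarrow> real \<Rightarrow> real \<Rightarrow> real \<Rightarrow> real \<Rightarrow> real \<Rightarrow> nat \<Rightarrow> real" where
  "cq \<alpha> x u \<theta> D r e1 e2 R1 R2 R3 R4 k =
    (let k0 = D * r - e1 * e2; k1 = D * x * u + r * \<theta> * x * u + u * (e1 + e2); k2 = \<theta> * x\<^sup>2 * u\<^sup>2 - u\<^sup>2 in
     if k = 0 then \<alpha> * k0 - R1 * R2 * r + x * R1 * R4 * e1 + x * R3 * R2 * e2 - x\<^sup>2 * R3 * R4 * D
     else if k = 1 then \<alpha> * k1 - x * k0 - R1 * R2 * x * u - x * u * R1 * R4 - x * u * R2 * R3 - x ^ 3 * \<theta> * u * R3 * R4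
     else if k = 2 then \<alpha> * k2 - x * k1
     else - x * k2)"

text \<open>The even row and column contribute a factor x each, the odd row and column a factor
  \<xi> each, so \<xi>^2 x^2 comes out of the determinant. Centring the eigenvalue at \<xi> \<nu>0
  is what gives the entries between even and odd this size: they become \<xi> x (e - u s).\<close>

lemma reduced_determinant:
  fixes s \<alpha> x u \<theta> D \<rho> e1 e2 R1 R2 R3 R4 \<xi> \<nu>0 :: "'a::comm_ring_1"
  defines "\<nu> \<equiv> \<nu>0 + x * s" and "D' \<equiv> D + \<theta> * \<nu>0 * u" and "r \<equiv> \<rho> + \<nu>0 * u"
  defines "k0 \<equiv> D' * r - e1 * e2" and "k1 \<equiv> D' * x * u + r * \<theta> * x * u + u * (e1 + e2)" and "k2 \<equiv> \<theta> * x\<^sup>2 * u\<^sup>2 - u\<^sup>2"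
  assumes th: "\<xi>\<^sup>2 = \<theta> * x\<^sup>2"
  shows "(\<alpha> + \<nu>0 - \<nu>) * ((x\<^sup>2 * D + \<xi>\<^sup>2 * \<nu> * u) * (\<xi>\<^sup>2 * \<rho> + \<xi>\<^sup>2 * \<nu> * u)
        - (\<xi> * (\<nu>0 * u + x * e1) - \<xi> * \<nu> * u) * (\<xi> * (\<nu>0 * u + x * e2) - \<xi> * \<nu> * u))
     - (x * R1) * ((x * R2) * (\<xi>\<^sup>2 * \<rho> + \<xi>\<^sup>2 * \<nu> * u) - (\<xi> * (\<nu>0 * u + x * e1) - \<xi> * \<nu> * u) * (\<xi> * x * R4))
     + (\<xi> * x * R3) * ((x * R2) * (\<xi> * (\<nu>0 * u + x * e2) - \<xi> * \<nu> * u) - (x\<^sup>2 * D + \<xi>\<^sup>2 * \<nu> * u) * (\<xi> * x * R4))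
    = \<xi>\<^sup>2 * x\<^sup>2 * ((- x * k2) * s ^ 3 + (\<alpha> * k2 - x * k1) * s\<^sup>2
       + (\<alpha> * k1 - x * k0 - R1 * R2 * x * u - x * u * R1 * R4 - x * u * R2 * R3 - x ^ 3 * \<theta> * u * R3 * R4) * s
       + (\<alpha> * k0 - R1 * R2 * r + x * R1 * R4 * e1 + x * R3 * R2 * e2 - x\<^sup>2 * R3 * R4 * D'))"
proof -
  have e: "\<xi> * (\<nu>0 * u + x * e) - \<xi> * \<nu> * u = \<xi> * x * (e - u * s)" for e
    by (simp add: \<nu>_def algebra_simps)
  have d: "x\<^sup>2 * D + \<xi>\<^sup>2 * \<nu> * u = x\<^sup>2 * (D' + \<theta> * x * u * s)"
    unfolding th D'_def \<nu>_def by (simp add: algebra_simps)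
  have r: "\<xi>\<^sup>2 * \<rho> + \<xi>\<^sup>2 * \<nu> * u = \<xi>\<^sup>2 * (r + x * u * s)"
    unfolding r_def \<nu>_def by (simp add: algebra_simps)
  have a: "\<alpha> + \<nu>0 - \<nu> = \<alpha> - x * s" by (simp add: \<nu>_def)
  show ?thesis unfolding e d r a k0_def k1_def k2_def
    by (simp add: algebra_simps power2_eq_square power3_eq_cube)
qed

section \<open>The small-amplitude limit of the reduced matrix\<close>

lemma abs_half_le:
  fixes y z B :: real
  assumes "\<bar>y + 2 * z\<bar> \<le> 2 * B" shows "\<bar>y / 2 + z\<bar> \<le> B"
  using assms by (intro abs_leI) (simp_all add: abs_le_iff)

context wave
begin

lemma S_minus_1: "S (- 1 + \<xi>) = S (1 - \<xi>)" "S (- 1) = S 1"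
  using S_even[of "1 - \<xi>"] S_even[of 1] by simp_all

text \<open>The accuracies are dictated by the scaling of \<open>reduced_determinant\<close>:
  relative to the weights 1, x and \<xi>, every error has to vanish in the limit. The odd-odd entry,
  of size \<xi>^2, takes \<open>as_second_order\<close>; the even-even entry, of size x^2, takes
  \<open>At_cross\<close>; the others follow from the first order and Lipschitz bounds.\<close>

lemma entry_bounds:
  assumes xi: "\<bar>\<xi>\<bar> \<le> \<xi>0"
  shows "\<bar>At \<xi> 0 0 - (V - S \<xi>)\<bar> \<le> 2 * (P * R)"
    and "\<bar>At \<xi> 0 1 + At \<xi> 0 (-1) + 4 * p 1\<bar> \<le> 4 * (P * R)"
    and "\<bar>(At \<xi> 1 0 + At \<xi> (-1) 0) / 2 + 2 * p 1\<bar> \<le> 2 * (P * R)"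
    and "\<bar>At \<xi> 0 1 - At \<xi> 0 (-1)\<bar> \<le> 4 * (P * Q) * \<bar>\<xi>\<bar>"
    and "\<bar>(At \<xi> 1 0 - At \<xi> (-1) 0) / 2\<bar> \<le> 2 * (P * Q) * \<bar>\<xi>\<bar>"
    and "\<bar>(At \<xi> 1 1 + At \<xi> 1 (-1) + At \<xi> (-1) 1 + At \<xi> (-1) (-1)) / 2 + 4 * p 2\<bar>
        \<le> 2 * (8 * \<bar>p 1\<bar> * (T2 + P * R) / \<gamma> + 2 * (T2 * R)) + (4 * (P * Q) + \<Lambda>) * \<bar>\<xi>\<bar>"
    and "\<bar>(At \<xi> 1 1 - At \<xi> 1 (-1) - At \<xi> (-1) 1 + At \<xi> (-1) (-1)) / 2 + (S (1 + \<xi>) + S (1 - \<xi>) - 2 * S 1) / 2\<bar>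
        \<le> 30 * \<Lambda> * R * (R + Q) * \<xi>\<^sup>2"
    and "\<bar>(At \<xi> 1 1 - At \<xi> 1 (-1) + At \<xi> (-1) 1 - At \<xi> (-1) (-1)) / 2 + (S (1 + \<xi>) - S (1 - \<xi>)) / 2\<bar>
        \<le> 4 * (P * Q) * \<bar>\<xi>\<bar>"
    and "\<bar>(At \<xi> 1 1 + At \<xi> 1 (-1) - At \<xi> (-1) 1 - At \<xi> (-1) (-1)) / 2 + (S (1 + \<xi>) - S (1 - \<xi>)) / 2\<bar>
        \<le> 4 * (P * Q) * \<bar>\<xi>\<bar>"
proof -
  note b = At_bound[OF xi] and C = mem_Core
  have L: "\<bar>At \<xi> i j - At 0 i j + of_bool (i = j) * (S (of_int i + \<xi>) - S (of_int i))\<bar> \<le> 2 * (P * Q * \<bar>\<xi>\<bar>)"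
    if "i \<in> Core" "j \<in> Core" for i j using At_lipschitz[OF xi that] by (simp add: mult.assoc)
  have p: "p (-1) = p 1" using p_even[of 1] by simp
  define W where "W = P * Q * \<bar>\<xi>\<bar>"
  define E1 where "E1 = S (1 + \<xi>) - S 1"
  define E2 where "E2 = S (1 - \<xi>) - S 1"
  have L11: "\<bar>At \<xi> 1 1 - At 0 1 1 + E1\<bar> \<le> 2 * W" and L1m: "\<bar>At \<xi> 1 (-1) - At 0 1 (-1)\<bar> \<le> 2 * W"
    and Lm1: "\<bar>At \<xi> (-1) 1 - At 0 (-1) 1\<bar> \<le> 2 * W" and Lmm: "\<bar>At \<xi> (-1) (-1) - At 0 (-1) (-1) + E2\<bar> \<le> 2 * W"
    and L10: "\<bar>At \<xi> 1 0 - At 0 1 0\<bar> \<le> 2 * W" and Lm0: "\<bar>At \<xi> (-1) 0 - At 0 (-1) 0\<bar> \<le> 2 * W"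
    using L[OF C(2) C(2)] L[OF C(2) C(1)] L[OF C(1) C(2)] L[OF C(1) C(1)] L[OF C(2) C(3)] L[OF C(1) C(3)]
    S_even[of "1 - \<xi>"] by (simp_all add: W_def E1_def E2_def S_minus_1)
  have sym: "At 0 1 1 = At 0 1 (-1)" "At 0 (-1) 1 = At 0 1 (-1)" "At 0 (-1) (-1) = At 0 1 (-1)" "At 0 (-1) 0 = At 0 1 0"
    using At_kernel[of 1] At_kernel[of "-1"] At_reflect[of 1 1] At_reflect[of 1 0] by simp_all
  have E: "\<bar>E1\<bar> \<le> \<Lambda> * \<bar>\<xi>\<bar>" "\<bar>E2\<bar> \<le> \<Lambda> * \<bar>\<xi>\<bar>"
    using lip[of 1 \<xi>] lip[of 1 "- \<xi>"] xi by (simp_all add: E1_def E2_def)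
  show "\<bar>At \<xi> 0 0 - (V - S \<xi>)\<bar> \<le> 2 * (P * R)" using b[OF C(3) C(3)] p_0 by simp
  show "\<bar>At \<xi> 0 1 + At \<xi> 0 (-1) + 4 * p 1\<bar> \<le> 4 * (P * R)" using b[OF C(3) C(2)] b[OF C(3) C(1)] p by simp
  show "\<bar>(At \<xi> 1 0 + At \<xi> (-1) 0) / 2 + 2 * p 1\<bar> \<le> 2 * (P * R)"
  proof -
    have "\<bar>At \<xi> 1 0 + 2 * p 1\<bar> \<le> 2 * (P * R)" "\<bar>At \<xi> (-1) 0 + 2 * p 1\<bar> \<le> 2 * (P * R)"
      using b[OF C(2) C(3)] b[OF C(1) C(3)] p by simp_all
    then show ?thesis by (intro abs_half_le) linarith
  qed
  show "\<bar>At \<xi> 0 1 - At \<xi> 0 (-1)\<bar> \<le> 4 * (P * Q) * \<bar>\<xi>\<bar>"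
    using as_bound(1)[OF xi] by (simp add: as_def mult.assoc)
  have W: "4 * (P * Q) * \<bar>\<xi>\<bar> = 4 * W" "2 * (P * Q) * \<bar>\<xi>\<bar> = 2 * W" "(4 * (P * Q) + \<Lambda>) * \<bar>\<xi>\<bar> = 4 * W + \<Lambda> * \<bar>\<xi>\<bar>"
    by (simp_all add: W_def algebra_simps)
  show "\<bar>(At \<xi> 1 0 - At \<xi> (-1) 0) / 2\<bar> \<le> 2 * (P * Q) * \<bar>\<xi>\<bar>"
    using abs_half_le[of "At \<xi> 1 0 - At \<xi> (-1) 0" 0 "2 * W"] L10 Lm0 unfolding W sym by simp
  show "\<bar>(At \<xi> 1 1 + At \<xi> 1 (-1) + At \<xi> (-1) 1 + At \<xi> (-1) (-1)) / 2 + 4 * p 2\<bar>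
        \<le> 2 * (8 * \<bar>p 1\<bar> * (T2 + P * R) / \<gamma> + 2 * (T2 * R)) + (4 * (P * Q) + \<Lambda>) * \<bar>\<xi>\<bar>"
  proof -
    define X where "X = 8 * \<bar>p 1\<bar> * (T2 + P * R) / \<gamma> + 2 * (T2 * R)"
    define Y where "Y = \<Lambda> * \<bar>\<xi>\<bar>"
    have X: "\<bar>At 0 1 (-1) + 2 * p 2\<bar> \<le> X" using At_cross by (simp add: X_def)
    note facts = X L11[unfolded sym] L1m[unfolded sym] Lm1[unfolded sym] Lmm[unfolded sym] E[folded Y_def]
    show ?thesis
      unfolding W X_def[symmetric] Y_def[symmetric]
      using facts by (simp only: add_divide_distrib diff_divide_distrib distrib_left)
  qed
  show "\<bar>(At \<xi> 1 1 - At \<xi> 1 (-1) - At \<xi> (-1) 1 + At \<xi> (-1) (-1)) / 2 + (S (1 + \<xi>) + S (1 - \<xi>) - 2 * S 1) / 2\<bar>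
        \<le> 30 * \<Lambda> * R * (R + Q) * \<xi>\<^sup>2"
  proof -
    have "\<bar>y / 2 + z / 2\<bar> \<le> 30 * w" if "\<bar>y + z\<bar> \<le> 60 * w" for y z w :: real
      by (rule abs_half_le) (use that in simp)
    from this[of "as \<xi> 1 - as \<xi> (-1)" "S (1 + \<xi>) + S (1 - \<xi>) - 2 * S 1" "\<Lambda> * R * (R + Q) * \<xi>\<^sup>2"]
    show ?thesis using as_second_order[OF xi] by (simp add: as_def algebra_simps)
  qed
  show "\<bar>(At \<xi> 1 1 - At \<xi> 1 (-1) + At \<xi> (-1) 1 - At \<xi> (-1) (-1)) / 2 + (S (1 + \<xi>) - S (1 - \<xi>)) / 2\<bar>
        \<le> 4 * (P * Q) * \<bar>\<xi>\<bar>"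
  proof -
    note facts = L11[unfolded sym E1_def] L1m[unfolded sym] Lm1[unfolded sym] Lmm[unfolded sym E2_def]
    show ?thesis unfolding W
      using facts by (simp only: add_divide_distrib diff_divide_distrib distrib_left)
  qed
  show "\<bar>(At \<xi> 1 1 + At \<xi> 1 (-1) - At \<xi> (-1) 1 - At \<xi> (-1) (-1)) / 2 + (S (1 + \<xi>) - S (1 - \<xi>)) / 2\<bar>
        \<le> 4 * (P * Q) * \<bar>\<xi>\<bar>"
  proof -
    note facts = L11[unfolded sym E1_def] L1m[unfolded sym] Lm1[unfolded sym] Lmm[unfolded sym E2_def]
    show ?thesis unfolding W
      using facts by (simp only: add_divide_distrib diff_divide_distrib distrib_left)
  qed
qed

text \<open>At \<xi> = 0 row 0 vanishes, the rows 1 and -1 are opposite, and the outer entries of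
  each row agree; such a matrix squares to zero.\<close>

lemma core_eigenvalue_at_0:
  assumes "core_eigenvalue (Bm 0 (frame 0)) \<mu>" shows "\<mu> = 0"
proof (rule ccontr)
  assume mu: "\<mu> \<noteq> 0"
  obtain u where nz: "\<exists>i\<in>Core. u i \<noteq> 0" and u: "\<And>i. i \<in> Core \<Longrightarrow> (\<Sum>j\<in>Core. of_real (Bm 0 (frame 0) i j) * u j) = \<mu> * u i"
    using assms unfolding core_eigenvalue_def by blast
  have sym: "At 0 1 1 = At 0 1 (-1)" "At 0 (-1) 1 = At 0 1 (-1)" "At 0 (-1) (-1) = At 0 1 (-1)" "At 0 (-1) 0 = At 0 1 0"
    using At_kernel[of 1] At_kernel[of "-1"] At_reflect[of 1 1] At_reflect[of 1 0] by simp_all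
  have u0: "u 0 = 0" using u[OF mem_Core(3)] mu by (simp add: sum_Core Bm_At)
  have e1: "of_real (At 0 1 (-1)) * (u (-1) + u 1) = \<mu> * u 1"
    using u[OF mem_Core(2)] u0 by (simp add: sum_Core Bm_At sym algebra_simps)
  have e2: "- (of_real (At 0 1 (-1)) * (u (-1) + u 1)) = \<mu> * u (-1)"
    using u[OF mem_Core(1)] u0 by (simp add: sum_Core Bm_At sym algebra_simps)
  have "\<mu> * (u 1 + u (-1)) = 0" using e1 e2 by (simp add: distrib_left) (metis add.right_inverse)
  then have "u (-1) + u 1 = 0" using mu by (simp add: add.commute)
  then have "u 1 = 0" "u (-1) = 0" using e1 e2 mu by auto
  then show False using nz u0 by (auto simp: Core_def)
qed

end

lemma eigenvalue_cubic:
  fixes a :: "int \<Rightarrow> int \<Rightarrow> real" and \<xi> x \<nu>0 :: real and s :: complex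
  assumes xi: "\<xi> \<noteq> 0" "\<bar>\<xi>\<bar> < 1" and x: "x \<noteq> 0"
  defines "u \<equiv> 1 / (1 - \<xi>\<^sup>2)" and "\<theta> \<equiv> \<xi>\<^sup>2 / x\<^sup>2"
  defines "\<alpha> \<equiv> a 0 0 - \<nu>0"
    and "R1 \<equiv> (a 0 1 + a 0 (-1)) / x" and "R3 \<equiv> (a 0 1 - a 0 (-1)) / (\<xi> * x)"
    and "R2 \<equiv> (a 1 0 + a (-1) 0) / 2 / x" and "R4 \<equiv> (a 1 0 - a (-1) 0) / 2 / (\<xi> * x)"
    and "D \<equiv> (a 1 1 + a 1 (-1) + a (-1) 1 + a (-1) (-1)) / 2 / x\<^sup>2 + \<theta> * \<nu>0 * u"
    and "r \<equiv> (a 1 1 - a 1 (-1) - a (-1) 1 + a (-1) (-1)) / 2 / \<xi>\<^sup>2 + \<nu>0 * u"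
    and "e1 \<equiv> ((a 1 1 - a 1 (-1) + a (-1) 1 - a (-1) (-1)) / 2 / \<xi> - \<nu>0 * u) / x"
    and "e2 \<equiv> ((a 1 1 + a 1 (-1) - a (-1) 1 - a (-1) (-1)) / 2 / \<xi> - \<nu>0 * u) / x"
  shows "core_eigenvalue (\<lambda>i j. (of_int i + \<xi>) * a i j) (of_real \<xi> * (of_real \<nu>0 + of_real x * s)) \<longleftrightarrow>
     of_real (cq \<alpha> x u \<theta> D r e1 e2 R1 R2 R3 R4 3) * s ^ 3 + of_real (cq \<alpha> x u \<theta> D r e1 e2 R1 R2 R3 R4 2) * s\<^sup>2
     + of_real (cq \<alpha> x u \<theta> D r e1 e2 R1 R2 R3 R4 1) * s + of_real (cq \<alpha> x u \<theta> D r e1 e2 R1 R2 R3 R4 0) = 0"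
proof -
  define D0 where "D0 = (a 1 1 + a 1 (-1) + a (-1) 1 + a (-1) (-1)) / 2 / x\<^sup>2"
  define \<rho> where "\<rho> = (a 1 1 - a 1 (-1) - a (-1) 1 + a (-1) (-1)) / 2 / \<xi>\<^sup>2"
  have eqs: "a 0 0 = \<alpha> + \<nu>0" "a 0 1 + a 0 (-1) = x * R1" "a 0 1 - a 0 (-1) = \<xi> * x * R3"
    "(a 1 0 + a (-1) 0) / 2 = x * R2" "(a 1 0 - a (-1) 0) / 2 = \<xi> * x * R4"
    "(a 1 1 + a 1 (-1) + a (-1) 1 + a (-1) (-1)) / 2 = x\<^sup>2 * D0"
    "(a 1 1 - a 1 (-1) - a (-1) 1 + a (-1) (-1)) / 2 = \<xi>\<^sup>2 * \<rho>"
    "(a 1 1 - a 1 (-1) + a (-1) 1 - a (-1) (-1)) / 2 = \<xi> * (\<nu>0 * u + x * e1)"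
    "(a 1 1 + a 1 (-1) - a (-1) 1 - a (-1) (-1)) / 2 = \<xi> * (\<nu>0 * u + x * e2)"
    using xi x by (simp_all add: \<alpha>_def R1_def R2_def R3_def R4_def D0_def \<rho>_def e1_def e2_def)
  have th: "(complex_of_real \<xi>)\<^sup>2 = of_real \<theta> * (of_real x)\<^sup>2"
  proof -
    have "\<xi>\<^sup>2 = \<theta> * x\<^sup>2" using x by (simp add: \<theta>_def)
    then show ?thesis by (metis of_real_mult of_real_power)
  qed
  have nz: "(complex_of_real \<xi>)\<^sup>2 * (of_real x)\<^sup>2 \<noteq> 0" using xi x by simp
  have D: "D = D0 + \<theta> * \<nu>0 * u" and r: "r = \<rho> + \<nu>0 * u" by (simp_all add: D_def D0_def r_def \<rho>_def)
  show ?thesis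
    unfolding core_eigenvalue_parity[OF xi] u_def[symmetric] eqs of_real_add of_real_mult of_real_power
      reduced_determinant[OF th]
    using nz by (simp add: cq_def Let_def D r)
qed

lemma tendsto_abs_le:
  fixes f g :: "nat \<Rightarrow> real"
  assumes "\<And>n. \<bar>f n - l\<bar> \<le> g n" "g \<longlonglongrightarrow> 0" shows "f \<longlonglongrightarrow> l"
proof -
  have "(\<lambda>n. f n - l) \<longlonglongrightarrow> 0" by (rule Lim_null_comparison[OF _ assms(2)]) (simp add: assms(1))
  then show ?thesis by (rule LIM_zero_cancel)
qed

lemma cq_tendsto:
  fixes \<alpha> x u \<theta> D r e1 e2 R1 R2 R3 R4 :: "nat \<Rightarrow> real"
  assumes lims: "\<alpha> \<longlonglongrightarrow> \<alpha>'" "x \<longlonglongrightarrow> 0" "u \<longlonglongrightarrow> 1" "\<theta> \<longlonglongrightarrow> 0" "D \<longlonglongrightarrow> D'" "r \<longlonglongrightarrow> r'"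
    "e1 \<longlonglongrightarrow> 0" "e2 \<longlonglongrightarrow> 0" "R1 \<longlonglongrightarrow> - 4" "R2 \<longlonglongrightarrow> - 2" "R3 \<longlonglongrightarrow> 0" "R4 \<longlonglongrightarrow> 0"
  defines "q \<equiv> \<lambda>k n. cq (\<alpha> n) (x n) (u n) (\<theta> n) (D n) (r n) (e1 n) (e2 n) (R1 n) (R2 n) (R3 n) (R4 n) k"
  shows "q 0 \<longlonglongrightarrow> \<alpha>' * (D' * r') - 8 * r'" "q 1 \<longlonglongrightarrow> 0" "q 2 \<longlonglongrightarrow> - \<alpha>'"
proof -
  have k0: "(\<lambda>n. D n * r n - e1 n * e2 n) \<longlonglongrightarrow> D' * r' - 0 * 0" by (intro tendsto_intros lims)
  have k1: "(\<lambda>n. D n * x n * u n + r n * \<theta> n * x n * u n + u n * (e1 n + e2 n)) \<longlonglongrightarrow> D' * 0 * 1 + r' * 0 * 0 * 1 + 1 * (0 + 0)"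
    by (intro tendsto_intros lims)
  have k2: "(\<lambda>n. \<theta> n * (x n)\<^sup>2 * (u n)\<^sup>2 - (u n)\<^sup>2) \<longlonglongrightarrow> 0 * 0\<^sup>2 * 1\<^sup>2 - 1\<^sup>2" by (intro tendsto_intros lims)
  have 0: "(\<lambda>n. \<alpha> n * (D n * r n - e1 n * e2 n) - R1 n * R2 n * r n + x n * R1 n * R4 n * e1 n + x n * R3 n * R2 n * e2 n - (x n)\<^sup>2 * R3 n * R4 n * D n)
    \<longlonglongrightarrow> \<alpha>' * (D' * r' - 0 * 0) - (-4) * (-2) * r' + 0 * (-4) * 0 * 0 + 0 * 0 * (-2) * 0 - 0\<^sup>2 * 0 * 0 * D'"
    by (intro tendsto_intros k0 lims)
  then show "q 0 \<longlonglongrightarrow> \<alpha>' * (D' * r') - 8 * r'" by (simp add: q_def cq_def Let_def)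
  have 1: "(\<lambda>n. \<alpha> n * (D n * x n * u n + r n * \<theta> n * x n * u n + u n * (e1 n + e2 n)) - x n * (D n * r n - e1 n * e2 n)
      - R1 n * R2 n * x n * u n - x n * u n * R1 n * R4 n - x n * u n * R2 n * R3 n - x n ^ 3 * \<theta> n * u n * R3 n * R4 n)
    \<longlonglongrightarrow> \<alpha>' * (D' * 0 * 1 + r' * 0 * 0 * 1 + 1 * (0 + 0)) - 0 * (D' * r' - 0 * 0)
      - (-4) * (-2) * 0 * 1 - 0 * 1 * (-4) * 0 - 0 * 1 * (-2) * 0 - 0 ^ 3 * 0 * 1 * 0 * 0"
    by (intro tendsto_intros k0 k1 lims)
  then show "q 1 \<longlonglongrightarrow> 0" by (simp add: q_def cq_def Let_def)
  have 2: "(\<lambda>n. \<alpha> n * (\<theta> n * (x n)\<^sup>2 * (u n)\<^sup>2 - (u n)\<^sup>2) - x n * (D n * x n * u n + r n * \<theta> n * x n * u n + u n * (e1 n + e2 n)))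
    \<longlonglongrightarrow> \<alpha>' * (0 * 0\<^sup>2 * 1\<^sup>2 - 1\<^sup>2) - 0 * (D' * 0 * 1 + r' * 0 * 0 * 1 + 1 * (0 + 0))"
    by (intro tendsto_intros k1 k2 lims)
  then show "q 2 \<longlonglongrightarrow> - \<alpha>'" by (simp add: q_def cq_def Let_def)
qed

text \<open>The hypotheses \<open>b0\<close> to \<open>b8\<close> restate
  \<open>entry_bounds\<close> along a sequence, detached from the locale because its parameters vary
  with n. The power in \<bar>\<xi>\<bar> \<le> \<bar>x\<bar>^3 is felt in the even-even entry: its
  error contains \<Lambda> \<bar>\<xi>\<bar>, which has to be negligible against x^2.\<close>

lemma cubic_coefficients_tendsto:
  fixes a :: "nat \<Rightarrow> int \<Rightarrow> int \<Rightarrow> real" and x V P T2 p2 \<xi> :: "nat \<Rightarrow> real" and S :: "real \<Rightarrow> real"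
    and \<gamma> \<Lambda> Ct \<xi>0 \<sigma>1 \<sigma>2 :: real
  defines "R \<equiv> \<lambda>n. 8 * P n / \<gamma>" and "Q \<equiv> \<lambda>n. 20 * (8 * P n / \<gamma>) * \<Lambda> / \<gamma>"
  assumes gamma: "0 < \<gamma>" and Lam: "0 \<le> \<Lambda>" and Ct: "0 \<le> Ct"
    and x: "\<And>n. x n \<noteq> 0" "x \<longlonglongrightarrow> 0" and V: "V \<longlonglongrightarrow> S 1"
    and P: "\<And>n. 0 \<le> P n" "\<And>n. P n \<le> 3 * \<bar>x n\<bar>" and T2: "\<And>n. 0 \<le> T2 n" "\<And>n. T2 n \<le> Ct * (x n)\<^sup>2"
    and xi: "\<And>n. \<xi> n \<noteq> 0" "\<And>n. \<bar>\<xi> n\<bar> \<le> \<bar>x n\<bar> ^ 3" "\<And>n. \<bar>\<xi> n\<bar> \<le> \<xi>0"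
    and S0: "isCont S 0"
    and S1: "\<And>h. \<bar>h\<bar> \<le> \<xi>0 \<Longrightarrow> \<bar>S (1 + h) - S 1 - \<sigma>1 * h\<bar> \<le> \<Lambda> * h\<^sup>2"
    and S2: "((\<lambda>h. (S (1 + h) + S (1 - h) - 2 * S 1) / h\<^sup>2) \<longlongrightarrow> \<sigma>2) (at 0)"
    and S12: "S 2 \<noteq> S 1"
    and p2: "\<And>n. \<bar>(S 2 - V n) * p2 n + (x n)\<^sup>2\<bar> \<le> T2 n * \<bar>x n\<bar> + T2 n * P n"
    and b0: "\<And>n. \<bar>a n 0 0 - (V n - S (\<xi> n))\<bar> \<le> 2 * (P n * R n)"
    and b1: "\<And>n. \<bar>a n 0 1 + a n 0 (-1) + 4 * x n\<bar> \<le> 4 * (P n * R n)"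
    and b2: "\<And>n. \<bar>(a n 1 0 + a n (-1) 0) / 2 + 2 * x n\<bar> \<le> 2 * (P n * R n)"
    and b3: "\<And>n. \<bar>a n 0 1 - a n 0 (-1)\<bar> \<le> 4 * (P n * Q n) * \<bar>\<xi> n\<bar>"
    and b4: "\<And>n. \<bar>(a n 1 0 - a n (-1) 0) / 2\<bar> \<le> 2 * (P n * Q n) * \<bar>\<xi> n\<bar>"
    and b5: "\<And>n. \<bar>(a n 1 1 + a n 1 (-1) + a n (-1) 1 + a n (-1) (-1)) / 2 + 4 * p2 n\<bar>
        \<le> 2 * (8 * \<bar>x n\<bar> * (T2 n + P n * R n) / \<gamma> + 2 * (T2 n * R n)) + (4 * (P n * Q n) + \<Lambda>) * \<bar>\<xi> n\<bar>"
    and b6: "\<And>n. \<bar>(a n 1 1 - a n 1 (-1) - a n (-1) 1 + a n (-1) (-1)) / 2 + (S (1 + \<xi> n) + S (1 - \<xi> n) - 2 * S 1) / 2\<bar>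
        \<le> 30 * \<Lambda> * R n * (R n + Q n) * (\<xi> n)\<^sup>2"
    and b7: "\<And>n. \<bar>(a n 1 1 - a n 1 (-1) + a n (-1) 1 - a n (-1) (-1)) / 2 + (S (1 + \<xi> n) - S (1 - \<xi> n)) / 2\<bar>
        \<le> 4 * (P n * Q n) * \<bar>\<xi> n\<bar>"
    and b8: "\<And>n. \<bar>(a n 1 1 + a n 1 (-1) - a n (-1) 1 - a n (-1) (-1)) / 2 + (S (1 + \<xi> n) - S (1 - \<xi> n)) / 2\<bar>
        \<le> 4 * (P n * Q n) * \<bar>\<xi> n\<bar>"
  defines "u \<equiv> \<lambda>n. 1 / (1 - (\<xi> n)\<^sup>2)" and "\<theta> \<equiv> \<lambda>n. (\<xi> n)\<^sup>2 / (x n)\<^sup>2" and "\<nu>0 \<equiv> - \<sigma>1"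
  defines "\<alpha> \<equiv> \<lambda>n. a n 0 0 - \<nu>0"
    and "R1 \<equiv> \<lambda>n. (a n 0 1 + a n 0 (-1)) / x n" and "R3 \<equiv> \<lambda>n. (a n 0 1 - a n 0 (-1)) / (\<xi> n * x n)"
    and "R2 \<equiv> \<lambda>n. (a n 1 0 + a n (-1) 0) / 2 / x n" and "R4 \<equiv> \<lambda>n. (a n 1 0 - a n (-1) 0) / 2 / (\<xi> n * x n)"
    and "D \<equiv> \<lambda>n. (a n 1 1 + a n 1 (-1) + a n (-1) 1 + a n (-1) (-1)) / 2 / (x n)\<^sup>2 + \<theta> n * \<nu>0 * u n"
    and "r \<equiv> \<lambda>n. (a n 1 1 - a n 1 (-1) - a n (-1) 1 + a n (-1) (-1)) / 2 / (\<xi> n)\<^sup>2 + \<nu>0 * u n"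
    and "e1 \<equiv> \<lambda>n. ((a n 1 1 - a n 1 (-1) + a n (-1) 1 - a n (-1) (-1)) / 2 / \<xi> n - \<nu>0 * u n) / x n"
    and "e2 \<equiv> \<lambda>n. ((a n 1 1 + a n 1 (-1) - a n (-1) 1 - a n (-1) (-1)) / 2 / \<xi> n - \<nu>0 * u n) / x n"
  defines "q \<equiv> \<lambda>k n. cq (\<alpha> n) (x n) (u n) (\<theta> n) (D n) (r n) (e1 n) (e2 n) (R1 n) (R2 n) (R3 n) (R4 n) k"
  shows "q 0 \<longlonglongrightarrow> (S 1 - S 0 + \<sigma>1) * ((- 4 / (S 1 - S 2)) * (- \<sigma>2 / 2 - \<sigma>1)) - 8 * (- \<sigma>2 / 2 - \<sigma>1)"
    and "q 1 \<longlonglongrightarrow> 0" and "q 2 \<longlonglongrightarrow> - (S 1 - S 0 + \<sigma>1)" and "q 3 \<longlonglongrightarrow> 0"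
    and "q 3 = (\<lambda>n. x n * u n)"
proof -
  have ax: "(\<lambda>n. \<bar>x n\<bar>) \<longlonglongrightarrow> 0" using x(2) by (rule tendsto_rabs_zero)
  have P0: "P \<longlonglongrightarrow> 0"
    by (rule tendsto_abs_le[where g="\<lambda>n. 3 * \<bar>x n\<bar>"]) (use P in \<open>auto intro!: tendsto_mult_right_zero ax\<close>)
  have R0: "R \<longlonglongrightarrow> 0" unfolding R_def using tendsto_divide[OF tendsto_mult_right_zero[OF P0, of 8] tendsto_const[of \<gamma>]] gamma by simp
  have Q_eq: "Q = (\<lambda>n. 20 * \<Lambda> / \<gamma> * R n)" by (simp add: Q_def R_def fun_eq_iff)
  have Q0: "Q \<longlonglongrightarrow> 0" unfolding Q_eq by (rule tendsto_mult_right_zero[OF R0])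
  have Rn: "0 \<le> R n" and Qn: "0 \<le> Q n" for n using P(1)[of n] gamma Lam by (simp_all add: R_def Q_def)
  have T0: "T2 \<longlonglongrightarrow> 0"
  proof (rule tendsto_abs_le[where g="\<lambda>n. Ct * (x n)\<^sup>2"])
    show "(\<lambda>n. Ct * (x n)\<^sup>2) \<longlonglongrightarrow> 0" using tendsto_mult[OF tendsto_const tendsto_power[OF x(2), of 2], of Ct] by simp
  qed (use T2 in auto)
  have ax_pos: "0 < \<bar>x n\<bar>" for n using x(1)[of n] by simp
  have xx: "(x n)\<^sup>2 = \<bar>x n\<bar> * \<bar>x n\<bar>" for n by (simp add: power2_eq_square)
  have axi: "(\<lambda>n. \<bar>\<xi> n\<bar>) \<longlonglongrightarrow> 0"
    by (rule tendsto_abs_le[where g="\<lambda>n. \<bar>x n\<bar> ^ 3"]) (use xi(2) tendsto_power[OF ax, of 3] in simp_all)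
  have xi0: "\<xi> \<longlonglongrightarrow> 0" using axi by (simp add: tendsto_rabs_zero_iff)
  have PR: "P n * R n / \<bar>x n\<bar> \<le> 3 * R n" and PQ: "P n * Q n / \<bar>x n\<bar> \<le> 3 * Q n" for n
    using mult_right_mono[OF P(2)[of n] Rn[of n]] mult_right_mono[OF P(2)[of n] Qn[of n]] ax_pos[of n]
    by (simp_all add: divide_le_eq mult.commute mult.left_commute)
  have th: "\<theta> \<longlonglongrightarrow> 0" and xi_x2: "(\<lambda>n. \<bar>\<xi> n\<bar> / (x n)\<^sup>2) \<longlonglongrightarrow> 0" and xi_x: "(\<lambda>n. \<bar>\<xi> n\<bar> / \<bar>x n\<bar>) \<longlonglongrightarrow> 0"
  proof -
    have l2: "\<bar>\<xi> n\<bar> / (x n)\<^sup>2 \<le> \<bar>x n\<bar>" for n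
    proof -
      have "\<bar>\<xi> n\<bar> \<le> \<bar>x n\<bar> * (\<bar>x n\<bar> * \<bar>x n\<bar>)" using xi(2)[of n] by (simp only: power3_eq_cube mult.assoc)
      moreover have "0 < \<bar>x n\<bar> * \<bar>x n\<bar>" using ax_pos[of n] by (intro mult_pos_pos)
      ultimately show ?thesis unfolding xx by (simp only: pos_divide_le_eq)
    qed
    show A: "(\<lambda>n. \<bar>\<xi> n\<bar> / (x n)\<^sup>2) \<longlonglongrightarrow> 0"
      by (rule tendsto_abs_le[where g="\<lambda>n. \<bar>x n\<bar>"]) (use l2 ax in simp_all)
    have "(\<lambda>n. \<bar>x n\<bar> * (\<bar>\<xi> n\<bar> / (x n)\<^sup>2)) \<longlonglongrightarrow> 0 * 0" by (intro tendsto_mult ax A)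
    moreover have "\<bar>x n\<bar> * (\<bar>\<xi> n\<bar> / (x n)\<^sup>2) = \<bar>\<xi> n\<bar> / \<bar>x n\<bar>" for n
    proof -
      have "y * (z / (y * y)) = z / y" if "0 < y" for y z :: real using that by simp
      then show ?thesis unfolding xx using ax_pos[of n] by blast
    qed
    ultimately show B: "(\<lambda>n. \<bar>\<xi> n\<bar> / \<bar>x n\<bar>) \<longlonglongrightarrow> 0" by simp
    have "(\<lambda>n. (\<bar>\<xi> n\<bar> / \<bar>x n\<bar>)\<^sup>2) \<longlonglongrightarrow> 0\<^sup>2" by (intro tendsto_power B)
    then show "\<theta> \<longlonglongrightarrow> 0" by (simp add: \<theta>_def power_divide)
  qed
  have u1: "u \<longlonglongrightarrow> 1"
  proof -
    have "(\<lambda>n. 1 / (1 - (\<xi> n)\<^sup>2)) \<longlonglongrightarrow> 1 / (1 - 0\<^sup>2)" by (intro tendsto_intros xi0) simp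
    then show ?thesis by (simp add: u_def)
  qed
  have al: "\<alpha> \<longlonglongrightarrow> S 1 - S 0 + \<sigma>1"
  proof -
    have "(\<lambda>n. a n 0 0 - (V n - S (\<xi> n))) \<longlonglongrightarrow> 0"
      by (rule tendsto_abs_le[where g="\<lambda>n. 2 * (P n * R n)"]) (use b0 tendsto_mult_right_zero[OF tendsto_mult_zero[OF P0 R0], of 2] in simp_all)
    moreover have "(\<lambda>n. S (\<xi> n)) \<longlonglongrightarrow> S 0" by (rule isCont_tendsto_compose[OF S0 xi0])
    ultimately have "(\<lambda>n. (a n 0 0 - (V n - S (\<xi> n))) + (V n - S (\<xi> n)) + \<sigma>1) \<longlonglongrightarrow> 0 + (S 1 - S 0) + \<sigma>1"
      by (intro tendsto_intros V)
    then show ?thesis by (simp add: \<alpha>_def \<nu>0_def)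
  qed
  have quot: "\<bar>y / w - l\<bar> \<le> B / \<bar>w\<bar>" if "\<bar>y - l * w\<bar> \<le> B" "w \<noteq> 0" for y w l B :: real
  proof -
    have "y / w - l = (y - l * w) / w" using that(2) by (simp add: diff_divide_distrib)
    then show ?thesis using that by (simp add: abs_divide divide_right_mono)
  qed
  have R1: "R1 \<longlonglongrightarrow> - 4"
  proof (rule tendsto_abs_le[where g="\<lambda>n. 12 * R n"])
    show "\<bar>R1 n - - 4\<bar> \<le> 12 * R n" for n
      using quot[of "a n 0 1 + a n 0 (-1)" "-4" "x n", OF _ x(1)] b1[of n] PR[of n] by (fastforce simp: R1_def)
  qed (rule tendsto_mult_right_zero[OF R0])
  have R2: "R2 \<longlonglongrightarrow> - 2"
  proof (rule tendsto_abs_le[where g="\<lambda>n. 6 * R n"])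
    show "\<bar>R2 n - - 2\<bar> \<le> 6 * R n" for n
      using quot[of "(a n 1 0 + a n (-1) 0) / 2" "-2" "x n", OF _ x(1)] b2[of n] PR[of n] by (fastforce simp: R2_def)
  qed (rule tendsto_mult_right_zero[OF R0])
  have small: "\<bar>y / (\<xi> n * x n)\<bar> \<le> c * 3 * Q n" if "\<bar>y\<bar> \<le> c * (P n * Q n) * \<bar>\<xi> n\<bar>" "0 \<le> c" for y c n
  proof -
    have "\<bar>y / (\<xi> n * x n)\<bar> \<le> (c * (P n * Q n) * \<bar>\<xi> n\<bar>) / (\<bar>\<xi> n\<bar> * \<bar>x n\<bar>)"
      unfolding abs_divide abs_mult by (rule divide_right_mono[OF that(1)]) simp
    also have "\<dots> = c * (P n * Q n / \<bar>x n\<bar>)" using xi(1)[of n] by simp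
    also have "\<dots> \<le> c * (3 * Q n)" by (rule mult_left_mono[OF PQ that(2)])
    finally show ?thesis by simp
  qed
  have R3: "R3 \<longlonglongrightarrow> 0"
    by (rule tendsto_abs_le[where g="\<lambda>n. 4 * 3 * Q n"]) (use small[OF b3] tendsto_mult_right_zero[OF Q0] in \<open>simp_all add: R3_def\<close>)
  have R4: "R4 \<longlonglongrightarrow> 0"
    by (rule tendsto_abs_le[where g="\<lambda>n. 2 * 3 * Q n"]) (use small[OF b4] tendsto_mult_right_zero[OF Q0] in \<open>simp_all add: R4_def\<close>)
  have T2x: "T2 n / (x n)\<^sup>2 \<le> Ct" "0 \<le> T2 n / (x n)\<^sup>2" for n using T2[of n] x(1)[of n] by (simp_all add: divide_le_eq)
  have p2x: "(\<lambda>n. p2 n / (x n)\<^sup>2) \<longlonglongrightarrow> 1 / (S 1 - S 2)"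
  proof -
    have "(\<lambda>n. ((S 2 - V n) * p2 n) / (x n)\<^sup>2) \<longlonglongrightarrow> - 1"
    proof (rule tendsto_abs_le[where g="\<lambda>n. Ct * (\<bar>x n\<bar> + P n)"])
      show "(\<lambda>n. Ct * (\<bar>x n\<bar> + P n)) \<longlonglongrightarrow> 0" by (intro tendsto_mult_right_zero tendsto_add_zero ax P0)
      fix n
      have "\<bar>((S 2 - V n) * p2 n) / (x n)\<^sup>2 - - 1\<bar> \<le> (T2 n * \<bar>x n\<bar> + T2 n * P n) / \<bar>(x n)\<^sup>2\<bar>"
        by (rule quot) (use p2[of n] x(1)[of n] in auto)
      also have "\<dots> = T2 n / (x n)\<^sup>2 * (\<bar>x n\<bar> + P n)" by (simp add: algebra_simps add_divide_distrib)
      also have "\<dots> \<le> Ct * (\<bar>x n\<bar> + P n)" using T2x[of n] P(1)[of n] by (intro mult_right_mono) auto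
      finally show "\<bar>((S 2 - V n) * p2 n) / (x n)\<^sup>2 - - 1\<bar> \<le> Ct * (\<bar>x n\<bar> + P n)" .
    qed
    then have lim: "(\<lambda>n. ((S 2 - V n) * p2 n) / (x n)\<^sup>2 / (S 2 - V n)) \<longlonglongrightarrow> - 1 / (S 2 - S 1)"
      using S12 by (intro tendsto_divide tendsto_diff tendsto_const V) auto
    have "(\<lambda>n. S 2 - V n) \<longlonglongrightarrow> S 2 - S 1" by (intro tendsto_intros V)
    then have "\<forall>\<^sub>F n in sequentially. S 2 - V n \<noteq> 0" using S12 by (intro tendsto_imp_eventually_ne) auto
    then have "\<forall>\<^sub>F n in sequentially. ((S 2 - V n) * p2 n) / (x n)\<^sup>2 / (S 2 - V n) = p2 n / (x n)\<^sup>2"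
      by eventually_elim simp
    then have "(\<lambda>n. p2 n / (x n)\<^sup>2) \<longlonglongrightarrow> - 1 / (S 2 - S 1)" using lim by (rule tendsto_cong[THEN iffD1])
    moreover have "- 1 / (S 2 - S 1) = 1 / (S 1 - S 2)" using S12 by (simp add: divide_simps)
    ultimately show ?thesis by simp
  qed
  have D: "D \<longlonglongrightarrow> - 4 / (S 1 - S 2)"
  proof -
    let ?y = "\<lambda>n. (a n 1 1 + a n 1 (-1) + a n (-1) 1 + a n (-1) (-1)) / 2"
    let ?g = "\<lambda>n. 2 * (8 * (Ct * \<bar>x n\<bar> + 3 * R n) / \<gamma> + 2 * (Ct * R n)) + (4 * (P n * Q n) + \<Lambda>) * (\<bar>\<xi> n\<bar> / (x n)\<^sup>2)"
    have "(\<lambda>n. (?y n + 4 * p2 n) / (x n)\<^sup>2) \<longlonglongrightarrow> 0"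
    proof (rule tendsto_abs_le)
      show "?g \<longlonglongrightarrow> 0"
      proof -
        have "?g \<longlonglongrightarrow> 2 * (8 * (Ct * 0 + 3 * 0) / \<gamma> + 2 * (Ct * 0)) + (4 * (0 * 0) + \<Lambda>) * 0"
          by (intro tendsto_intros ax R0 P0 Q0 xi_x2) (use gamma in auto)
        then show ?thesis by simp
      qed
      fix n
      have x2: "0 < (x n)\<^sup>2" using x(1)[of n] by simp
      have a1: "\<bar>x n\<bar> * (T2 n + P n * R n) / (x n)\<^sup>2 \<le> Ct * \<bar>x n\<bar> + 3 * R n"
      proof -
        have "\<bar>x n\<bar> * (T2 n + P n * R n) / (x n)\<^sup>2 = T2 n / (x n)\<^sup>2 * \<bar>x n\<bar> + P n * R n / \<bar>x n\<bar>"
          unfolding xx using ax_pos[of n] by (simp add: field_simps)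
        then show ?thesis using mult_right_mono[OF T2x(1)[of n] abs_ge_zero[of "x n"]] PR[of n] by linarith
      qed
      have a2: "T2 n * R n / (x n)\<^sup>2 \<le> Ct * R n" using mult_right_mono[OF T2x(1)[of n] Rn[of n]] by simp
      have "\<bar>(?y n + 4 * p2 n) / (x n)\<^sup>2 - 0\<bar> \<le> (2 * (8 * \<bar>x n\<bar> * (T2 n + P n * R n) / \<gamma> + 2 * (T2 n * R n)) + (4 * (P n * Q n) + \<Lambda>) * \<bar>\<xi> n\<bar>) / (x n)\<^sup>2"
        using divide_right_mono[OF b5[of n], of "(x n)\<^sup>2"] x2 by (simp add: abs_divide)
      also have "\<dots> = 2 * (8 * (\<bar>x n\<bar> * (T2 n + P n * R n) / (x n)\<^sup>2) / \<gamma> + 2 * (T2 n * R n / (x n)\<^sup>2)) + (4 * (P n * Q n) + \<Lambda>) * (\<bar>\<xi> n\<bar> / (x n)\<^sup>2)"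
        by (simp add: add_divide_distrib algebra_simps)
      also have "\<dots> \<le> ?g n"
        using a1 a2 gamma P(1)[of n] Qn[of n] Lam by (intro add_mono mult_left_mono divide_right_mono) auto
      finally show "\<bar>(?y n + 4 * p2 n) / (x n)\<^sup>2 - 0\<bar> \<le> ?g n" .
    qed
    then have "(\<lambda>n. (?y n + 4 * p2 n) / (x n)\<^sup>2 - 4 * (p2 n / (x n)\<^sup>2) + \<theta> n * \<nu>0 * u n) \<longlonglongrightarrow> 0 - 4 * (1 / (S 1 - S 2)) + 0 * \<nu>0 * 1"
      by (intro tendsto_intros p2x th u1)
    then show ?thesis by (simp add: D_def add_divide_distrib)
  qed
  have r: "r \<longlonglongrightarrow> - \<sigma>2 / 2 - \<sigma>1"
  proof -
    let ?y = "\<lambda>n. (a n 1 1 - a n 1 (-1) - a n (-1) 1 + a n (-1) (-1)) / 2" and ?s = "\<lambda>h. S (1 + h) + S (1 - h) - 2 * S 1"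
    have "(\<lambda>n. (?y n + ?s (\<xi> n) / 2) / (\<xi> n)\<^sup>2) \<longlonglongrightarrow> 0"
    proof (rule tendsto_abs_le)
      show "(\<lambda>n. 30 * \<Lambda> * R n * (R n + Q n)) \<longlonglongrightarrow> 0"
        by (intro tendsto_mult_zero tendsto_mult_right_zero R0 tendsto_add_zero Q0)
      show "\<bar>(?y n + ?s (\<xi> n) / 2) / (\<xi> n)\<^sup>2 - 0\<bar> \<le> 30 * \<Lambda> * R n * (R n + Q n)" for n
        using b6[of n] xi(1)[of n] by (simp add: abs_divide divide_le_eq)
    qed
    moreover have "(\<lambda>n. ?s (\<xi> n) / (\<xi> n)\<^sup>2) \<longlonglongrightarrow> \<sigma>2"
      by (rule tendsto_compose_filtermap[THEN iffD2, unfolded comp_def] filterlim_compose[OF S2]) (use xi0 xi(1) in \<open>auto simp: filterlim_at\<close>)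
    ultimately have "(\<lambda>n. (?y n + ?s (\<xi> n) / 2) / (\<xi> n)\<^sup>2 - ?s (\<xi> n) / (\<xi> n)\<^sup>2 / 2 + \<nu>0 * u n) \<longlonglongrightarrow> 0 - \<sigma>2 / 2 + \<nu>0 * 1"
      by (intro tendsto_intros u1) auto
    then show ?thesis by (simp add: r_def \<nu>0_def add_divide_distrib)
  qed
  have e: "(\<lambda>n. (y n / \<xi> n - \<nu>0 * u n) / x n) \<longlonglongrightarrow> 0"
    if y: "\<And>n. \<bar>y n + (S (1 + \<xi> n) - S (1 - \<xi> n)) / 2\<bar> \<le> 4 * (P n * Q n) * \<bar>\<xi> n\<bar>" for y
  proof -
    have 1: "(\<lambda>n. (y n + (S (1 + \<xi> n) - S (1 - \<xi> n)) / 2) / (\<xi> n * x n)) \<longlonglongrightarrow> 0"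
      by (rule tendsto_abs_le[where g="\<lambda>n. 4 * 3 * Q n"]) (use small[OF y] tendsto_mult_right_zero[OF Q0] in simp_all)
    have 2: "(\<lambda>n. ((S (1 + \<xi> n) - S (1 - \<xi> n)) / 2 - \<sigma>1 * \<xi> n) / (\<xi> n * x n)) \<longlonglongrightarrow> 0"
    proof (rule tendsto_abs_le)
      show "(\<lambda>n. \<Lambda> * (\<bar>\<xi> n\<bar> / \<bar>x n\<bar>)) \<longlonglongrightarrow> 0" by (rule tendsto_mult_right_zero[OF xi_x])
      fix n
      have "\<bar>(S (1 + \<xi> n) - S (1 - \<xi> n)) / 2 - \<sigma>1 * \<xi> n\<bar> \<le> \<Lambda> * (\<xi> n)\<^sup>2"
      proof -
        have "\<bar>(A - B) / 2 - c\<bar> \<le> L" if "\<bar>A - s - c\<bar> \<le> L" "\<bar>B - s + c\<bar> \<le> L" for A B s c L :: real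
          using that by (simp only: diff_divide_distrib)
        then show ?thesis using S1[of "\<xi> n"] S1[of "- \<xi> n"] xi(3)[of n] by simp
      qed
      also have "\<dots> = (\<Lambda> * (\<bar>\<xi> n\<bar> / \<bar>x n\<bar>)) * \<bar>\<xi> n * x n\<bar>"
        using x(1)[of n] by (simp add: abs_mult power2_eq_square)
      finally show "\<bar>((S (1 + \<xi> n) - S (1 - \<xi> n)) / 2 - \<sigma>1 * \<xi> n) / (\<xi> n * x n) - 0\<bar> \<le> \<Lambda> * (\<bar>\<xi> n\<bar> / \<bar>x n\<bar>)"
        using x(1)[of n] xi(1)[of n] by (simp add: abs_divide divide_le_eq)
    qed
    have 3: "(\<lambda>n. \<nu>0 * (1 - u n) / x n) \<longlonglongrightarrow> 0"
    proof -
      have "(\<lambda>n. - \<nu>0 * u n * ((\<bar>\<xi> n\<bar> / \<bar>x n\<bar>) * (\<bar>\<xi> n\<bar> * sgn (x n)))) \<longlonglongrightarrow> - \<nu>0 * 1 * (0 * 0)"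
      proof (intro tendsto_intros u1 xi_x)
        show "(\<lambda>n. \<bar>\<xi> n\<bar> * sgn (x n)) \<longlonglongrightarrow> 0"
          by (rule tendsto_abs_le[where g="\<lambda>n. \<bar>\<xi> n\<bar>"]) (use axi in \<open>auto simp: abs_mult sgn_if\<close>)
      qed
      moreover have "- \<nu>0 * u n * ((\<bar>\<xi> n\<bar> / \<bar>x n\<bar>) * (\<bar>\<xi> n\<bar> * sgn (x n))) = \<nu>0 * (1 - u n) / x n"
        if "(\<xi> n)\<^sup>2 \<noteq> 1" for n
      proof -
        have "1 - u n = - u n * (\<xi> n)\<^sup>2" using that by (simp add: u_def divide_simps)
        moreover have "(\<bar>\<xi> n\<bar> / \<bar>x n\<bar>) * (\<bar>\<xi> n\<bar> * sgn (x n)) = (\<xi> n)\<^sup>2 / x n"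
          using x(1)[of n] by (simp add: sgn_if power2_eq_square abs_mult_self_eq)
        ultimately show ?thesis by simp
      qed
      moreover have "\<forall>\<^sub>F n in sequentially. (\<xi> n)\<^sup>2 \<noteq> 1"
      proof -
        have "(\<lambda>n. (\<xi> n)\<^sup>2) \<longlonglongrightarrow> 0" using tendsto_power[OF xi0, of 2] by simp
        then show ?thesis by (rule tendsto_imp_eventually_ne) simp
      qed
      ultimately have lim: "(\<lambda>n. - \<nu>0 * u n * ((\<bar>\<xi> n\<bar> / \<bar>x n\<bar>) * (\<bar>\<xi> n\<bar> * sgn (x n)))) \<longlonglongrightarrow> 0"
        and ev: "\<forall>\<^sub>F n in sequentially. - \<nu>0 * u n * ((\<bar>\<xi> n\<bar> / \<bar>x n\<bar>) * (\<bar>\<xi> n\<bar> * sgn (x n))) = \<nu>0 * (1 - u n) / x n"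
        by (simp_all add: eventually_mono)
      show ?thesis by (rule tendsto_cong[OF ev, THEN iffD1, OF lim])
    qed
    have "(\<lambda>n. (y n + (S (1 + \<xi> n) - S (1 - \<xi> n)) / 2) / (\<xi> n * x n) - ((S (1 + \<xi> n) - S (1 - \<xi> n)) / 2 - \<sigma>1 * \<xi> n) / (\<xi> n * x n)
         + \<nu>0 * (1 - u n) / x n) \<longlonglongrightarrow> 0 - 0 + 0" by (intro tendsto_intros 1 2 3)
    moreover have "(y n + (S (1 + \<xi> n) - S (1 - \<xi> n)) / 2) / (\<xi> n * x n) - ((S (1 + \<xi> n) - S (1 - \<xi> n)) / 2 - \<sigma>1 * \<xi> n) / (\<xi> n * x n)
         + \<nu>0 * (1 - u n) / x n = (y n / \<xi> n - \<nu>0 * u n) / x n" for n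
    proof -
      have "(y + d) / (e * w) - (d - c * e) / (e * w) + - c * (1 - v) / w = (y / e - - c * v) / w"
        if "e \<noteq> 0" "w \<noteq> 0" for y d e w c v :: real
        using that by (simp add: field_simps)
      then show ?thesis unfolding \<nu>0_def using xi(1)[of n] x(1)[of n] by blast
    qed
    ultimately show ?thesis by simp
  qed
  have e1: "e1 \<longlonglongrightarrow> 0" unfolding e1_def by (rule e[OF b7])
  have e2: "e2 \<longlonglongrightarrow> 0" unfolding e2_def by (rule e[OF b8])
  note lims = al x(2) u1 th D r e1 e2 R1 R2 R3 R4
  note cq_tendsto[OF lims]
  then show "q 0 \<longlonglongrightarrow> (S 1 - S 0 + \<sigma>1) * ((- 4 / (S 1 - S 2)) * (- \<sigma>2 / 2 - \<sigma>1)) - 8 * (- \<sigma>2 / 2 - \<sigma>1)"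
    "q 1 \<longlonglongrightarrow> 0" "q 2 \<longlonglongrightarrow> - (S 1 - S 0 + \<sigma>1)" by (simp_all only: q_def)
  show q3: "q 3 = (\<lambda>n. x n * u n)"
  proof
    fix n
    have eq: "\<theta> n * (x n)\<^sup>2 = (\<xi> n)\<^sup>2" using x(1)[of n] by (simp add: \<theta>_def)
    \<comment> \<open>The alternative u = 0 is the default value of the division at \<xi>^2 = 1; the
      identity below holds in that case as well.\<close>
    have "u n - (\<xi> n)\<^sup>2 * u n = 1 \<or> u n = 0" by (auto simp: u_def diff_divide_distrib[symmetric])
    moreover have "(u n)\<^sup>2 - (\<xi> n)\<^sup>2 * (u n)\<^sup>2 = u n * (u n - (\<xi> n)\<^sup>2 * u n)" by (simp add: algebra_simps power2_eq_square)
    ultimately have "(u n)\<^sup>2 - (\<xi> n)\<^sup>2 * (u n)\<^sup>2 = u n" by auto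
    moreover have "q 3 n = x n * ((u n)\<^sup>2 - \<theta> n * (x n)\<^sup>2 * (u n)\<^sup>2)"
      unfolding q_def cq_def Let_def by (simp add: right_diff_distrib)
    ultimately show "q 3 n = x n * u n" by (simp only: eq)
  qed
  show "q 3 \<longlonglongrightarrow> 0" unfolding q3 using tendsto_mult[OF x(2) u1] by simp
qed

section \<open>Fourier coefficients of periodic functions\<close>

text \<open>One period as a finite measure space, so that the lemmas on Bochner integrals apply
  without indicator functions.\<close>

definition per :: "real measure" where
  "per = restrict_space lborel {-pi..pi}"

definition fseries :: "(int \<Rightarrow> complex) \<Rightarrow> real \<Rightarrow> complex" where
  "fseries v z = (\<Sum>\<^sub>\<infinity>n. v n * cis (of_int n * z))"

lemma integrable_per_iff: "integrable per f \<longleftrightarrow> set_integrable lborel {-pi..pi} (f :: real \<Rightarrow> 'a::{banach, second_countable_topology})"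
  unfolding per_def set_integrable_def by (rule integrable_restrict_space) simp

lemma integral_per: "integral\<^sup>L per f = (LINT z:{-pi..pi}|lborel. (f z :: 'a::{banach, second_countable_topology}))"
  unfolding per_def set_lebesgue_integral_def by (rule integral_restrict_space) simp

lemma space_per [simp]: "space per = {-pi..pi}"
  by (simp add: per_def space_restrict_space)

lemma measurable_per: "f \<in> borel_measurable borel \<Longrightarrow> f \<in> borel_measurable per"
  unfolding per_def by (rule measurable_restrict_space1) simp

lemma emeasure_per: "emeasure per {-pi..pi} = ennreal (2 * pi)"
  unfolding per_def by (subst emeasure_restrict_space) auto

interpretation per: finite_measure per
  by standard (use emeasure_per in \<open>simp add: ennreal_mult_top\<close>)

lemma measure_per: "measure per {-pi..pi} = 2 * pi"
  by (simp add: measure_def emeasure_per)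

lemma fourier_coeff_per: "fourier_coeff f n = (\<integral>z. f z * cis (- (of_int n * z)) \<partial>per) / of_real (2 * pi)"
  by (simp add: fourier_coeff_def integral_per)

lemma L2per_iff: "f \<in> L2per \<longleftrightarrow> f \<in> borel_measurable borel \<and> (\<forall>z. f (z + 2 * pi) = f z) \<and> integrable per (\<lambda>z. (cmod (f z))\<^sup>2)"
  by (simp add: L2per_def integrable_per_iff)

lemma L2per_norm_per: "L2per_norm f = sqrt (\<integral>z. (cmod (f z))\<^sup>2 \<partial>per)"
  by (simp add: L2per_norm_def integral_per)

lemma integrable_per_continuous: "continuous_on UNIV f \<Longrightarrow> integrable per (f :: real \<Rightarrow> 'a::{banach, second_countable_topology})"
  unfolding integrable_per_iff by (rule borel_integrable_atLeastAtMost') (erule continuous_on_subset, simp)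

lemma integrable_per_mult:
  fixes f g :: "real \<Rightarrow> complex"
  assumes f: "integrable per f" and g: "g \<in> borel_measurable per" and B: "\<And>z. cmod (g z) \<le> B"
  shows "integrable per (\<lambda>z. g z * f z)"
proof (rule Bochner_Integration.integrable_bound)
  show "integrable per (\<lambda>z. B * cmod (f z))" using f by simp
  show "(\<lambda>z. g z * f z) \<in> borel_measurable per" using f g by (intro borel_measurable_times) auto
  have "0 \<le> B" using B[of 0] by (rule order_trans[OF norm_ge_zero])
  then show "AE z in per. cmod (g z * f z) \<le> norm (B * cmod (f z))"
    using B by (auto simp: norm_mult intro!: mult_right_mono)
qed

lemma cis_measurable: "(\<lambda>z. cis (c * z)) \<in> borel_measurable per"
  by (intro measurable_per borel_measurable_continuous_onI) (intro continuous_intros)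

lemma integrable_per_cis: "integrable per f \<Longrightarrow> integrable per (\<lambda>z. f z * cis (- (of_int n * z)))"
  using integrable_per_mult[of f "\<lambda>z. cis (- of_int n * z)" 1] cis_measurable[of "- of_int n"] by (simp add: mult.commute)

lemma L2per_integrable:
  assumes "f \<in> L2per" shows "integrable per f"
proof (rule Bochner_Integration.integrable_bound)
  show "integrable per (\<lambda>z. 1 + (cmod (f z))\<^sup>2)" using assms by (auto simp: L2per_iff)
  show "f \<in> borel_measurable per" using assms by (auto simp: L2per_iff intro: measurable_per)
  show "AE z in per. cmod (f z) \<le> norm (1 + (cmod (f z))\<^sup>2)"
  proof (rule AE_I2)
    fix z
    have "0 \<le> (cmod (f z) - 1)\<^sup>2 + cmod (f z)" by simp
    moreover have "(cmod (f z) - 1)\<^sup>2 + cmod (f z) = 1 + (cmod (f z))\<^sup>2 - cmod (f z)" by (simp add: power2_eq_square algebra_simps)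
    ultimately show "cmod (f z) \<le> norm (1 + (cmod (f z))\<^sup>2)" by simp
  qed
qed

lemma fourier_coeff_add: "integrable per f \<Longrightarrow> integrable per g \<Longrightarrow> fourier_coeff (\<lambda>z. f z + g z) n = fourier_coeff f n + fourier_coeff g n"
  by (simp add: fourier_coeff_per integrable_per_cis distrib_right add_divide_distrib)

lemma fourier_coeff_diff: "integrable per f \<Longrightarrow> integrable per g \<Longrightarrow> fourier_coeff (\<lambda>z. f z - g z) n = fourier_coeff f n - fourier_coeff g n"
  by (simp add: fourier_coeff_per integrable_per_cis left_diff_distrib diff_divide_distrib)

lemma fourier_coeff_cmult: "fourier_coeff (\<lambda>z. c * f z) n = c * fourier_coeff f n"
  by (simp add: fourier_coeff_per mult.assoc)

lemma fourier_coeff_sum: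
  "finite F \<Longrightarrow> (\<And>j. j \<in> F \<Longrightarrow> integrable per (f j)) \<Longrightarrow> fourier_coeff (\<lambda>z. \<Sum>j\<in>F. f j z) n = (\<Sum>j\<in>F. fourier_coeff (f j) n)"
  by (simp add: fourier_coeff_per integrable_per_cis sum_distrib_right sum_divide_distrib)

lemma fourier_coeff_shift: "fourier_coeff (\<lambda>z. cis (of_int j * z) * f z) n = fourier_coeff f (n - j)"
  unfolding fourier_coeff_per
  by (rule arg_cong2[where f="(/)"], rule Bochner_Integration.integral_cong)
    (auto simp: cis_mult algebra_simps mult.left_commute[of "cis _" "f _"] simp flip: mult.assoc)

lemma fourier_coeff_cong_AE:
  "AE z in per. f z = g z \<Longrightarrow> f \<in> borel_measurable per \<Longrightarrow> g \<in> borel_measurable per \<Longrightarrow> fourier_coeff f n = fourier_coeff g n"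
  unfolding fourier_coeff_per using cis_measurable[of "- of_int n"]
  by (intro arg_cong2[where f="(/)"] integral_cong_AE borel_measurable_times) auto

lemma integral_cis:
  assumes "j \<noteq> 0" shows "(\<integral>z. cis (of_int j * z) \<partial>per) = 0"
proof -
  define F where "F z = cis (of_int j * z) / (\<i> * of_int j)" for z :: real
  have "(F has_vector_derivative cis (of_int j * z)) (at z within S)" for z S
  proof -
    have "((\<lambda>w. exp (\<i> * of_int j * w) / (\<i> * of_int j)) has_field_derivative exp (\<i> * of_int j * of_real z)) (at (of_real z))"
      using assms by (auto intro!: derivative_eq_intros)
    from has_vector_derivative_real_field[OF this, of S] show ?thesis
      by (simp add: F_def[abs_def] cis_conv_exp mult.assoc)
  qed
  then have "(\<integral>z. indicator {-pi..pi} z *\<^sub>R cis (of_int j * z) \<partial>lborel) = F pi - F (- pi)"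
    by (intro integral_FTC_Icc continuous_intros) auto
  moreover have "F pi = F (- pi)"
  proof -
    have "cis (of_int j * pi) = cis (of_int j * (- pi)) * cis (2 * pi * of_int j)" by (simp add: cis_mult algebra_simps)
    then show ?thesis by (simp add: F_def cis_multiple_2pi)
  qed
  ultimately show ?thesis by (simp add: integral_per set_lebesgue_integral_def)
qed

lemma fourier_coeff_one: "fourier_coeff (\<lambda>z. 1) n = (if n = 0 then 1 else 0)"
proof (cases "n = 0")
  case False
  then show ?thesis using integral_cis[of "- n"] by (simp add: fourier_coeff_per)
qed (simp add: fourier_coeff_per measure_per scaleR_conv_of_real)

lemma fourier_coeff_cis: "fourier_coeff (\<lambda>z. cis (of_int j * z)) n = (if n = j then 1 else 0)"
  using fourier_coeff_shift[of j "\<lambda>_. 1" n] by (simp add: fourier_coeff_one)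

lemma integral_per_bound:
  fixes f g :: "real \<Rightarrow> complex"
  assumes f: "integrable per f" and g: "g \<in> borel_measurable per" and B: "\<And>z. cmod (g z) \<le> B"
  shows "cmod (\<integral>z. g z * f z \<partial>per) \<le> B * (\<integral>z. cmod (f z) \<partial>per)"
proof -
  have "cmod (\<integral>z. g z * f z \<partial>per) \<le> (\<integral>z. cmod (g z * f z) \<partial>per)" by (rule integral_norm_bound)
  also have "\<dots> \<le> (\<integral>z. B * cmod (f z) \<partial>per)"
    by (intro integral_mono integrable_norm integrable_per_mult[OF f g B]) (use f B in \<open>auto simp: norm_mult intro!: mult_right_mono\<close>)
  finally show ?thesis by simp
qed

lemma fourier_coeff_mult_bound:
  fixes f g :: "real \<Rightarrow> complex"
  assumes f: "integrable per f" and g: "g \<in> borel_measurable per" and B: "\<And>z. cmod (g z) \<le> B"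
  shows "cmod (fourier_coeff (\<lambda>z. g z * f z) n) \<le> B * (\<integral>z. cmod (f z) \<partial>per) / (2 * pi)"
proof -
  have "cmod (\<integral>z. g z * (f z * cis (- (of_int n * z))) \<partial>per) \<le> B * (\<integral>z. cmod (f z * cis (- (of_int n * z))) \<partial>per)"
    by (rule integral_per_bound[OF integrable_per_cis[OF f] g B])
  then show ?thesis
    by (simp add: fourier_coeff_per norm_divide norm_mult mult.assoc divide_right_mono)
qed

lemma fourier_coeff_bound:
  "integrable per f \<Longrightarrow> cmod (fourier_coeff f n) \<le> (\<integral>z. cmod (f z) \<partial>per) / (2 * pi)"
  using fourier_coeff_mult_bound[of f "\<lambda>_. 1" 1 n] by simp

lemma fseries_uniform:
  assumes "l1_le v M"
  shows "uniform_limit UNIV (\<lambda>F z. \<Sum>n\<in>F. v n * cis (of_int n * z)) (fseries v) (finite_subsets_at_top UNIV)"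
  unfolding fseries_def[abs_def]
  by (rule Weierstrass_m_test_general[where M="\<lambda>n. cmod (v n)"]) (auto simp: norm_mult l1_le_summable[OF assms])

lemma fseries_continuous:
  assumes "l1_le v M" shows "continuous_on UNIV (fseries v)"
  by (rule uniform_limit_theorem[OF _ fseries_uniform[OF assms]]) (auto intro!: always_eventually continuous_intros)

lemma fseries_norm:
  assumes "l1_le v M" shows "cmod (fseries v z) \<le> M"
  unfolding fseries_def by (rule l1_le_norm_infsum(1), rule l1_le_compare[OF assms]) (simp add: norm_mult)

lemma fseries_periodic: "fseries v (z + 2 * pi) = fseries v z"
proof -
  have "cis (of_int n * (z + 2 * pi)) = cis (of_int n * z)" for n
    by (simp add: distrib_left cis_multiple_2pi mult.commute[of _ "2 * pi"] flip: cis_mult)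
  then show ?thesis by (simp add: fseries_def)
qed

lemma fseries_measurable: "l1_le v M \<Longrightarrow> fseries v \<in> borel_measurable borel"
  by (intro borel_measurable_continuous_onI fseries_continuous)

lemma continuous_L2per:
  assumes "continuous_on UNIV f" "\<And>z. f (z + 2 * pi) = f z" shows "f \<in> L2per"
  unfolding L2per_iff using assms
  by (auto intro!: borel_measurable_continuous_onI integrable_per_continuous continuous_intros)

lemma fseries_L2per: "l1_le v M \<Longrightarrow> fseries v \<in> L2per"
  by (intro continuous_L2per fseries_continuous fseries_periodic)

text \<open>The partial sums converge uniformly, so multiplication by an integrable function
  followed by taking a coefficient commutes with the limit; for finite sums the claim is the shift
  rule.\<close>

lemma fourier_coeff_fseries_mult:
  assumes v: "l1_le v M" and f: "integrable per f"
  shows "((\<lambda>j. v j * fourier_coeff f (n - j)) has_sum fourier_coeff (\<lambda>z. fseries v z * f z) n) UNIV"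
  unfolding has_sum_def
proof (rule tendstoI)
  fix e :: real assume e: "0 < e"
  define C where "C = (\<integral>z. cmod (f z) \<partial>per) / (2 * pi)"
  have C: "0 \<le> C" unfolding C_def by (intro divide_nonneg_nonneg integral_nonneg) auto
  define \<epsilon> where "\<epsilon> = e / (C + 1)"
  have eps: "0 < \<epsilon>" "\<epsilon> * C < e" using e C by (auto simp: \<epsilon>_def divide_less_eq intro!: mult_strict_left_mono)
  have fin: "\<forall>\<^sub>F F :: int set in finite_subsets_at_top UNIV. finite F"
    by (auto simp: eventually_finite_subsets_at_top)
  show "\<forall>\<^sub>F F in finite_subsets_at_top UNIV. dist (\<Sum>j\<in>F. v j * fourier_coeff f (n - j)) (fourier_coeff (\<lambda>z. fseries v z * f z) n) < e"
    using uniform_limitD[OF fseries_uniform[OF v] eps(1)] fin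
  proof eventually_elim
    case (elim F)
    define G where "G z = (\<Sum>j\<in>F. v j * cis (of_int j * z))" for z
    have Gm: "G \<in> borel_measurable per" unfolding G_def[abs_def]
      by (intro measurable_per borel_measurable_continuous_onI) (intro continuous_intros)
    have fm: "fseries v \<in> borel_measurable per" by (intro measurable_per fseries_measurable[OF v])
    have GB: "cmod (G z) \<le> (\<Sum>j\<in>F. cmod (v j))" for z unfolding G_def by (rule order_trans[OF norm_sum]) (simp add: norm_mult)
    have i1: "integrable per (\<lambda>z. G z * f z)" by (rule integrable_per_mult[OF f Gm GB])
    have i2: "integrable per (\<lambda>z. fseries v z * f z)" by (rule integrable_per_mult[OF f fm fseries_norm[OF v]])
    have "fourier_coeff (\<lambda>z. G z * f z) n = (\<Sum>j\<in>F. fourier_coeff (\<lambda>z. v j * (cis (of_int j * z) * f z)) n)"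
      unfolding G_def sum_distrib_right mult.assoc using elim(2)
      by (intro fourier_coeff_sum integrable_mult_right integrable_per_mult[OF f cis_measurable, of _ 1]) auto
    then have "fourier_coeff (\<lambda>z. G z * f z) n = (\<Sum>j\<in>F. v j * fourier_coeff f (n - j))"
      by (simp add: fourier_coeff_cmult fourier_coeff_shift)
    then have "dist (\<Sum>j\<in>F. v j * fourier_coeff f (n - j)) (fourier_coeff (\<lambda>z. fseries v z * f z) n)
        = cmod (fourier_coeff (\<lambda>z. (G z - fseries v z) * f z) n)"
      by (simp add: dist_norm fourier_coeff_diff[OF i1 i2] left_diff_distrib)
    also have "\<dots> \<le> \<epsilon> * (\<integral>z. cmod (f z) \<partial>per) / (2 * pi)"
      by (rule fourier_coeff_mult_bound[OF f borel_measurable_diff[OF Gm fm]]) (use elim(1) in \<open>auto simp: dist_norm G_def less_imp_le\<close>)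
    finally show ?case using eps(2) by (simp add: C_def)
  qed
qed

lemma fourier_coeff_fseries:
  assumes "l1_le v M" shows "fourier_coeff (fseries v) n = v n"
proof -
  have "((\<lambda>j. v j * fourier_coeff (\<lambda>_. 1) (n - j)) has_sum fourier_coeff (fseries v) n) UNIV"
    using fourier_coeff_fseries_mult[OF assms, of "\<lambda>_. 1" n] by simp
  moreover have "((\<lambda>j. v j * fourier_coeff (\<lambda>_. 1) (n - j)) has_sum v n) UNIV"
    by (rule has_sum_finite_neutralI[of "{n}"]) (auto simp: fourier_coeff_one)
  ultimately show ?thesis by (rule has_sum_unique)
qed

lemma l1_le_int_of_nat:
  fixes f :: "nat \<Rightarrow> real"
  assumes f: "summable f" "\<And>n. 0 \<le> f n"
  shows "l1_le (\<lambda>n::int. f (nat \<bar>n\<bar>)) (2 * suminf f)"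
proof (rule l1_leI)
  fix F :: "int set" assume F: "finite F"
  have part: "(\<Sum>n\<in>A. f (nat \<bar>n\<bar>)) \<le> suminf f" if "finite A" "inj_on (\<lambda>n. nat \<bar>n\<bar>) A" for A
  proof -
    have "(\<Sum>n\<in>A. f (nat \<bar>n\<bar>)) = (\<Sum>k\<in>(\<lambda>n. nat \<bar>n\<bar>) ` A. f k)" by (subst sum.reindex[OF that(2)]) simp
    also have "\<dots> \<le> suminf f" using that f by (intro sum_le_suminf) auto
    finally show ?thesis .
  qed
  have "(\<Sum>n\<in>F. norm (f (nat \<bar>n\<bar>))) = (\<Sum>n\<in>{n\<in>F. 0 \<le> n}. f (nat \<bar>n\<bar>)) + (\<Sum>n\<in>{n\<in>F. n < 0}. f (nat \<bar>n\<bar>))"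
    using F f by (subst sum.union_disjoint[symmetric]) (auto intro!: sum.cong)
  also have "\<dots> \<le> suminf f + suminf f" using F by (intro add_mono part) (auto simp: inj_on_def)
  finally show "(\<Sum>n\<in>F. norm (f (nat \<bar>n\<bar>))) \<le> 2 * suminf f" by simp
qed

lemma l1_le_inverse_square: "\<exists>B. l1_le (\<lambda>n::int. 1 / (real_of_int n)\<^sup>2) B"
proof -
  have "summable (\<lambda>n. 1 / (real n)\<^sup>2)"
    using inverse_power_summable[of 2, where 'a=real] by (simp add: inverse_eq_divide)
  from l1_le_int_of_nat[OF this] show ?thesis by auto
qed

lemma integral_mult_trig_polynomial:
  assumes f: "integrable per f" and F: "finite F"
  shows "(\<integral>z. f z * cnj (\<Sum>n\<in>F. c n * cis (of_int n * z)) \<partial>per) = of_real (2 * pi) * (\<Sum>n\<in>F. cnj (c n) * fourier_coeff f n)"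
proof -
  have "(\<integral>z. f z * cnj (\<Sum>n\<in>F. c n * cis (of_int n * z)) \<partial>per) = (\<integral>z. (\<Sum>n\<in>F. cnj (c n) * (f z * cis (- (of_int n * z)))) \<partial>per)"
    by (simp add: sum_distrib_left cis_cnj mult.left_commute)
  also have "\<dots> = (\<Sum>n\<in>F. cnj (c n) * (\<integral>z. f z * cis (- (of_int n * z)) \<partial>per))"
    by (subst Bochner_Integration.integral_sum) (auto intro: integrable_per_cis[OF f])
  finally show ?thesis by (simp add: fourier_coeff_per sum_distrib_left)
qed

lemma bessel:
  assumes f: "f \<in> L2per" and F: "finite F"
  shows "2 * pi * (\<Sum>n\<in>F. (cmod (fourier_coeff f n))\<^sup>2) \<le> (L2per_norm f)\<^sup>2"
proof -
  define c where "c = fourier_coeff f"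
  define G where "G z = (\<Sum>n\<in>F. c n * cis (of_int n * z))" for z
  define s where "s = 2 * pi * (\<Sum>n\<in>F. (cmod (c n))\<^sup>2)"
  have Gc: "continuous_on UNIV G" unfolding G_def by (intro continuous_intros)
  have Gi: "integrable per G" by (rule integrable_per_continuous[OF Gc])
  have fi: "integrable per f" by (rule L2per_integrable[OF f])
  have GB: "cmod (G z) \<le> (\<Sum>j\<in>F. cmod (c j))" for z unfolding G_def by (rule order_trans[OF norm_sum]) (simp add: norm_mult)
  have Gm: "(\<lambda>z. cnj (G z)) \<in> borel_measurable per"
    by (intro measurable_per borel_measurable_continuous_onI continuous_intros Gc)
  have cG: "fourier_coeff G n = c n" if "n \<in> F" for n
  proof -
    have "fourier_coeff G n = (\<Sum>j\<in>F. c j * (if n = j then 1 else 0))" unfolding G_def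
      by (subst fourier_coeff_sum[OF F]) (auto intro!: integrable_per_continuous continuous_intros simp: fourier_coeff_cmult fourier_coeff_cis)
    then show ?thesis using that F by (simp add: if_distrib[of "(*) _"] cong: if_cong)
  qed
  have cc: "of_real (2 * pi) * (\<Sum>n\<in>F. cnj (c n) * c n) = of_real s"
  proof -
    have "cnj (c n) * c n = of_real ((cmod (c n))\<^sup>2)" for n by (metis complex_norm_square mult.commute)
    then show ?thesis by (simp add: s_def)
  qed
  have "(\<Sum>n\<in>F. cnj (c n) * fourier_coeff G n) = (\<Sum>n\<in>F. cnj (c n) * c n)" by (rule sum.cong) (auto simp: cG)
  then have I2: "(\<integral>z. G z * cnj (G z) \<partial>per) = of_real s"
    using integral_mult_trig_polynomial[OF Gi F, of c] cc by (simp add: G_def[symmetric])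
  have I1: "(\<integral>z. f z * cnj (G z) \<partial>per) = of_real s"
    using integral_mult_trig_polynomial[OF fi F, of c] cc by (simp add: G_def[symmetric] c_def[symmetric])
  have i1: "integrable per (\<lambda>z. f z * cnj (G z))"
    using integrable_per_mult[OF fi Gm, of "\<Sum>j\<in>F. cmod (c j)"] GB by (simp add: mult.commute)
  have i2: "integrable per (\<lambda>z. G z * cnj (G z))"
    using integrable_per_mult[OF Gi Gm, of "\<Sum>j\<in>F. cmod (c j)"] GB by (simp add: mult.commute)
  have i3: "integrable per (\<lambda>z. (cmod (f z))\<^sup>2)" using f by (simp add: L2per_iff)
  have "0 \<le> (\<integral>z. (cmod (f z - G z))\<^sup>2 \<partial>per)" by simp
  also have "\<dots> = (\<integral>z. (cmod (f z))\<^sup>2 - 2 * Re (f z * cnj (G z)) + Re (G z * cnj (G z)) \<partial>per)"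
    by (rule Bochner_Integration.integral_cong, simp, simp only: cmod_power2 minus_complex.sel, simp add: power2_eq_square algebra_simps)
  also have "\<dots> = (\<integral>z. (cmod (f z))\<^sup>2 \<partial>per) - 2 * Re (of_real s) + Re (of_real s)"
    using i1 i2 i3 by (simp only: Bochner_Integration.integral_add Bochner_Integration.integral_diff integral_mult_right_zero
      Bochner_Integration.integrable_diff integrable_mult_right integrable_Re integral_Re I1 I2)
  finally have "s \<le> (\<integral>z. (cmod (f z))\<^sup>2 \<partial>per)" by simp
  then show ?thesis by (simp add: s_def c_def L2per_norm_per)
qed

lemma fourier_coeff_le_L2per_norm:
  assumes "f \<in> L2per" shows "cmod (fourier_coeff f n) \<le> L2per_norm f"
proof -
  have "1 * (cmod (fourier_coeff f n))\<^sup>2 \<le> 2 * pi * (cmod (fourier_coeff f n))\<^sup>2"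
    using pi_gt3 by (intro mult_right_mono) auto
  then have "(cmod (fourier_coeff f n))\<^sup>2 \<le> (L2per_norm f)\<^sup>2" using bessel[OF assms, of "{n}"] by simp
  then show ?thesis by (rule power2_le_imp_le) (simp add: L2per_norm_per)
qed

text \<open>Bessel's inequality and Cauchy-Schwarz against 1 / n. This is the bridge from square
  integrable data to the summable sequences on which the resolvent equation is solved.\<close>

lemma fourier_coeff_div_l1:
  "\<exists>C. \<forall>f\<in>L2per. \<forall>\<xi>. \<bar>\<xi>\<bar> \<le> 1/2 \<longrightarrow> l1_le (\<lambda>n. if \<bar>n\<bar> \<le> 1 then 0 else fourier_coeff f n / of_real (of_int n + \<xi>)) (C * L2per_norm f)"
proof -
  obtain B where B: "l1_le (\<lambda>n::int. 1 / (real_of_int n)\<^sup>2) B" using l1_le_inverse_square by blast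
  have "l1_le (\<lambda>n. if \<bar>n\<bar> \<le> 1 then 0 else fourier_coeff f n / of_real (of_int n + \<xi>)) ((2 * sqrt B) * L2per_norm f)"
    if f: "f \<in> L2per" and xi: "\<bar>\<xi>\<bar> \<le> 1/2" for f \<xi>
  proof (rule l1_leI)
    fix F :: "int set" assume F: "finite F"
    have "(\<Sum>n\<in>F. norm (if \<bar>n\<bar> \<le> 1 then 0 else fourier_coeff f n / of_real (of_int n + \<xi>)))
       \<le> (\<Sum>n\<in>F. \<bar>2 * cmod (fourier_coeff f n)\<bar> * \<bar>1 / real_of_int n\<bar>)"
    proof (rule sum_mono)
      fix n
      show "norm (if \<bar>n\<bar> \<le> 1 then 0 else fourier_coeff f n / of_real (of_int n + \<xi>)) \<le> \<bar>2 * cmod (fourier_coeff f n)\<bar> * \<bar>1 / real_of_int n\<bar>"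
      proof (cases "\<bar>n\<bar> \<le> 1")
        case False
        then have "2 \<le> \<bar>real_of_int n\<bar>" by linarith
        then have "\<bar>real_of_int n\<bar> / 2 \<le> \<bar>of_int n + \<xi>\<bar>" "0 < \<bar>real_of_int n\<bar> / 2" using xi by linarith+
        then have "cmod (fourier_coeff f n) / \<bar>of_int n + \<xi>\<bar> \<le> cmod (fourier_coeff f n) / (\<bar>real_of_int n\<bar> / 2)"
          by (intro divide_left_mono mult_pos_pos) auto
        moreover have "norm (complex_of_real (of_int n + \<xi>)) = \<bar>of_int n + \<xi>\<bar>" by (rule norm_of_real)
        ultimately show ?thesis using False by (simp add: norm_divide abs_mult mult.commute del: of_real_add)
      qed simp
    qed
    also have "\<dots> \<le> L2_set (\<lambda>n. 2 * cmod (fourier_coeff f n)) F * L2_set (\<lambda>n. 1 / real_of_int n) F"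
      by (rule L2_set_mult_ineq)
    also have "\<dots> \<le> (2 * L2per_norm f) * sqrt B"
    proof (rule mult_mono)
      have "(\<Sum>n\<in>F. (cmod (fourier_coeff f n))\<^sup>2) \<le> 2 * pi * (\<Sum>n\<in>F. (cmod (fourier_coeff f n))\<^sup>2)"
        using pi_gt3 mult_right_mono[of 1 "2 * pi" "\<Sum>n\<in>F. (cmod (fourier_coeff f n))\<^sup>2"] by (simp add: sum_nonneg)
      then have "(\<Sum>n\<in>F. (2 * cmod (fourier_coeff f n))\<^sup>2) \<le> (2 * L2per_norm f)\<^sup>2"
        using bessel[OF f F] by (simp add: power_mult_distrib flip: sum_distrib_left)
      then show "L2_set (\<lambda>n. 2 * cmod (fourier_coeff f n)) F \<le> 2 * L2per_norm f"
        unfolding L2_set_def by (rule real_le_lsqrt[rotated 1]) (auto simp: L2per_norm_per)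
      show "L2_set (\<lambda>n. 1 / real_of_int n) F \<le> sqrt B"
        using l1_leD[OF B F] by (simp add: L2_set_def power_divide)
    qed (auto simp: L2per_norm_per)
    finally show "(\<Sum>n\<in>F. norm (if \<bar>n\<bar> \<le> 1 then 0 else fourier_coeff f n / of_real (of_int n + \<xi>))) \<le> (2 * sqrt B) * L2per_norm f"
      by (simp add: mult_ac)
  qed
  then show ?thesis by blast
qed

section \<open>Completeness of the Fourier system\<close>

lemma integral_cos_polynomial_zero:
  fixes f :: "real \<Rightarrow> complex"
  assumes f: "integrable per f" and p: "real_polynomial_function p"
    and h: "continuous_on UNIV h" "\<And>z. cmod (h z) \<le> B"
    and zero: "\<And>n. fourier_coeff (\<lambda>z. h z * f z) n = 0"
  shows "fourier_coeff (\<lambda>z. of_real (p (cos z)) * h z * f z) n = 0"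
proof -
  \<comment> \<open>T consists of the multipliers that preserve the vanishing of all coefficients.
    An exponential factor merely shifts the index, so T is stable under exponentials, hence under
    cos z and under polynomials in cos z.\<close>
  define T where "T = {h :: real \<Rightarrow> complex. continuous_on UNIV h \<and> (\<exists>B. \<forall>z. cmod (h z) \<le> B) \<and> (\<forall>n. fourier_coeff (\<lambda>z. h z * f z) n = 0)}"
  have int: "integrable per (\<lambda>z. h z * f z)" if "h \<in> T" for h
    using that unfolding T_def by (auto intro!: integrable_per_mult[OF f] measurable_per borel_measurable_continuous_onI)
  have smult: "(\<lambda>z. c * h z) \<in> T" if hT: "h \<in> T" for c h
  proof -
    obtain B where B: "\<And>z. cmod (h z) \<le> B" using hT unfolding T_def by blast
    have "\<And>z. cmod (c * h z) \<le> cmod c * B" by (simp add: norm_mult mult_left_mono B)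
    then show ?thesis using that unfolding T_def
      by (auto simp: mult.assoc fourier_coeff_cmult intro: continuous_intros)
  qed
  have add: "(\<lambda>z. h z + k z) \<in> T" if hk: "h \<in> T" "k \<in> T" for h k
  proof -
    obtain B B' where "\<And>z. cmod (h z) \<le> B" "\<And>z. cmod (k z) \<le> B'" using hk unfolding T_def by blast
    then have "\<And>z. cmod (h z + k z) \<le> B + B'" by (meson norm_triangle_mono)
    then show ?thesis using hk int[OF hk(1)] int[OF hk(2)] unfolding T_def
      by (auto simp: distrib_right fourier_coeff_add intro!: continuous_intros)
  qed
  have shift: "(\<lambda>z. cis (of_int j * z) * h z) \<in> T" if "h \<in> T" for h j
    using that unfolding T_def by (auto simp: norm_mult mult.assoc fourier_coeff_shift intro!: continuous_intros)
  have cosT: "(\<lambda>z. of_real (cos z) * h z) \<in> T" if "h \<in> T" for h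
  proof -
    have "(\<lambda>z. 1/2 * (cis (of_int 1 * z) * h z + cis (of_int (-1) * z) * h z)) \<in> T"
      by (intro smult add shift that)
    moreover have "1/2 * (cis (of_int 1 * z) * h z + cis (of_int (-1) * z) * h z) = of_real (cos z) * h z" for z
    proof -
      have "cis z + cis (- z) = 2 * of_real (cos z)" by (simp add: complex_eq_iff)
      then show ?thesis by (simp flip: distrib_right)
    qed
    ultimately show ?thesis by simp
  qed
  have "\<forall>h\<in>T. (\<lambda>z. of_real (p (cos z)) * h z) \<in> T"
    using p
  proof induction
    case (linear q)
    have q: "q y = y * q 1" for y using linear_cmul[OF bounded_linear.linear[OF linear], of y 1] by simp
    show ?case
    proof
      fix h assume "h \<in> T"
      then have "(\<lambda>z. of_real (q 1) * (of_real (cos z) * h z)) \<in> T" by (intro smult cosT)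
      then show "(\<lambda>z. of_real (q (cos z)) * h z) \<in> T" by (subst q) (simp add: mult_ac)
    qed
  next
    case (const c) then show ?case by (simp add: smult)
  next
    case (add q r) then show ?case by (simp add: distrib_right) (use \<open>\<And>h k. h \<in> T \<Longrightarrow> k \<in> T \<Longrightarrow> _\<close> in blast)
  next
    case (mult q r) then show ?case by (simp add: mult.assoc)
  qed
  moreover have "h \<in> T" using h zero by (auto simp: T_def)
  ultimately have "(\<lambda>z. of_real (p (cos z)) * h z) \<in> T" by blast
  then show ?thesis by (simp add: T_def)
qed

text \<open>On one period an even continuous function is a continuous function of cos z, recovered
  through arccos. Approximation by trigonometric polynomials thus becomes approximation by
  polynomials on [-1, 1].\<close>

lemma integral_even_zero:
  fixes f :: "real \<Rightarrow> complex" and e :: "real \<Rightarrow> real"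
  assumes f: "integrable per f" and zero: "\<And>n. fourier_coeff (\<lambda>z. h z * f z) n = 0"
    and h: "continuous_on UNIV h" "\<And>z. cmod (h z) \<le> B"
    and e: "continuous_on UNIV e" "\<And>z. e (- z) = e z"
  shows "(\<integral>z. of_real (e z) * (h z * f z) \<partial>per) = 0"
proof -
  have ec: "e z = e (arccos (cos z))" if "z \<in> {-pi..pi}" for z
    using that e(2)[of z] by (cases "0 \<le> z") (auto simp: arccos_cos arccos_cos2)
  have hf: "integrable per (\<lambda>z. h z * f z)"
    using h by (auto intro!: integrable_per_mult[OF f] measurable_per borel_measurable_continuous_onI)
  define C where "C = (\<integral>z. cmod (h z * f z) \<partial>per)"
  have C: "0 \<le> C" by (simp add: C_def)
  have cont: "continuous_on {-1..1} (\<lambda>y. e (arccos y))"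
    by (intro continuous_on_compose2[OF e(1)] continuous_on_arccos') auto
  have "cmod (\<integral>z. of_real (e z) * (h z * f z) \<partial>per) \<le> \<epsilon> * C" if eps: "0 < \<epsilon>" for \<epsilon>
  proof -
    obtain p where p: "real_polynomial_function p" "\<And>y. y \<in> {-1..1} \<Longrightarrow> \<bar>e (arccos y) - p y\<bar> < \<epsilon>"
      using Stone_Weierstrass_real_polynomial_function[OF compact_Icc cont eps] by blast
    have pc: "continuous_on UNIV (\<lambda>z. p (cos z))"
      by (intro continuous_on_compose2[OF continuous_on_polymonial_function[of p UNIV]] continuous_intros)
        (use p(1) in \<open>auto simp: real_polynomial_function_eq\<close>)
    have bnd: "\<exists>B. \<forall>z\<in>{-pi..pi}. cmod (of_real (q z)) \<le> B" if "continuous_on UNIV q" for q :: "real \<Rightarrow> real"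
    proof -
      have "compact (q ` {-pi..pi})" by (rule compact_continuous_image[OF continuous_on_subset[OF that] compact_Icc]) auto
      from compact_imp_bounded[OF this] show ?thesis by (auto simp: bounded_iff)
    qed
    have int: "integrable per (\<lambda>z. of_real (q z) * (h z * f z))" if q: "continuous_on UNIV q" for q :: "real \<Rightarrow> real"
    proof -
      obtain B where B: "\<And>z. z \<in> {-pi..pi} \<Longrightarrow> cmod (of_real (q z)) \<le> B" using bnd[OF q] by blast
      \<comment> \<open>The continuous factor is known to be bounded on the period only; it is cut
        off there to meet the global bound in \<open>integrable_per_mult\<close>.\<close>
      have "integrable per (\<lambda>z. indicator {-pi..pi} z *\<^sub>R of_real (q z) * (h z * f z))"
      proof (rule integrable_per_mult[OF hf])
        show "(\<lambda>z. indicator {-pi..pi} z *\<^sub>R complex_of_real (q z)) \<in> borel_measurable per"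
          using q by (intro measurable_per borel_measurable_scaleR borel_measurable_indicator borel_measurable_of_real borel_measurable_continuous_onI) auto
        show "cmod (indicator {-pi..pi} z *\<^sub>R complex_of_real (q z)) \<le> \<bar>B\<bar>" for z
          using B[of z] by (auto simp: indicator_def)
      qed
      then show ?thesis by (rule Bochner_Integration.integrable_cong[THEN iffD1, rotated -1]) auto
    qed
    have "(\<integral>z. of_real (p (cos z)) * (h z * f z) \<partial>per) = 0"
      using integral_cos_polynomial_zero[OF f p(1) h zero, of 0] by (simp add: fourier_coeff_per mult.assoc)
    then have "(\<integral>z. of_real (e z) * (h z * f z) \<partial>per) = (\<integral>z. of_real (e z) * (h z * f z) - of_real (p (cos z)) * (h z * f z) \<partial>per)"
      by (subst Bochner_Integration.integral_diff[OF int[OF e(1)] int[OF pc]]) simp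
    also have "cmod \<dots> \<le> (\<integral>z. cmod (of_real (e z) * (h z * f z) - of_real (p (cos z)) * (h z * f z)) \<partial>per)"
      by (rule integral_norm_bound)
    also have "\<dots> \<le> (\<integral>z. \<epsilon> * cmod (h z * f z) \<partial>per)"
    proof (rule integral_mono)
      show "integrable per (\<lambda>z. cmod (of_real (e z) * (h z * f z) - of_real (p (cos z)) * (h z * f z)))"
        by (intro integrable_norm Bochner_Integration.integrable_diff int e(1) pc)
      show "integrable per (\<lambda>z. \<epsilon> * cmod (h z * f z))" using hf by simp
      fix z assume "z \<in> space per"
      then have "\<bar>e z - p (cos z)\<bar> \<le> \<epsilon>" using p(2)[of "cos z"] ec[of z] by (simp add: less_imp_le)
      moreover have "cmod (of_real (e z) * (h z * f z) - of_real (p (cos z)) * (h z * f z)) = \<bar>e z - p (cos z)\<bar> * cmod (h z * f z)"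
        by (metis (no_types) left_diff_distrib norm_mult norm_of_real of_real_diff)
      ultimately show "cmod (of_real (e z) * (h z * f z) - of_real (p (cos z)) * (h z * f z)) \<le> \<epsilon> * cmod (h z * f z)"
        by (simp add: mult_right_mono)
    qed
    finally show ?thesis by (simp add: C_def)
  qed
  from this[of "d / (C + 1)" for d] have "cmod (\<integral>z. of_real (e z) * (h z * f z) \<partial>per) \<le> 0 + d" if "0 < d" for d
  proof -
    have "d / (C + 1) * C \<le> d" using that C by (simp add: divide_le_eq mult_left_mono)
    moreover have "0 < d / (C + 1)" using that C by simp
    ultimately show ?thesis using \<open>\<And>d. 0 < d / (C + 1) \<Longrightarrow> _\<close>[of d] by simp
  qed
  from field_le_epsilon[OF this] show ?thesis by simp
qed

text \<open>The factor \<open>sin\<^sup>2\<close> makes both the even and the odd part of a test function a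
  continuous function of \<open>cos z\<close> times \<open>1\<close> or \<open>sin z\<close>.\<close>

lemma integral_sin_square_zero:
  fixes f :: "real \<Rightarrow> complex" and q :: "real \<Rightarrow> real"
  assumes f: "integrable per f" and zero: "\<And>n. fourier_coeff f n = 0" and q: "continuous_on UNIV q"
  shows "(\<integral>z. of_real (q z * (sin z)\<^sup>2) * f z \<partial>per) = 0"
    and "integrable per (\<lambda>z. of_real (q z * (sin z)\<^sup>2) * f z)"
proof -
  have qm: "continuous_on UNIV (\<lambda>z. q (- z))" by (intro continuous_on_compose2[OF q] continuous_intros) auto
  define e o' where "e z = (q z + q (- z)) / 2 * (sin z)\<^sup>2" and "o' z = (q z - q (- z)) / 2 * sin z" for z
  have ec: "continuous_on UNIV e" and oc: "continuous_on UNIV o'"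
    unfolding e_def o'_def by (intro continuous_intros q qm; simp)+
  have sc: "continuous_on UNIV (\<lambda>z. complex_of_real (sin z))" by (intro continuous_intros)
  have zs: "fourier_coeff (\<lambda>z. of_real (sin z) * f z) n = 0" for n
  proof -
    have i: "integrable per (\<lambda>z. cis (of_int j * z) * f z)" for j
      by (intro integrable_per_mult[OF f cis_measurable, of _ 1]) auto
    have sin: "of_real (sin z) = - \<i> / 2 * cis z + \<i> / 2 * cis (- z)" for z by (simp add: complex_eq_iff)
    have "(\<lambda>z. of_real (sin z) * f z) = (\<lambda>z. - \<i> / 2 * (cis (of_int 1 * z) * f z) + \<i> / 2 * (cis (of_int (-1) * z) * f z))"
      unfolding sin by (simp add: fun_eq_iff distrib_right algebra_simps)
    then have "fourier_coeff (\<lambda>z. of_real (sin z) * f z) n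
       = - \<i> / 2 * fourier_coeff (\<lambda>z. cis (of_int 1 * z) * f z) n + \<i> / 2 * fourier_coeff (\<lambda>z. cis (of_int (-1) * z) * f z) n"
      by (simp only: fourier_coeff_add[OF integrable_mult_right[OF i] integrable_mult_right[OF i]] fourier_coeff_cmult)
    then show ?thesis by (simp only: fourier_coeff_shift zero mult_zero_right add_0)
  qed
  have 1: "(\<integral>z. of_real (e z) * (1 * f z) \<partial>per) = 0"
    by (rule integral_even_zero[OF f _ _ _ ec, of _ 1]) (auto simp: zero e_def add.commute)
  have 2: "(\<integral>z. of_real (o' z) * (of_real (sin z) * f z) \<partial>per) = 0"
    by (rule integral_even_zero[OF f zs sc _ oc, of 1]) (auto simp: o'_def algebra_simps diff_divide_distrib)
  have int: "integrable per (\<lambda>z. of_real (r z) * f z)" if r: "continuous_on UNIV r" for r :: "real \<Rightarrow> real"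
  proof -
    have "compact (r ` {-pi..pi})" by (rule compact_continuous_image[OF continuous_on_subset[OF r] compact_Icc]) auto
    from compact_imp_bounded[OF this] obtain B where B: "\<forall>z\<in>{-pi..pi}. \<bar>r z\<bar> \<le> B" by (auto simp: bounded_iff)
    have "integrable per (\<lambda>z. indicator {-pi..pi} z *\<^sub>R of_real (r z) * f z)"
    proof (rule integrable_per_mult[OF f])
      show "(\<lambda>z. indicator {-pi..pi} z *\<^sub>R complex_of_real (r z)) \<in> borel_measurable per"
        using r by (intro measurable_per borel_measurable_scaleR borel_measurable_indicator borel_measurable_of_real borel_measurable_continuous_onI) auto
      show "cmod (indicator {-pi..pi} z *\<^sub>R complex_of_real (r z)) \<le> \<bar>B\<bar>" for z
        using B by (force simp: indicator_def)
    qed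
    then show ?thesis by (rule Bochner_Integration.integrable_cong[THEN iffD1, rotated -1]) auto
  qed
  show "integrable per (\<lambda>z. of_real (q z * (sin z)\<^sup>2) * f z)" by (intro int continuous_intros q)
  have "(\<lambda>z. of_real (q z * (sin z)\<^sup>2) * f z) = (\<lambda>z. of_real (e z) * f z + of_real (o' z * sin z) * f z)"
    unfolding distrib_right[symmetric] of_real_add[symmetric] by (simp add: e_def o'_def power2_eq_square field_simps)
  moreover have "(\<integral>z. of_real (e z) * f z + of_real (o' z * sin z) * f z \<partial>per)
     = (\<integral>z. of_real (e z) * f z \<partial>per) + (\<integral>z. of_real (o' z * sin z) * f z \<partial>per)"
    by (intro Bochner_Integration.integral_add int continuous_intros ec oc)
  ultimately show "(\<integral>z. of_real (q z * (sin z)\<^sup>2) * f z \<partial>per) = 0"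
    using 1 2 by (simp add: mult.assoc)
qed

text \<open>The test functions are made to approach sgn F: a measurable function is almost
  everywhere a limit of continuous ones, and truncation to [-1, 1] preserves this limit. Dominated
  convergence shows that \<bar>F\<bar> sin^2 integrates to zero, and sin vanishes only at three
  points of the period.\<close>

lemma AE_per_zero_real:
  fixes F :: "real \<Rightarrow> real"
  assumes F: "F \<in> borel_measurable borel" "integrable per F"
    and zero: "\<And>q. continuous_on UNIV q \<Longrightarrow> (\<integral>z. q z * (sin z)\<^sup>2 * F z \<partial>per) = 0"
  shows "AE z in per. F z = 0"
proof -
  have "(\<lambda>z. sgn (F z)) \<in> borel_measurable lebesgue"
    using F(1) by (intro measurable_completion) (simp add: measurable_lborel2)
  then have "(\<lambda>z. sgn (F z)) measurable_on UNIV" by (rule lebesgue_measurable_imp_measurable_on) simp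
  then obtain N g where N: "negligible N" and g: "\<And>n. continuous_on UNIV (g n)"
    and lim: "\<And>z. z \<notin> N \<Longrightarrow> (\<lambda>n. g n z) \<longlonglongrightarrow> sgn (F z)"
    unfolding measurable_on_def by auto
  define q where "q n z = max (-1) (min 1 (g n z))" for n z
  have qc: "continuous_on UNIV (q n)" for n unfolding q_def by (intro continuous_intros g)
  have q1: "\<bar>q n z\<bar> \<le> 1" for n z by (auto simp: q_def)
  have qlim: "(\<lambda>n. q n z) \<longlonglongrightarrow> sgn (F z)" if "z \<notin> N" for z
  proof -
    have "(\<lambda>n. q n z) \<longlonglongrightarrow> max (-1) (min 1 (sgn (F z)))" unfolding q_def by (intro tendsto_intros lim that)
    then show ?thesis by (auto simp: sgn_if split: if_splits)
  qed
  have Fm: "F \<in> borel_measurable per" by (rule measurable_per[OF F(1)])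
  have sm: "(\<lambda>z. (sin z)\<^sup>2) \<in> borel_measurable per"
    by (intro measurable_per borel_measurable_continuous_onI continuous_intros)
  have qm: "q n \<in> borel_measurable per" for n by (intro measurable_per borel_measurable_continuous_onI qc)
  have AE1: "AE z in lborel. z \<notin> N"
    using N AE_not_in[of N lebesgue] by (simp add: negligible_iff_null_sets AE_completion_iff)
  have AE2: "AE z in per. z \<notin> N"
    unfolding per_def using AE1 by (subst AE_restrict_space_iff) auto
  have "(\<lambda>n. \<integral>z. q n z * (sin z)\<^sup>2 * F z \<partial>per) \<longlonglongrightarrow> (\<integral>z. \<bar>F z\<bar> * (sin z)\<^sup>2 \<partial>per)"
  proof (rule integral_dominated_convergence[where w="\<lambda>z. \<bar>F z\<bar>"])
    show "(\<lambda>z. \<bar>F z\<bar> * (sin z)\<^sup>2) \<in> borel_measurable per" using Fm sm by (intro borel_measurable_times borel_measurable_abs)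
    show "(\<lambda>z. q n z * (sin z)\<^sup>2 * F z) \<in> borel_measurable per" for n using Fm sm qm by (intro borel_measurable_times)
    show "integrable per (\<lambda>z. \<bar>F z\<bar>)" using F(2) by simp
    show "AE z in per. (\<lambda>n. q n z * (sin z)\<^sup>2 * F z) \<longlonglongrightarrow> \<bar>F z\<bar> * (sin z)\<^sup>2"
      using AE2
    proof eventually_elim
      case (elim z)
      have "(\<lambda>n. q n z * (sin z)\<^sup>2 * F z) \<longlonglongrightarrow> sgn (F z) * (sin z)\<^sup>2 * F z" by (intro tendsto_intros qlim elim)
      moreover have "sgn (F z) * (sin z)\<^sup>2 * F z = \<bar>F z\<bar> * (sin z)\<^sup>2" by (auto simp: sgn_if)
      ultimately show ?case by simp
    qed
    show "AE z in per. norm (q n z * (sin z)\<^sup>2 * F z) \<le> \<bar>F z\<bar>" for n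
    proof (rule AE_I2)
      fix z
      have "\<bar>q n z\<bar> * (sin z)\<^sup>2 \<le> 1 * 1" using q1[of n z] abs_sin_le_one[of z]
        by (intro mult_mono) (auto simp: abs_square_le_1)
      then have "\<bar>q n z\<bar> * (sin z)\<^sup>2 * \<bar>F z\<bar> \<le> 1 * \<bar>F z\<bar>" by (intro mult_right_mono) auto
      then show "norm (q n z * (sin z)\<^sup>2 * F z) \<le> \<bar>F z\<bar>" by (simp add: abs_mult)
    qed
  qed
  then have "(\<integral>z. \<bar>F z\<bar> * (sin z)\<^sup>2 \<partial>per) = 0" by (simp add: zero[OF qc] LIMSEQ_const_iff)
  moreover have "integrable per (\<lambda>z. \<bar>F z\<bar> * (sin z)\<^sup>2)"
  proof (rule Bochner_Integration.integrable_bound[OF F(2)])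
    show "(\<lambda>z. \<bar>F z\<bar> * (sin z)\<^sup>2) \<in> borel_measurable per" using Fm sm by (intro borel_measurable_times borel_measurable_abs)
    show "AE z in per. norm (\<bar>F z\<bar> * (sin z)\<^sup>2) \<le> norm (F z)"
      by (rule AE_I2) (use abs_sin_le_one in \<open>auto simp: abs_mult abs_square_le_1 intro!: mult_left_le\<close>)
  qed
  ultimately have "AE z in per. \<bar>F z\<bar> * (sin z)\<^sup>2 = 0"
    by (subst integral_nonneg_eq_0_iff_AE[symmetric]) auto
  moreover have "AE z in per. z \<noteq> -pi \<and> z \<noteq> 0 \<and> z \<noteq> pi"
    unfolding per_def using AE_lborel_singleton[of "-pi"] AE_lborel_singleton[of "0::real"] AE_lborel_singleton[of pi]
    by (subst AE_restrict_space_iff) auto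
  moreover have "AE z in per. z \<in> {-pi..pi}" using AE_space[of per] by simp
  ultimately show ?thesis
  proof eventually_elim
    case (elim z)
    have "sin z \<noteq> 0"
      using elim sin_gt_zero[of z] sin_gt_zero[of "- z"] by (cases "0 < z") auto
    then show ?case using elim by simp
  qed
qed

lemma fourier_coeff_zero_AE:
  assumes f: "f \<in> borel_measurable borel" "integrable per f" and zero: "\<And>n. fourier_coeff f n = 0"
  shows "AE z in per. f z = 0"
proof -
  have I: "(\<integral>z. of_real (q z * (sin z)\<^sup>2) * f z \<partial>per) = 0" "integrable per (\<lambda>z. of_real (q z * (sin z)\<^sup>2) * f z)"
    if "continuous_on UNIV q" for q using integral_sin_square_zero[OF f(2) zero that] .
  have "AE z in per. Re (f z) = 0"
  proof (rule AE_per_zero_real)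
    show "(\<integral>z. q z * (sin z)\<^sup>2 * Re (f z) \<partial>per) = 0" if q: "continuous_on UNIV q" for q
      using arg_cong[OF I(1)[OF q], of Re] I(2)[OF q] by (simp flip: integral_Re)
  qed (use f in auto)
  moreover have "AE z in per. Im (f z) = 0"
  proof (rule AE_per_zero_real)
    show "(\<integral>z. q z * (sin z)\<^sup>2 * Im (f z) \<partial>per) = 0" if q: "continuous_on UNIV q" for q
      using arg_cong[OF I(1)[OF q], of Im] I(2)[OF q] by (simp flip: integral_Im)
  qed (use f in auto)
  ultimately show ?thesis by eventually_elim (simp add: complex_eq_iff)
qed

section \<open>The Bloch operator in Fourier coordinates\<close>

lemma L2per_linear:
  assumes f: "f \<in> L2per" and h: "h \<in> L2per"
  shows "(\<lambda>z. a * f z + b * h z) \<in> L2per"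
proof -
  have m: "(\<lambda>z. a * f z + b * h z) \<in> borel_measurable borel"
    using f h by (auto simp: L2per_iff)
  have "integrable per (\<lambda>z. (cmod (a * f z + b * h z))\<^sup>2)"
  proof (rule Bochner_Integration.integrable_bound)
    show "integrable per (\<lambda>z. 2 * (cmod a)\<^sup>2 * (cmod (f z))\<^sup>2 + 2 * (cmod b)\<^sup>2 * (cmod (h z))\<^sup>2)"
      using f h by (auto simp: L2per_iff)
    show "(\<lambda>z. (cmod (a * f z + b * h z))\<^sup>2) \<in> borel_measurable per"
      using measurable_per[OF m] by simp
    show "AE z in per. norm ((cmod (a * f z + b * h z))\<^sup>2) \<le> norm (2 * (cmod a)\<^sup>2 * (cmod (f z))\<^sup>2 + 2 * (cmod b)\<^sup>2 * (cmod (h z))\<^sup>2)"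
    proof (rule AE_I2)
      fix z
      have "(cmod (a * f z + b * h z))\<^sup>2 \<le> (cmod (a * f z) + cmod (b * h z))\<^sup>2"
        by (intro power_mono norm_triangle_ineq) auto
      also have "\<dots> \<le> 2 * (cmod (a * f z))\<^sup>2 + 2 * (cmod (b * h z))\<^sup>2"
        using zero_le_power2[of "cmod (a * f z) - cmod (b * h z)"] by (simp add: power2_eq_square algebra_simps)
      finally show "norm ((cmod (a * f z + b * h z))\<^sup>2) \<le> norm (2 * (cmod a)\<^sup>2 * (cmod (f z))\<^sup>2 + 2 * (cmod b)\<^sup>2 * (cmod (h z))\<^sup>2)"
        by (simp add: norm_mult power_mult_distrib)
    qed
  qed
  then show ?thesis using f h m by (simp add: L2per_iff)
qed

lemma L2per_norm_bound:
  assumes f: "f \<in> L2per" and B: "AE z in per. cmod (f z) \<le> K" and K: "0 \<le> K"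
  shows "L2per_norm f \<le> sqrt (2 * pi) * K"
proof -
  have "(\<integral>z. (cmod (f z))\<^sup>2 \<partial>per) \<le> (\<integral>z. K\<^sup>2 \<partial>per)"
  proof (rule integral_mono_AE)
    show "integrable per (\<lambda>z. (cmod (f z))\<^sup>2)" using f by (simp add: L2per_iff)
    show "AE z in per. (cmod (f z))\<^sup>2 \<le> K\<^sup>2" using B by eventually_elim (simp add: power_mono)
  qed simp
  also have "\<dots> = 2 * pi * K\<^sup>2" by (simp add: measure_per)
  finally have "L2per_norm f \<le> sqrt (2 * pi * K\<^sup>2)" by (simp add: L2per_norm_per)
  then show ?thesis using K by (simp add: real_sqrt_mult)
qed

text \<open>By completeness w agrees almost everywhere with its absolutely convergent series, so
  multiplication by w acts on coefficients as convolution; the mean is split off because p vanishes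
  at 0.\<close>

lemma fourier_coeff_real_mult:
  fixes f :: "real \<Rightarrow> complex" and p :: "int \<Rightarrow> real"
  assumes f: "integrable per f" and w_cont: "continuous_on UNIV w" and p_l1: "l1_le p P" and p_0: "p 0 = 0"
    and w_coeff: "\<And>n. fourier_coeff (\<lambda>z. of_real (w z)) n = of_real (if n = 0 then w0 else p n)"
  shows "fourier_coeff (\<lambda>z. of_real (w z) * f z) n = of_real w0 * fourier_coeff f n + conv p (fourier_coeff f) n"
proof -
  define W where "W n = complex_of_real (p n) + (if n = 0 then of_real w0 else 0)" for n
  have pW: "l1_le (\<lambda>n. complex_of_real (p n)) P" by (rule l1_le_compare[OF p_l1]) simp
  have W: "l1_le W (P + (\<Sum>n\<in>{0}. norm (if n = (0::int) then complex_of_real w0 else 0)))"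
    unfolding W_def by (intro l1_le_add pW l1_le_finite_support) auto
  have wm: "(\<lambda>z. complex_of_real (w z)) \<in> borel_measurable borel"
    by (intro borel_measurable_continuous_onI continuous_intros w_cont)
  have wi: "integrable per (\<lambda>z. complex_of_real (w z))" by (intro integrable_per_continuous continuous_intros w_cont)
  have si: "integrable per (fseries W)" by (intro integrable_per_continuous fseries_continuous[OF W])
  have "AE z in per. of_real (w z) - fseries W z = 0"
  proof (rule fourier_coeff_zero_AE)
    show "(\<lambda>z. of_real (w z) - fseries W z) \<in> borel_measurable borel"
      by (intro borel_measurable_diff wm fseries_measurable[OF W])
    show "integrable per (\<lambda>z. of_real (w z) - fseries W z)" using wi si by simp
    show "fourier_coeff (\<lambda>z. of_real (w z) - fseries W z) n = 0" for n
      by (simp add: fourier_coeff_diff[OF wi si] w_coeff fourier_coeff_fseries[OF W] W_def p_0)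
  qed
  then have "AE z in per. of_real (w z) * f z = fseries W z * f z" by eventually_elim simp
  then have "fourier_coeff (\<lambda>z. of_real (w z) * f z) n = fourier_coeff (\<lambda>z. fseries W z * f z) n"
    using f by (intro fourier_coeff_cong_AE borel_measurable_times measurable_per[OF wm] measurable_per[OF fseries_measurable[OF W]]) auto
  moreover have "((\<lambda>j. W j * fourier_coeff f (n - j)) has_sum conv p (fourier_coeff f) n + of_real w0 * fourier_coeff f n) UNIV"
  proof -
    have "((\<lambda>j. p j *\<^sub>R fourier_coeff f (n - j)) has_sum conv p (fourier_coeff f) n) UNIV"
      unfolding conv_def by (rule has_sum_infsum, rule conv_summable[OF p_l1 fourier_coeff_bound[OF f]])
    moreover have "((\<lambda>j. (if j = 0 then of_real w0 else 0) * fourier_coeff f (n - j)) has_sum of_real w0 * fourier_coeff f n) UNIV"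
      by (rule has_sum_finite_neutralI[of "{0}"]) auto
    ultimately show ?thesis using has_sum_add by (fastforce simp: W_def scaleR_conv_of_real distrib_right)
  qed
  ultimately show ?thesis using has_sum_unique[OF fourier_coeff_fseries_mult[OF W f]] by (simp add: add.commute)
qed

locale bloch = potential +
  fixes g d T k c w0 :: real and w :: "real \<Rightarrow> real"
  assumes S_eq: "S y = phase_speed g d T (k * y)"
    and w_cont: "continuous_on UNIV w" and w_per: "w (z + 2 * pi) = w z"
    and w_coeff: "fourier_coeff (\<lambda>z. of_real (w z)) n = of_real (if n = 0 then w0 else p n)"
    and V_eq: "V = c - 2 * w0"
begin

lemmas w_mult_coeff = fourier_coeff_real_mult[OF _ w_cont p_l1 p_0 w_coeff]

lemma flux_coeff:
  assumes f: "integrable per f" and h: "integrable per h" and eq: "fourier_coeff h n = of_real (S (of_int n + \<xi>)) * fourier_coeff f n"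
  shows "fourier_coeff (\<lambda>z. - h z + of_real (c - 2 * w z) * f z) n = Aop \<xi> (fourier_coeff f) n"
    and "integrable per (\<lambda>z. - h z + of_real (c - 2 * w z) * f z)"
proof -
  have bnd: "integrable per (\<lambda>z. of_real (w z) * f z)"
  proof -
    have "compact (w ` {-pi..pi})" by (rule compact_continuous_image[OF continuous_on_subset[OF w_cont] compact_Icc]) auto
    from compact_imp_bounded[OF this] obtain B where B: "\<forall>z\<in>{-pi..pi}. \<bar>w z\<bar> \<le> B" by (auto simp: bounded_iff)
    have "integrable per (\<lambda>z. indicator {-pi..pi} z *\<^sub>R of_real (w z) * f z)"
    proof (rule integrable_per_mult[OF f])
      show "(\<lambda>z. indicator {-pi..pi} z *\<^sub>R complex_of_real (w z)) \<in> borel_measurable per"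
        using w_cont by (intro measurable_per borel_measurable_scaleR borel_measurable_indicator borel_measurable_of_real borel_measurable_continuous_onI) auto
      show "cmod (indicator {-pi..pi} z *\<^sub>R complex_of_real (w z)) \<le> \<bar>B\<bar>" for z
        using B by (force simp: indicator_def)
    qed
    then show ?thesis by (rule Bochner_Integration.integrable_cong[THEN iffD1, rotated -1]) auto
  qed
  have e: "(\<lambda>z. - h z + of_real (c - 2 * w z) * f z) = (\<lambda>z. (of_real c * f z - h z) + (- 2) * (of_real (w z) * f z))"
    by (simp add: fun_eq_iff algebra_simps)
  have i: "integrable per (\<lambda>z. of_real c * f z)" "integrable per (\<lambda>z. (- 2) * (of_real (w z) * f z))" using f bnd by simp_all
  show "integrable per (\<lambda>z. - h z + of_real (c - 2 * w z) * f z)" unfolding e using i h by (intro Bochner_Integration.integrable_add Bochner_Integration.integrable_diff)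
  have "fourier_coeff (\<lambda>z. - h z + of_real (c - 2 * w z) * f z) n
      = of_real c * fourier_coeff f n - fourier_coeff h n + (- 2) * fourier_coeff (\<lambda>z. of_real (w z) * f z) n"
    unfolding e using i h by (simp only: fourier_coeff_add Bochner_Integration.integrable_diff fourier_coeff_diff fourier_coeff_cmult)
  then show "fourier_coeff (\<lambda>z. - h z + of_real (c - 2 * w z) * f z) n = Aop \<xi> (fourier_coeff f) n"
    unfolding Aop_def eq w_mult_coeff[OF f] by (simp only: V_eq) (simp add: scaleR_conv_of_real algebra_simps)
qed

lemma bloch_operator_coeff:
  assumes "(\<phi>, \<psi>) \<in> bloch_operator g d T k w c \<xi>"
  shows "\<phi> \<in> L2per" "\<psi> \<in> L2per"
    "fourier_coeff \<psi> n = \<i> * of_real (of_int n + \<xi>) * Aop \<xi> (fourier_coeff \<phi>) n"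
proof -
  obtain \<eta> where 1: "(\<phi>, \<eta>) \<in> multiplier_graph (\<lambda>n. of_real (phase_speed g d T (k * (of_int n + \<xi>))))"
    and 2: "(\<lambda>z. - \<eta> z + of_real (c - 2 * w z) * \<phi> z, \<psi>) \<in> multiplier_graph (\<lambda>n. \<i> * of_real (of_int n + \<xi>))"
    using assms by (auto simp: bloch_operator_def)
  show L: "\<phi> \<in> L2per" "\<psi> \<in> L2per" using 1 2 by (auto simp: multiplier_graph_def)
  have "integrable per \<phi>" "integrable per \<eta>" "fourier_coeff \<eta> n = of_real (S (of_int n + \<xi>)) * fourier_coeff \<phi> n"
    using 1 by (auto simp: multiplier_graph_def S_eq intro: L2per_integrable)
  from flux_coeff(1)[OF this] show "fourier_coeff \<psi> n = \<i> * of_real (of_int n + \<xi>) * Aop \<xi> (fourier_coeff \<phi>) n"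
    using 2 by (simp add: multiplier_graph_def)
qed

text \<open>Membership in the natural domain asks that the multiplier S applied to v again yields a
  square integrable function. This regularity is recovered from the operator itself: S v equals V v
  minus twice the convolution minus \<open>Aop \<xi> v\<close>, and all three are summable.\<close>

lemma bloch_operatorI:
  assumes v: "l1_le v M" and tl: "l1_le (tail (Aop \<xi> v)) N" and psi: "\<psi> \<in> L2per"
    and eq: "\<And>n. fourier_coeff \<psi> n = \<i> * of_real (of_int n + \<xi>) * Aop \<xi> v n"
  shows "(fseries v, \<psi>) \<in> bloch_operator g d T k w c \<xi>"
proof -
  define h where "h n = of_real (S (of_int n + \<xi>)) * v n" for n
  have "l1_le (\<lambda>n. (V *\<^sub>R v n - 2 *\<^sub>R conv p v n) - (tail (Aop \<xi> v) n + (if n \<in> Core then Aop \<xi> v n else 0)))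
     ((\<bar>V\<bar> * M + \<bar>2\<bar> * (P * M)) + (N + (\<Sum>n\<in>Core. norm (if n \<in> Core then Aop \<xi> v n else 0))))"
    by (intro l1_le_diff l1_le_add l1_le_cmult v conv_l1[OF p_l1 v] tl l1_le_finite_support) (auto simp: Core_def)
  moreover have "(V *\<^sub>R v n - 2 *\<^sub>R conv p v n) - (tail (Aop \<xi> v) n + (if n \<in> Core then Aop \<xi> v n else 0)) = h n" for n
    by (simp add: tail_def Aop_def h_def scaleR_conv_of_real algebra_simps)
  ultimately obtain M' where h: "l1_le h M'" by (simp add: h_def[abs_def])
  have hv: "fourier_coeff (fseries h) n = of_real (S (of_int n + \<xi>)) * fourier_coeff (fseries v) n" for n
    by (simp add: fourier_coeff_fseries[OF h] fourier_coeff_fseries[OF v] h_def)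
  have fl: "(\<lambda>z. - fseries h z + of_real (c - 2 * w z) * fseries v z) \<in> L2per"
    by (intro continuous_L2per continuous_intros fseries_continuous[OF h] fseries_continuous[OF v] w_cont)
      (simp add: fseries_periodic w_per)
  note fc = flux_coeff(1)[OF L2per_integrable L2per_integrable hv, OF fseries_L2per[OF v] fseries_L2per[OF h]]
  have fv: "fourier_coeff (fseries v) = v" by (simp add: fun_eq_iff fourier_coeff_fseries[OF v])
  show ?thesis
    unfolding bloch_operator_def multiplier_graph_def mem_Collect_eq prod.case
    by (intro exI[of _ "fseries h"] conjI allI fseries_L2per[OF v] fseries_L2per[OF h] fl psi) (simp_all only: hv S_eq eq fc fv)
qed

lemma xi_half: "\<bar>\<xi>\<bar> \<le> \<xi>0 \<Longrightarrow> \<bar>\<xi>\<bar> \<le> 1/2"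
proof -
  assume "\<bar>\<xi>\<bar> \<le> \<xi>0"
  moreover have "\<gamma> / (100 * \<Lambda>) \<le> 1 / 2" using gamma Lambda by (simp add: divide_le_eq)
  ultimately show ?thesis using xi0 by linarith
qed

lemma tail_div_l1:
  fixes v :: "int \<Rightarrow> complex"
  assumes "\<bar>\<xi>\<bar> \<le> 1/2" "l1_le v M"
  shows "l1_le (tail (\<lambda>n. v n / of_real (of_int n + \<xi>))) M"
proof (rule l1_le_compare[OF assms(2)])
  fix n :: int
  show "cmod (tail (\<lambda>n. v n / of_real (of_int n + \<xi>)) n) \<le> cmod (v n)"
  proof (cases "n \<in> Core")
    case False
    then have "2 \<le> \<bar>real_of_int n\<bar>" by (auto simp: Core_def)
    then have "1 \<le> \<bar>of_int n + \<xi>\<bar>" using assms(1) by linarith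
    moreover have "norm (complex_of_real (of_int n + \<xi>)) = \<bar>of_int n + \<xi>\<bar>" by (rule norm_of_real)
    ultimately show ?thesis using False mult_left_mono[of 1 "\<bar>of_int n + \<xi>\<bar>" "cmod (v n)"]
      by (simp add: tail_def norm_divide divide_le_eq del: of_real_add)
  qed (simp add: tail_def)
qed

text \<open>An eigenvector of the reduced matrix sums to an eigenfunction, which violates the lower
  bound in the resolvent set. For \<xi> \<noteq> 0 no divisor n + \<xi> vanishes, so the eigenvalue
  equation expresses \<open>Aop\<close> through v, and the eigenfunction lies in the domain.\<close>

lemma core_eigenvalue_in_spectrum:
  assumes xi: "\<bar>\<xi>\<bar> \<le> \<xi>0" "\<xi> \<noteq> 0" and ev: "core_eigenvalue (Bm \<xi> (frame \<xi>)) \<mu>"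
  shows "\<i> * \<mu> \<in> L2per_spectrum (bloch_operator g d T k w c \<xi>)"
  unfolding L2per_spectrum_def
proof
  assume res: "\<i> * \<mu> \<in> L2per_resolvent_set (bloch_operator g d T k w c \<xi>)"
  obtain u where nz: "\<exists>i\<in>Core. u i \<noteq> 0" and u: "\<And>i. i \<in> Core \<Longrightarrow> (\<Sum>j\<in>Core. of_real (Bm \<xi> (frame \<xi>) i j) * u j) = \<mu> * u i"
    using ev unfolding core_eigenvalue_def by blast
  define v where "v = combine \<xi> u"
  obtain M where v: "l1_le v M" unfolding v_def using combine_l1[OF xi(1)] by blast
  have D: "of_real (of_int n + \<xi>) * Aop \<xi> v n = \<mu> * v n" for n
    using eigenvector_sequence[OF xi(1) u, of n] by (simp add: Defect_def v_def)
  have half: "\<bar>\<xi>\<bar> \<le> 1/2" by (rule xi_half[OF xi(1)])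
  have nz': "of_int n + \<xi> \<noteq> 0" for n
  proof (cases "n = 0")
    case False
    then have "1 \<le> \<bar>n\<bar>" by linarith
    then have "1 \<le> \<bar>real_of_int n\<bar>" by linarith
    then show ?thesis using half by linarith
  qed (use xi(2) in simp)
  have "l1_le (\<lambda>n. \<mu> * v n) (norm \<mu> * M)" by (rule l1_le_scale[OF v]) (auto simp: norm_mult)
  then have "l1_le (tail (\<lambda>n. (\<mu> * v n) / of_real (of_int n + \<xi>))) (norm \<mu> * M)" by (rule tail_div_l1[OF half])
  moreover have "(\<lambda>n. (\<mu> * v n) / of_real (of_int n + \<xi>)) = Aop \<xi> v"
    using nz' by (simp add: fun_eq_iff D[symmetric] del: of_real_add)
  ultimately have tl: "l1_le (tail (Aop \<xi> v)) (norm \<mu> * M)" by simp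
  have psi: "(\<lambda>z. \<i> * \<mu> * fseries v z) \<in> L2per"
    using L2per_linear[OF fseries_L2per[OF v] fseries_L2per[OF v], of "\<i> * \<mu>" 0] by simp
  have in_op: "(fseries v, \<lambda>z. \<i> * \<mu> * fseries v z) \<in> bloch_operator g d T k w c \<xi>"
    by (rule bloch_operatorI[OF v tl psi])
      (simp add: fourier_coeff_cmult fourier_coeff_fseries[OF v] mult.assoc D del: of_real_add)
  obtain C where "L2per_norm \<phi> \<le> C * L2per_norm (\<lambda>z. \<i> * \<mu> * \<phi> z - \<psi> z)" if "(\<phi>, \<psi>) \<in> bloch_operator g d T k w c \<xi>" for \<phi> \<psi>
    using res unfolding L2per_resolvent_set_def by blast
  from this[OF in_op] have 0: "L2per_norm (fseries v) \<le> 0" by (simp add: L2per_norm_per)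
  have "v n = 0" for n
    using order_trans[OF fourier_coeff_le_L2per_norm[OF fseries_L2per[OF v], of n] 0] by (simp add: fourier_coeff_fseries[OF v])
  then show False using nz combine_core[OF xi(1)] by (metis v_def)
qed

text \<open>If \<mu> is not a core eigenvalue, the resolvent equation has a solution with summable
  coefficients. For the lower bound an arbitrary element of the domain is compared with the solution
  for the same right-hand side: uniqueness among bounded sequences makes the coefficients equal, and
  their l^1 bound controls the sup norm and thus the norm of the space.\<close>

lemma spectrum_core_eigenvalue:
  assumes xi: "\<bar>\<xi>\<bar> \<le> \<xi>0" and mu: "cmod \<mu> \<le> \<gamma> / 8"
    and spec: "\<i> * \<mu> \<in> L2per_spectrum (bloch_operator g d T k w c \<xi>)"
  shows "core_eigenvalue (Bm \<xi> (frame \<xi>)) \<mu>"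
proof (rule ccontr)
  assume no: "\<not> core_eigenvalue (Bm \<xi> (frame \<xi>)) \<mu>"
  have half: "\<bar>\<xi>\<bar> \<le> 1/2" by (rule xi_half[OF xi])
  obtain C where C: "0 \<le> C" and surj: "\<And>f N. (\<And>i. i \<in> Core \<Longrightarrow> norm (f i) \<le> N) \<Longrightarrow>
       l1_le (tail (\<lambda>n. f n / of_real (of_int n + \<xi>))) N \<Longrightarrow> \<exists>v. l1_le v (C * N) \<and> (\<forall>n. Defect \<xi> \<mu> v n = f n)"
    by (rule Defect_surjective[OF xi mu no]) blast
  obtain C1 where C1: "\<And>f. f \<in> L2per \<Longrightarrow> l1_le (\<lambda>n. if \<bar>n\<bar> \<le> 1 then 0 else fourier_coeff f n / of_real (of_int n + \<xi>)) (C1 * L2per_norm f)"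
    using fourier_coeff_div_l1 half by blast
  define C2 where "C2 = max 1 C1"
  have solve: "\<exists>v. l1_le v (C * (C2 * L2per_norm f)) \<and> (\<forall>n. Defect \<xi> \<mu> v n = - \<i> * fourier_coeff f n)
      \<and> l1_le (tail (\<lambda>n. - \<i> * fourier_coeff f n / of_real (of_int n + \<xi>))) (C2 * L2per_norm f)"
    if f: "f \<in> L2per" for f
  proof -
    have n0: "0 \<le> L2per_norm f" by (simp add: L2per_norm_per)
    have le: "L2per_norm f \<le> C2 * L2per_norm f" "C1 * L2per_norm f \<le> C2 * L2per_norm f"
      using mult_right_mono[OF _ n0, of 1 C2] mult_right_mono[OF _ n0, of C1 C2] by (auto simp: C2_def)
    have "l1_le (tail (\<lambda>n. - \<i> * fourier_coeff f n / of_real (of_int n + \<xi>))) (C1 * L2per_norm f)"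
      by (rule l1_le_compare[OF C1[OF f]]) (auto simp: tail_def Core_def norm_mult norm_divide)
    then have t: "l1_le (tail (\<lambda>n. - \<i> * fourier_coeff f n / of_real (of_int n + \<xi>))) (C2 * L2per_norm f)"
      by (rule l1_le_mono[OF _ le(2)])
    have "norm (- \<i> * fourier_coeff f i) \<le> C2 * L2per_norm f" for i
      using order_trans[OF fourier_coeff_le_L2per_norm[OF f] le(1)] by (simp add: norm_mult)
    from surj[OF this t] t show ?thesis by blast
  qed
  have "\<i> * \<mu> \<in> L2per_resolvent_set (bloch_operator g d T k w c \<xi>)"
    unfolding L2per_resolvent_set_def mem_Collect_eq
  proof (intro conjI ballI)
    fix f assume f: "f \<in> L2per"
    obtain v where v: "l1_le v (C * (C2 * L2per_norm f))" and D: "\<And>n. Defect \<xi> \<mu> v n = - \<i> * fourier_coeff f n"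
      and t: "l1_le (tail (\<lambda>n. - \<i> * fourier_coeff f n / of_real (of_int n + \<xi>))) (C2 * L2per_norm f)"
      using solve[OF f] by blast
    have A: "of_real (of_int n + \<xi>) * Aop \<xi> v n = \<mu> * v n + \<i> * fourier_coeff f n" for n
      using D[of n] by (simp add: Defect_def algebra_simps)
    have "l1_le (\<lambda>n. \<mu> * v n) (norm \<mu> * (C * (C2 * L2per_norm f)))" by (rule l1_le_scale[OF v]) (auto simp: norm_mult)
    from l1_le_diff[OF tail_div_l1[OF half this] t]
    have "l1_le (\<lambda>n. tail (\<lambda>n. \<mu> * v n / of_real (of_int n + \<xi>)) n - tail (\<lambda>n. - \<i> * fourier_coeff f n / of_real (of_int n + \<xi>)) n)
        (norm \<mu> * (C * (C2 * L2per_norm f)) + C2 * L2per_norm f)" .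
    moreover have "tail (\<lambda>n. \<mu> * v n / of_real (of_int n + \<xi>)) n - tail (\<lambda>n. - \<i> * fourier_coeff f n / of_real (of_int n + \<xi>)) n = tail (Aop \<xi> v) n" for n
    proof (cases "n \<in> Core")
      case False
      then have "2 \<le> \<bar>real_of_int n\<bar>" by (auto simp: Core_def)
      then have "of_int n + \<xi> \<noteq> 0" using half by linarith
      then have "complex_of_real (of_int n + \<xi>) \<noteq> 0" by (simp only: of_real_eq_0_iff not_False_eq_True)
      then have "Aop \<xi> v n = (\<mu> * v n + \<i> * fourier_coeff f n) / of_real (of_int n + \<xi>)"
        by (simp add: A[symmetric] del: of_real_add)
      then show ?thesis using False by (simp add: tail_def add_divide_distrib del: of_real_add)
    qed (simp add: tail_def)
    ultimately have tl: "l1_le (tail (Aop \<xi> v)) (norm \<mu> * (C * (C2 * L2per_norm f)) + C2 * L2per_norm f)" by simp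
    have psi: "(\<lambda>z. \<i> * \<mu> * fseries v z + (- 1) * f z) \<in> L2per" by (rule L2per_linear[OF fseries_L2per[OF v] f])
    have i: "integrable per (\<lambda>z. \<i> * \<mu> * fseries v z)" "integrable per (\<lambda>z. (- 1) * f z)"
      using L2per_integrable[OF fseries_L2per[OF v]] L2per_integrable[OF f] by simp_all
    have "(fseries v, \<lambda>z. \<i> * \<mu> * fseries v z + (- 1) * f z) \<in> bloch_operator g d T k w c \<xi>"
    proof (rule bloch_operatorI[OF v tl psi])
      fix n
      have "fourier_coeff (\<lambda>z. \<i> * \<mu> * fseries v z + (- 1) * f z) n = \<i> * \<mu> * v n + (- 1) * fourier_coeff f n"
        by (simp only: fourier_coeff_add[OF i] fourier_coeff_cmult fourier_coeff_fseries[OF v])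
      also have "\<dots> = \<i> * (\<mu> * v n + \<i> * fourier_coeff f n)" by (simp add: algebra_simps)
      finally show "fourier_coeff (\<lambda>z. \<i> * \<mu> * fseries v z + (- 1) * f z) n = \<i> * of_real (of_int n + \<xi>) * Aop \<xi> v n"
        by (simp only: A mult.assoc)
    qed
    then show "\<exists>(\<phi>, \<psi>)\<in>bloch_operator g d T k w c \<xi>. AE z in lborel. \<i> * \<mu> * \<phi> z - \<psi> z = f z"
      by (rule bexI[rotated]) simp
  next
    show "\<exists>C. \<forall>(\<phi>, \<psi>)\<in>bloch_operator g d T k w c \<xi>. L2per_norm \<phi> \<le> C * L2per_norm (\<lambda>z. \<i> * \<mu> * \<phi> z - \<psi> z)"
    proof (intro exI[of _ "sqrt (2 * pi) * (C * C2)"] ballI, clarify)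
      fix \<phi> \<psi> assume pair: "(\<phi>, \<psi>) \<in> bloch_operator g d T k w c \<xi>"
      note op = bloch_operator_coeff[OF pair]
      define f where "f z = \<i> * \<mu> * \<phi> z - \<psi> z" for z
      have f: "f \<in> L2per" using L2per_linear[OF op(1,2), of "\<i> * \<mu>" "-1"] by (simp add: f_def[abs_def])
      have ip: "integrable per \<phi>" "integrable per \<psi>" using op by (auto intro: L2per_integrable)
      have fc: "fourier_coeff f n = \<i> * Defect \<xi> \<mu> (fourier_coeff \<phi>) n" for n
      proof -
        have "fourier_coeff f n = \<i> * \<mu> * fourier_coeff \<phi> n - fourier_coeff \<psi> n"
          unfolding f_def using ip by (simp only: fourier_coeff_diff integrable_mult_right fourier_coeff_cmult)
        then show ?thesis by (simp only: op(3) Defect_def mult.assoc right_diff_distrib)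
      qed
      obtain v where v: "l1_le v (C * (C2 * L2per_norm f))" and D: "\<And>n. Defect \<xi> \<mu> v n = - \<i> * fourier_coeff f n"
        using solve[OF f] by blast
      have D': "Defect \<xi> \<mu> v n = Defect \<xi> \<mu> (fourier_coeff \<phi>) n" for n by (simp add: D fc)
      have "(\<lambda>n. fourier_coeff \<phi> n + (- 1) * v n) = (\<lambda>_. 0)"
      proof (rule Defect_unique[OF xi mu no])
        have b: "cmod (- 1 * v n) \<le> C * (C2 * L2per_norm f)" for n using l1_le_norm[OF v] by (simp add: norm_mult)
        show "cmod (fourier_coeff \<phi> n + (- 1) * v n) \<le> (\<integral>z. cmod (\<phi> z) \<partial>per) / (2 * pi) + C * (C2 * L2per_norm f)" for n
          by (rule norm_triangle_mono[OF fourier_coeff_bound[OF ip(1)] b])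
        show "Defect \<xi> \<mu> (\<lambda>n. fourier_coeff \<phi> n + (- 1) * v n) n = 0" for n
        proof -
          have A: "Aop \<xi> (\<lambda>n. fourier_coeff \<phi> n + (- 1) * v n) n = Aop \<xi> (fourier_coeff \<phi>) n + (- 1) * Aop \<xi> v n"
            using Aop_add[where v="fourier_coeff \<phi>" and w="\<lambda>n. - 1 * v n" and \<xi>=\<xi> and n=n, OF fourier_coeff_bound[OF ip(1)] b]
            by (simp only: Aop_cmult)
          show ?thesis using D'[of n] unfolding Defect_def A by (simp add: algebra_simps)
        qed
      qed
      then have eq: "fourier_coeff \<phi> n = v n" for n by (simp add: fun_eq_iff)
      have iv: "integrable per (fseries v)" by (rule L2per_integrable[OF fseries_L2per[OF v]])
      have "AE z in per. \<phi> z - fseries v z = 0"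
      proof (rule fourier_coeff_zero_AE)
        show "(\<lambda>z. \<phi> z - fseries v z) \<in> borel_measurable borel"
          using op(1) by (intro borel_measurable_diff fseries_measurable[OF v]) (simp add: L2per_iff)
        show "integrable per (\<lambda>z. \<phi> z - fseries v z)" using ip iv by simp
        show "fourier_coeff (\<lambda>z. \<phi> z - fseries v z) n = 0" for n
          by (simp add: fourier_coeff_diff[OF ip(1) iv] eq fourier_coeff_fseries[OF v])
      qed
      then have "AE z in per. cmod (\<phi> z) \<le> C * (C2 * L2per_norm f)"
        by eventually_elim (use fseries_norm[OF v] in simp)
      from L2per_norm_bound[OF op(1) this l1_le_nonneg[OF v]]
      show "L2per_norm \<phi> \<le> sqrt (2 * pi) * (C * C2) * L2per_norm (\<lambda>z. \<i> * \<mu> * \<phi> z - \<psi> z)"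
        by (simp add: f_def[abs_def] mult.assoc)
    qed
  qed
  then show False using spec by (simp add: L2per_spectrum_def)
qed

end

section \<open>The dispersion symbol\<close>

text \<open>The case c = 0 means positivity on the open half-line; with it included, weak and strong
  surface tension are treated alike.\<close>

definition neg_then_pos :: "real \<Rightarrow> (real \<Rightarrow> real) \<Rightarrow> bool" where
  "neg_then_pos c f \<longleftrightarrow> 0 \<le> c \<and> (\<forall>x. 0 < x \<and> x < c \<longrightarrow> f x < 0) \<and> (\<forall>x>c. 0 < f x)"

text \<open>The function falls from 0 until c and rises afterwards. If it is positive somewhere, it
  crosses zero exactly once, or not at all when c = 0. A sign pattern can thus be integrated
  repeatedly.\<close>

lemma neg_then_pos_primitive:
  assumes f': "neg_then_pos c f'" and f0: "f 0 = 0"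
    and der: "\<And>x. 0 \<le> x \<Longrightarrow> (f has_real_derivative f' x) (at x)"
    and pos: "0 < f x0" "0 < x0"
  obtains c' where "neg_then_pos c' f" "c = 0 \<Longrightarrow> c' = 0"
proof -
  have c0: "0 \<le> c" using f' by (simp add: neg_then_pos_def)
  have cont: "continuous_on {a..b} f" if "0 \<le> a" for a b
    using that by (intro continuous_at_imp_continuous_on ballI DERIV_isCont[OF der]) auto
  have inc: "f a < f b" if "c \<le> a" "a < b" for a b
  proof (rule DERIV_pos_imp_increasing_open[OF that(2)])
    fix x assume "a < x" "x < b"
    then show "\<exists>y. (f has_real_derivative y) (at x) \<and> 0 < y"
      using der[of x] f' c0 that by (auto simp: neg_then_pos_def)
  qed (use cont[of a b] c0 that in auto)
  have dec: "f b < f a" if "0 \<le> a" "a < b" "b \<le> c" for a b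
  proof (rule DERIV_neg_imp_decreasing_open[OF that(2)])
    fix x assume "a < x" "x < b"
    then show "\<exists>y. (f has_real_derivative y) (at x) \<and> y < 0"
      using der[of x] f' that by (auto simp: neg_then_pos_def)
  qed (use cont[of a b] that in auto)
  show ?thesis
  proof (cases "c = 0")
    case True
    then show ?thesis using inc[of 0] f0 by (intro that[of 0]) (auto simp: neg_then_pos_def)
  next
    case False
    then have fc: "f c < 0" using dec[of 0 c] c0 f0 by auto
    have x0: "c < x0"
    proof (rule ccontr)
      assume "\<not> c < x0" then show False using dec[of 0 x0] pos f0 by auto
    qed
    obtain c' where c': "c \<le> c'" "c' \<le> x0" "f c' = 0"
      using IVT'[of f c 0 x0] fc pos x0 cont[OF c0] by auto
    have "c < c'" using c' fc by (cases "c = c'") auto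
    have "f x < 0" if "0 < x" "x < c'" for x
    proof (cases "x \<le> c")
      case True then show ?thesis using dec[of 0 x] that f0 by auto
    next
      case False then show ?thesis using inc[of x c'] that c' by auto
    qed
    moreover have "0 < f x" if "c' < x" for x using inc[of c' x] that c' by auto
    ultimately show ?thesis using c0 \<open>c < c'\<close> False by (intro that[of c']) (auto simp: neg_then_pos_def)
  qed
qed

text \<open>By \<open>M1_sign\<close> this function carries the sign of the derivative of m^2. It
  and its first two derivatives vanish at 0, and the third is cosh x times a function J increasing
  on the half-line. The sign pattern of J is integrated three times; J 0 = 12 \<tau> - 4 is the
  origin of the threshold 1/3.\<close>

lemma discriminant_sign:
  fixes \<tau> :: real
  assumes tau: "0 < \<tau>"
  obtains c where "neg_then_pos c (\<lambda>x. \<tau> * (x\<^sup>2 * sinh x + x ^ 3) - 4 * sinh x + 4 * x)"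
    "1 / 3 \<le> \<tau> \<Longrightarrow> c = 0"
proof -
  define D3 where "D3 x = cosh x * (\<tau> * (6 + 6 * (x * tanh x) + x\<^sup>2 + 6 / cosh x) - 4)" for x :: real
  define D2 where "D2 x = \<tau> * (2 * sinh x + 4 * x * cosh x + x\<^sup>2 * sinh x + 6 * x) - 4 * sinh x" for x :: real
  define D1 where "D1 x = \<tau> * (2 * x * sinh x + x\<^sup>2 * cosh x + 3 * x\<^sup>2) - 4 * cosh x + 4" for x :: real
  define D0 where "D0 x = \<tau> * (x\<^sup>2 * sinh x + x ^ 3) - 4 * sinh x + 4 * x" for x :: real
  define J where "J x = \<tau> * (6 + 6 * (x * tanh x) + x\<^sup>2 + 6 / cosh x) - 4" for x :: real
  define J' where "J' x = \<tau> * (6 * (tanh x * (1 - 1 / cosh x)) + 6 * (x * (1 - (tanh x)\<^sup>2)) + 2 * x)" for x :: real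
  have cosh_nz: "cosh x \<noteq> 0" for x :: real using cosh_real_pos[of x] by simp
  have dJ: "(J has_real_derivative J' x) (at x)" for x
  proof -
    have dt: "(tanh has_real_derivative 1 - (tanh x)\<^sup>2) (at x)"
      using cosh_nz by (auto intro!: derivative_eq_intros)
    have dc: "((\<lambda>x. 6 / cosh x) has_real_derivative (0 * cosh x - 6 * (sinh x * 1)) / (cosh x * cosh x)) (at x)"
      by (intro DERIV_divide DERIV_const has_field_derivative_cosh DERIV_ident cosh_nz)
    have dq: "((\<lambda>x. x\<^sup>2) has_real_derivative 2 * x) (at x)" by (auto intro!: derivative_eq_intros)
    have "(J has_real_derivative \<tau> * (0 + 6 * (1 * tanh x + (1 - (tanh x)\<^sup>2) * x) + 2 * x
        + (0 * cosh x - 6 * (sinh x * 1)) / (cosh x * cosh x)) - 0) (at x)"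
      unfolding J_def
      by (rule dt dc dq DERIV_diff DERIV_cmult DERIV_add DERIV_mult DERIV_const DERIV_ident)+
    moreover have "(0 * cosh x - 6 * (sinh x * 1)) / (cosh x * cosh x) = - 6 * (tanh x * (1 / cosh x))"
      by (simp add: tanh_def)
    moreover have "\<tau> * (0 + 6 * (1 * t + s * x) + 2 * x + - 6 * (t * u)) - 0 = \<tau> * (6 * (t * (1 - u)) + 6 * (x * s) + 2 * x)"
      for t s u by (simp add: algebra_simps)
    ultimately show ?thesis unfolding J'_def by metis
  qed
  have J'_pos: "0 < J' x" if "0 < x" for x
  proof -
    have "1 < cosh x" using that cosh_real_strict_mono[of 0 x] by simp
    then have "0 < 1 - 1 / cosh x" by simp
    moreover have "0 < tanh x" using that by simp
    moreover have "(tanh x)\<^sup>2 < 1" using tanh_real_bounds[of x] unfolding abs_square_less_1 by (auto simp: abs_less_iff)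
    ultimately show ?thesis using tau that unfolding J'_def by (intro mult_pos_pos add_pos_pos) auto
  qed
  have J0: "J 0 = 12 * \<tau> - 4" by (simp add: J_def)
  \<comment> \<open>Any x0 > 0 with \<tau> x0^2 > 4 makes the leading terms outweigh -4, -4 sinh and
    -4 cosh, so that J and all its primitives are positive there.\<close>
  define x0 where "x0 = 2 / sqrt \<tau> + 2"
  have x0: "0 < x0" "4 < \<tau> * x0\<^sup>2"
  proof -
    show "0 < x0" using tau by (simp add: x0_def add_pos_pos)
    have "\<tau> * x0\<^sup>2 = (sqrt \<tau> * x0)\<^sup>2" using tau by (simp add: power_mult_distrib)
    moreover have "sqrt \<tau> * x0 = 2 + 2 * sqrt \<tau>" using tau by (simp add: x0_def field_simps)
    ultimately have "\<tau> * x0\<^sup>2 = (2 + 2 * sqrt \<tau>)\<^sup>2" by simp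
    moreover have "2\<^sup>2 < (2 + 2 * sqrt \<tau>)\<^sup>2" using tau by (intro power_strict_mono) auto
    ultimately show "4 < \<tau> * x0\<^sup>2" by simp
  qed
  have sx: "0 < sinh x0" "0 < cosh x0" using x0 by auto
  have Jx0: "0 < J x0"
  proof -
    have "0 \<le> \<tau> * (6 + 6 * (x0 * tanh x0) + 6 / cosh x0)" using tau x0 sx by auto
    then show ?thesis using x0 by (simp add: J_def algebra_simps)
  qed
  have Jinc: "J a < J b" if "0 \<le> a" "a < b" for a b
  proof (rule DERIV_pos_imp_increasing_open[OF that(2)])
    show "\<exists>y. (J has_real_derivative y) (at x) \<and> 0 < y" if "a < x" "x < b" for x
      using dJ[of x] J'_pos[of x] that \<open>0 \<le> a\<close> by auto
    show "continuous_on {a..b} J"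
      using dJ by (intro continuous_at_imp_continuous_on ballI) (blast intro: DERIV_isCont)
  qed
  obtain c3 where c3: "neg_then_pos c3 J" "1 / 3 \<le> \<tau> \<Longrightarrow> c3 = 0"
  proof (cases "1 / 3 \<le> \<tau>")
    case True
    then have "0 < J x" if "0 < x" for x using Jinc[of 0 x] that J0 by simp
    then show ?thesis by (intro that[of 0]) (auto simp: neg_then_pos_def)
  next
    case False
    then have "J 0 < 0" using J0 by simp
    moreover have "continuous_on {0..x0} J"
      using dJ by (intro continuous_at_imp_continuous_on ballI) (blast intro: DERIV_isCont)
    ultimately obtain c where c: "0 \<le> c" "c \<le> x0" "J c = 0" using IVT'[of J 0 0 x0] Jx0 x0 by auto
    have "J x < 0" if "0 < x" "x < c" for x using Jinc[of x c] that c by simp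
    moreover have "0 < J x" if "c < x" for x using Jinc[of c x] that c by simp
    ultimately have "neg_then_pos c J" using c by (simp add: neg_then_pos_def)
    then show ?thesis using that False by blast
  qed
  have D3: "neg_then_pos c3 D3"
    using c3(1) unfolding neg_then_pos_def D3_def J_def by (auto simp: mult_pos_neg)
  have D3_eq: "D3 x = \<tau> * (6 * cosh x + 6 * x * sinh x + x\<^sup>2 * cosh x + 6) - 4 * cosh x" for x
  proof -
    have "sinh x = cosh x * tanh x" by (simp add: tanh_def cosh_nz)
    moreover have "cosh x * (6 / cosh x) = 6" by (simp add: cosh_nz)
    moreover have "u * (\<tau> * (6 + 6 * (x * t) + x\<^sup>2 + v) - 4)
        = \<tau> * (6 * u + 6 * x * (u * t) + x\<^sup>2 * u + u * v) - 4 * u" for u t v :: real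
      by (simp add: algebra_simps)
    ultimately show ?thesis unfolding D3_def by metis
  qed
  have d2: "(D2 has_real_derivative D3 x) (at x)" for x
    unfolding D2_def D3_eq by (auto intro!: derivative_eq_intros simp: algebra_simps)
  have d1: "(D1 has_real_derivative D2 x) (at x)" for x
    unfolding D1_def D2_def by (auto intro!: derivative_eq_intros simp: algebra_simps)
  have d0: "(D0 has_real_derivative D1 x) (at x)" for x
    unfolding D0_def D1_def by (auto intro!: derivative_eq_intros simp: algebra_simps power2_eq_square)
  have big: "4 * y < \<tau> * (x0\<^sup>2 * y)" if "0 < y" for y
    using mult_strict_right_mono[OF x0(2) that] by (simp only: mult.assoc)
  have z: "D2 0 = 0" "D1 0 = 0" "D0 0 = 0" by (simp_all add: D2_def D1_def D0_def)
  have p2: "0 < D2 x0"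
  proof -
    have "0 < \<tau> * (2 * sinh x0 + 4 * x0 * cosh x0 + 6 * x0)" using tau x0 sx by (intro mult_pos_pos add_pos_pos) auto
    moreover have "D2 x0 = \<tau> * (2 * sinh x0 + 4 * x0 * cosh x0 + 6 * x0) + \<tau> * (x0\<^sup>2 * sinh x0) - 4 * sinh x0"
      by (simp add: D2_def algebra_simps)
    ultimately show ?thesis using big[OF sx(1)] by linarith
  qed
  obtain c2 where c2: "neg_then_pos c2 D2" "c3 = 0 \<Longrightarrow> c2 = 0"
    using neg_then_pos_primitive[OF D3 z(1) d2 p2 x0(1)] by blast
  have p1: "0 < D1 x0"
  proof -
    have "0 < \<tau> * (2 * x0 * sinh x0 + 3 * x0\<^sup>2)" using tau x0 sx by (intro mult_pos_pos add_pos_pos) auto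
    moreover have "D1 x0 = \<tau> * (2 * x0 * sinh x0 + 3 * x0\<^sup>2) + \<tau> * (x0\<^sup>2 * cosh x0) - 4 * cosh x0 + 4"
      by (simp add: D1_def algebra_simps)
    ultimately show ?thesis using big[OF sx(2)] by linarith
  qed
  obtain c1 where c1: "neg_then_pos c1 D1" "c2 = 0 \<Longrightarrow> c1 = 0"
    using neg_then_pos_primitive[OF c2(1) z(2) d1 p1 x0(1)] by blast
  have p0: "0 < D0 x0"
  proof -
    have "0 < \<tau> * x0 ^ 3" using tau x0 by simp
    moreover have "D0 x0 = \<tau> * x0 ^ 3 + \<tau> * (x0\<^sup>2 * sinh x0) - 4 * sinh x0 + 4 * x0"
      by (simp add: D0_def algebra_simps)
    ultimately show ?thesis using big[OF sx(1)] x0(1) by linarith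
  qed
  obtain c0 where c0: "neg_then_pos c0 D0" "c1 = 0 \<Longrightarrow> c0 = 0"
    using neg_then_pos_primitive[OF c1(1) z(3) d0 p0 x0(1)] by blast
  show ?thesis using that[of c0] c0 c1 c2 c3 unfolding D0_def by blast
qed

section \<open>Explicit derivatives of the phase speed\<close>

locale dispersion =
  fixes g d T :: real
  assumes g: "0 < g" and d: "0 < d" and T: "0 < T"
begin

abbreviation m :: "real \<Rightarrow> real" where "m \<equiv> phase_speed g d T"

definition A :: real where "A = g * d"
definition B :: real where "B = T / d"
text \<open>The square of m away from 0, where the parameter T / (g d^2) appears as B / A.
  \<open>M1\<close> and \<open>M2\<close> are its derivatives, \<open>m1\<close> and
  \<open>m2\<close> those of m on the positive half-line; all are written in tanh k and 1 - (tanh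
  k)^2, for which bounds are at hand.\<close>

definition M :: "real \<Rightarrow> real" where "M k = A * (tanh k / k) + B * (k * tanh k)"
definition M1 :: "real \<Rightarrow> real" where
  "M1 k = A * ((1 - (tanh k)\<^sup>2) / k - tanh k / k\<^sup>2) + B * (tanh k + k * (1 - (tanh k)\<^sup>2))"
definition M2 :: "real \<Rightarrow> real" where
  "M2 k = A * (- 2 * tanh k * (1 - (tanh k)\<^sup>2) / k - 2 * (1 - (tanh k)\<^sup>2) / k\<^sup>2 + 2 * tanh k / k ^ 3)
        + B * (2 * (1 - (tanh k)\<^sup>2) - 2 * (k * (1 - (tanh k)\<^sup>2)) * tanh k)"
definition m1 :: "real \<Rightarrow> real" where "m1 k = M1 k / (2 * m k)"
definition m2 :: "real \<Rightarrow> real" where "m2 k = M2 k / (2 * m k) - (M1 k)\<^sup>2 / (4 * (m k) ^ 3)"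

lemma A_pos: "0 < A" and B_pos: "0 < B" using g d T by (simp_all add: A_def B_def)

lemma m_eq: "k \<noteq> 0 \<Longrightarrow> m k = sqrt (M k)"
  using g d by (simp add: phase_speed_def M_def A_def B_def field_simps power2_eq_square)

lemma m_0: "m 0 = sqrt A" by (simp add: phase_speed_def A_def)

lemma m_even: "m (- k) = m k" by (simp add: phase_speed_def)

lemma M_ge: assumes "0 < k" shows "B * (k * tanh k) \<le> M k" "0 < M k"
  using assms A_pos B_pos by (auto simp: M_def intro!: add_pos_pos mult_pos_pos)

lemma m_pos: "0 < k \<Longrightarrow> 0 < m k" using M_ge by (simp add: m_eq)

lemma m_square: "0 < k \<Longrightarrow> (m k)\<^sup>2 = M k" using M_ge(2)[of k] by (simp add: m_eq)

lemma M_deriv: "0 < k \<Longrightarrow> (M has_real_derivative M1 k) (at k)"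
  unfolding M_def[abs_def] M1_def
  by (auto intro!: derivative_eq_intros) (simp add: field_simps power2_eq_square)

lemma M1_deriv: assumes "0 < k" shows "(M1 has_real_derivative M2 k) (at k)"
proof -
  define t s where "t = tanh k" and "s = 1 - (tanh k)\<^sup>2"
  have c: "cosh k \<noteq> 0" using cosh_real_pos[of k] by simp
  have dt: "(tanh has_real_derivative s) (at k)" unfolding s_def using c by (auto intro!: derivative_eq_intros)
  have "((\<lambda>k. 1 - (tanh k)\<^sup>2) has_real_derivative 0 - of_nat 2 * (s * tanh k ^ (2 - Suc 0))) (at k)"
    by (intro DERIV_diff DERIV_const DERIV_power dt)
  then have ds: "((\<lambda>k. 1 - (tanh k)\<^sup>2) has_real_derivative - 2 * (t * s)) (at k)"
    by (simp add: t_def mult.commute)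
  have nz: "k \<noteq> 0" "k\<^sup>2 \<noteq> 0" using assms by auto
  have dq: "((\<lambda>k. k\<^sup>2) has_real_derivative 2 * k) (at k)" by (auto intro!: derivative_eq_intros)
  have D: "(M1 has_real_derivative A * ((- 2 * (t * s) * k - s * 1) / (k * k) - (s * k\<^sup>2 - t * (2 * k)) / (k\<^sup>2 * k\<^sup>2))
      + B * (s + (1 * s + - 2 * (t * s) * k))) (at k)"
    unfolding M1_def[abs_def]
    by (rule DERIV_cong, (rule ds dt dq nz DERIV_add DERIV_cmult DERIV_diff DERIV_divide DERIV_mult DERIV_ident)+)
       (simp add: t_def s_def)
  have alg: "(- 2 * (t * s) * k - s * 1) / (k * k) - (s * k\<^sup>2 - t * (2 * k)) / (k\<^sup>2 * k\<^sup>2)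
      = - 2 * t * s / k - 2 * s / k\<^sup>2 + 2 * t / k ^ 3" for t s :: real
    using assms by (simp add: field_simps power2_eq_square power3_eq_cube)
  have M2_eq: "M2 k = A * (- 2 * t * s / k - 2 * s / k\<^sup>2 + 2 * t / k ^ 3) + B * (2 * s - 2 * (k * s) * t)"
    by (simp add: M2_def t_def s_def)
  have B_eq: "B * (s + (1 * s + - 2 * (t * s) * k)) = B * (2 * s - 2 * (k * s) * t)" by (simp add: algebra_simps)
  show ?thesis using D unfolding alg M2_eq B_eq .
qed

lemma m_deriv: assumes "0 < k" shows "(m has_real_derivative m1 k) (at k)"
proof -
  have "((\<lambda>k. sqrt (M k)) has_real_derivative (inverse (sqrt (M k)) / 2 * M1 k)) (at k)"
    by (rule DERIV_chain2[OF DERIV_real_sqrt M_deriv]) (use assms M_ge in auto)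
  then have "(m has_real_derivative (inverse (sqrt (M k)) / 2 * M1 k)) (at k)"
    by (rule has_field_derivative_transform_within_open[where S="{0<..}"]) (use assms in \<open>auto simp: m_eq\<close>)
  moreover have "inverse (sqrt (M k)) / 2 * M1 k = m1 k"
  proof -
    have "sqrt (M k) = m k" using m_eq assms by simp
    moreover have "inverse y / 2 * x = x / (2 * y)" for x y :: real by (simp add: divide_simps)
    ultimately show ?thesis unfolding m1_def by simp
  qed
  ultimately show ?thesis by simp
qed

lemma m1_deriv: assumes "0 < k" shows "(m1 has_real_derivative m2 k) (at k)"
proof -
  have nz: "m k \<noteq> 0" using m_pos[OF assms] by simp
  have "((\<lambda>k. M1 k / (2 * m k)) has_real_derivative (M2 k * (2 * m k) - M1 k * (2 * m1 k)) / ((2 * m k) * (2 * m k))) (at k)"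
    using nz by (intro DERIV_divide DERIV_cmult M1_deriv m_deriv assms) auto
  moreover have "(a * (2 * y) - b * (2 * (b / (2 * y)))) / ((2 * y) * (2 * y)) = a / (2 * y) - b\<^sup>2 / (4 * y ^ 3)"
    if "y \<noteq> 0" for a b y :: real
    using that by (simp add: field_simps power2_eq_square power3_eq_cube)
  from this[OF nz, of "M2 k" "M1 k"]
  have "(M2 k * (2 * m k) - M1 k * (2 * m1 k)) / ((2 * m k) * (2 * m k)) = m2 k"
    unfolding m1_def m2_def .
  ultimately show ?thesis by (simp add: m1_def[abs_def])
qed

lemma one_minus_tanh: fixes k :: real shows "0 \<le> 1 - (tanh k)\<^sup>2" "1 - (tanh k)\<^sup>2 \<le> 1"
proof -
  have "\<bar>tanh k\<bar> \<le> 1" using tanh_real_bounds[of k] by (intro abs_leI) auto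
  then have "(tanh k)\<^sup>2 \<le> 1" by (simp add: abs_square_le_1)
  then show "0 \<le> 1 - (tanh k)\<^sup>2" "1 - (tanh k)\<^sup>2 \<le> 1" by simp_all
qed

lemma le_sinh: assumes "0 \<le> x" shows "x \<le> sinh (x::real)"
proof -
  have "sinh 0 - 0 \<le> sinh x - x"
  proof (rule DERIV_nonneg_imp_nondecreasing[OF assms])
    fix y :: real
    have "((\<lambda>x. sinh x - x) has_real_derivative cosh y - 1) (at y)" by (auto intro!: derivative_eq_intros)
    moreover have "0 \<le> cosh y - 1" using cosh_real_ge_1[of y] by simp
    ultimately show "\<exists>D. ((\<lambda>x. sinh x - x) has_real_derivative D) (at y) \<and> 0 \<le> D" by blast
  qed
  then show ?thesis by simp
qed

text \<open>The chain k \<le> sinh k \<le> 1 + sinh^2 k = cosh^2 k bounds k / cosh^2 k. The terms of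
  \<open>M1\<close> and \<open>M2\<close> with an explicit factor k stay bounded for this
  reason.\<close>

lemma k_sech: fixes k :: real assumes "0 < k" shows "0 \<le> k * (1 - (tanh k)\<^sup>2)" "k * (1 - (tanh k)\<^sup>2) \<le> 1"
proof -
  show "0 \<le> k * (1 - (tanh k)\<^sup>2)" using assms one_minus_tanh[of k] by simp
  have c: "0 < cosh k" by simp
  have "1 - (tanh k)\<^sup>2 = ((cosh k)\<^sup>2 - (sinh k)\<^sup>2) / (cosh k)\<^sup>2"
    using c by (simp add: tanh_def power_divide diff_divide_distrib)
  then have "1 - (tanh k)\<^sup>2 = 1 / (cosh k)\<^sup>2" by (simp add: cosh_square_eq)
  moreover have "k \<le> (cosh k)\<^sup>2"
  proof -
    have "sinh k \<le> (sinh k)\<^sup>2 + 1"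
    proof -
      have "(sinh k - 1)\<^sup>2 = (sinh k)\<^sup>2 - 2 * sinh k + 1" by (simp add: power2_diff)
      then show ?thesis using zero_le_power2[of "sinh k - 1"] zero_le_power2[of "sinh k"] by linarith
    qed
    then show ?thesis using le_sinh[of k] assms cosh_square_eq[of k] by simp
  qed
  ultimately show "k * (1 - (tanh k)\<^sup>2) \<le> 1" using c by (simp add: divide_le_eq)
qed

end

section \<open>Monotonicity, resonances and growth of the phase speed\<close>

context dispersion
begin

text \<open>Multiplication by cosh^2 k leaves only sinh k cosh k and constants, which the double
  angle formula expresses through 2 k; the factor k^2 clears the denominators and 8 matches the
  powers of 2 k.\<close>

lemma M1_sign:
  assumes "0 < k"
  shows "M1 k * (8 * k\<^sup>2 * (cosh k)\<^sup>2)
       = A * ((B / A) * ((2 * k)\<^sup>2 * sinh (2 * k) + (2 * k) ^ 3) - 4 * sinh (2 * k) + 4 * (2 * k))"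
proof -
  have c: "cosh k \<noteq> 0" using cosh_real_pos[of k] by simp
  have tc: "tanh k * cosh k = sinh k" using c by (simp add: tanh_def)
  have "(1 - (tanh k)\<^sup>2) * (cosh k)\<^sup>2 = (cosh k)\<^sup>2 - (tanh k * cosh k)\<^sup>2"
    by (simp add: left_diff_distrib power_mult_distrib)
  then have t2: "(1 - (tanh k)\<^sup>2) * (cosh k)\<^sup>2 = 1" unfolding tc by (simp add: cosh_square_eq)
  have "tanh k * (cosh k)\<^sup>2 = tanh k * cosh k * cosh k" by (simp only: power2_eq_square mult.assoc)
  then have t: "tanh k * (cosh k)\<^sup>2 = sinh k * cosh k" unfolding tc .
  have "M1 k * k\<^sup>2 = A * (k * (1 - (tanh k)\<^sup>2) - tanh k) + B * k\<^sup>2 * (tanh k + k * (1 - (tanh k)\<^sup>2))"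
    using assms by (simp add: M1_def field_simps power2_eq_square)
  then have "M1 k * k\<^sup>2 * (cosh k)\<^sup>2 = A * (k * ((1 - (tanh k)\<^sup>2) * (cosh k)\<^sup>2) - tanh k * (cosh k)\<^sup>2)
      + B * k\<^sup>2 * (tanh k * (cosh k)\<^sup>2 + k * ((1 - (tanh k)\<^sup>2) * (cosh k)\<^sup>2))"
    by (simp only: distrib_right left_diff_distrib right_diff_distrib distrib_left mult.assoc mult_1_left)
  then have "M1 k * k\<^sup>2 * (cosh k)\<^sup>2 = A * (k - sinh k * cosh k) + B * k\<^sup>2 * (sinh k * cosh k + k)"
    unfolding t t2 by simp
  then have h8: "8 * (M1 k * k\<^sup>2 * (cosh k)\<^sup>2) = 8 * (A * (k - sinh k * cosh k) + B * k\<^sup>2 * (sinh k * cosh k + k))" by simp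
  have alg: "A * ((B / A) * ((2 * k)\<^sup>2 * (2 * y) + (2 * k) ^ 3) - 4 * (2 * y) + 4 * (2 * k))
     = 8 * (A * (k - y) + B * k\<^sup>2 * (y + k))" for y
    using A_pos by (simp add: field_simps power2_eq_square power3_eq_cube)
  have "sinh (2 * k) = 2 * (sinh k * cosh k)" by (simp add: sinh_double)
  moreover have "M1 k * (8 * k\<^sup>2 * (cosh k)\<^sup>2) = 8 * (M1 k * k\<^sup>2 * (cosh k)\<^sup>2)" by simp
  ultimately show ?thesis using h8 alg[of "sinh k * cosh k"] by metis
qed

lemma m_monotone:
  obtains c where "0 \<le> c" "1 / 3 \<le> B / A \<Longrightarrow> c = 0"
    "\<And>x y. 0 < x \<Longrightarrow> x < y \<Longrightarrow> y \<le> c \<Longrightarrow> m y < m x"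
    "\<And>x y. c \<le> x \<Longrightarrow> 0 < x \<Longrightarrow> x < y \<Longrightarrow> m x < m y"
proof -
  have "0 < B / A" using A_pos B_pos by simp
  then obtain e where
    e: "neg_then_pos e (\<lambda>x. (B / A) * (x\<^sup>2 * sinh x + x ^ 3) - 4 * sinh x + 4 * x)" "1 / 3 \<le> B / A \<Longrightarrow> e = 0"
    by (rule discriminant_sign) blast
  have pos: "0 < 8 * k\<^sup>2 * (cosh k)\<^sup>2" if "0 < k" for k :: real using that by simp
  have neg: "M1 k < 0" if "0 < k" "2 * k < e" for k
  proof -
    have "M1 k * (8 * k\<^sup>2 * (cosh k)\<^sup>2) < 0"
      unfolding M1_sign[OF that(1)]
      by (rule mult_pos_neg[OF A_pos e(1)[unfolded neg_then_pos_def, THEN conjunct2, THEN conjunct1, rule_format]])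
         (use that in auto)
    then show ?thesis using pos[OF that(1)] by (simp add: mult_less_0_iff)
  qed
  have pos': "0 < M1 k" if "0 < k" "e < 2 * k" for k
  proof -
    have "0 < M1 k * (8 * k\<^sup>2 * (cosh k)\<^sup>2)"
      unfolding M1_sign[OF that(1)]
      by (rule mult_pos_pos[OF A_pos e(1)[unfolded neg_then_pos_def, THEN conjunct2, THEN conjunct2, rule_format]])
         (use that in auto)
    then show ?thesis using pos[OF that(1)] by (simp add: zero_less_mult_iff)
  qed
  have cont: "continuous_on {a..b} m" if "0 < a" for a b
    using that by (intro continuous_at_imp_continuous_on ballI DERIV_isCont[OF m_deriv]) auto
  show ?thesis
  \<comment> \<open>The turning point is halved because \<open>discriminant_sign\<close> is applied
    at the argument 2 k.\<close>
  proof (rule that[of "e / 2"])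
    show "0 \<le> e / 2" "1 / 3 \<le> B / A \<Longrightarrow> e / 2 = 0" using e by (auto simp: neg_then_pos_def)
    show "m y < m x" if "0 < x" "x < y" "y \<le> e / 2" for x y
    proof (rule DERIV_neg_imp_decreasing_open[OF that(2)])
      fix z assume z: "x < z" "z < y"
      then have "m1 z < 0" using neg[of z] m_pos[of z] that by (simp add: m1_def divide_neg_pos)
      then show "\<exists>D. (m has_real_derivative D) (at z) \<and> D < 0" using m_deriv[of z] z that by auto
    qed (use cont that in auto)
    show "m x < m y" if "e / 2 \<le> x" "0 < x" "x < y" for x y
    proof (rule DERIV_pos_imp_increasing_open[OF that(3)])
      fix z assume z: "x < z" "z < y"
      then have "0 < m1 z" using pos'[of z] m_pos[of z] that by (simp add: m1_def)
      then show "\<exists>D. (m has_real_derivative D) (at z) \<and> 0 < D" using m_deriv[of z] z that by auto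
    qed (use cont that in auto)
  qed
qed

lemma B_over_A: "B / A = T / (g * d\<^sup>2)" using d by (simp add: A_def B_def power2_eq_square)

text \<open>A resonant x satisfies x < c < n x for the turning point c. For two resonant numbers x <
  y, m would decrease from x to y and increase from n x to n y, which is contradictory. Hence k
  would be the only resonant number, the definite description in \<open>resonant_number\<close>
  would evaluate to k, and k is excluded from the admissible set.\<close>

lemma no_resonance:
  assumes k: "k \<in> admissible_wave_numbers g d T" and n: "2 \<le> n"
  shows "m (real n * k) \<noteq> m k"
proof
  assume eq: "m (real n * k) = m k"
  have k0: "0 < k" using k by (auto simp: admissible_wave_numbers_def split: if_splits)
  have grow: "x < real n * x" if "0 < x" for x using n that by simp
  obtain c where c: "0 \<le> c" "1 / 3 \<le> B / A \<Longrightarrow> c = 0"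
    "\<And>x y. 0 < x \<Longrightarrow> x < y \<Longrightarrow> y \<le> c \<Longrightarrow> m y < m x"
    "\<And>x y. c \<le> x \<Longrightarrow> 0 < x \<Longrightarrow> x < y \<Longrightarrow> m x < m y"
    by (rule m_monotone) blast
  have straddle: "x < c \<and> c < real n * x" if "0 < x" "m x = m (real n * x)" for x
  proof (intro conjI; rule ccontr)
    assume "\<not> x < c" then show False using c(4)[of x "real n * x"] grow[of x] that by simp
  next
    assume "\<not> c < real n * x" then show False using c(3)[of x "real n * x"] grow[of x] that by simp
  qed
  have less: False if xy: "0 < x" "x < y" and e: "m x = m (real n * x)" "m y = m (real n * y)" for x y
  proof -
    have "m y < m x" using c(3)[of x y] straddle[of y] xy e by auto
    moreover have "m (real n * x) < m (real n * y)" using c(4)[of "real n * x" "real n * y"] straddle[of x] xy e n c(1) by auto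
    ultimately show False using e by simp
  qed
  have c_pos: "c \<noteq> 0" using straddle[of k] eq k0 by auto
  then have "\<not> 1 / 3 \<le> T / (g * d\<^sup>2)" using c(2) B_over_A by auto
  then have "k \<noteq> resonant_number g d T n" using k n by (auto simp: admissible_wave_numbers_def)
  moreover have "resonant_number g d T n = k"
    unfolding resonant_number_def
  proof (rule the_equality)
    show "0 < k \<and> m k = m (real n * k)" using k0 eq by simp
    fix x assume x: "0 < x \<and> m x = m (real n * x)"
    show "x = k" using less[of x k] less[of k x] x k0 eq by (metis linorder_neqE_linordered_idom)
  qed
  ultimately show False by simp
qed

lemma m_at_top: "filterlim m at_top at_top"
proof -
  have "filterlim (\<lambda>k::real. sqrt (B * (tanh 1 * k))) at_top at_top"
    using B_pos by (intro filterlim_compose[OF sqrt_at_top] filterlim_tendsto_pos_mult_at_top[OF tendsto_const] filterlim_ident) auto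
  moreover have "\<forall>\<^sub>F k in at_top. sqrt (B * (tanh 1 * k)) \<le> m k"
    using eventually_ge_at_top[of 1]
  proof eventually_elim
    case (elim k)
    have "tanh 1 \<le> tanh k" using elim by simp
    then have "B * (tanh 1 * k) \<le> B * (k * tanh k)" using elim B_pos by (simp add: mult.commute mult_left_mono)
    then show ?case using elim M_ge(1)[of k] by (simp add: m_eq)
  qed
  ultimately show ?thesis by (rule filterlim_at_top_mono)
qed

lemma tanh_le: assumes "0 \<le> x" shows "tanh x \<le> (x::real)"
proof -
  have "0 - tanh 0 \<le> x - tanh x"
  proof (rule DERIV_nonneg_imp_nondecreasing[OF assms])
    fix y :: real
    have "((\<lambda>x. x - tanh x) has_real_derivative 1 - (1 - (tanh y)\<^sup>2)) (at y)"
      using cosh_real_pos[of y] by (auto intro!: derivative_eq_intros)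
    then show "\<exists>D. ((\<lambda>x. x - tanh x) has_real_derivative D) (at y) \<and> 0 \<le> D" by (intro exI conjI) auto
  qed
  then show ?thesis by simp
qed

text \<open>The true growth is that of a square root. A linear bound is enough, as coefficients with
  cubic decay stay summable after a linear weight.\<close>

lemma m_growth: "\<bar>m k\<bar> \<le> (A + B + 1) * (1 + \<bar>k\<bar>)"
proof -
  have pos: "\<bar>m k\<bar> \<le> (A + B + 1) * (1 + k)" if "0 \<le> k" for k
  proof -
    have "m k \<ge> 0 \<and> (m k)\<^sup>2 \<le> A + B * k"
    proof (cases "k = 0")
      case True then show ?thesis using A_pos by (simp add: m_0)
    next
      case False
      then have k: "0 < k" using that by simp
      have "A * (tanh k / k) \<le> A * 1" using tanh_le[of k] k A_pos by (intro mult_left_mono) auto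
      moreover have "B * (k * tanh k) \<le> B * (k * 1)"
        using tanh_real_lt_1[of k] k B_pos by (intro mult_left_mono) auto
      ultimately show ?thesis using m_pos[OF k] m_square[OF k] by (simp add: M_def)
    qed
    moreover have "A + B * k \<le> X\<^sup>2" if X: "X = (A + B + 1) * (1 + k)" for X
    proof -
      have k0: "0 \<le> k * A" "0 \<le> k * B" using A_pos B_pos \<open>0 \<le> k\<close> by simp_all
      have X_eq: "X = A + B + 1 + k * A + k * B + k" using X by (simp add: algebra_simps)
      have "1 \<le> X" "A + B * k \<le> X" using k0 A_pos B_pos \<open>0 \<le> k\<close> unfolding X_eq by (simp_all add: mult.commute)
      moreover have "X * 1 \<le> X * X" using \<open>1 \<le> X\<close> by (intro mult_left_mono) auto
      ultimately show ?thesis unfolding power2_eq_square by linarith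
    qed
    moreover have "0 \<le> (A + B + 1) * (1 + k)" using A_pos B_pos that by simp
    ultimately have "m k \<le> (A + B + 1) * (1 + k)" by (meson order_trans power2_le_imp_le)
    then show ?thesis using \<open>m k \<ge> 0 \<and> (m k)\<^sup>2 \<le> A + B * k\<close> by simp
  qed
  show ?thesis
  proof (cases "0 \<le> k")
    case True then show ?thesis using pos[of k] by simp
  next
    case False then show ?thesis using pos[of "- k"] by (simp add: m_even)
  qed
qed

lemma m_isCont_0: "isCont m 0"
proof -
  have "((\<lambda>k::real. tanh k / k) \<longlongrightarrow> 1) (at 0)"
  proof -
    have "(tanh has_real_derivative (1 - (tanh 0)\<^sup>2) * 1) (at (0::real))"
      by (auto intro!: derivative_eq_intros)
    then show ?thesis by (simp add: has_field_derivative_iff)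
  qed
  then have "((\<lambda>k. sqrt (A * (tanh k / k) + B * (k * tanh k))) \<longlongrightarrow> sqrt (A * 1 + B * (0 * tanh 0))) (at 0)"
    by (intro tendsto_intros) auto
  then have "((\<lambda>k. sqrt (M k)) \<longlongrightarrow> m 0) (at 0)" by (simp add: M_def m_0)
  moreover have "\<forall>\<^sub>F k in at 0. sqrt (M k) = m k" by (auto simp: eventually_at_filter m_eq)
  ultimately show ?thesis unfolding isCont_def using tendsto_cong by fast
qed

text \<open>Bounds on a half-line are uniform in the mode number, as \<open>lip\<close> and
  \<open>second\<close> demand. Away from 0 the negative powers of k are harmless, and m is bounded
  below because k tanh k increases.\<close>

lemma derivs_bounded:
  assumes k0: "0 < k0"
  obtains C where "0 \<le> C" "\<And>k. k0 \<le> k \<Longrightarrow> \<bar>m1 k\<bar> \<le> C" "\<And>k. k0 \<le> k \<Longrightarrow> \<bar>m2 k\<bar> \<le> C"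
proof -
  define \<mu> where "\<mu> = sqrt (B * (k0 * tanh k0))"
  define C1 where "C1 = A * (1 / k0 + 1 / k0\<^sup>2) + B * 2"
  define C2 where "C2 = A * (2 / k0 + 2 / k0\<^sup>2 + 2 / k0 ^ 3) + B * 4"
  have mu: "0 < \<mu>" using k0 B_pos by (simp add: \<mu>_def)
  have low: "\<mu> \<le> m k" if "k0 \<le> k" for k
  proof -
    have "B * (k0 * tanh k0) \<le> B * (k * tanh k)" using that k0 B_pos by (intro mult_left_mono mult_mono) auto
    then show ?thesis using M_ge(1)[of k] that k0 by (simp add: m_eq \<mu>_def)
  qed
  have b: "\<bar>M1 k\<bar> \<le> C1 \<and> \<bar>M2 k\<bar> \<le> C2" if k: "k0 \<le> k" for k
  proof -
    have k_pos: "0 < k" using k k0 by simp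
    define t where "t = tanh k"
    define s where "s = 1 - (tanh k)\<^sup>2"
    have t: "0 \<le> t" "t \<le> 1" using k_pos tanh_real_lt_1[of k] by (auto simp: t_def)
    have s: "0 \<le> s" "s \<le> 1" using one_minus_tanh[of k] by (auto simp: s_def)
    have ks: "0 \<le> k * s" "k * s \<le> 1" using k_sech[OF k_pos] by (auto simp: s_def)
    have q: "x / k ^ n \<le> 1 / k0 ^ n" "0 \<le> x / k ^ n" if "0 \<le> x" "x \<le> 1" for x n
      using that k k0 by (auto intro!: frac_le power_mono)
    have q1: "x / k \<le> 1 / k0" "0 \<le> x / k" if "0 \<le> x" "x \<le> 1" for x using q[OF that, of 1] by auto
    have ts: "0 \<le> t * s" "t * s \<le> 1" using t s by (auto intro: mult_le_one)
    have kst: "0 \<le> k * s * t" "k * s * t \<le> 1" using ks t by (auto intro: mult_le_one)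
    have "\<bar>s / k - t / k\<^sup>2\<bar> \<le> 1 / k0 + 1 / k0\<^sup>2"
      using q1[OF s] q[OF t, of 2] k0 by (auto simp: abs_le_iff intro: order_trans)
    then have "\<bar>A * (s / k - t / k\<^sup>2)\<bar> \<le> A * (1 / k0 + 1 / k0\<^sup>2)" using A_pos by (simp add: abs_mult)
    moreover have "\<bar>B * (t + k * s)\<bar> \<le> B * 2" unfolding abs_mult using B_pos t ks by (intro mult_mono) auto
    moreover have "M1 k = A * (s / k - t / k\<^sup>2) + B * (t + k * s)" by (simp add: M1_def s_def t_def)
    ultimately have 1: "\<bar>M1 k\<bar> \<le> C1" unfolding C1_def by linarith
    have e: "M2 k = A * (- 2 * (t * s / k) - 2 * (s / k\<^sup>2) + 2 * (t / k ^ 3)) + B * (2 * s - 2 * (k * s * t))"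
      by (simp add: M2_def s_def t_def mult.assoc)
    have "\<bar>- 2 * (t * s / k) - 2 * (s / k\<^sup>2) + 2 * (t / k ^ 3)\<bar> \<le> 2 / k0 + 2 / k0\<^sup>2 + 2 / k0 ^ 3"
    proof -
      have "\<bar>- 2 * a - 2 * b + 2 * c\<bar> \<le> 2 * a' + 2 * b' + 2 * c'"
        if "0 \<le> a" "a \<le> a'" "0 \<le> b" "b \<le> b'" "0 \<le> c" "c \<le> c'" for a b c a' b' c' :: real
        using that by linarith
      from this[OF q1(2)[OF ts] q1(1)[OF ts] q(2)[OF s, of 2] q(1)[OF s, of 2] q(2)[OF t, of 3] q(1)[OF t, of 3]]
      show ?thesis by simp
    qed
    then have "\<bar>A * (- 2 * (t * s / k) - 2 * (s / k\<^sup>2) + 2 * (t / k ^ 3))\<bar> \<le> A * (2 / k0 + 2 / k0\<^sup>2 + 2 / k0 ^ 3)"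
      unfolding abs_mult using A_pos by (intro mult_mono) auto
    moreover have "\<bar>B * (2 * s - 2 * (k * s * t))\<bar> \<le> B * 4"
      unfolding abs_mult using B_pos s kst by (intro mult_mono) auto
    ultimately have "\<bar>M2 k\<bar> \<le> C2" unfolding e C2_def
      by (rule order_trans[OF abs_triangle_ineq add_mono])
    with 1 show ?thesis by simp
  qed
  have C1: "0 \<le> C1" using b[of k0] by (meson abs_ge_zero order_refl order_trans)
  have C2: "0 \<le> C2" using b[of k0] by (meson abs_ge_zero order_refl order_trans)
  let ?C = "C1 / (2 * \<mu>) + (C2 / (2 * \<mu>) + C1\<^sup>2 / (4 * \<mu> ^ 3))"
  show ?thesis
  proof (rule that[of ?C])
    show "0 \<le> ?C" using C1 C2 mu by simp
    fix k assume k: "k0 \<le> k"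
    have "\<bar>m1 k\<bar> \<le> C1 / (2 * \<mu>)"
      unfolding m1_def abs_divide using b[OF k] low[OF k] mu C1 by (intro frac_le) auto
    then show "\<bar>m1 k\<bar> \<le> ?C" using C2 mu by (simp add: add_increasing2)
    have 1: "\<bar>M2 k / (2 * m k)\<bar> \<le> C2 / (2 * \<mu>)"
      unfolding abs_divide using b[OF k] low[OF k] mu C2 by (intro frac_le) auto
    have "(M1 k)\<^sup>2 \<le> C1\<^sup>2" using b[OF k] C1 by (simp add: abs_le_square_iff[symmetric])
    moreover have "\<mu> ^ 3 \<le> m k ^ 3" using low[OF k] mu by (intro power_mono) auto
    ultimately have 2: "\<bar>(M1 k)\<^sup>2 / (4 * m k ^ 3)\<bar> \<le> C1\<^sup>2 / (4 * \<mu> ^ 3)"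
      unfolding abs_divide using low[OF k] mu by (intro frac_le) auto
    have "\<bar>m2 k\<bar> \<le> C2 / (2 * \<mu>) + C1\<^sup>2 / (4 * \<mu> ^ 3)"
      unfolding m2_def by (rule order_trans[OF abs_triangle_ineq4 add_mono[OF 1 2]])
    then show "\<bar>m2 k\<bar> \<le> ?C" using C1 mu by (simp add: add_increasing)
  qed
qed

lemma deriv_zm:
  assumes "0 < z"
  shows "deriv (\<lambda>x. x * m x) z = m z + z * m1 z"
    and "deriv (deriv (\<lambda>x. x * m x)) z = 2 * m1 z + z * m2 z"
proof -
  have 1: "deriv (\<lambda>x. x * m x) y = m y + y * m1 y" if "0 < y" for y
    by (rule DERIV_imp_deriv) (use m_deriv[OF that] in \<open>auto intro!: derivative_eq_intros\<close>)
  show "deriv (\<lambda>x. x * m x) z = m z + z * m1 z" by (rule 1[OF assms])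
  have "((\<lambda>y. m y + y * m1 y) has_real_derivative 2 * m1 z + z * m2 z) (at z)"
    using m_deriv[OF assms] m1_deriv[OF assms] by (auto intro!: derivative_eq_intros)
  then have "(deriv (\<lambda>x. x * m x) has_real_derivative 2 * m1 z + z * m2 z) (at z)"
    by (rule has_field_derivative_transform_within_open[where S="{0<..}"]) (use assms 1 in auto)
  then show "deriv (deriv (\<lambda>x. x * m x)) z = 2 * m1 z + z * m2 z" by (rule DERIV_imp_deriv)
qed

end

section \<open>Taylor estimates, spectral gap and the assumptions on the symbol\<close>

context dispersion
begin

text \<open>The mean value inequality is applied to m1 and then, on the segment, to m minus its
  linear part; this gives C where the integral remainder would give C / 2.\<close>

lemma m_taylor:
  assumes C: "\<And>t. k0 \<le> t \<Longrightarrow> \<bar>m1 t\<bar> \<le> C" "\<And>t. k0 \<le> t \<Longrightarrow> \<bar>m2 t\<bar> \<le> C"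
    and k0: "0 < k0" and xy: "k0 \<le> x" "k0 \<le> y"
  shows "\<bar>m y - m x\<bar> \<le> C * \<bar>y - x\<bar>" "\<bar>m y - m x - m1 x * (y - x)\<bar> \<le> C * (y - x)\<^sup>2"
proof -
  have d: "(m has_field_derivative m1 t) (at t within S)" "(m1 has_field_derivative m2 t) (at t within S)" if "k0 \<le> t" for t S
    using that k0 by (auto intro!: has_field_derivative_at_within m_deriv m1_deriv)
  have lip: "\<bar>m1 t - m1 x\<bar> \<le> C * \<bar>t - x\<bar>" if "k0 \<le> t" for t
    using field_differentiable_bound[of "{k0..}" m1 m2 C t x] C(2) xy that d(2) by simp
  show "\<bar>m y - m x\<bar> \<le> C * \<bar>y - x\<bar>"
    using field_differentiable_bound[of "{k0..}" m m1 C y x] C(1) xy d(1) by simp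
  have C0: "0 \<le> C" using C(1)[OF xy(1)] by linarith
  have "norm ((m y - m1 x * y) - (m x - m1 x * x)) \<le> (C * \<bar>y - x\<bar>) * norm (y - x)"
  proof (rule field_differentiable_bound[of "closed_segment x y" "\<lambda>y. m y - m1 x * y" "\<lambda>t. m1 t - m1 x" "C * \<bar>y - x\<bar>" y x])
    fix t assume t: "t \<in> closed_segment x y"
    then have t0: "k0 \<le> t" "\<bar>t - x\<bar> \<le> \<bar>y - x\<bar>" using xy by (auto simp: closed_segment_eq_real_ivl split: if_splits)
    show "((\<lambda>y. m y - m1 x * y) has_real_derivative m1 t - m1 x) (at t within closed_segment x y)"
      by (rule DERIV_diff[OF d(1)[OF t0(1)] DERIV_cmult_Id])
    show "norm (m1 t - m1 x) \<le> C * \<bar>y - x\<bar>"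
      using order_trans[OF lip[OF t0(1)] mult_left_mono[OF t0(2) C0]] by simp
  qed auto
  moreover have "(m y - m1 x * y) - (m x - m1 x * x) = m y - m x - m1 x * (y - x)" by (simp add: algebra_simps)
  moreover have "(C * \<bar>y - x\<bar>) * norm (y - x) = C * (y - x)\<^sup>2" by (simp add: power2_eq_square mult.assoc)
  ultimately show "\<bar>m y - m x - m1 x * (y - x)\<bar> \<le> C * (y - x)\<^sup>2" by (simp only: real_norm_def)
qed

text \<open>Finitely many multiples of k are handled by \<open>no_resonance\<close>, the remaining
  ones by the growth of m.\<close>

lemma m_gap:
  assumes k: "k \<in> admissible_wave_numbers g d T"
  obtains \<gamma> where "0 < \<gamma>" "\<And>n::nat. 2 \<le> n \<Longrightarrow> \<gamma> \<le> \<bar>m (real n * k) - m k\<bar>"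
proof -
  have k0: "0 < k" using k by (auto simp: admissible_wave_numbers_def split: if_splits)
  obtain K where K: "\<And>x. K \<le> x \<Longrightarrow> m k + 1 \<le> m x"
    using m_at_top unfolding filterlim_at_top eventually_at_top_linorder by blast
  obtain N :: nat where N: "K / k \<le> real N" using real_arch_simple by blast
  define F where "F = insert 1 ((\<lambda>n. \<bar>m (real n * k) - m k\<bar>) ` {2..N})"
  have F: "finite F" "F \<noteq> {}" by (auto simp: F_def)
  show ?thesis
  proof (rule that[of "Min F"])
    show "0 < Min F" using F no_resonance[OF k] by (auto simp: Min_gr_iff F_def)
    fix n :: nat assume n: "2 \<le> n"
    show "Min F \<le> \<bar>m (real n * k) - m k\<bar>"
    proof (cases "n \<le> N")
      case True then show ?thesis using n F(1) by (intro Min_le) (auto simp: F_def)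
    next
      case False
      then have "K / k \<le> real n" using N by linarith
      then have "K \<le> real n * k" using k0 by (simp add: divide_le_eq)
      from K[OF this] have "1 \<le> \<bar>m (real n * k) - m k\<bar>" by linarith
      moreover have "Min F \<le> 1" using F(1) by (intro Min_le) (auto simp: F_def)
      ultimately show ?thesis by linarith
    qed
  qed
qed

lemma dispersion_symbol:
  assumes k: "k \<in> admissible_wave_numbers g d T"
  obtains \<gamma> \<Lambda> \<xi>0 where "symbol (\<lambda>y. m (k * y)) \<gamma> \<Lambda> \<xi>0"
    "\<And>h. \<bar>h\<bar> \<le> \<xi>0 \<Longrightarrow> \<bar>m (k * (1 + h)) - m (k * 1) - k * m1 k * h\<bar> \<le> \<Lambda> * h\<^sup>2"
proof -
  have k0: "0 < k" using k by (auto simp: admissible_wave_numbers_def split: if_splits)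
  \<comment> \<open>The left end k / 2 is taken because n + h \<ge> 1 / 2 for n \<ge> 1 and
    \<bar>h\<bar> \<le> 1 / 2.\<close>
  obtain C where C0: "0 \<le> C" and C: "\<And>t. k / 2 \<le> t \<Longrightarrow> \<bar>m1 t\<bar> \<le> C" "\<And>t. k / 2 \<le> t \<Longrightarrow> \<bar>m2 t\<bar> \<le> C"
    by (rule derivs_bounded[of "k / 2"]) (use k0 in auto)
  obtain \<gamma>0 where g0: "0 < \<gamma>0" "\<And>n::nat. 2 \<le> n \<Longrightarrow> \<gamma>0 \<le> \<bar>m (real n * k) - m k\<bar>"
    using m_gap[OF k] by blast
  obtain \<delta> where del: "0 < \<delta>" "\<And>y. \<bar>y\<bar> < \<delta> \<Longrightarrow> \<bar>m y - m 0\<bar> < 1"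
    using m_isCont_0 unfolding isCont_def LIM_def
    by (metis (no_types, opaque_lifting) abs_zero diff_zero dist_real_def diff_self zero_less_one)
  \<comment> \<open>A quarter of the gap at the integers: there the distance is at least 4 \<gamma>,
    and a Bloch shift costs at most \<gamma>, which leaves more than the required 2
    \<gamma>.\<close>
  define \<gamma> where "\<gamma> = min 1 (\<gamma>0 / 4)"
  define \<Lambda> where "\<Lambda> = \<bar>m (k * 0) - m (k * 1)\<bar> + 2 + C * k + 2 * (C * k\<^sup>2)"
  define \<xi>0 where "\<xi>0 = min (min (1/2) (\<gamma> / (100 * \<Lambda>))) (\<delta> / (2 * k))"
  have Lpos: "0 < \<Lambda>" "C * k \<le> \<Lambda>" "2 * (C * k\<^sup>2) \<le> \<Lambda>" using C0 k0 by (simp_all add: \<Lambda>_def add_pos_nonneg add_nonneg_pos)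
  have gpos: "0 < \<gamma>" using g0 by (simp add: \<gamma>_def)
  have xpos: "0 < \<xi>0" using Lpos gpos del k0 by (simp add: \<xi>0_def)
  have xhalf: "\<bar>h\<bar> \<le> 1/2" if "\<bar>h\<bar> \<le> \<xi>0" for h using that by (simp add: \<xi>0_def)
  have ge: "k / 2 \<le> k * (real n + h)" if "1 \<le> n" "\<bar>h\<bar> \<le> \<xi>0" for n :: nat and h
  proof -
    have "1 / 2 \<le> real n + h" using that xhalf[OF that(2)] by linarith
    from mult_left_mono[OF this, of k] show ?thesis using k0 by simp
  qed
  have lipn: "\<bar>m (k * (real n + h)) - m (k * real n)\<bar> \<le> \<Lambda> * \<bar>h\<bar>" if n: "1 \<le> n" and h: "\<bar>h\<bar> \<le> \<xi>0" for n :: nat and h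
  proof -
    have "\<bar>m (k * (real n + h)) - m (k * real n)\<bar> \<le> C * \<bar>k * (real n + h) - k * real n\<bar>"
      using m_taylor(1)[OF C _ ge[OF n, of 0] ge[OF n h]] k0 xpos by simp
    also have "\<dots> = C * k * \<bar>h\<bar>" using k0 by (simp add: algebra_simps abs_mult)
    finally show ?thesis using mult_right_mono[OF Lpos(2) abs_ge_zero[of h]] by linarith
  qed
  have tayn: "\<bar>m (k * (real n + h)) - m (k * real n) - k * m1 (k * real n) * h\<bar> \<le> C * k\<^sup>2 * h\<^sup>2" if n: "1 \<le> n" and h: "\<bar>h\<bar> \<le> \<xi>0" for n :: nat and h
  proof -
    have "\<bar>m (k * (real n + h)) - m (k * real n) - m1 (k * real n) * (k * (real n + h) - k * real n)\<bar> \<le> C * (k * (real n + h) - k * real n)\<^sup>2"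
      using m_taylor(2)[OF C _ ge[OF n, of 0] ge[OF n h]] k0 xpos by simp
    moreover have "k * (real n + h) - k * real n = k * h" by (simp add: algebra_simps)
    ultimately show ?thesis by (simp add: power_mult_distrib mult_ac)
  qed
  have secn: "\<bar>m (k * (real n + h)) + m (k * (real n - h)) - 2 * m (k * real n)\<bar> \<le> \<Lambda> * h\<^sup>2" if n: "1 \<le> n" and h: "\<bar>h\<bar> \<le> \<xi>0" for n :: nat and h
  proof -
    have "\<bar>m (k * (real n + h)) + m (k * (real n - h)) - 2 * m (k * real n)\<bar> \<le> C * k\<^sup>2 * h\<^sup>2 + C * k\<^sup>2 * h\<^sup>2"
    proof -
      have gen: "\<bar>a + b - 2 * c\<bar> \<le> L + L" if "\<bar>a - c - e\<bar> \<le> L" "\<bar>b - c + e\<bar> \<le> L" for a b c e L :: real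
        using that by linarith
      have "\<bar>m (k * (real n - h)) - m (k * real n) + k * m1 (k * real n) * h\<bar> \<le> C * k\<^sup>2 * h\<^sup>2"
        using tayn[OF n, of "- h"] h by simp
      from gen[OF tayn[OF n h] this] show ?thesis .
    qed
    also have "\<dots> = 2 * (C * k\<^sup>2) * h\<^sup>2" by simp
    also have "\<dots> \<le> \<Lambda> * h\<^sup>2" by (rule mult_right_mono[OF Lpos(3)]) simp
    finally show ?thesis .
  qed
  have refl: "\<exists>n'::nat. 1 \<le> n' \<and> (real_of_int n = real n' \<or> real_of_int n = - real n')" if "n \<noteq> 0" for n :: int
    using that by (intro exI[of _ "nat \<bar>n\<bar>"]) auto
  have ev: "m (k * (- y)) = m (k * y)" for y using m_even[of "k * y"] by simp
  have "symbol (\<lambda>y. m (k * y)) \<gamma> \<Lambda> \<xi>0"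
  proof
    show "m (k * - y) = m (k * y)" for y by (rule ev)
    show "0 < \<gamma>" "\<gamma> \<le> 1" using gpos by (simp_all add: \<gamma>_def)
    show "\<bar>m (k * 0) - m (k * 1)\<bar> + 2 \<le> \<Lambda>" using C0 k0 by (simp add: \<Lambda>_def)
    show "0 < \<xi>0" "\<xi>0 \<le> \<gamma> / (100 * \<Lambda>)" using xpos by (simp_all add: \<xi>0_def)
    show lip': "\<bar>m (k * (of_int n + \<xi>)) - m (k * of_int n)\<bar> \<le> \<Lambda> * \<bar>\<xi>\<bar>" if n: "n \<noteq> 0" and xi: "\<bar>\<xi>\<bar> \<le> \<xi>0" for n :: int and \<xi>
    proof -
      obtain n' :: nat where n': "1 \<le> n'" "real_of_int n = real n' \<or> real_of_int n = - real n'" using refl[OF n] by blast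
      have "m (k * (- real n' + \<xi>)) = m (k * (real n' + - \<xi>))" using ev[of "real n' + - \<xi>"] by simp
      then show ?thesis using n'(2) lipn[OF n'(1) xi] lipn[OF n'(1), of "- \<xi>"] xi ev[of "real n'"] by auto
    qed
    show "\<bar>m (k * (of_int n + \<xi>)) + m (k * (of_int n - \<xi>)) - 2 * m (k * of_int n)\<bar> \<le> \<Lambda> * \<xi>\<^sup>2"
      if n: "n \<noteq> 0" and xi: "\<bar>\<xi>\<bar> \<le> \<xi>0" for n :: int and \<xi>
    proof -
      obtain n' :: nat where n': "1 \<le> n'" "real_of_int n = real n' \<or> real_of_int n = - real n'" using refl[OF n] by blast
      have "m (k * (- real n' + \<xi>)) = m (k * (real n' - \<xi>))" "m (k * (- real n' - \<xi>)) = m (k * (real n' + \<xi>))"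
        using ev[of "real n' - \<xi>"] ev[of "real n' + \<xi>"] by simp_all
      then show ?thesis using n'(2) secn[OF n'(1) xi] ev[of "real n'"] by (auto simp: add.commute)
    qed
    show "2 * \<gamma> \<le> \<bar>m (k * (of_int n + \<xi>)) - m (k * 1)\<bar>" if n: "n \<notin> Core" and xi: "\<bar>\<xi>\<bar> \<le> \<xi>0" for n :: int and \<xi>
    proof -
      have n0: "n \<noteq> 0" using n by (auto simp: Core_def)
      have "m (k * of_int n) = m (real (nat \<bar>n\<bar>) * k)"
        using ev[of "of_int n"] by (cases "0 \<le> n") (simp_all add: mult.commute)
      moreover have "2 \<le> nat \<bar>n\<bar>" using n by (auto simp: Core_def)
      ultimately have "4 * \<gamma> \<le> \<bar>m (k * of_int n) - m (k * 1)\<bar>"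
        using g0(2)[of "nat \<bar>n\<bar>"] by (simp add: \<gamma>_def)
      moreover have "\<Lambda> * \<bar>\<xi>\<bar> \<le> \<gamma>"
      proof -
        have "\<bar>\<xi>\<bar> \<le> \<gamma> / (100 * \<Lambda>)" using xi by (simp add: \<xi>0_def)
        then have "\<bar>\<xi>\<bar> * (100 * \<Lambda>) \<le> \<gamma>" using Lpos by (simp add: pos_le_divide_eq)
        moreover have "0 \<le> \<bar>\<xi>\<bar> * \<Lambda>" using Lpos by simp
        ultimately show ?thesis by (simp add: mult_ac)
      qed
      ultimately show ?thesis using lip'[OF n0 xi] gpos by linarith
    qed
    show "\<bar>m (k * \<xi>) - m (k * 0)\<bar> \<le> 1" if "\<bar>\<xi>\<bar> \<le> \<xi>0" for \<xi>
    proof -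
      have "\<bar>\<xi>\<bar> \<le> \<delta> / (2 * k)" using that by (simp add: \<xi>0_def)
      then have "\<bar>k * \<xi>\<bar> < \<delta>" using k0 del(1) by (simp add: abs_mult pos_le_divide_eq mult_ac)
      from del(2)[OF this] show ?thesis by simp
    qed
  qed
  moreover have "\<bar>m (k * (1 + h)) - m (k * 1) - k * m1 k * h\<bar> \<le> \<Lambda> * h\<^sup>2" if "\<bar>h\<bar> \<le> \<xi>0" for h
  proof -
    have "C * k\<^sup>2 \<le> \<Lambda>" using Lpos(3) C0 by (auto intro: order_trans[rotated])
    then have "C * k\<^sup>2 * h\<^sup>2 \<le> \<Lambda> * h\<^sup>2" by (rule mult_right_mono) simp
    then show ?thesis using tayn[of 1 h] that by simp
  qed
  ultimately show ?thesis by (rule that)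
qed

text \<open>One application of L'Hopital's rule reduces the symmetric second difference to a first
  difference of m1, whose quotient converges by the definition of the derivative; two derivatives of
  m thus suffice.\<close>

lemma m_second_difference:
  assumes k: "0 < k"
  shows "((\<lambda>h. (m (k * (1 + h)) + m (k * (1 - h)) - 2 * m (k * 1)) / h\<^sup>2) \<longlongrightarrow> k\<^sup>2 * m2 k) (at 0)"
proof -
  define F where "F h = (k * m1 (k * (1 + h)) - k * m1 (k * (1 - h))) / 2" for h
  have pos: "0 < k * (1 + h)" "0 < k * (1 - h)" if "\<bar>h\<bar> < 1" for h using that k by (auto intro!: mult_pos_pos)
  have m1d1: "((\<lambda>h. m1 (k * (1 + h))) has_real_derivative m2 (k * (1 + 0)) * k) (at 0)"
    by (rule DERIV_chain2[where f=m1 and g="\<lambda>h. k * (1 + h)"]) (use k in \<open>auto intro!: m1_deriv derivative_eq_intros\<close>)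
  have m1d2: "((\<lambda>h. m1 (k * (1 - h))) has_real_derivative m2 (k * (1 - 0)) * (- k)) (at 0)"
    by (rule DERIV_chain2[where f=m1 and g="\<lambda>h. k * (1 - h)"]) (use k in \<open>auto intro!: m1_deriv derivative_eq_intros\<close>)
  have md: "((\<lambda>h. m (k * (1 + h)) + m (k * (1 - h)) - 2 * m (k * 1)) has_real_derivative 2 * F h) (at h)" if h: "\<bar>h\<bar> < 1" for h
  proof -
    have 1: "((\<lambda>h. m (k * (1 + h))) has_real_derivative m1 (k * (1 + h)) * k) (at h)"
      by (rule DERIV_chain2[where f=m and g="\<lambda>h. k * (1 + h)"]) (use pos[OF h] in \<open>auto intro!: m_deriv derivative_eq_intros\<close>)
    have 2: "((\<lambda>h. m (k * (1 - h))) has_real_derivative m1 (k * (1 - h)) * (- k)) (at h)"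
      by (rule DERIV_chain2[where f=m and g="\<lambda>h. k * (1 - h)"]) (use pos[OF h] in \<open>auto intro!: m_deriv derivative_eq_intros\<close>)
    have "m1 (k * (1 + h)) * k + m1 (k * (1 - h)) * (- k) - 0 = 2 * F h" by (simp add: F_def mult.commute)
    with DERIV_diff[OF DERIV_add[OF 1 2] DERIV_const[of "2 * m (k * 1)"]] show ?thesis by (simp only:)
  qed
  have "(k * (m2 (k * (1 + 0)) * k) - k * (m2 (k * (1 - 0)) * (- k))) / 2 = k\<^sup>2 * m2 k" by (simp add: power2_eq_square)
  with DERIV_cdivide[OF DERIV_diff[OF DERIV_cmult[OF m1d1, of k] DERIV_cmult[OF m1d2, of k]], of 2]
  have "(F has_real_derivative k\<^sup>2 * m2 k) (at 0)" unfolding F_def by (simp only:)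
  then have lim: "((\<lambda>h. F h / h) \<longlongrightarrow> k\<^sup>2 * m2 k) (at 0)" by (simp add: DERIV_def F_def)
  have ev: "\<forall>\<^sub>F h in at 0. \<bar>h::real\<bar> < 1" by (auto simp: eventually_at intro!: exI[of _ 1])
  have nz: "\<forall>\<^sub>F h in at 0. h \<noteq> (0::real)" by (simp add: eventually_at_filter)
  show ?thesis
  proof (rule lhopital[where f'="\<lambda>h. 2 * F h" and g'="\<lambda>h. 2 * h"])
    have "isCont (\<lambda>h. m (k * (1 + h)) + m (k * (1 - h)) - 2 * m (k * 1)) 0" by (rule DERIV_isCont[OF md]) simp
    then show "((\<lambda>h. m (k * (1 + h)) + m (k * (1 - h)) - 2 * m (k * 1)) \<longlongrightarrow> 0) (at 0)" by (simp add: isCont_def)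
    show "((\<lambda>h::real. h\<^sup>2) \<longlongrightarrow> 0) (at 0)" by (auto intro!: tendsto_eq_intros)
    show "\<forall>\<^sub>F h in at 0. (h::real)\<^sup>2 \<noteq> 0" using nz by eventually_elim simp
    show "\<forall>\<^sub>F h in at 0. 2 * h \<noteq> (0::real)" using nz by eventually_elim simp
    show "\<forall>\<^sub>F h in at 0. ((\<lambda>h. m (k * (1 + h)) + m (k * (1 - h)) - 2 * m (k * 1)) has_real_derivative 2 * F h) (at h)"
      using ev by eventually_elim (rule md)
    show "\<forall>\<^sub>F h in at 0. ((\<lambda>h::real. h\<^sup>2) has_real_derivative 2 * h) (at h)" by (auto intro!: always_eventually derivative_eq_intros)
    show "((\<lambda>h. 2 * F h / (2 * h)) \<longlongrightarrow> k\<^sup>2 * m2 k) (at 0)" using lim by simp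
  qed
qed

end

section \<open>Fourier coefficients of the small waves\<close>

lemma cis_has_vector_derivative:
  "((\<lambda>z. cis (c * z)) has_vector_derivative \<i> * of_real c * cis (c * z)) (at z within S)"
proof -
  have "((\<lambda>w. exp (\<i> * of_real c * w)) has_field_derivative \<i> * of_real c * exp (\<i> * of_real c * of_real z)) (at (of_real z))"
    by (auto intro!: derivative_eq_intros)
  from has_vector_derivative_real_field[OF this, of S] show ?thesis
    by (simp add: cis_conv_exp mult.assoc)
qed

lemma fourier_coeff_deriv:
  fixes f f' :: "real \<Rightarrow> real"
  assumes f: "\<And>z. (f has_real_derivative f' z) (at z)" and f': "continuous_on UNIV f'" and per: "\<And>z. f (z + 2 * pi) = f z"
  shows "fourier_coeff (\<lambda>z. of_real (f' z)) n = \<i> * of_int n * fourier_coeff (\<lambda>z. of_real (f z)) n"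
proof -
  have fc: "continuous_on UNIV f" using f by (intro continuous_at_imp_continuous_on ballI DERIV_isCont)
  define H where "H z = complex_of_real (f z) * cis (- of_int n * z)" for z
  define H' where "H' z = complex_of_real (f z) * (\<i> * of_real (- of_int n) * cis (- of_int n * z)) + complex_of_real (f' z) * cis (- of_int n * z)" for z
  have Hc: "continuous_on UNIV H'" unfolding H'_def by (intro continuous_intros fc f')
  have "(H has_vector_derivative H' z) (at z within S)" for z S
  proof -
    have "((\<lambda>z. complex_of_real (f z)) has_vector_derivative of_real (f' z)) (at z within S)"
      by (rule bounded_linear.has_vector_derivative[OF bounded_linear_of_real])
        (use f in \<open>auto simp flip: has_real_derivative_iff_has_vector_derivative intro: has_field_derivative_at_within\<close>)
    from has_vector_derivative_mult[OF this cis_has_vector_derivative[of "- of_int n"]] show ?thesis by (simp add: H_def[abs_def] H'_def)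
  qed
  then have "(\<integral>z. indicator {-pi..pi} z *\<^sub>R H' z \<partial>lborel) = H pi - H (- pi)"
    by (intro integral_FTC_Icc) (auto intro: continuous_on_subset[OF Hc])
  moreover have "H pi = H (- pi)"
  proof -
    have c1: "cis (2 * pi * of_int (- n)) = 1" by (rule cis_multiple_2pi) simp
    have "cis (- of_int n * pi) = cis (- of_int n * (- pi)) * cis (2 * pi * of_int (- n))" by (simp add: cis_mult algebra_simps)
    then have "cis (- of_int n * pi) = cis (- of_int n * (- pi))" by (simp only: c1 mult_1_right)
    moreover have "f pi = f (- pi)" using per[of "- pi"] by simp
    ultimately show ?thesis unfolding H_def by (simp only:)
  qed
  ultimately have "(\<integral>z. H' z \<partial>per) = 0" by (simp add: integral_per set_lebesgue_integral_def)
  moreover have "H' = (\<lambda>z. - (\<i> * of_int n) * (of_real (f z) * cis (- (of_int n * z))) + of_real (f' z) * cis (- (of_int n * z)))"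
    by (simp add: H'_def fun_eq_iff)
  moreover have "integrable per (\<lambda>z. - (\<i> * of_int n) * (of_real (f z) * cis (- (of_int n * z))))" "integrable per (\<lambda>z. of_real (f' z) * cis (- (of_int n * z)))"
    by (intro integrable_per_continuous continuous_intros fc f')+
  ultimately have "- (\<i> * of_int n) * (\<integral>z. of_real (f z) * cis (- (of_int n * z)) \<partial>per) + (\<integral>z. of_real (f' z) * cis (- (of_int n * z)) \<partial>per) = 0"
    by (simp only: Bochner_Integration.integral_add integral_mult_right_zero)
  then have "(\<integral>z. of_real (f' z) * cis (- (of_int n * z)) \<partial>per) = \<i> * of_int n * (\<integral>z. of_real (f z) * cis (- (of_int n * z)) \<partial>per)"
    by (simp add: algebra_simps add_eq_0_iff)
  then show ?thesis by (simp add: fourier_coeff_per)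
qed

lemma fourier_coeff_sup:
  assumes f: "integrable per f" and B: "\<And>z. z \<in> {-pi..pi} \<Longrightarrow> cmod (f z) \<le> B"
  shows "cmod (fourier_coeff f n) \<le> B"
proof -
  have "(\<integral>z. cmod (f z) \<partial>per) \<le> (\<integral>z. B \<partial>per)" using f B by (intro integral_mono) auto
  then have "(\<integral>z. cmod (f z) \<partial>per) / (2 * pi) \<le> B" by (simp add: measure_per divide_le_eq mult.commute)
  then show ?thesis using fourier_coeff_bound[OF f, of n] by linarith
qed

text \<open>Three integrations by parts. The third power is chosen so that after multiplication by
  n, or by the dispersion symbol, the coefficients are still dominated by 1 / n^2.\<close>

lemma fourier_coeff_cubic_decay:
  fixes D :: "nat \<Rightarrow> real \<Rightarrow> real"
  assumes D: "\<And>j z. (D j has_real_derivative D (Suc j) z) (at z)" and per: "\<And>z. D 0 (z + 2 * pi) = D 0 z"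
    and B: "\<And>z. z \<in> {-pi..pi} \<Longrightarrow> \<bar>D 3 z\<bar> \<le> B" and n: "n \<noteq> 0"
  shows "cmod (fourier_coeff (\<lambda>z. of_real (D 0 z)) n) \<le> B / \<bar>of_int n\<bar> ^ 3"
proof -
  have cont: "continuous_on UNIV (D j)" for j using D by (intro continuous_at_imp_continuous_on ballI DERIV_isCont)
  have per': "D j (z + 2 * pi) = D j z" for j z
  proof (induction j arbitrary: z)
    case (Suc j)
    have "((\<lambda>z. D j (z + 2 * pi)) has_real_derivative D (Suc j) (z + 2 * pi) * 1) (at z)"
      by (rule DERIV_chain2[OF D]) (auto intro!: derivative_eq_intros)
    moreover have "(\<lambda>z. D j (z + 2 * pi)) = D j" using Suc by (simp add: fun_eq_iff)
    ultimately show ?case using DERIV_unique[OF D[of j z]] by simp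
  qed (rule per)
  have step: "fourier_coeff (\<lambda>z. of_real (D (Suc j) z)) n = \<i> * of_int n * fourier_coeff (\<lambda>z. of_real (D j z)) n" for j
    by (rule fourier_coeff_deriv[OF D cont per'])
  have "fourier_coeff (\<lambda>z. of_real (D 3 z)) n = (\<i> * of_int n) ^ 3 * fourier_coeff (\<lambda>z. of_real (D 0 z)) n"
    using step[of 0] step[of 1] step[of 2] by (simp add: numeral_eq_Suc power3_eq_cube mult.assoc)
  moreover have "cmod (fourier_coeff (\<lambda>z. of_real (D 3 z)) n) \<le> B"
    by (rule fourier_coeff_sup) (use B in \<open>auto intro!: integrable_per_continuous continuous_intros cont\<close>)
  ultimately have "\<bar>of_int n\<bar> ^ 3 * cmod (fourier_coeff (\<lambda>z. of_real (D 0 z)) n) \<le> B"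
    by (simp add: norm_mult norm_power)
  then show ?thesis using n by (simp add: pos_le_divide_eq mult.commute)
qed

lemma fourier_coeff_uminus_arg: "fourier_coeff (\<lambda>z. f (- z)) n = fourier_coeff f (- n)"
proof -
  have "{x :: real. - x \<in> {-pi..pi}} = {-pi..pi}" by auto
  then show ?thesis unfolding fourier_coeff_def
    by (subst set_integral_reflect) simp
qed

lemma fourier_coeff_cnj: "fourier_coeff (\<lambda>z. cnj (f z)) n = cnj (fourier_coeff f (- n))"
  unfolding fourier_coeff_per complex_cnj_divide Bochner_Integration.integral_cnj[symmetric] complex_cnj_mult cis_cnj by simp

lemma even_fourier_coeff:
  assumes "\<And>z. w (- z) = (w z :: real)"
  shows "fourier_coeff (\<lambda>z. of_real (w z)) (- n) = fourier_coeff (\<lambda>z. of_real (w z)) n"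
    "fourier_coeff (\<lambda>z. of_real (w z)) n = of_real (Re (fourier_coeff (\<lambda>z. of_real (w z)) n))"
proof -
  show e: "fourier_coeff (\<lambda>z. of_real (w z)) (- n) = fourier_coeff (\<lambda>z. of_real (w z)) n" for n
    using fourier_coeff_uminus_arg[of "\<lambda>z. of_real (w z)" n] by (simp add: assms)
  have "fourier_coeff (\<lambda>z. of_real (w z)) n = cnj (fourier_coeff (\<lambda>z. of_real (w z)) n)"
    using fourier_coeff_cnj[of "\<lambda>z. of_real (w z)" n] e[of n] by simp
  then show "fourier_coeff (\<lambda>z. of_real (w z)) n = of_real (Re (fourier_coeff (\<lambda>z. of_real (w z)) n))"
    by (metis complex_cnj_cancel_iff Reals_cnj_iff of_real_Re)
qed

lemma smooth_on_frechet:
  "smooth_on \<Omega> f \<Longrightarrow> smooth_on \<Omega> (\<lambda>x. frechet_derivative f (at x) v)"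
  unfolding smooth_on_def by (metis Ck_on.simps(2))

text \<open>At fixed wave number, the derivatives in z are iterated Frechet derivatives in the
  direction \<open>(0, 0, 0, 1)\<close>; joint smoothness makes each of them continuous in (a, b,
  z).\<close>

lemma smooth_on_slices:
  fixes w :: "real \<Rightarrow> real \<Rightarrow> real \<Rightarrow> real \<Rightarrow> real"
  assumes w: "smooth_on (K \<times> I \<times> I \<times> UNIV) (\<lambda>(\<kappa>, a, b, z). w \<kappa> a b z)" and k: "k \<in> K"
  obtains D where "D 0 = w k"
    "\<And>j a b z. a \<in> I \<Longrightarrow> b \<in> I \<Longrightarrow> (D j a b has_real_derivative D (Suc j) a b z) (at z)"
    "\<And>j. continuous_on (I \<times> I \<times> UNIV) (\<lambda>(a, b, z). D j a b z)"
proof -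
  define E where "E = rec_nat (\<lambda>(\<kappa>, a, b, z). w \<kappa> a b z) (\<lambda>j e x. frechet_derivative e (at x) (0, 0, 0, 1))"
  have E0: "E 0 = (\<lambda>(\<kappa>, a, b, z). w \<kappa> a b z)" and ES: "E (Suc j) = (\<lambda>x. frechet_derivative (E j) (at x) (0, 0, 0, 1))" for j
    by (simp_all add: E_def)
  have sm: "smooth_on (K \<times> I \<times> I \<times> UNIV) (E j)" for j
    by (induction j) (use w smooth_on_frechet in \<open>auto simp: E0 ES\<close>)
  show ?thesis
  proof (rule that[of "\<lambda>j a b z. E j (k, a, b, z)"])
    show "(\<lambda>a b z. E 0 (k, a, b, z)) = w k" by (simp add: E0)
    fix j
    have "continuous_on (K \<times> I \<times> I \<times> UNIV) (E j)" using sm[of j] unfolding smooth_on_def by (metis Ck_on.simps(1))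
    then have "continuous_on (I \<times> I \<times> UNIV) (\<lambda>x. E j (k, x))"
      by (rule continuous_on_compose2) (use k in \<open>auto intro!: continuous_intros\<close>)
    then show "continuous_on (I \<times> I \<times> UNIV) (\<lambda>(a, b, z). E j (k, a, b, z))" by (simp add: case_prod_unfold)
    fix a b z assume ab: "a \<in> I" "b \<in> I"
    have "E j differentiable (at (k, a, b, z))"
      using sm[of j] ab k unfolding smooth_on_def by (metis Ck_on.simps(2) UNIV_I mem_Sigma_iff)
    then have d: "(E j has_derivative frechet_derivative (E j) (at (k, a, b, z))) (at (k, a, b, z))"
      by (simp add: frechet_derivative_works)
    then have lin: "linear (frechet_derivative (E j) (at (k, a, b, z)))" by (rule has_derivative_linear)
    have "((\<lambda>z. (k, a, b, z)) has_derivative (\<lambda>h. (0, 0, 0, h))) (at z)" by (auto intro!: derivative_eq_intros)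
    from has_derivative_compose[OF this d]
    have "((\<lambda>z. E j (k, a, b, z)) has_derivative (\<lambda>h. frechet_derivative (E j) (at (k, a, b, z)) (0, 0, 0, h))) (at z)" .
    moreover have "frechet_derivative (E j) (at (k, a, b, z)) (0, 0, 0, h) = h * E (Suc j) (k, a, b, z)" for h
      using linear_scale[OF lin, of h "(0, 0, 0, 1)"] by (simp add: ES)
    ultimately show "((\<lambda>z. E j (k, a, b, z)) has_real_derivative E (Suc j) (k, a, b, z)) (at z)"
      by (intro has_derivative_imp_has_field_derivative) auto
  qed
qed

lemma uniformly_small:
  fixes D :: "real \<Rightarrow> real \<Rightarrow> real \<Rightarrow> real"
  assumes D: "continuous_on ({-\<epsilon><..<\<epsilon>} \<times> {-\<epsilon><..<\<epsilon>} \<times> UNIV) (\<lambda>(a, b, z). D a b z)" and eps: "0 < \<epsilon>"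
    and zero: "\<And>z. D 0 0 z = 0" and e: "0 < e"
  obtains \<delta> where "0 < \<delta>" "\<And>a b z. \<bar>a\<bar> < \<delta> \<Longrightarrow> \<bar>b\<bar> < \<delta> \<Longrightarrow> z \<in> {-pi..pi} \<Longrightarrow> \<bar>D a b z\<bar> \<le> e"
proof -
  define C where "C = {-\<epsilon>/2..\<epsilon>/2} \<times> {-\<epsilon>/2..\<epsilon>/2} \<times> {-pi..pi}"
  have "uniformly_continuous_on C (\<lambda>(a, b, z). D a b z)"
    by (rule compact_uniformly_continuous) (use eps in \<open>auto simp: C_def intro!: compact_Times continuous_on_subset[OF D]\<close>)
  then obtain r where r: "0 < r" "\<And>x y. x \<in> C \<Longrightarrow> y \<in> C \<Longrightarrow> dist y x < r \<Longrightarrow> dist (case y of (a, b, z) \<Rightarrow> D a b z) (case x of (a, b, z) \<Rightarrow> D a b z) < e"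
    using e unfolding uniformly_continuous_on_def by blast
  show ?thesis
  proof (rule that[of "min (r / 2) (\<epsilon> / 2)"])
    show "0 < min (r / 2) (\<epsilon> / 2)" using r eps by simp
    fix a b z :: real assume ab: "\<bar>a\<bar> < min (r / 2) (\<epsilon> / 2)" "\<bar>b\<bar> < min (r / 2) (\<epsilon> / 2)" and z: "z \<in> {-pi..pi}"
    have "sqrt (a\<^sup>2 + b\<^sup>2) \<le> \<bar>a\<bar> + \<bar>b\<bar>" by (rule sqrt_sum_squares_le_sum_abs)
    then have "dist (a, b, z) (0, 0, z) < r" using ab by (simp add: dist_Pair_Pair)
    moreover have "(a, b, z) \<in> C" "(0, 0, z) \<in> C" using ab z eps by (auto simp: C_def)
    ultimately show "\<bar>D a b z\<bar> \<le> e" using r(2)[of "(0, 0, z)" "(a, b, z)"] by (simp add: zero dist_real_def)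
  qed
qed

lemma eventually_nhds_pair:
  fixes P :: "real \<Rightarrow> real \<Rightarrow> bool"
  assumes "\<forall>\<^sub>F (a, b) in nhds (0, 0). P a b"
  obtains \<delta> where "0 < \<delta>" "\<And>a b. \<bar>a\<bar> < \<delta> \<Longrightarrow> \<bar>b\<bar> < \<delta> \<Longrightarrow> P a b"
proof -
  obtain r where r: "0 < r" "\<And>x. dist x (0, 0) < r \<Longrightarrow> case x of (a, b) \<Rightarrow> P a b"
    using assms unfolding eventually_nhds_metric by blast
  show ?thesis
  proof (rule that[of "r / 2"])
    fix a b :: real assume ab: "\<bar>a\<bar> < r / 2" "\<bar>b\<bar> < r / 2"
    have "sqrt (a\<^sup>2 + b\<^sup>2) \<le> \<bar>a\<bar> + \<bar>b\<bar>" by (rule sqrt_sum_squares_le_sum_abs)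
    then have "dist (a, b) (0, 0) < r" using ab by (simp add: dist_Pair_Pair)
    from r(2)[OF this] show "P a b" by simp
  qed (use r in simp)
qed

text \<open>All quotients of the expansion sit in the modes 0 and \<plusminus>2, so the value at
  mode 1 is independent of them, also when a denominator is 0.\<close>

lemma fourier_coeff_expansion:
  "fourier_coeff (\<lambda>z. complex_of_real (A + a * cos z + B * (C + cos (2 * z) / D))) 1 = of_real (a / 2)"
proof -
  define F where "F j z = (case j of 0 \<Rightarrow> of_real (A + B * C) | Suc 0 \<Rightarrow> of_real (a / 2) * cis (of_int 1 * z)
     | Suc (Suc 0) \<Rightarrow> of_real (a / 2) * cis (of_int (-1) * z)
     | Suc (Suc (Suc 0)) \<Rightarrow> of_real (B / D / 2) * cis (of_int 2 * z) | _ \<Rightarrow> of_real (B / D / 2) * cis (of_int (-2) * z))" for j :: nat and z :: real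
  have F: "F 0 = (\<lambda>z. of_real (A + B * C) * 1)" "F (Suc 0) = (\<lambda>z. of_real (a / 2) * cis (of_int 1 * z))"
    "F (Suc (Suc 0)) = (\<lambda>z. of_real (a / 2) * cis (of_int (-1) * z))"
    "F (Suc (Suc (Suc 0))) = (\<lambda>z. of_real (B / D / 2) * cis (of_int 2 * z))"
    "F (Suc (Suc (Suc (Suc 0)))) = (\<lambda>z. of_real (B / D / 2) * cis (of_int (-2) * z))"
    by (simp_all add: F_def fun_eq_iff)
  have five: "{..<5::nat} = {0, Suc 0, Suc (Suc 0), Suc (Suc (Suc 0)), Suc (Suc (Suc (Suc 0)))}" by auto
  have int: "integrable per (F j)" if "j \<in> {..<5}" for j
    using that unfolding five by (auto simp only: F insert_iff empty_iff intro!: integrable_per_continuous continuous_intros)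
  have "complex_of_real (A + a * cos z + B * (C + cos (2 * z) / D)) = (\<Sum>j<5. F j z)" for z
    unfolding five by (simp add: F complex_eq_iff algebra_simps add_divide_distrib)
  then have "fourier_coeff (\<lambda>z. complex_of_real (A + a * cos z + B * (C + cos (2 * z) / D))) 1 = (\<Sum>j<5. fourier_coeff (F j) 1)"
    by (simp only: fourier_coeff_sum[OF finite_lessThan int])
  also have "\<dots> = of_real (a / 2)"
  proof -
    have "fourier_coeff (F j) 1 = (if j = Suc 0 then of_real (a / 2) else 0)" if "j \<in> {..<5}" for j
      using that unfolding five by (elim insertE emptyE; simp only: F fourier_coeff_cmult fourier_coeff_cis fourier_coeff_one; simp)
    then have "(\<Sum>j<5. fourier_coeff (F j) 1) = (\<Sum>j<5. if j = Suc 0 then of_real (a / 2) else 0)" by (intro sum.cong) auto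
    then show ?thesis by simp
  qed
  finally show ?thesis .
qed

text \<open>From the expansion come the values at a = b = 0, where the wave vanishes and has speed m
  k, and the first mode, which is a / 2 up to a small multiple of a. The decay in n comes from joint
  smoothness: all derivatives in z vanish at a = b = 0 and are therefore small nearby, uniformly on
  one period.\<close>

lemma wave_family_small:
  assumes wf: "wave_family g d T k w c" and e: "0 < e"
  obtains \<delta> where "0 < \<delta>" "\<And>a b. \<bar>a\<bar> < \<delta> \<Longrightarrow> \<bar>b\<bar> < \<delta> \<Longrightarrow>
     travelling_wave g d T k b (w k a b) (c k a b) \<and> continuous_on UNIV (w k a b)
     \<and> (\<forall>n. n \<noteq> 0 \<longrightarrow> cmod (fourier_coeff (\<lambda>z. of_real (w k a b z)) n) \<le> e / \<bar>of_int n\<bar> ^ 3)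
     \<and> cmod (fourier_coeff (\<lambda>z. of_real (w k a b z)) 0) \<le> e
     \<and> \<bar>c k a b - phase_speed g d T k\<bar> \<le> e
     \<and> cmod (fourier_coeff (\<lambda>z. of_real (w k a b z)) 1 - of_real (a / 2)) \<le> e * \<bar>a\<bar>"
proof -
  let ?m = "phase_speed g d T"
  obtain \<epsilon> where eps: "0 < \<epsilon>" and sw: "smooth_on ({k - \<epsilon> <..< k + \<epsilon>} \<times> {- \<epsilon> <..< \<epsilon>} \<times> {- \<epsilon> <..< \<epsilon>} \<times> UNIV) (\<lambda>(\<kappa>, a, b, z). w \<kappa> a b z)"
    and sc: "smooth_on ({k - \<epsilon> <..< k + \<epsilon>} \<times> {- \<epsilon> <..< \<epsilon>} \<times> {- \<epsilon> <..< \<epsilon>}) (\<lambda>(\<kappa>, a, b). c \<kappa> a b)"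
    and tw: "\<And>\<kappa> a b. \<kappa> \<in> {k - \<epsilon> <..< k + \<epsilon>} \<Longrightarrow> a \<in> {- \<epsilon> <..< \<epsilon>} \<Longrightarrow> b \<in> {- \<epsilon> <..< \<epsilon>} \<Longrightarrow> travelling_wave g d T \<kappa> b (w \<kappa> a b) (c \<kappa> a b)"
    and ex: "\<And>\<kappa>. \<kappa> \<in> {k - \<epsilon> <..< k + \<epsilon>} \<Longrightarrow> small_amplitude_expansion g d T \<kappa> (w \<kappa>) (c \<kappa>)"
    using wf unfolding wave_family_def Let_def by blast
  have kK: "k \<in> {k - \<epsilon> <..< k + \<epsilon>}" using eps by simp
  obtain D where D0: "D 0 = w k" and D: "\<And>j a b z. a \<in> {- \<epsilon> <..< \<epsilon>} \<Longrightarrow> b \<in> {- \<epsilon> <..< \<epsilon>} \<Longrightarrow> (D j a b has_real_derivative D (Suc j) a b z) (at z)"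
    and Dc: "\<And>j. continuous_on ({- \<epsilon> <..< \<epsilon>} \<times> {- \<epsilon> <..< \<epsilon>} \<times> UNIV) (\<lambda>(a, b, z). D j a b z)"
    using smooth_on_slices[OF sw kK] by blast
  obtain W0 c0 r s :: "real \<Rightarrow> real" where r: "r \<in> O[nhds 0](\<lambda>b. b ^ 3)" and s: "s \<in> O[nhds 0](\<lambda>b. b ^ 3)"
    and W0: "\<forall>\<^sub>F b in nhds 0. W0 b = (?m 0 - ?m k) * (b - 3 * b\<^sup>2 + r b) \<and> c0 b = ?m k + 2 * (?m 0 - ?m k) * (b - 3 * b\<^sup>2 + s b)"
    and exK: "\<exists>K. \<forall>\<^sub>F (a, b) in nhds (0, 0).
           (\<forall>z. \<bar>w k a b z - (W0 b + a * cos z + 1/2 * a\<^sup>2 * (1 / (?m k - ?m 0) + cos (2 * z) / (?m k - ?m (2 * k))))\<bar>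
               \<le> K * (\<bar>a\<bar> * (a\<^sup>2 + b\<^sup>2))) \<and>
           \<bar>c k a b - (c0 b + a\<^sup>2 * (1 / (?m k - ?m 0) + 1/2 * (1 / (?m k - ?m (2 * k)))))\<bar> \<le> K * (\<bar>a\<bar> * (a\<^sup>2 + b\<^sup>2))"
    using ex[OF kK] unfolding small_amplitude_expansion_def Let_def by blast
  define PP where "PP K a b \<longleftrightarrow>
           (\<forall>z. \<bar>w k a b z - (W0 b + a * cos z + 1/2 * a\<^sup>2 * (1 / (?m k - ?m 0) + cos (2 * z) / (?m k - ?m (2 * k))))\<bar>
               \<le> K * (\<bar>a\<bar> * (a\<^sup>2 + b\<^sup>2))) \<and>
           \<bar>c k a b - (c0 b + a\<^sup>2 * (1 / (?m k - ?m 0) + 1/2 * (1 / (?m k - ?m (2 * k)))))\<bar> \<le> K * (\<bar>a\<bar> * (a\<^sup>2 + b\<^sup>2))" for K a b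
  obtain K where "\<forall>\<^sub>F (a, b) in nhds (0, 0). PP K a b" using exK unfolding PP_def[symmetric] by blast
  then obtain \<delta>1 where d1: "0 < \<delta>1" and PP: "\<And>a b. \<bar>a\<bar> < \<delta>1 \<Longrightarrow> \<bar>b\<bar> < \<delta>1 \<Longrightarrow> PP K a b"
    by (rule eventually_nhds_pair) blast
  note expand = PP[unfolded PP_def]
  \<comment> \<open>The filter \<open>nhds 0\<close> contains the point itself, so an error O(b^3)
    is zero at b = 0. The expansion is evaluated at a = b = 0 for the same reason.\<close>
  have rs0: "f 0 = 0" if fO: "f \<in> O[nhds 0](\<lambda>b. b ^ 3)" for f :: "real \<Rightarrow> real"
  proof -
    obtain C where "\<forall>\<^sub>F x in nhds 0. norm (f x) \<le> C * norm ((x::real) ^ 3)" using fO by (elim landau_o.bigE)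
    from eventually_nhds_x_imp_x[OF this] show ?thesis by simp
  qed
  have zero0: "W0 0 = 0" "c0 0 = ?m k" using eventually_nhds_x_imp_x[OF W0] rs0[OF r] rs0[OF s] by simp_all
  have w00: "w k 0 0 z = 0" and c00: "c k 0 0 = ?m k" for z using expand[of 0 0] d1 zero0 by simp_all
  have D00: "D j 0 0 = (\<lambda>_. 0)" for j
  proof (induction j)
    case (Suc j)
    have "(D j 0 0 has_real_derivative D (Suc j) 0 0 z) (at z)" for z using eps by (intro D) auto
    then have "((\<lambda>_::real. 0) has_real_derivative D (Suc j) 0 0 z) (at z)" for z by (simp only: Suc)
    then show ?case using DERIV_unique[OF _ DERIV_const] by (metis (no_types, lifting) ext)
  qed (use w00 D0 in auto)
  obtain \<delta>2 where d2: "0 < \<delta>2" "\<And>a b z. \<bar>a\<bar> < \<delta>2 \<Longrightarrow> \<bar>b\<bar> < \<delta>2 \<Longrightarrow> z \<in> {-pi..pi} \<Longrightarrow> \<bar>D 3 a b z\<bar> \<le> e"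
    by (rule uniformly_small[OF Dc[of 3] eps _ e]) (use D00 in auto)
  obtain \<delta>3 where d3: "0 < \<delta>3" "\<And>a b z. \<bar>a\<bar> < \<delta>3 \<Longrightarrow> \<bar>b\<bar> < \<delta>3 \<Longrightarrow> z \<in> {-pi..pi} \<Longrightarrow> \<bar>D 0 a b z\<bar> \<le> e"
    by (rule uniformly_small[OF Dc[of 0] eps _ e]) (use D00 in auto)
  have "continuous_on ({k - \<epsilon> <..< k + \<epsilon>} \<times> {- \<epsilon> <..< \<epsilon>} \<times> {- \<epsilon> <..< \<epsilon>}) (\<lambda>(\<kappa>, a, b). c \<kappa> a b)"
    using sc unfolding smooth_on_def by (metis Ck_on.simps(1))
  then have "continuous_on ({- \<epsilon> <..< \<epsilon>} \<times> {- \<epsilon> <..< \<epsilon>} \<times> (UNIV::real set)) (\<lambda>x. case (k, fst x, fst (snd x)) of (\<kappa>, a, b) \<Rightarrow> c \<kappa> a b)"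
    by (rule continuous_on_compose2) (use kK in \<open>auto intro!: continuous_intros\<close>)
  then have cc: "continuous_on ({- \<epsilon> <..< \<epsilon>} \<times> {- \<epsilon> <..< \<epsilon>} \<times> UNIV) (\<lambda>(a, b, z::real). c k a b - ?m k)"
    by (auto simp: case_prod_unfold intro!: continuous_intros)
  obtain \<delta>4 where d4: "0 < \<delta>4" "\<And>a b z. \<bar>a\<bar> < \<delta>4 \<Longrightarrow> \<bar>b\<bar> < \<delta>4 \<Longrightarrow> z \<in> {-pi..pi} \<Longrightarrow> \<bar>c k a b - ?m k\<bar> \<le> e"
    by (rule uniformly_small[OF cc eps _ e]) (use c00 in auto)
  \<comment> \<open>Below 1 a square is at most its base, so a^2 + b^2 \<le> 2 \<delta>5, and the
    error K \<bar>a\<bar> (a^2 + b^2) is at most e \<bar>a\<bar>.\<close>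
  define \<delta>5 where "\<delta>5 = min 1 (e / (2 * (\<bar>K\<bar> + 1)))"
  have d5: "0 < \<delta>5" using e by (simp add: \<delta>5_def add_nonneg_pos)
  show ?thesis
  proof (rule that[of "min (min \<epsilon> \<delta>1) (min (min \<delta>2 \<delta>3) (min \<delta>4 \<delta>5))"])
    show "0 < min (min \<epsilon> \<delta>1) (min (min \<delta>2 \<delta>3) (min \<delta>4 \<delta>5))" using eps d1 d2(1) d3(1) d4(1) d5 by simp
    fix a b :: real
    assume "\<bar>a\<bar> < min (min \<epsilon> \<delta>1) (min (min \<delta>2 \<delta>3) (min \<delta>4 \<delta>5))" "\<bar>b\<bar> < min (min \<epsilon> \<delta>1) (min (min \<delta>2 \<delta>3) (min \<delta>4 \<delta>5))"
    then have a: "\<bar>a\<bar> < \<epsilon>" "\<bar>a\<bar> < \<delta>1" "\<bar>a\<bar> < \<delta>2" "\<bar>a\<bar> < \<delta>3" "\<bar>a\<bar> < \<delta>4" "\<bar>a\<bar> < \<delta>5"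
      and b: "\<bar>b\<bar> < \<epsilon>" "\<bar>b\<bar> < \<delta>1" "\<bar>b\<bar> < \<delta>2" "\<bar>b\<bar> < \<delta>3" "\<bar>b\<bar> < \<delta>4" "\<bar>b\<bar> < \<delta>5" by simp_all
    have abI: "a \<in> {- \<epsilon> <..< \<epsilon>}" "b \<in> {- \<epsilon> <..< \<epsilon>}" using a b by (auto simp: abs_less_iff)
    have t: "travelling_wave g d T k b (w k a b) (c k a b)" by (rule tw[OF kK abI])
    then have per: "w k a b (z + 2 * pi) = w k a b z" for z by (simp add: travelling_wave_def)
    have cont: "continuous_on UNIV (w k a b)"
      using D[OF abI, of 0] by (intro continuous_at_imp_continuous_on ballI DERIV_isCont) (simp add: D0)
    have wi: "integrable per (\<lambda>z. complex_of_real (w k a b z))" by (intro integrable_per_continuous continuous_intros cont)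
    have 3: "cmod (fourier_coeff (\<lambda>z. of_real (w k a b z)) n) \<le> e / \<bar>of_int n\<bar> ^ 3" if "n \<noteq> 0" for n
      using fourier_coeff_cubic_decay[where D="\<lambda>j. D j a b" and B=e and n=n, OF D[OF abI]] d2(2)[OF a(3) b(3)] per that by (simp add: D0)
    have 4: "cmod (fourier_coeff (\<lambda>z. of_real (w k a b z)) 0) \<le> e"
      by (rule fourier_coeff_sup[OF wi]) (use d3(2)[OF a(4) b(4)] in \<open>simp add: D0\<close>)
    have 5: "\<bar>c k a b - ?m k\<bar> \<le> e" by (rule d4(2)[OF a(5) b(5), of 0]) simp
    define E where "E z = W0 b + a * cos z + 1/2 * a\<^sup>2 * (1 / (?m k - ?m 0) + cos (2 * z) / (?m k - ?m (2 * k)))" for z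
    have Ei: "integrable per (\<lambda>z. complex_of_real (E z))"
      unfolding E_def divide_inverse by (intro integrable_per_continuous continuous_intros)
    have err: "cmod (of_real (w k a b z) - of_real (E z)) \<le> e * \<bar>a\<bar>" for z
    proof -
      have "cmod (of_real (w k a b z) - of_real (E z)) = \<bar>w k a b z - E z\<bar>" by (metis norm_of_real of_real_diff)
      also have "\<dots> \<le> K * (\<bar>a\<bar> * (a\<^sup>2 + b\<^sup>2))" using expand[OF a(2) b(2)] by (simp add: E_def)
      also have "\<dots> = (K * (a\<^sup>2 + b\<^sup>2)) * \<bar>a\<bar>" by (simp add: mult_ac)
      also have "\<dots> \<le> e * \<bar>a\<bar>"
      proof (rule mult_right_mono)
        have sq: "x\<^sup>2 \<le> \<delta>5" if "\<bar>x\<bar> < \<delta>5" for x :: real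
        proof -
          have "x\<^sup>2 = \<bar>x\<bar> * \<bar>x\<bar>" by (simp add: power2_eq_square)
          also have "\<dots> \<le> 1 * \<bar>x\<bar>" using that by (intro mult_right_mono) (auto simp: \<delta>5_def)
          finally show ?thesis using that by simp
        qed
        have "K * (a\<^sup>2 + b\<^sup>2) \<le> (\<bar>K\<bar> + 1) * (\<delta>5 + \<delta>5)"
          using sq[OF a(6)] sq[OF b(6)] by (intro mult_mono) auto
        also have "\<dots> \<le> (\<bar>K\<bar> + 1) * (e / (2 * (\<bar>K\<bar> + 1)) + e / (2 * (\<bar>K\<bar> + 1)))"
          by (intro mult_left_mono add_mono) (auto simp: \<delta>5_def)
        also have "\<dots> = e"
        proof -
          have gen: "q * (e / (2 * q) + e / (2 * q)) = e" if "0 < q" for q :: real using that by (simp add: field_simps)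
          show ?thesis by (rule gen) (simp add: add_nonneg_pos)
        qed
        finally show "K * (a\<^sup>2 + b\<^sup>2) \<le> e" .
      qed simp
      finally show ?thesis .
    qed
    have 6: "cmod (fourier_coeff (\<lambda>z. of_real (w k a b z)) 1 - of_real (a / 2)) \<le> e * \<bar>a\<bar>"
      using fourier_coeff_sup[OF Bochner_Integration.integrable_diff[OF wi Ei] err, of 1]
      unfolding fourier_coeff_diff[OF wi Ei] by (simp only: E_def fourier_coeff_expansion)
    show "travelling_wave g d T k b (w k a b) (c k a b) \<and> continuous_on UNIV (w k a b)
     \<and> (\<forall>n. n \<noteq> 0 \<longrightarrow> cmod (fourier_coeff (\<lambda>z. of_real (w k a b z)) n) \<le> e / \<bar>of_int n\<bar> ^ 3)
     \<and> cmod (fourier_coeff (\<lambda>z. of_real (w k a b z)) 0) \<le> e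
     \<and> \<bar>c k a b - ?m k\<bar> \<le> e
     \<and> cmod (fourier_coeff (\<lambda>z. of_real (w k a b z)) 1 - of_real (a / 2)) \<le> e * \<bar>a\<bar>"
      using t cont 3 4 5 6 by blast
  qed
qed

lemma travelling_wave_modes:
  assumes tw: "travelling_wave g d T k b w c" and cont: "continuous_on UNIV w"
    and p_l1: "l1_le p P" and p_0: "p 0 = 0"
    and coeff: "\<And>n. fourier_coeff (\<lambda>z. of_real (w z)) n = of_real (if n = 0 then w0 else p n)"
    and h_l1: "l1_le (\<lambda>n. complex_of_real (phase_speed g d T (k * of_int n)) * fourier_coeff (\<lambda>z. of_real (w z)) n) M"
    and n: "n \<noteq> 0"
  shows "(phase_speed g d T (k * of_int n) - (c - 2 * w0)) * p n + conv p p n = 0"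
proof -
  define h where "h n = complex_of_real (phase_speed g d T (k * of_int n)) * fourier_coeff (\<lambda>z. of_real (w z)) n" for n
  have h: "l1_le h M" using h_l1 by (simp add: h_def[abs_def])
  define K where "K = complex_of_real ((phase_speed g d T 0 - c)\<^sup>2 * b)"
  have eq: "fseries h z - of_real c * of_real (w z) + of_real (w z) * of_real (w z) = K * 1" for z
    using tw unfolding travelling_wave_def fourier_multiplier_def fseries_def h_def K_def
    by (simp add: power2_eq_square)
  have wi: "integrable per (\<lambda>z. complex_of_real (w z))" by (intro integrable_per_continuous continuous_intros cont)
  have i: "integrable per (fseries h)" "integrable per (\<lambda>z. of_real c * complex_of_real (w z))" "integrable per (\<lambda>z. complex_of_real (w z) * of_real (w z))"
    by (intro integrable_per_continuous continuous_intros cont fseries_continuous[OF h])+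
  have "fourier_coeff (\<lambda>z. fseries h z - of_real c * of_real (w z) + of_real (w z) * of_real (w z)) n = fourier_coeff (\<lambda>z. K * 1) n"
    by (simp only: eq)
  also have "fourier_coeff (\<lambda>z. K * 1) n = 0" using n by (simp only: fourier_coeff_cmult fourier_coeff_one if_False mult_zero_right)
  finally have "h n - of_real c * fourier_coeff (\<lambda>z. of_real (w z)) n
     + (of_real w0 * fourier_coeff (\<lambda>z. of_real (w z)) n + conv p (fourier_coeff (\<lambda>z. of_real (w z))) n) = 0"
    by (simp only: fourier_coeff_add[OF Bochner_Integration.integrable_diff[OF i(1,2)] i(3)] fourier_coeff_diff[OF i(1,2)]
      fourier_coeff_cmult fourier_coeff_fseries[OF h] fourier_coeff_real_mult[OF wi cont p_l1 p_0 coeff])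
  \<comment> \<open>The convolution of p with the full coefficient sequence contains the mean once
    more, which completes the 2 w0 in V.\<close>
  moreover have "conv p (fourier_coeff (\<lambda>z. of_real (w z))) n = of_real (conv p p n + p n * w0)"
  proof -
    have pb: "norm (p n) \<le> P" for n by (rule l1_le_norm[OF p_l1])
    have "((\<lambda>j. p j *\<^sub>R p (n - j)) has_sum conv p p n) UNIV"
      unfolding conv_def by (rule has_sum_infsum, rule conv_summable[OF p_l1 pb])
    moreover have "((\<lambda>j. p j *\<^sub>R (if n - j = 0 then w0 else 0)) has_sum p n * w0) UNIV"
      by (rule has_sum_finite_neutralI[of "{n}"]) auto
    ultimately have "((\<lambda>j. p j *\<^sub>R p (n - j) + p j *\<^sub>R (if n - j = 0 then w0 else 0)) has_sum (conv p p n + p n * w0)) UNIV"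
      by (rule has_sum_add)
    then have "((\<lambda>j. complex_of_real (p j *\<^sub>R p (n - j) + p j *\<^sub>R (if n - j = 0 then w0 else 0))) has_sum of_real (conv p p n + p n * w0)) UNIV"
      by (rule has_sum_of_real)
    moreover have "complex_of_real (p j *\<^sub>R p (n - j) + p j *\<^sub>R (if n - j = 0 then w0 else 0)) = p j *\<^sub>R fourier_coeff (\<lambda>z. of_real (w z)) (n - j)" for j
      by (simp add: coeff p_0 scaleR_conv_of_real)
    ultimately show ?thesis unfolding conv_def by (simp only: infsumI)
  qed
  ultimately have "complex_of_real ((phase_speed g d T (k * of_int n) - (c - 2 * w0)) * p n + conv p p n) = 0"
    using n by (simp add: h_def coeff algebra_simps)
  then show ?thesis by (simp only: of_real_eq_0_iff)
qed

section \<open>Small waves as instances of the abstract setting\<close>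

context dispersion
begin

text \<open>A bootstrap. The decay gives P = O(e); the profile equation, divided by the gap, bounds
  the higher harmonics by P^2 / \<gamma>, and smallness of P turns this into T2 \<le> P / 8. As P =
  T2 + 2 \<bar>p 1\<bar>, it follows that P \<le> 3 \<bar>p 1\<bar> and that T2 is quadratic in
  \<open>p 1\<close>. The three upper bounds on e supply, in this order,
  \<open>p 1 \<noteq> 0\<close>, the closeness of V to m k and the bound on P.\<close>

lemma small_wave_locale:
  fixes w :: "real \<Rightarrow> real"
  assumes sym: "symbol (\<lambda>y. m (k * y)) \<gamma> \<Lambda> \<xi>0" and k: "0 < k"
    and Bs: "l1_le (\<lambda>n::int. 1 / (real_of_int n)\<^sup>2) Bs"
    and e: "0 < e" "e \<le> 1 / 8" "e \<le> \<gamma> / 300" "e * (1200 * Bs) \<le> \<gamma>\<^sup>2"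
    and tw: "travelling_wave g d T k b w c" and cont: "continuous_on UNIV w"
    and decay: "\<And>n. n \<noteq> 0 \<Longrightarrow> cmod (fourier_coeff (\<lambda>z. of_real (w z)) n) \<le> e / \<bar>of_int n\<bar> ^ 3"
    and mean: "cmod (fourier_coeff (\<lambda>z. of_real (w z)) 0) \<le> e"
    and c: "\<bar>c - m k\<bar> \<le> e" and a: "a \<noteq> 0"
    and first: "cmod (fourier_coeff (\<lambda>z. of_real (w z)) 1 - of_real (a / 2)) \<le> e * \<bar>a\<bar>"
  obtains p V P T2 w0 where "wave (\<lambda>y. m (k * y)) \<gamma> \<Lambda> \<xi>0 p V P T2"
    "bloch (\<lambda>y. m (k * y)) \<gamma> \<Lambda> \<xi>0 p V P g d T k c w0 w"
    "T2 \<le> 9 / \<gamma> * (p 1)\<^sup>2" "\<bar>p 1\<bar> \<le> e" "\<bar>V - m k\<bar> \<le> 3 * e"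
proof -
  interpret symbol "\<lambda>y. m (k * y)" \<gamma> \<Lambda> \<xi>0 by (rule sym)
  define wh where "wh = fourier_coeff (\<lambda>z. of_real (w z))"
  define w0 where "w0 = Re (wh 0)"
  define p where "p n = (if n = 0 then 0 else Re (wh n))" for n
  define V where "V = c - 2 * w0"
  have even: "w (- z) = w z" and per: "w (z + 2 * pi) = w z" for z using tw by (simp_all add: travelling_wave_def)
  have coeff: "wh n = of_real (if n = 0 then w0 else p n)" for n
    using even_fourier_coeff(2)[where w=w and n=n, OF even] by (cases "n = 0") (simp_all add: wh_def w0_def p_def)
  have pe: "p (- n) = p n" for n using even_fourier_coeff(1)[where w=w and n=n, OF even] by (simp add: p_def wh_def)
  have p0: "p 0 = 0" by (simp add: p_def)
  have pn: "\<bar>p n\<bar> \<le> e / \<bar>of_int n\<bar> ^ 3" for n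
  proof (cases "n = 0")
    case False
    have "\<bar>p n\<bar> = cmod (wh n)" using False by (simp add: coeff)
    then show ?thesis using decay[OF False] by (simp add: wh_def)
  qed (simp add: p0)
  have cube: "1 / \<bar>real_of_int n\<bar> ^ 3 \<le> 1 / (real_of_int n)\<^sup>2" for n
  proof (cases "n = 0")
    case False
    then have "1 \<le> \<bar>n\<bar>" by linarith
    then have n1: "1 \<le> \<bar>real_of_int n\<bar>" by linarith
    have "\<bar>real_of_int n\<bar>\<^sup>2 \<le> \<bar>real_of_int n\<bar> ^ 3" using n1 by (intro power_increasing) auto
    then show ?thesis using n1 by (intro divide_left_mono mult_pos_pos) (auto simp: False)
  qed simp
  have p_l1: "l1_le p (e * Bs)"
  proof (rule l1_le_scale[OF Bs])
    show "norm (p n) \<le> e * norm (1 / (real_of_int n)\<^sup>2)" for n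
      using order_trans[OF pn[of n], of "e * (1 / (real_of_int n)\<^sup>2)"] mult_left_mono[OF cube[of n], of e] e(1) by simp
  qed (use e in simp)
  have dp_l1: "l1_le (\<lambda>n. of_int n * p n) (e * Bs)"
  proof (rule l1_le_scale[OF Bs])
    show "norm (real_of_int n * p n) \<le> e * norm (1 / (real_of_int n)\<^sup>2)" for n
    proof (cases "n = 0")
      case False
      have "\<bar>real_of_int n\<bar> * \<bar>p n\<bar> \<le> \<bar>real_of_int n\<bar> * (e / \<bar>of_int n\<bar> ^ 3)" by (intro mult_left_mono pn) auto
      also have "\<dots> = e * (1 / (real_of_int n)\<^sup>2)" using False by (simp add: power2_eq_square power3_eq_cube abs_mult_self_eq)
      finally show ?thesis by (simp add: abs_mult)
    qed simp
  qed (use e in simp)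
  have g: "0 < \<gamma>" "\<gamma> \<le> 1" by (rule gamma)+
  define x where "x = p 1"
  have xe: "\<bar>x\<bar> \<le> e" using pn[of 1] by (simp add: x_def)
  have xB: "\<bar>x\<bar> \<le> e * Bs" using l1_le_norm[OF p_l1, of 1] by (simp add: x_def)
  have x0: "x \<noteq> 0"
  proof
    assume "x = 0"
    then have "wh 1 = 0" by (simp add: coeff x_def)
    then have "\<bar>a\<bar> / 2 \<le> e * \<bar>a\<bar>" using first by (simp add: wh_def norm_divide)
    also have "\<dots> \<le> 1 / 8 * \<bar>a\<bar>" using e by (intro mult_right_mono) auto
    finally show False using a by simp
  qed
  have V: "\<bar>V - m k\<bar> \<le> 3 * e"
  proof -
    have "\<bar>w0\<bar> \<le> e" using mean by (simp add: coeff wh_def[symmetric])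
    then show ?thesis using c by (simp add: V_def)
  qed
  have Vg: "\<bar>V - m (k * 1)\<bar> \<le> \<gamma> / 100" using V e(3) by simp
  define T2 where "T2 = (\<Sum>\<^sub>\<infinity>n. norm (tail p n))"
  have tl: "l1_le (tail p) (e * Bs)" by (rule l1_le_compare[OF p_l1]) (simp add: tail_def)
  have tT: "l1_le (tail p) T2" unfolding T2_def by (rule summable_l1_le[OF l1_le_summable[OF tl]])
  have TB: "T2 \<le> e * Bs" unfolding T2_def by (rule l1_le_infsum[OF tl])
  have T0: "0 \<le> T2" by (rule l1_le_nonneg[OF tT])
  define P where "P = T2 + 2 * \<bar>x\<bar>"
  have pP: "l1_le p P"
  proof -
    have "l1_le (\<lambda>n. tail p n + (if n \<in> Core then p n else 0)) (T2 + (\<Sum>n\<in>Core. norm (if n \<in> Core then p n else 0)))"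
      by (intro l1_le_add tT l1_le_finite_support) (auto simp: Core_def)
    moreover have "(\<lambda>n. tail p n + (if n \<in> Core then p n else 0)) = p" by (simp add: fun_eq_iff tail_def)
    moreover have "(\<Sum>n\<in>Core. norm (if n \<in> Core then p n else 0)) = 2 * \<bar>x\<bar>"
      using pe[of 1] by (simp add: Core_def p0 x_def)
    ultimately show ?thesis by (simp add: P_def)
  qed
  have P0: "0 \<le> P" using T0 by (simp add: P_def)
  have Psmall: "P \<le> \<gamma>\<^sup>2 / 400"
  proof -
    have "P \<le> 3 * (e * Bs)" using TB xB by (simp add: P_def)
    then show ?thesis using e(4) by (simp add: mult_ac)
  qed
  have modes: "(m (k * of_int n) - V) * p n + conv p p n = 0" if n: "n \<noteq> 0" for n
  proof -
    have "\<exists>M. l1_le (\<lambda>n. complex_of_real (m (k * of_int n)) * wh n) M"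
    proof -
      define G where "G = (A + B + 1) * (1 + k) * e"
      have G0: "0 \<le> G" using A_pos B_pos k e(1) by (simp add: G_def)
      have "l1_le (\<lambda>n. (if n = 0 then 0 else complex_of_real (m (k * of_int n)) * wh n)) (G * Bs)"
      proof (rule l1_le_scale[OF Bs _ G0])
        fix n :: int
        show "norm (if n = 0 then 0 else complex_of_real (m (k * of_int n)) * wh n) \<le> G * norm (1 / (real_of_int n)\<^sup>2)"
        proof (cases "n = 0")
          case False
          then have "1 \<le> \<bar>n\<bar>" by linarith
          then have n1: "1 \<le> \<bar>real_of_int n\<bar>" by linarith
          have "\<bar>m (k * of_int n)\<bar> \<le> (A + B + 1) * (1 + \<bar>k * of_int n\<bar>)" by (rule m_growth)
          also have "\<dots> \<le> (A + B + 1) * ((1 + k) * \<bar>of_int n\<bar>)"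
            using A_pos B_pos k n1 by (intro mult_left_mono) (auto simp: abs_mult distrib_right)
          finally have mn: "\<bar>m (k * of_int n)\<bar> \<le> (A + B + 1) * (1 + k) * \<bar>of_int n\<bar>" by (simp add: mult.assoc)
          have "cmod (complex_of_real (m (k * of_int n)) * wh n) \<le> ((A + B + 1) * (1 + k) * \<bar>of_int n\<bar>) * (e / \<bar>of_int n\<bar> ^ 3)"
            unfolding norm_mult norm_of_real using decay[OF False] by (intro mult_mono mn) (use A_pos B_pos k in \<open>auto simp: wh_def\<close>)
          also have "\<dots> = G * (1 / (real_of_int n)\<^sup>2)"
            using False by (simp add: G_def power2_eq_square power3_eq_cube abs_mult_self_eq)
          finally show ?thesis using False by simp
        qed simp
      qed
      from l1_le_add[OF this l1_le_finite_support[of "{0::int}" "\<lambda>n. if n = 0 then complex_of_real (m (k * of_int n)) * wh n else 0"]]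
      have "l1_le (\<lambda>n. (if n = 0 then 0 else complex_of_real (m (k * of_int n)) * wh n) + (if n = 0 then complex_of_real (m (k * of_int n)) * wh n else 0))
        (G * Bs + (\<Sum>n\<in>{0::int}. norm (if n = 0 then complex_of_real (m (k * of_int n)) * wh n else 0)))" by simp
      moreover have "(\<lambda>n. (if n = 0 then 0 else complex_of_real (m (k * of_int n)) * wh n) + (if n = 0 then complex_of_real (m (k * of_int n)) * wh n else 0))
        = (\<lambda>n. complex_of_real (m (k * of_int n)) * wh n)" by (simp add: fun_eq_iff)
      ultimately show ?thesis by (intro exI) (simp only:)
    qed
    then obtain M where "l1_le (\<lambda>n. complex_of_real (m (k * of_int n)) * wh n) M" by blast
    from travelling_wave_modes[OF tw cont p_l1 p0 coeff[unfolded wh_def] this[unfolded wh_def] n] show ?thesis by (simp only: V_def)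
  qed
  have T2P: "T2 \<le> P * P / \<gamma>"
  proof -
    have "l1_le (tail p) (1 / \<gamma> * (P * P))"
    proof (rule l1_le_scale[OF conv_l1[OF pP pP]])
      show "norm (tail p n) \<le> 1 / \<gamma> * norm (conv p p n)" for n
      proof (cases "n \<in> Core")
        case False
        then have n0: "n \<noteq> 0" by (auto simp: Core_def)
        have "2 * \<gamma> \<le> \<bar>m (k * (of_int n + 0)) - m (k * 1)\<bar>" by (rule gap[OF False]) (use xi0 in simp)
        then have "2 * \<gamma> \<le> \<bar>m (k * of_int n) - m (k * 1)\<bar>" by simp
        then have "\<gamma> \<le> \<bar>m (k * of_int n) - V\<bar>" using Vg g by linarith
        from mult_right_mono[OF this, of "\<bar>p n\<bar>"] have "\<gamma> * \<bar>p n\<bar> \<le> \<bar>(m (k * of_int n) - V) * p n\<bar>" by (simp add: abs_mult)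
        also have "(m (k * of_int n) - V) * p n = - conv p p n" using modes[OF n0] by linarith
        finally show ?thesis using g False by (simp add: tail_def pos_le_divide_eq mult.commute)
      qed (use g in \<open>simp add: tail_def\<close>)
    qed (use g in simp)
    from l1_le_infsum[OF this] show ?thesis by (simp add: T2_def)
  qed
  have Tx: "T2 \<le> \<bar>x\<bar>"
  proof -
    have "\<gamma>\<^sup>2 \<le> \<gamma>" using g by (simp add: power2_eq_square mult_left_le)
    then have "P \<le> \<gamma> / 8" using Psmall g by linarith
    then have "P * P / \<gamma> \<le> P * (\<gamma> / 8) / \<gamma>" using P0 g by (intro divide_right_mono mult_left_mono) auto
    from order_trans[OF T2P this] have "T2 \<le> P / 8" using g by simp
    then show ?thesis using T0 by (simp add: P_def)
  qed
  have P3: "P \<le> 3 * \<bar>x\<bar>" using Tx by (simp add: P_def)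
  have T9: "T2 \<le> 9 / \<gamma> * x\<^sup>2"
  proof -
    have "P * P \<le> (3 * \<bar>x\<bar>) * (3 * \<bar>x\<bar>)" using P3 P0 by (intro mult_mono) auto
    also have "\<dots> = 9 * x\<^sup>2" by (simp add: power2_eq_square)
    finally have "P * P / \<gamma> \<le> 9 * x\<^sup>2 / \<gamma>" using g by (simp add: divide_right_mono)
    then show ?thesis using T2P by simp
  qed
  have pot: "potential (\<lambda>y. m (k * y)) \<gamma> \<Lambda> \<xi>0 p V P"
    by (intro potential.intro sym potential_axioms.intro pe p0 pP Psmall Vg)
  show ?thesis
  proof (rule that)
    show "wave (\<lambda>y. m (k * y)) \<gamma> \<Lambda> \<xi>0 p V P T2"
      by (intro wave.intro pot wave_axioms.intro modes tT exI[of _ "e * Bs"] dp_l1) (use x0 P3 in \<open>simp_all add: x_def\<close>)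
    show "bloch (\<lambda>y. m (k * y)) \<gamma> \<Lambda> \<xi>0 p V P g d T k c w0 w"
      by (intro bloch.intro pot bloch_axioms.intro cont per coeff[unfolded wh_def] V_def) simp
    show "T2 \<le> 9 / \<gamma> * (p 1)\<^sup>2" using T9 by (simp add: x_def)
    show "\<bar>p 1\<bar> \<le> e" using xe by (simp add: x_def)
    show "\<bar>V - m k\<bar> \<le> 3 * e" by (rule V)
  qed
qed

lemma small_waves:
  assumes sym: "symbol (\<lambda>y. m (k * y)) \<gamma> \<Lambda> \<xi>0" and k: "0 < k" and wf: "wave_family g d T k w c" and e: "0 < e"
  obtains \<delta> where "0 < \<delta>" "\<And>a b. a \<noteq> 0 \<Longrightarrow> \<bar>a\<bar> < \<delta> \<Longrightarrow> \<bar>b\<bar> < \<delta> \<Longrightarrow>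
     \<exists>p V P T2 w0. wave (\<lambda>y. m (k * y)) \<gamma> \<Lambda> \<xi>0 p V P T2 \<and> bloch (\<lambda>y. m (k * y)) \<gamma> \<Lambda> \<xi>0 p V P g d T k (c k a b) w0 (w k a b)
       \<and> T2 \<le> 9 / \<gamma> * (p 1)\<^sup>2 \<and> \<bar>p 1\<bar> \<le> e \<and> \<bar>V - m k\<bar> \<le> e"
proof -
  interpret symbol "\<lambda>y. m (k * y)" \<gamma> \<Lambda> \<xi>0 by (rule sym)
  obtain Bs where Bs: "l1_le (\<lambda>n::int. 1 / (real_of_int n)\<^sup>2) Bs" using l1_le_inverse_square by blast
  have B1: "1 \<le> Bs" using l1_le_norm[OF Bs, of 1] by simp
  define e' where "e' = min (min (e / 3) (1 / 8)) (min (\<gamma> / 300) (\<gamma>\<^sup>2 / (1200 * Bs)))"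
  have e': "0 < e'" "e' \<le> 1 / 8" "e' \<le> \<gamma> / 300" "e' * (1200 * Bs) \<le> \<gamma>\<^sup>2" "3 * e' \<le> e" "e' \<le> e"
  proof -
    show "0 < e'" using e gamma B1 by (simp add: e'_def)
    have "e' \<le> \<gamma>\<^sup>2 / (1200 * Bs)" by (simp add: e'_def)
    then show "e' * (1200 * Bs) \<le> \<gamma>\<^sup>2" using B1 by (simp add: pos_le_divide_eq)
    have "e' \<le> e / 3" by (simp add: e'_def)
    then show "3 * e' \<le> e" "e' \<le> e" using e by simp_all
  qed (simp_all add: e'_def)
  obtain \<delta> where d: "0 < \<delta>" and small: "\<And>a b. \<bar>a\<bar> < \<delta> \<Longrightarrow> \<bar>b\<bar> < \<delta> \<Longrightarrow>
     travelling_wave g d T k b (w k a b) (c k a b) \<and> continuous_on UNIV (w k a b)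
     \<and> (\<forall>n. n \<noteq> 0 \<longrightarrow> cmod (fourier_coeff (\<lambda>z. of_real (w k a b z)) n) \<le> e' / \<bar>of_int n\<bar> ^ 3)
     \<and> cmod (fourier_coeff (\<lambda>z. of_real (w k a b z)) 0) \<le> e'
     \<and> \<bar>c k a b - m k\<bar> \<le> e'
     \<and> cmod (fourier_coeff (\<lambda>z. of_real (w k a b z)) 1 - of_real (a / 2)) \<le> e' * \<bar>a\<bar>"
    by (rule wave_family_small[OF wf e'(1)]) blast
  show ?thesis
  proof (rule that[OF d])
    fix a b :: real assume a: "a \<noteq> 0" and ab: "\<bar>a\<bar> < \<delta>" "\<bar>b\<bar> < \<delta>"
    note s = small[OF ab]
    obtain p V P T2 w0 where "wave (\<lambda>y. m (k * y)) \<gamma> \<Lambda> \<xi>0 p V P T2" "bloch (\<lambda>y. m (k * y)) \<gamma> \<Lambda> \<xi>0 p V P g d T k (c k a b) w0 (w k a b)"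
      "T2 \<le> 9 / \<gamma> * (p 1)\<^sup>2" "\<bar>p 1\<bar> \<le> e'" "\<bar>V - m k\<bar> \<le> 3 * e'"
      by (rule small_wave_locale[OF sym k Bs e'(1-4), of b "w k a b" "c k a b" a]) (use s a in blast)+
    then show "\<exists>p V P T2 w0. wave (\<lambda>y. m (k * y)) \<gamma> \<Lambda> \<xi>0 p V P T2 \<and> bloch (\<lambda>y. m (k * y)) \<gamma> \<Lambda> \<xi>0 p V P g d T k (c k a b) w0 (w k a b)
       \<and> T2 \<le> 9 / \<gamma> * (p 1)\<^sup>2 \<and> \<bar>p 1\<bar> \<le> e \<and> \<bar>V - m k\<bar> \<le> e"
      using e'(5,6) order_trans by blast
  qed
qed

end

section \<open>Modulational stability\<close>

text \<open>The lower bound of \<open>q 3\<close> certifies that each cubic is genuine; it also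
  limits how fast a root may escape to infinity while \<open>q 3\<close> tends to 0.\<close>

lemma eigenvalue_cubic_sequence:
  fixes S :: "real \<Rightarrow> real" and p :: "nat \<Rightarrow> int \<Rightarrow> real" and V P T2 \<xi> :: "nat \<Rightarrow> real"
    and \<gamma> \<Lambda> \<xi>0 Ct \<sigma>1 \<sigma>2 :: real
  defines "B \<equiv> \<lambda>n. potential.Bm S (p n) (V n) (\<xi> n) (potential.frame S \<gamma> (p n) (V n) (P n) (\<xi> n))"
  assumes W: "\<And>n. wave S \<gamma> \<Lambda> \<xi>0 (p n) (V n) (P n) (T2 n)" and Ct: "0 \<le> Ct" "\<And>n. T2 n \<le> Ct * (p n 1)\<^sup>2"
    and x: "(\<lambda>n. p n 1) \<longlonglongrightarrow> 0" and V: "V \<longlonglongrightarrow> S 1"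
    and xi: "\<And>n. \<xi> n \<noteq> 0" "\<And>n. \<bar>\<xi> n\<bar> \<le> \<bar>p n 1\<bar> ^ 3" "\<And>n. \<bar>\<xi> n\<bar> \<le> \<xi>0"
    and S0: "isCont S 0"
    and S1: "\<And>h. \<bar>h\<bar> \<le> \<xi>0 \<Longrightarrow> \<bar>S (1 + h) - S 1 - \<sigma>1 * h\<bar> \<le> \<Lambda> * h\<^sup>2"
    and S2: "((\<lambda>h. (S (1 + h) + S (1 - h) - 2 * S 1) / h\<^sup>2) \<longlongrightarrow> \<sigma>2) (at 0)"
  obtains q :: "nat \<Rightarrow> nat \<Rightarrow> real"
  where "q 0 \<longlonglongrightarrow> (S 1 - S 0 + \<sigma>1) * ((- 4 / (S 1 - S 2)) * (- \<sigma>2 / 2 - \<sigma>1)) - 8 * (- \<sigma>2 / 2 - \<sigma>1)"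
    "q 1 \<longlonglongrightarrow> 0" "q 2 \<longlonglongrightarrow> - (S 1 - S 0 + \<sigma>1)" "q 3 \<longlonglongrightarrow> 0" "\<And>n. \<bar>p n 1\<bar> \<le> \<bar>q 3 n\<bar>"
    "\<And>n s. core_eigenvalue (B n) (of_real (\<xi> n) * (of_real (- \<sigma>1) + of_real (p n 1) * s)) \<longleftrightarrow>
       of_real (q 3 n) * s ^ 3 + of_real (q 2 n) * s\<^sup>2 + of_real (q 1 n) * s + of_real (q 0 n) = 0"
proof -
  have pot: "potential S \<gamma> \<Lambda> \<xi>0 (p n) (V n) (P n)" for n using W[of n] by (simp add: wave_def)
  have sym: "symbol S \<gamma> \<Lambda> \<xi>0" using pot[of 0] by (simp add: potential_def)
  interpret symbol S \<gamma> \<Lambda> \<xi>0 by (rule sym)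
  define a where "a n i j = wave.At S \<gamma> (p n) (V n) (P n) (\<xi> n) i j" for n i j
  have B: "B n = (\<lambda>i j. (of_int i + \<xi> n) * a n i j)" for n
    unfolding B_def a_def by (intro ext wave.Bm_At[OF W])
  have P0: "0 \<le> P n" for n by (rule potential.P_nonneg[OF pot])
  have x0: "p n 1 \<noteq> 0" for n by (rule wave.p_1[OF W])
  have P3: "P n \<le> 3 * \<bar>p n 1\<bar>" for n by (rule wave.P_le[OF W])
  have T0: "0 \<le> T2 n" for n by (rule l1_le_nonneg[OF wave.tail_p[OF W]])
  have L0: "0 \<le> \<Lambda>" using Lambda by linarith
  have S12: "S 2 \<noteq> S 1"
    using gap[of 2 0] gamma xi0 by (auto simp: Core_def)
  {
    fix n
    note wave.entry_bounds[OF W[of n] xi(3)[of n], unfolded potential.Q_def[OF pot[of n]] potential.R_def[OF pot[of n]], folded a_def]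
  }
  note bounds = this
  note lim = cubic_coefficients_tendsto[where a=a and x="\<lambda>n. p n 1" and V=V and P=P and ?T2.0=T2 and ?p2.0="\<lambda>n. p n 2" and \<xi>=\<xi> and S=S
      and \<gamma>=\<gamma> and \<Lambda>=\<Lambda> and Ct=Ct and ?\<xi>0.0=\<xi>0 and ?\<sigma>1.0=\<sigma>1 and ?\<sigma>2.0=\<sigma>2, OF gamma(1) L0 Ct(1) x0 x V P0 P3 T0 Ct(2) xi S0 S1 S2 S12 wave.p_2_eq[OF W] bounds]
  define q where "q i n = cq (a n 0 0 - - \<sigma>1) (p n 1) (1 / (1 - (\<xi> n)\<^sup>2)) ((\<xi> n)\<^sup>2 / (p n 1)\<^sup>2)
     ((a n 1 1 + a n 1 (-1) + a n (-1) 1 + a n (-1) (-1)) / 2 / (p n 1)\<^sup>2 + (\<xi> n)\<^sup>2 / (p n 1)\<^sup>2 * - \<sigma>1 * (1 / (1 - (\<xi> n)\<^sup>2)))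
     ((a n 1 1 - a n 1 (-1) - a n (-1) 1 + a n (-1) (-1)) / 2 / (\<xi> n)\<^sup>2 + - \<sigma>1 * (1 / (1 - (\<xi> n)\<^sup>2)))
     (((a n 1 1 - a n 1 (-1) + a n (-1) 1 - a n (-1) (-1)) / 2 / \<xi> n - - \<sigma>1 * (1 / (1 - (\<xi> n)\<^sup>2))) / p n 1)
     (((a n 1 1 + a n 1 (-1) - a n (-1) 1 - a n (-1) (-1)) / 2 / \<xi> n - - \<sigma>1 * (1 / (1 - (\<xi> n)\<^sup>2))) / p n 1)
     ((a n 0 1 + a n 0 (-1)) / p n 1) ((a n 1 0 + a n (-1) 0) / 2 / p n 1)
     ((a n 0 1 - a n 0 (-1)) / (\<xi> n * p n 1)) ((a n 1 0 - a n (-1) 0) / 2 / (\<xi> n * p n 1)) i" for i n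
  have xi1: "\<bar>\<xi> n\<bar> < 1" for n
  proof -
    have "\<gamma> / (100 * \<Lambda>) < 1" using gamma Lambda by (simp add: divide_less_eq)
    then show ?thesis using xi(3)[of n] xi0 by linarith
  qed
  show ?thesis
  proof (rule that[of q])
    show "q 0 \<longlonglongrightarrow> (S 1 - S 0 + \<sigma>1) * ((- 4 / (S 1 - S 2)) * (- \<sigma>2 / 2 - \<sigma>1)) - 8 * (- \<sigma>2 / 2 - \<sigma>1)"
      unfolding q_def[abs_def] by (rule lim(1))
    show "q 1 \<longlonglongrightarrow> 0" unfolding q_def[abs_def] by (rule lim(2))
    show "q 2 \<longlonglongrightarrow> - (S 1 - S 0 + \<sigma>1)" unfolding q_def[abs_def] by (rule lim(3))
    show "q 3 \<longlonglongrightarrow> 0" unfolding q_def[abs_def] by (rule lim(4))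
    show "\<bar>p n 1\<bar> \<le> \<bar>q 3 n\<bar>" for n
    proof -
      have "q 3 n = p n 1 * (1 / (1 - (\<xi> n)\<^sup>2))" unfolding q_def by (rule fun_cong[OF lim(5)])
      moreover have "1 \<le> \<bar>1 / (1 - (\<xi> n)\<^sup>2)\<bar>"
      proof -
        have "(\<xi> n)\<^sup>2 < 1" using xi1[of n] by (simp add: abs_square_less_1)
        then have "0 < 1 - (\<xi> n)\<^sup>2" "1 - (\<xi> n)\<^sup>2 \<le> 1" by simp_all
        then show ?thesis by (simp add: le_divide_eq)
      qed
      ultimately show ?thesis using mult_left_mono[of 1 "\<bar>1 / (1 - (\<xi> n)\<^sup>2)\<bar>" "\<bar>p n 1\<bar>"] by (simp only: abs_mult mult_1_right abs_ge_zero)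
    qed
    show "core_eigenvalue (B n) (of_real (\<xi> n) * (of_real (- \<sigma>1) + of_real (p n 1) * s)) \<longleftrightarrow>
       of_real (q 3 n) * s ^ 3 + of_real (q 2 n) * s\<^sup>2 + of_real (q 1 n) * s + of_real (q 0 n) = 0" for n s
      unfolding B q_def by (rule eigenvalue_cubic[OF xi(1) xi1 x0])
  qed
qed

context dispersion
begin

text \<open>Z is the negation of the claim, that is instability in one case and stability in the
  other. Its occurrence at arbitrarily small amplitude supplies waves with \<open>p 1\<close>
  tending to 0, so that limits take the place of estimates uniform in (a, b).\<close>

lemma wave_sequence:
  assumes sym: "symbol (\<lambda>y. m (k * y)) \<gamma> \<Lambda> \<xi>0" and k: "0 < k" and wf: "wave_family g d T k w c"
    and bad: "\<forall>\<epsilon>>0. \<exists>a b. a \<noteq> 0 \<and> \<bar>a\<bar> < \<epsilon> \<and> \<bar>b\<bar> < \<epsilon> \<and> Z (w k a b) (c k a b)"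
  obtains W C p V P T2 w0 where "\<And>n::nat. wave (\<lambda>y. m (k * y)) \<gamma> \<Lambda> \<xi>0 (p n) (V n) (P n) (T2 n)"
    "\<And>n. bloch (\<lambda>y. m (k * y)) \<gamma> \<Lambda> \<xi>0 (p n) (V n) (P n) g d T k (C n) (w0 n) (W n)"
    "\<And>n. T2 n \<le> 9 / \<gamma> * (p n 1)\<^sup>2" "(\<lambda>n. p n 1) \<longlonglongrightarrow> 0" "V \<longlonglongrightarrow> m (k * 1)" "\<And>n. Z (W n) (C n)"
proof -
  define G where "G n W C p V P T2 w0 \<longleftrightarrow> wave (\<lambda>y. m (k * y)) \<gamma> \<Lambda> \<xi>0 p V P T2 \<and> bloch (\<lambda>y. m (k * y)) \<gamma> \<Lambda> \<xi>0 p V P g d T k C w0 W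
       \<and> T2 \<le> 9 / \<gamma> * (p 1)\<^sup>2 \<and> \<bar>p 1\<bar> \<le> inverse (real (Suc n)) \<and> \<bar>V - m k\<bar> \<le> inverse (real (Suc n)) \<and> Z W C" for n W C p V P T2 w0
  have "\<exists>W C p V P T2 w0. G n W C p V P T2 w0" for n
  proof -
    have "0 < inverse (real (Suc n))" by simp
    then obtain \<delta> where d: "0 < \<delta>" and small: "\<And>a b. a \<noteq> 0 \<Longrightarrow> \<bar>a\<bar> < \<delta> \<Longrightarrow> \<bar>b\<bar> < \<delta> \<Longrightarrow>
     \<exists>p V P T2 w0. wave (\<lambda>y. m (k * y)) \<gamma> \<Lambda> \<xi>0 p V P T2 \<and> bloch (\<lambda>y. m (k * y)) \<gamma> \<Lambda> \<xi>0 p V P g d T k (c k a b) w0 (w k a b)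
       \<and> T2 \<le> 9 / \<gamma> * (p 1)\<^sup>2 \<and> \<bar>p 1\<bar> \<le> inverse (real (Suc n)) \<and> \<bar>V - m k\<bar> \<le> inverse (real (Suc n))"
      by (rule small_waves[OF sym k wf]) blast
    obtain a b where ab: "a \<noteq> 0" "\<bar>a\<bar> < \<delta>" "\<bar>b\<bar> < \<delta>" and Z: "Z (w k a b) (c k a b)" using bad d by blast
    from small[OF ab] Z show ?thesis unfolding G_def by blast
  qed
  then obtain W C p V P T2 w0 where G: "\<And>n. G n (W n) (C n) (p n) (V n) (P n) (T2 n) (w0 n)" by metis
  note G' = G[unfolded G_def]
  show ?thesis
  proof (rule that[of p V P T2 C w0 W])
    show "(\<lambda>n. p n 1) \<longlonglongrightarrow> 0"
      by (rule tendsto_abs_le[OF _ LIMSEQ_inverse_real_of_nat]) (use G' in simp)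
    show "V \<longlonglongrightarrow> m (k * 1)"
      by (rule tendsto_abs_le[OF _ LIMSEQ_inverse_real_of_nat]) (use G' in simp)
  qed (use G' in blast)+
qed

text \<open>With f1 = (k m)' - m(0), f2 = (k m)'' and D = m(k) - m(2k), the limiting coefficients
  are h0 = 2 k f2 (f1 + 2 D) / D and h2 = -f1. The factor f1 + 2 D is the Benjamin-Feir quantity
  \<open>Delta_BF\<close>. A negative product h0 h2 means real limiting roots.\<close>

lemma Delta_MI_cubic:
  assumes k: "0 < k" "m (2 * k) \<noteq> m k"
  defines "\<sigma>1 \<equiv> k * m1 k" and "\<sigma>2 \<equiv> k\<^sup>2 * m2 k"
  shows "((m (k * 1) - m (k * 0) + \<sigma>1) * ((- 4 / (m (k * 1) - m (k * 2))) * (- \<sigma>2 / 2 - \<sigma>1)) - 8 * (- \<sigma>2 / 2 - \<sigma>1))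
     * (- (m (k * 1) - m (k * 0) + \<sigma>1)) = - 2 * k * Delta_MI g d T k"
proof -
  define D where "D = m k - m (2 * k)"
  have D: "D \<noteq> 0" using k by (simp add: D_def)
  define f1 where "f1 = m k - m 0 + \<sigma>1"
  define f2 where "f2 = 2 * m1 k + k * m2 k"
  have "- \<sigma>2 / 2 - \<sigma>1 = - (k / 2) * f2" by (simp add: \<sigma>1_def \<sigma>2_def f2_def power2_eq_square algebra_simps)
  moreover have "Delta_MI g d T k = f2 * f1 / D * (2 * D + f1)"
  proof -
    have "m k + k * m1 k - m 0 = f1" by (simp add: f1_def \<sigma>1_def)
    then show ?thesis by (simp only: Delta_MI_def Delta_BF_def Let_def deriv_zm[OF k(1)] f2_def[symmetric] D_def[symmetric])
  qed
  moreover have "(f1 * ((- 4 / D) * (- (k / 2) * f2)) - 8 * (- (k / 2) * f2)) * (- f1) = - 2 * k * (f2 * f1 / D * (2 * D + f1))"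
    using D by (simp add: field_simps)
  ultimately show ?thesis unfolding f1_def D_def by (simp add: mult.commute)
qed

lemma isCont_m_scaled: "isCont (\<lambda>y. m (k * y)) 0"
  by (rule isCont_o2[where g=m]) (auto simp: m_isCont_0)

lemma stable_waves:
  assumes k: "k \<in> admissible_wave_numbers g d T" and wf: "wave_family g d T k w c" and pos: "0 < Delta_MI g d T k"
  shows "\<exists>\<epsilon>>0. \<forall>a b. a \<noteq> 0 \<and> \<bar>a\<bar> < \<epsilon> \<and> \<bar>b\<bar> < \<epsilon> \<longrightarrow> modulationally_stable g d T k (w k a b) (c k a b)"
proof (rule ccontr)
  assume no: "\<not> ?thesis"
  have k0: "0 < k" using k by (auto simp: admissible_wave_numbers_def split: if_splits)
  have k2: "m (2 * k) \<noteq> m k" using no_resonance[OF k, of 2] by simp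
  obtain \<gamma> \<Lambda> \<xi>0 where sym: "symbol (\<lambda>y. m (k * y)) \<gamma> \<Lambda> \<xi>0"
    and tay: "\<And>h. \<bar>h\<bar> \<le> \<xi>0 \<Longrightarrow> \<bar>m (k * (1 + h)) - m (k * 1) - k * m1 k * h\<bar> \<le> \<Lambda> * h\<^sup>2"
    by (rule dispersion_symbol[OF k]) blast
  interpret symbol "\<lambda>y. m (k * y)" \<gamma> \<Lambda> \<xi>0 by (rule sym)
  define S where "S = (\<lambda>y. m (k * y))"
  have bad: "\<forall>\<epsilon>>0. \<exists>a b. a \<noteq> 0 \<and> \<bar>a\<bar> < \<epsilon> \<and> \<bar>b\<bar> < \<epsilon> \<and> modulationally_unstable g d T k (w k a b) (c k a b)"
    using no by blast
  obtain W C p V P T2 w0 where wv: "\<And>n::nat. wave S \<gamma> \<Lambda> \<xi>0 (p n) (V n) (P n) (T2 n)"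
    and bl: "\<And>n. bloch S \<gamma> \<Lambda> \<xi>0 (p n) (V n) (P n) g d T k (C n) (w0 n) (W n)"
    and T2: "\<And>n. T2 n \<le> 9 / \<gamma> * (p n 1)\<^sup>2" and x: "(\<lambda>n. p n 1) \<longlonglongrightarrow> 0" and V1: "V \<longlonglongrightarrow> m (k * 1)"
    and un: "\<And>n. modulationally_unstable g d T k (W n) (C n)"
    by (rule wave_sequence[where Z="\<lambda>w c. modulationally_unstable g d T k w c", OF sym k0 wf bad, folded S_def]) (rule that, assumption+)
  have V: "V \<longlonglongrightarrow> S 1" using V1 by (simp add: S_def)
  have x0: "p n 1 \<noteq> 0" for n by (rule wave.p_1[OF wv])
  \<comment> \<open>Instability is evaluated with \<delta> = min \<xi>0 (\<bar>p 1\<bar>^3) and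
    radius \<gamma> / 8, which places the offending spectral point inside the range of the
    reduction.\<close>
  have "\<exists>\<xi> \<mu>. \<bar>\<xi>\<bar> < min \<xi>0 (\<bar>p n 1\<bar> ^ 3) \<and> \<mu> \<in> L2per_spectrum (bloch_operator g d T k (W n) (C n) \<xi>) \<and> cmod \<mu> < \<gamma> / 8 \<and> Re \<mu> \<noteq> 0" for n
  proof -
    have "0 < min \<xi>0 (\<bar>p n 1\<bar> ^ 3)" "0 < \<gamma> / 8" using xi0 gamma x0[of n] by simp_all
    then show ?thesis using un[of n] unfolding modulationally_unstable_def by blast
  qed
  then obtain \<xi> \<mu> where xi: "\<And>n. \<bar>\<xi> n\<bar> < min \<xi>0 (\<bar>p n 1\<bar> ^ 3)"
    and spec: "\<And>n. \<mu> n \<in> L2per_spectrum (bloch_operator g d T k (W n) (C n) (\<xi> n))"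
    and mu: "\<And>n. cmod (\<mu> n) < \<gamma> / 8" "\<And>n. Re (\<mu> n) \<noteq> 0" by metis
  have xi': "\<bar>\<xi> n\<bar> \<le> \<xi>0" "\<bar>\<xi> n\<bar> \<le> \<bar>p n 1\<bar> ^ 3" for n using xi[of n] by simp_all
  have ev: "core_eigenvalue (potential.Bm S (p n) (V n) (\<xi> n) (potential.frame S \<gamma> (p n) (V n) (P n) (\<xi> n))) (- \<i> * \<mu> n)" for n
    by (rule bloch.spectrum_core_eigenvalue[OF bl xi'(1)]) (use mu(1)[of n] spec[of n] in \<open>simp_all add: norm_mult\<close>)
  have xnz: "\<xi> n \<noteq> 0" for n
  proof
    assume z: "\<xi> n = 0"
    from wave.core_eigenvalue_at_0[OF wv ev[of n, unfolded z]] show False using mu(2)[of n] by simp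
  qed
  have Ct: "0 \<le> 9 / \<gamma>" using gamma by simp
  obtain q :: "nat \<Rightarrow> nat \<Rightarrow> real"
    where q: "q 0 \<longlonglongrightarrow> (S 1 - S 0 + k * m1 k) * ((- 4 / (S 1 - S 2)) * (- (k\<^sup>2 * m2 k) / 2 - k * m1 k)) - 8 * (- (k\<^sup>2 * m2 k) / 2 - k * m1 k)"
      "q 1 \<longlonglongrightarrow> 0" "q 2 \<longlonglongrightarrow> - (S 1 - S 0 + k * m1 k)" "q 3 \<longlonglongrightarrow> 0" and q3: "\<And>n. \<bar>p n 1\<bar> \<le> \<bar>q 3 n\<bar>"
    and cubic: "\<And>n s. core_eigenvalue (potential.Bm S (p n) (V n) (\<xi> n) (potential.frame S \<gamma> (p n) (V n) (P n) (\<xi> n)))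
        (of_real (\<xi> n) * (of_real (- (k * m1 k)) + of_real (p n 1) * s)) \<longleftrightarrow>
       of_real (q 3 n) * s ^ 3 + of_real (q 2 n) * s\<^sup>2 + of_real (q 1 n) * s + of_real (q 0 n) = 0"
    by (rule eigenvalue_cubic_sequence[OF wv Ct T2 x V xnz xi'(2,1), where ?\<sigma>1.0="k * m1 k" and ?\<sigma>2.0="k\<^sup>2 * m2 k"])
      (use isCont_m_scaled tay m_second_difference[OF k0] in \<open>auto simp: S_def\<close>)
  define h0 where "h0 = (S 1 - S 0 + k * m1 k) * ((- 4 / (S 1 - S 2)) * (- (k\<^sup>2 * m2 k) / 2 - k * m1 k)) - 8 * (- (k\<^sup>2 * m2 k) / 2 - k * m1 k)"
  define h2 where "h2 = - (S 1 - S 0 + k * m1 k)"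
  have "h0 * h2 = - 2 * k * Delta_MI g d T k" unfolding h0_def h2_def S_def by (rule Delta_MI_cubic[OF k0 k2])
  then have "h0 * h2 < 0" using k0 pos by simp
  then obtain \<eta> where eta: "0 < \<eta>" and real: "\<And>q0 q1 q2 q3 s. \<bar>q0 - h0\<bar> < \<eta> \<Longrightarrow> \<bar>q1\<bar> < \<eta> \<Longrightarrow> \<bar>q2 - h2\<bar> < \<eta> \<Longrightarrow> \<bar>q3\<bar> < \<eta> \<Longrightarrow> q3 \<noteq> 0 \<Longrightarrow>
       of_real q3 * s ^ 3 + of_real q2 * s\<^sup>2 + of_real q1 * s + of_real q0 = (0::complex) \<Longrightarrow> Im s = 0"
    by (rule cubic_all_real) blast
  have "\<forall>\<^sub>F n in sequentially. \<bar>q 0 n - h0\<bar> < \<eta> \<and> \<bar>q 1 n\<bar> < \<eta> \<and> \<bar>q 2 n - h2\<bar> < \<eta> \<and> \<bar>q 3 n\<bar> < \<eta>"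
    using tendstoD[OF q(1) eta] tendstoD[OF q(2) eta] tendstoD[OF q(3) eta] tendstoD[OF q(4) eta]
    by eventually_elim (simp add: dist_real_def h0_def h2_def)
  then obtain n where n: "\<bar>q 0 n - h0\<bar> < \<eta>" "\<bar>q 1 n\<bar> < \<eta>" "\<bar>q 2 n - h2\<bar> < \<eta>" "\<bar>q 3 n\<bar> < \<eta>"
    by (auto dest!: eventually_happens simp: trivial_limit_sequentially)
  define s where "s = (- \<i> * \<mu> n / of_real (\<xi> n) - of_real (- (k * m1 k))) / of_real (p n 1)"
  have s: "- \<i> * \<mu> n = of_real (\<xi> n) * (of_real (- (k * m1 k)) + of_real (p n 1) * s)"
    using xnz[of n] x0[of n] by (simp add: s_def)
  have q30: "q 3 n \<noteq> 0" using q3[of n] x0[of n] by auto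
  have "Im s = 0" by (rule real[OF n q30]) (use ev[of n] cubic[of n s] s in simp)
  then have "Im (- \<i> * \<mu> n) = 0" unfolding s by simp
  then show False using mu(2)[of n] by simp
qed

lemma unstable_waves:
  assumes k: "k \<in> admissible_wave_numbers g d T" and wf: "wave_family g d T k w c" and neg: "Delta_MI g d T k < 0"
  shows "\<exists>\<epsilon>>0. \<forall>a b. a \<noteq> 0 \<and> \<bar>a\<bar> < \<epsilon> \<and> \<bar>b\<bar> < \<epsilon> \<longrightarrow> modulationally_unstable g d T k (w k a b) (c k a b)"
proof (rule ccontr)
  assume no: "\<not> ?thesis"
  have k0: "0 < k" using k by (auto simp: admissible_wave_numbers_def split: if_splits)
  have k2: "m (2 * k) \<noteq> m k" using no_resonance[OF k, of 2] by simp
  obtain \<gamma> \<Lambda> \<xi>0 where sym: "symbol (\<lambda>y. m (k * y)) \<gamma> \<Lambda> \<xi>0"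
    and tay: "\<And>h. \<bar>h\<bar> \<le> \<xi>0 \<Longrightarrow> \<bar>m (k * (1 + h)) - m (k * 1) - k * m1 k * h\<bar> \<le> \<Lambda> * h\<^sup>2"
    by (rule dispersion_symbol[OF k]) blast
  interpret symbol "\<lambda>y. m (k * y)" \<gamma> \<Lambda> \<xi>0 by (rule sym)
  define S where "S = (\<lambda>y. m (k * y))"
  have bad: "\<forall>\<epsilon>>0. \<exists>a b. a \<noteq> 0 \<and> \<bar>a\<bar> < \<epsilon> \<and> \<bar>b\<bar> < \<epsilon> \<and> modulationally_stable g d T k (w k a b) (c k a b)"
    using no by blast
  obtain W C p V P T2 w0 where wv: "\<And>n::nat. wave S \<gamma> \<Lambda> \<xi>0 (p n) (V n) (P n) (T2 n)"
    and bl: "\<And>n. bloch S \<gamma> \<Lambda> \<xi>0 (p n) (V n) (P n) g d T k (C n) (w0 n) (W n)"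
    and T2: "\<And>n. T2 n \<le> 9 / \<gamma> * (p n 1)\<^sup>2" and x: "(\<lambda>n. p n 1) \<longlonglongrightarrow> 0" and V1: "V \<longlonglongrightarrow> m (k * 1)"
    and st: "\<And>n. modulationally_stable g d T k (W n) (C n)"
    by (rule wave_sequence[where Z="\<lambda>w c. modulationally_stable g d T k w c", OF sym k0 wf bad, folded S_def]) (rule that, assumption+)
  have V: "V \<longlonglongrightarrow> S 1" using V1 by (simp add: S_def)
  have x0: "p n 1 \<noteq> 0" for n by (rule wave.p_1[OF wv])
  have "\<exists>\<delta> r. 0 < \<delta> \<and> 0 < r \<and> (\<forall>\<xi>\<in>{-1/2..<1/2}. \<bar>\<xi>\<bar> < \<delta> \<longrightarrow>
      (\<forall>\<mu>\<in>L2per_spectrum (bloch_operator g d T k (W n) (C n) \<xi>). cmod \<mu> < r \<longrightarrow> Re \<mu> = 0))" for n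
    using st[of n] unfolding modulationally_unstable_def by blast
  then obtain \<delta> r where del: "\<And>n. 0 < \<delta> n" "\<And>n. 0 < r n" and
    imag: "\<And>n \<xi> \<mu>. \<xi> \<in> {-1/2..<1/2} \<Longrightarrow> \<bar>\<xi>\<bar> < \<delta> n \<Longrightarrow> \<mu> \<in> L2per_spectrum (bloch_operator g d T k (W n) (C n) \<xi>) \<Longrightarrow> cmod \<mu> < r n \<Longrightarrow> Re \<mu> = 0"
    by metis
  define h0 where "h0 = (S 1 - S 0 + k * m1 k) * ((- 4 / (S 1 - S 2)) * (- (k\<^sup>2 * m2 k) / 2 - k * m1 k)) - 8 * (- (k\<^sup>2 * m2 k) / 2 - k * m1 k)"
  define h2 where "h2 = - (S 1 - S 0 + k * m1 k)"
  \<comment> \<open>Bound for the eigenvalue divided by \<xi>: far along the sequence \<bar>p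
    1\<bar> \<bar>s\<bar> is at most \<bar>h0\<bar> + \<bar>h2\<bar> + 4 for every root s. The
    choice \<xi> \<le> r / (2 N) then puts the eigenvalue into the disc of radius r in which
    stability forbids nonzero real parts.\<close>
  define N where "N = \<bar>k * m1 k\<bar> + \<bar>h0\<bar> + \<bar>h2\<bar> + 4"
  have N: "0 < N" by (simp add: N_def)
  define \<xi> where "\<xi> n = min (min \<xi>0 (\<bar>p n 1\<bar> ^ 3)) (min (\<delta> n / 2) (r n / (2 * N)))" for n
  have xpos: "0 < \<xi> n" for n using xi0 x0[of n] del[of n] N by (simp add: \<xi>_def)
  have xi': "\<bar>\<xi> n\<bar> \<le> \<xi>0" "\<bar>\<xi> n\<bar> \<le> \<bar>p n 1\<bar> ^ 3" "\<bar>\<xi> n\<bar> < \<delta> n" "\<bar>\<xi> n\<bar> \<le> r n / (2 * N)" for n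
  proof -
    have "\<xi> n \<le> \<delta> n / 2" by (simp add: \<xi>_def)
    then show "\<bar>\<xi> n\<bar> < \<delta> n" using xpos[of n] del(1)[of n] by simp
  qed (use xpos[of n] in \<open>simp_all add: \<xi>_def\<close>)
  have xnz: "\<xi> n \<noteq> 0" for n using xpos[of n] by simp
  have Ct: "0 \<le> 9 / \<gamma>" using gamma by simp
  obtain q :: "nat \<Rightarrow> nat \<Rightarrow> real"
    where q: "q 0 \<longlonglongrightarrow> h0" "q 1 \<longlonglongrightarrow> 0" "q 2 \<longlonglongrightarrow> h2" "q 3 \<longlonglongrightarrow> 0" and q3: "\<And>n. \<bar>p n 1\<bar> \<le> \<bar>q 3 n\<bar>"
    and cubic: "\<And>n s. core_eigenvalue (potential.Bm S (p n) (V n) (\<xi> n) (potential.frame S \<gamma> (p n) (V n) (P n) (\<xi> n)))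
        (of_real (\<xi> n) * (of_real (- (k * m1 k)) + of_real (p n 1) * s)) \<longleftrightarrow>
       of_real (q 3 n) * s ^ 3 + of_real (q 2 n) * s\<^sup>2 + of_real (q 1 n) * s + of_real (q 0 n) = 0"
    unfolding h0_def h2_def
    by (rule eigenvalue_cubic_sequence[OF wv Ct T2 x V xnz xi'(2,1), where ?\<sigma>1.0="k * m1 k" and ?\<sigma>2.0="k\<^sup>2 * m2 k"])
      (use isCont_m_scaled tay m_second_difference[OF k0] in \<open>auto simp: S_def\<close>)
  have "h0 * h2 = - 2 * k * Delta_MI g d T k" unfolding h0_def h2_def S_def by (rule Delta_MI_cubic[OF k0 k2])
  then have "0 < h0 * h2" using k0 neg by (simp add: mult_pos_neg)
  then have "0\<^sup>2 - 2 * h0 * h2 < 0" by simp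
  moreover have "(\<lambda>n. (q 1 n)\<^sup>2 - 2 * q 0 n * q 2 n) \<longlonglongrightarrow> 0\<^sup>2 - 2 * h0 * h2" by (intro tendsto_intros q)
  ultimately have disc: "\<forall>\<^sub>F n in sequentially. (q 1 n)\<^sup>2 - 2 * q 0 n * q 2 n < 0" by (rule order_tendstoD(2)[rotated])
  have "\<forall>\<^sub>F n in sequentially. (q 1 n)\<^sup>2 - 2 * q 0 n * q 2 n < 0 \<and> \<bar>q 0 n - h0\<bar> < 1 \<and> \<bar>q 1 n\<bar> < 1 \<and> \<bar>q 2 n - h2\<bar> < 1 \<and> \<bar>p n 1\<bar> < 1"
    using disc tendstoD[OF q(1) zero_less_one] tendstoD[OF q(2) zero_less_one] tendstoD[OF q(3) zero_less_one] tendstoD[OF x zero_less_one]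
    by eventually_elim (simp add: dist_real_def)
  then obtain n where n: "(q 1 n)\<^sup>2 - 2 * q 0 n * q 2 n < 0" "\<bar>q 0 n - h0\<bar> < 1" "\<bar>q 1 n\<bar> < 1" "\<bar>q 2 n - h2\<bar> < 1" "\<bar>p n 1\<bar> < 1"
    by (auto dest!: eventually_happens simp: trivial_limit_sequentially)
  have q30: "q 3 n \<noteq> 0" using q3[of n] x0[of n] by auto
  obtain s where root: "of_real (q 3 n) * s ^ 3 + of_real (q 2 n) * s\<^sup>2 + of_real (q 1 n) * s + of_real (q 0 n) = (0::complex)" and s: "Im s \<noteq> 0"
    by (rule cubic_nonreal_root[OF n(1) q30]) blast
  define \<mu> where "\<mu> = of_real (\<xi> n) * (of_real (- (k * m1 k)) + of_real (p n 1) * s)"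
  have "core_eigenvalue (potential.Bm S (p n) (V n) (\<xi> n) (potential.frame S \<gamma> (p n) (V n) (P n) (\<xi> n))) \<mu>"
    unfolding \<mu>_def using cubic[of n s] root by blast
  then have spec: "\<i> * \<mu> \<in> L2per_spectrum (bloch_operator g d T k (W n) (C n) (\<xi> n))"
    by (rule bloch.core_eigenvalue_in_spectrum[OF bl xi'(1) xnz])
  have "cmod \<mu> \<le> \<bar>\<xi> n\<bar> * N"
  proof -
    have x0': "0 < \<bar>p n 1\<bar>" using x0[of n] by simp
    have num: "\<bar>q 0 n\<bar> + \<bar>q 1 n\<bar> + \<bar>q 2 n\<bar> \<le> \<bar>h0\<bar> + \<bar>h2\<bar> + 3" using n by linarith
    have "cmod s \<le> 1 + (\<bar>q 0 n\<bar> + \<bar>q 1 n\<bar> + \<bar>q 2 n\<bar>) / \<bar>q 3 n\<bar>" by (rule cubic_root_bound[OF root q30])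
    also have "\<dots> \<le> 1 + (\<bar>h0\<bar> + \<bar>h2\<bar> + 3) / \<bar>p n 1\<bar>"
      by (intro add_left_mono frac_le num x0' q3) simp
    finally have "\<bar>p n 1\<bar> * cmod s \<le> \<bar>p n 1\<bar> * (1 + (\<bar>h0\<bar> + \<bar>h2\<bar> + 3) / \<bar>p n 1\<bar>)" by (rule mult_left_mono) simp
    also have "\<dots> = \<bar>p n 1\<bar> + (\<bar>h0\<bar> + \<bar>h2\<bar> + 3)"
    proof -
      have "y * (1 + z / y) = y + z" if "0 < y" for y z :: real using that by (simp add: distrib_left)
      from this[OF x0'] show ?thesis .
    qed
    finally have "\<bar>p n 1\<bar> * cmod s \<le> \<bar>h0\<bar> + \<bar>h2\<bar> + 4" using n(5) by linarith
    moreover have "cmod (of_real (- (k * m1 k)) + of_real (p n 1) * s) \<le> \<bar>k * m1 k\<bar> + \<bar>p n 1\<bar> * cmod s"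
      using norm_triangle_ineq[of "of_real (- (k * m1 k))" "of_real (p n 1) * s"] unfolding norm_mult norm_of_real by simp
    ultimately have "cmod (of_real (- (k * m1 k)) + of_real (p n 1) * s) \<le> N" by (simp add: N_def)
    then show ?thesis unfolding \<mu>_def norm_mult norm_of_real by (rule mult_left_mono) simp
  qed
  also have "\<dots> \<le> r n / (2 * N) * N" using xi'(4)[of n] N by (intro mult_right_mono) auto
  also have "\<dots> < r n" using del(2)[of n] N by simp
  finally have small: "cmod (\<i> * \<mu>) < r n" by (simp add: norm_mult)
  have half: "\<xi> n \<in> {-1/2..<1/2}"
  proof -
    have "\<gamma> / (100 * \<Lambda>) < 1/2" using gamma Lambda by (simp add: divide_less_eq)
    then show ?thesis using xi'(1)[of n] xi0 xpos[of n] by simp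
  qed
  have "Re (\<i> * \<mu>) = 0" by (rule imag[OF half xi'(3) spec small])
  then show False using xnz[of n] x0[of n] s by (simp add: \<mu>_def)
qed

end

theorem theorem3p1:
  fixes g d T k :: real
    and w :: "real \<Rightarrow> real \<Rightarrow> real \<Rightarrow> real \<Rightarrow> real"
    and c :: "real \<Rightarrow> real \<Rightarrow> real \<Rightarrow> real"
  assumes "g > 0" and "d > 0" and "T > 0"
    and "T / (g * d\<^sup>2) \<noteq> 1/3"
    and "k \<in> admissible_wave_numbers g d T"
    and "wave_family g d T k w c"
  shows "(Delta_MI g d T k < 0 \<longrightarrow>
            (\<exists>\<epsilon>>0. \<forall>a b. a \<noteq> 0 \<and> \<bar>a\<bar> < \<epsilon> \<and> \<bar>b\<bar> < \<epsilon> \<longrightarrow>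
               modulationally_unstable g d T k (w k a b) (c k a b))) \<and>
         (Delta_MI g d T k > 0 \<longrightarrow>
            (\<exists>\<epsilon>>0. \<forall>a b. a \<noteq> 0 \<and> \<bar>a\<bar> < \<epsilon> \<and> \<bar>b\<bar> < \<epsilon> \<longrightarrow>
               modulationally_stable g d T k (w k a b) (c k a b)))"
proof -
  interpret dispersion g d T by standard (use assms in auto)
  show ?thesis using stable_waves unstable_waves assms by blast
qed

end
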